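(* Let $G$ be a finitely generated soluble group. Then either $G_\pi$ is virtually nilpotent for all sets of primes $\pi$ (with $\pi$ not the set of all primes), or there exists a finite set of primes $\tau$ such that $G_\pi$ is not soluble whenever $\pi$ is a set of primes, not the set of all primes, with $\tau\subseteq\pi$.
   Context: For a set of primes $\pi$, a group $G$ is $\pi$-local if the map $G\to G$, $x\mapsto x^q$, is bijective for every prime $q\notin\pi$. A $\pi$-localization of a group $G$ is a homomorphism $\phi_\pi: G\to G_\pi$ with $G_\pi$ a $\pi$-local group, such that for every homomorphism $\theta: G\to H$ with $H$ $\pi$-local there is a unique homomorphism $\theta_\pi: G_\pi\to H$ with $\theta_\pi\phi_\pi=\theta$. It always exists and is unique up to isomorphism. A group is virtually nilpotent if it has a nilpotent subgroup of finite index. *)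

theory Defs
  imports
    "HOL-Algebra.Algebra"
    "HOL-Library.Countable_Set"
    "HOL-Library.Infinite_Typeclass"
    "HOL-Computational_Algebra.Primes"
begin

hide_const (open) Divisibility.prime

section \<open>Finiteness, nilpotency\<close>

definition finitely_generated :: "('a, 'm) monoid_scheme \<Rightarrow> bool" where
  "finitely_generated G \<longleftrightarrow> (\<exists>S. finite S \<and> S \<subseteq> carrier G \<and> generate G S = carrier G)"

primrec lower_central :: "('a, 'm) monoid_scheme \<Rightarrow> nat \<Rightarrow> 'a set" where
  "lower_central G 0 = carrier G"
| "lower_central G (Suc n) = generate G
     (\<Union>x \<in> lower_central G n. \<Union>y \<in> carrier G. {x \<otimes>\<^bsub>G\<^esub> y \<otimes>\<^bsub>G\<^esub> inv\<^bsub>G\<^esub> x \<otimes>\<^bsub>G\<^esub> inv\<^bsub>G\<^esub> y})"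

definition nilpotent :: "('a, 'm) monoid_scheme \<Rightarrow> bool" where
  "nilpotent G \<longleftrightarrow> (\<exists>n. lower_central G n = {\<one>\<^bsub>G\<^esub>})"

definition virtually_nilpotent :: "('a, 'm) monoid_scheme \<Rightarrow> bool" where
  "virtually_nilpotent G \<longleftrightarrow>
     (\<exists>N. subgroup N G \<and> finite (rcosets\<^bsub>G\<^esub> N) \<and> nilpotent (G \<lparr>carrier := N\<rparr>))"


section \<open>Localization at a set of primes\<close>

definition pi_local :: "nat set \<Rightarrow> ('a, 'm) monoid_scheme \<Rightarrow> bool" where
  "pi_local \<pi> G \<longleftrightarrow> group G \<and>
     (\<forall>q. prime q \<and> q \<notin> \<pi> \<longrightarrow> bij_betw (\<lambda>x. x [^]\<^bsub>G\<^esub> q) (carrier G) (carrier G))"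

text \<open>HOL cannot quantify over groups of all types inside a definition, so the test groups
  \<open>H\<close> live on the same infinite type \<open>'b\<close> as the localization. For countable \<open>G\<close>
  (in particular for finitely generated \<open>G\<close>) this is the usual notion: a localization exists
  on every infinite type (\<open>pi_localization_exists\<close> below), and the universal property
  then holds against test groups of every type (\<open>pi_localization_universal\<close>). Maps are
  compared only on the carrier, whence \<open>extensional\<close>.\<close>

definition pi_localization ::
  "nat set \<Rightarrow> ('a, 'm) monoid_scheme \<Rightarrow> ('b::infinite) monoid \<Rightarrow> ('a \<Rightarrow> 'b) \<Rightarrow> bool" where
  "pi_localization \<pi> G L \<phi> \<longleftrightarrow> pi_local \<pi> L \<and> \<phi> \<in> hom G L \<and>
     (\<forall>(H :: 'b monoid) \<theta>. pi_local \<pi> H \<longrightarrow> \<theta> \<in> hom G H \<longrightarrow>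
        (\<exists>!\<psi>. \<psi> \<in> hom L H \<and> \<psi> \<in> extensional (carrier L) \<and> (\<forall>x\<in>carrier G. \<psi> (\<phi> x) = \<theta> x)))"


section \<open>Existence, and the universal property for all types\<close>

text \<open>The localization of a countable group is built from formal terms in (an enumeration of) its
  elements, the group operations and \<open>q\<close>-th roots.\<close>

datatype loc_term = Gen nat | One | Mul loc_term loc_term | Inv loc_term | Root nat loc_term

instance loc_term :: countable
  by countable_datatype

primrec tpow :: "loc_term \<Rightarrow> nat \<Rightarrow> loc_term" where
  "tpow t 0 = One"
| "tpow t (Suc n) = Mul (tpow t n) t"

inductive loc_eq :: "nat set \<Rightarrow> ('a, 'm) monoid_scheme \<Rightarrow> loc_term \<Rightarrow> loc_term \<Rightarrow> bool"
  for \<pi> :: "nat set" and G :: "('a, 'm) monoid_scheme" where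
  refl: "loc_eq \<pi> G t t"
| sym: "loc_eq \<pi> G s t \<Longrightarrow> loc_eq \<pi> G t s"
| trans: "loc_eq \<pi> G s t \<Longrightarrow> loc_eq \<pi> G t u \<Longrightarrow> loc_eq \<pi> G s u"
| mul: "loc_eq \<pi> G s s' \<Longrightarrow> loc_eq \<pi> G t t' \<Longrightarrow> loc_eq \<pi> G (Mul s t) (Mul s' t')"
| inv: "loc_eq \<pi> G s s' \<Longrightarrow> loc_eq \<pi> G (Inv s) (Inv s')"
| root: "loc_eq \<pi> G s s' \<Longrightarrow> loc_eq \<pi> G (Root q s) (Root q s')"
| assoc: "loc_eq \<pi> G (Mul (Mul s t) u) (Mul s (Mul t u))"
| l_one: "loc_eq \<pi> G (Mul One t) t"
| l_inv: "loc_eq \<pi> G (Mul (Inv t) t) One"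
| gen: "from_nat_into (carrier G) k =
          from_nat_into (carrier G) m \<otimes>\<^bsub>G\<^esub> from_nat_into (carrier G) n \<Longrightarrow>
        loc_eq \<pi> G (Mul (Gen m) (Gen n)) (Gen k)"
| root_pow: "prime q \<Longrightarrow> q \<notin> \<pi> \<Longrightarrow> loc_eq \<pi> G (tpow (Root q t) q) t"
| pow_root: "prime q \<Longrightarrow> q \<notin> \<pi> \<Longrightarrow> loc_eq \<pi> G (Root q (tpow t q)) t"
| no_root: "\<not> (prime q \<and> q \<notin> \<pi>) \<Longrightarrow> loc_eq \<pi> G (Root q t) One"

definition loc_code :: "nat set \<Rightarrow> ('a, 'm) monoid_scheme \<Rightarrow> loc_term \<Rightarrow> 'b::infinite" where
  "loc_code \<pi> G = (SOME c. \<forall>s t. c s = c t \<longleftrightarrow> loc_eq \<pi> G s t)"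

lemma loc_code_eq: "(loc_code \<pi> G s :: 'b::infinite) = loc_code \<pi> G t \<longleftrightarrow> loc_eq \<pi> G s t"
proof -
  obtain g :: "nat \<Rightarrow> 'b" where g: "inj g"
    using infinite_countable_subset[OF infinite_UNIV] by auto
  define r where "r t = (SOME s. loc_eq \<pi> G s t)" for t
  have r: "loc_eq \<pi> G (r t) t" for t
    unfolding r_def by (rule someI) (rule loc_eq.refl)
  have "r s = r t \<longleftrightarrow> loc_eq \<pi> G s t" for s t
  proof
    assume "r s = r t"
    then show "loc_eq \<pi> G s t" using r[of s] r[of t] by (metis loc_eq.sym loc_eq.trans)
  next
    assume *: "loc_eq \<pi> G s t"
    have "loc_eq \<pi> G u s \<longleftrightarrow> loc_eq \<pi> G u t" for u
      using * by (meson loc_eq.sym loc_eq.trans)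
    then show "r s = r t" by (simp add: r_def)
  qed
  then have "\<exists>c :: loc_term \<Rightarrow> 'b. \<forall>s t. c s = c t \<longleftrightarrow> loc_eq \<pi> G s t"
    by (intro exI[of _ "\<lambda>t. g (to_nat (r t))"]) (simp add: inj_eq[OF g])
  from someI_ex[OF this] show ?thesis by (simp add: loc_code_def)
qed

definition loc_grp :: "nat set \<Rightarrow> ('a, 'm) monoid_scheme \<Rightarrow> ('b::infinite) monoid" where
  "loc_grp \<pi> G = \<lparr>carrier = range (loc_code \<pi> G),
     monoid.mult = (\<lambda>x y. loc_code \<pi> G (Mul (inv_into UNIV (loc_code \<pi> G) x) (inv_into UNIV (loc_code \<pi> G) y))),
     one = loc_code \<pi> G One\<rparr>"

definition loc_map :: "nat set \<Rightarrow> ('a, 'm) monoid_scheme \<Rightarrow> 'a \<Rightarrow> 'b::infinite" where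
  "loc_map \<pi> G x = loc_code \<pi> G (Gen (to_nat_on (carrier G) x))"

lemma loc_grp_mult:
  "(loc_code \<pi> G s :: 'b::infinite) \<otimes>\<^bsub>loc_grp \<pi> G\<^esub> loc_code \<pi> G t = loc_code \<pi> G (Mul s t)"
proof -
  have "loc_eq \<pi> G ((inv_into UNIV (loc_code \<pi> G) :: 'b \<Rightarrow> _) (loc_code \<pi> G u)) u" for u
    using f_inv_into_f[OF rangeI[of "loc_code \<pi> G :: loc_term \<Rightarrow> 'b" u]] by (simp add: loc_code_eq)
  then show ?thesis by (simp add: loc_grp_def loc_code_eq loc_eq.mul)
qed

lemma loc_grp_carrier: "carrier (loc_grp \<pi> G) = range (loc_code \<pi> G)"
  and loc_grp_one: "\<one>\<^bsub>loc_grp \<pi> G\<^esub> = loc_code \<pi> G One"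
  by (simp_all add: loc_grp_def)

lemma loc_grp_group: "group (loc_grp \<pi> G)"
proof (rule groupI)
  fix x assume "x \<in> carrier (loc_grp \<pi> G)"
  then obtain t where "x = loc_code \<pi> G t" by (auto simp: loc_grp_carrier)
  then show "\<exists>y\<in>carrier (loc_grp \<pi> G). y \<otimes>\<^bsub>loc_grp \<pi> G\<^esub> x = \<one>\<^bsub>loc_grp \<pi> G\<^esub>"
    by (intro bexI[of _ "loc_code \<pi> G (Inv t)"])
       (auto simp: loc_grp_carrier loc_grp_one loc_grp_mult loc_code_eq intro: loc_eq.l_inv)
qed (auto simp: loc_grp_carrier loc_grp_one loc_grp_mult loc_code_eq
       intro: rangeI loc_eq.assoc loc_eq.l_one)

lemma loc_grp_pow: "loc_code \<pi> G t [^]\<^bsub>loc_grp \<pi> G\<^esub> n = loc_code \<pi> G (tpow t n)"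
proof -
  interpret L: group "loc_grp \<pi> G" by (rule loc_grp_group)
  show ?thesis by (induction n) (simp_all add: loc_grp_one loc_grp_mult)
qed

lemma loc_grp_local: "pi_local \<pi> (loc_grp \<pi> G :: ('b::infinite) monoid)"
  unfolding pi_local_def
proof (intro conjI allI impI loc_grp_group)
  fix q :: nat assume q: "prime q \<and> q \<notin> \<pi>"
  let ?L = "loc_grp \<pi> G :: 'b monoid"
  have inj: "(loc_code \<pi> G s :: 'b) = loc_code \<pi> G t"
    if "loc_code \<pi> G s [^]\<^bsub>?L\<^esub> q = loc_code \<pi> G t [^]\<^bsub>?L\<^esub> q" for s t
  proof -
    have "loc_eq \<pi> G (tpow s q) (tpow t q)" using that by (simp add: loc_grp_pow loc_code_eq)
    then have "loc_eq \<pi> G (Root q (tpow s q)) (Root q (tpow t q))" by (rule loc_eq.root)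
    then show ?thesis
      unfolding loc_code_eq using q loc_eq.pow_root by (meson loc_eq.sym loc_eq.trans)
  qed
  have surj: "loc_code \<pi> G t = loc_code \<pi> G (Root q t) [^]\<^bsub>?L\<^esub> q" for t
    using q by (simp add: loc_grp_pow loc_code_eq loc_eq.root_pow loc_eq.sym)
  show "bij_betw (\<lambda>x. x [^]\<^bsub>?L\<^esub> q) (carrier ?L) (carrier ?L)"
  proof (rule bij_betw_imageI)
    show "inj_on (\<lambda>x. x [^]\<^bsub>?L\<^esub> q) (carrier ?L)"
      using inj unfolding inj_on_def loc_grp_carrier by blast
    have "loc_code \<pi> G t [^]\<^bsub>?L\<^esub> q \<in> range (loc_code \<pi> G)" for t
      by (simp only: loc_grp_pow rangeI)
    then show "(\<lambda>x. x [^]\<^bsub>?L\<^esub> q) ` carrier ?L = carrier ?L"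
      unfolding loc_grp_carrier using surj by blast
  qed
qed

context
  fixes \<pi> :: "nat set" and G :: "('a, 'm) monoid_scheme"
  assumes grp: "group G" and cnt: "countable (carrier G)"
begin

lemma enum_in: "from_nat_into (carrier G) n \<in> carrier G"
  using from_nat_into[OF monoid.carrier_not_empty[OF group.is_monoid[OF grp]]] .

lemma enum_inv: "x \<in> carrier G \<Longrightarrow> from_nat_into (carrier G) (to_nat_on (carrier G) x) = x"
  using cnt by simp

lemma loc_map_hom: "loc_map \<pi> G \<in> hom G (loc_grp \<pi> G)"
proof -
  interpret group G by (rule grp)
  show ?thesis
    by (auto simp: hom_def loc_map_def loc_grp_carrier loc_grp_mult loc_code_eq enum_inv
          intro!: rangeI loc_eq.sym[OF loc_eq.gen])
qed

lemma gen_eq: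
  assumes "from_nat_into (carrier G) m = from_nat_into (carrier G) n"
  shows "loc_eq \<pi> G (Gen m) (Gen n)"
proof -
  interpret group G by (rule grp)
  let ?o = "to_nat_on (carrier G) \<one>\<^bsub>G\<^esub>"
  have "loc_eq \<pi> G (Mul (Gen ?o) (Gen m)) (Gen m)" "loc_eq \<pi> G (Mul (Gen ?o) (Gen m)) (Gen n)"
    using assms by (auto intro!: loc_eq.gen simp: enum_inv enum_in)
  then show ?thesis by (meson loc_eq.sym loc_eq.trans)
qed

lemma loc_map_enum: "loc_map \<pi> G (from_nat_into (carrier G) n) = loc_code \<pi> G (Gen n)"
  by (simp add: loc_map_def loc_code_eq gen_eq enum_inv enum_in)

context
  fixes H :: "('c, 'n) monoid_scheme" and \<theta> :: "'a \<Rightarrow> 'c"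
  assumes loc: "pi_local \<pi> H" and \<theta>: "\<theta> \<in> hom G H"
begin

primrec ev :: "loc_term \<Rightarrow> 'c" where
  "ev (Gen n) = \<theta> (from_nat_into (carrier G) n)"
| "ev One = \<one>\<^bsub>H\<^esub>"
| "ev (Mul s t) = ev s \<otimes>\<^bsub>H\<^esub> ev t"
| "ev (Inv t) = inv\<^bsub>H\<^esub> ev t"
| "ev (Root q t) = (if prime q \<and> q \<notin> \<pi>
     then inv_into (carrier H) (\<lambda>x. x [^]\<^bsub>H\<^esub> q) (ev t) else \<one>\<^bsub>H\<^esub>)"

lemma pow_bij: "prime q \<Longrightarrow> q \<notin> \<pi> \<Longrightarrow> bij_betw (\<lambda>x. x [^]\<^bsub>H\<^esub> q) (carrier H) (carrier H)"
  using loc by (simp add: pi_local_def)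

lemma H_group: "group H"
  using loc by (simp add: pi_local_def)

lemma ev_in: "ev t \<in> carrier H"
proof -
  interpret H: group H by (rule H_group)
  show ?thesis
  proof (induction t)
    case (Gen n) then show ?case using \<theta> enum_in by (auto simp: hom_def)
  next
    case (Root q t) then show ?case
      using bij_betw_inv_into[OF pow_bij, of q] by (auto simp: bij_betw_def)
  qed auto
qed

lemma ev_pow: "ev (tpow t n) = ev t [^]\<^bsub>H\<^esub> n"
proof -
  interpret H: group H by (rule H_group)
  show ?thesis by (induction n) simp_all
qed

lemma ev_eq: "loc_eq \<pi> G s t \<Longrightarrow> ev s = ev t"
proof -
  interpret H: group H by (rule H_group)
  show "loc_eq \<pi> G s t \<Longrightarrow> ev s = ev t"
  proof (induction rule: loc_eq.induct)
    case (gen k m n) then show ?case using \<theta> enum_in by (simp add: hom_def)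
  next
    case (root_pow q t) then show ?case
      using bij_betw_inv_into_right[OF pow_bij ev_in] by (simp add: ev_pow)
  next
    case (pow_root q t) then show ?case
      using bij_betw_inv_into_left[OF pow_bij ev_in] by (simp add: ev_pow)
  qed (auto simp: ev_in H.m_assoc)
qed

lemma loc_grp_factor:
  "\<exists>\<psi>. \<psi> \<in> hom (loc_grp \<pi> G :: ('b::infinite) monoid) H \<and> (\<forall>x\<in>carrier G. \<psi> (loc_map \<pi> G x) = \<theta> x)"
proof -
  define \<psi> where "\<psi> x = ev ((inv_into UNIV (loc_code \<pi> G) :: 'b \<Rightarrow> _) x)" for x
  have \<psi>: "\<psi> (loc_code \<pi> G t) = ev t" for t
    unfolding \<psi>_def
    using f_inv_into_f[OF rangeI[of "loc_code \<pi> G :: loc_term \<Rightarrow> 'b" t]]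
    by (intro ev_eq) (simp add: loc_code_eq)
  show ?thesis
    by (rule exI[of _ \<psi>]) (auto simp: hom_def loc_grp_carrier loc_grp_mult \<psi> ev_in loc_map_def enum_inv)
qed

lemma loc_grp_unique:
  fixes \<psi> \<psi>' :: "'b::infinite \<Rightarrow> 'c"
  assumes "\<psi> \<in> hom (loc_grp \<pi> G) H" "\<psi>' \<in> hom (loc_grp \<pi> G) H"
    and "\<And>x. x \<in> carrier G \<Longrightarrow> \<psi> (loc_map \<pi> G x) = \<theta> x"
    and "\<And>x. x \<in> carrier G \<Longrightarrow> \<psi>' (loc_map \<pi> G x) = \<theta> x"
    and "y \<in> carrier (loc_grp \<pi> G)"
  shows "\<psi> y = \<psi>' y"
proof -
  interpret H: group H by (rule H_group)
  have *: "\<rho> (loc_code \<pi> G t) = ev t"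
    if h: "\<rho> \<in> hom (loc_grp \<pi> G) H" and g: "\<And>x. x \<in> carrier G \<Longrightarrow> \<rho> (loc_map \<pi> G x) = \<theta> x"
    for \<rho> :: "'b \<Rightarrow> 'c" and t
  proof -
    interpret L: group "loc_grp \<pi> G :: 'b monoid" by (rule loc_grp_group)
    interpret h: group_hom "loc_grp \<pi> G :: 'b monoid" H \<rho>
      using h by unfold_locales
    have in_L: "loc_code \<pi> G t \<in> carrier (loc_grp \<pi> G :: 'b monoid)" for t
      by (simp add: loc_grp_carrier)
    have one: "\<rho> (loc_code \<pi> G One) = \<one>\<^bsub>H\<^esub>"
      using h.hom_one by (simp add: loc_grp_one)
    show ?thesis
    proof (induction t)
      case (Gen n) then show ?case using g[OF enum_in[of n]] by (simp add: loc_map_enum)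
    next
      case One then show ?case by (simp add: one)
    next
      case (Mul s t) then show ?case
        using h.hom_mult[OF in_L in_L, of s t] by (simp add: loc_grp_mult)
    next
      case (Inv t)
      have "loc_code \<pi> G (Inv t) \<otimes>\<^bsub>loc_grp \<pi> G\<^esub> loc_code \<pi> G t = (\<one>\<^bsub>loc_grp \<pi> G\<^esub> :: 'b)"
        by (simp add: loc_grp_mult loc_grp_one loc_code_eq loc_eq.l_inv)
      then have "\<rho> (loc_code \<pi> G (Inv t)) \<otimes>\<^bsub>H\<^esub> ev t = \<one>\<^bsub>H\<^esub>"
        using h.hom_mult[OF in_L in_L, of "Inv t" t] Inv by (simp add: loc_grp_one one)
      then show ?case
        using H.inv_equality[OF _ ev_in h.hom_closed[OF in_L]] by simp
    next
      case (Root q t)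
      show ?case
      proof (cases "prime q \<and> q \<notin> \<pi>")
        case True
        have "loc_code \<pi> G (Root q t) [^]\<^bsub>loc_grp \<pi> G\<^esub> q = (loc_code \<pi> G t :: 'b)"
          using True by (simp add: loc_grp_pow loc_code_eq loc_eq.root_pow)
        then have "\<rho> (loc_code \<pi> G (Root q t)) [^]\<^bsub>H\<^esub> q = ev t"
          using h.hom_nat_pow[OF in_L, of "Root q t" q] Root by simp
        then show ?thesis
          using True bij_betw_inv_into_left[OF pow_bij h.hom_closed[OF in_L], of q "Root q t"]
          by simp
      next
        case False
        then have "loc_code \<pi> G (Root q t) = (loc_code \<pi> G One :: 'b)"
          by (simp add: loc_code_eq loc_eq.no_root)
        then show ?thesis using False by (auto simp: one)
      qed
    qed
  qed
  show ?thesis using assms *[of \<psi>] *[of \<psi>'] by (auto simp: loc_grp_carrier)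
qed

end

lemma loc_grp_universal:
  fixes H :: "('c, 'n) monoid_scheme"
  assumes "pi_local \<pi> H" "\<theta> \<in> hom G H"
  shows "\<exists>!\<psi>. \<psi> \<in> hom (loc_grp \<pi> G :: ('b::infinite) monoid) H
    \<and> \<psi> \<in> extensional (carrier (loc_grp \<pi> G)) \<and> (\<forall>x\<in>carrier G. \<psi> (loc_map \<pi> G x) = \<theta> x)"
proof -
  let ?L = "loc_grp \<pi> G :: 'b monoid"
  interpret L: group ?L by (rule loc_grp_group)
  obtain \<psi> where \<psi>: "\<psi> \<in> hom ?L H" "\<forall>x\<in>carrier G. \<psi> (loc_map \<pi> G x) = \<theta> x"
    using loc_grp_factor[OF assms] by blast
  show ?thesis
  proof (rule ex1I[of _ "restrict \<psi> (carrier ?L)"], intro conjI)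
    show "restrict \<psi> (carrier ?L) \<in> hom ?L H"
      using \<psi>(1) by (auto simp: hom_def)
    show "\<forall>x\<in>carrier G. restrict \<psi> (carrier ?L) (loc_map \<pi> G x) = \<theta> x"
      using \<psi>(2) by (auto simp: loc_map_def loc_grp_carrier)
  next
    fix \<psi>' assume "\<psi>' \<in> hom ?L H \<and> \<psi>' \<in> extensional (carrier ?L)
      \<and> (\<forall>x\<in>carrier G. \<psi>' (loc_map \<pi> G x) = \<theta> x)"
    then show "\<psi>' = restrict \<psi> (carrier ?L)"
      using loc_grp_unique[OF assms, of \<psi>' \<psi>] \<psi> by (intro extensionalityI[of _ "carrier ?L"]) auto
  qed auto
qed

lemma loc_grp_localization: "pi_localization \<pi> G (loc_grp \<pi> G) (loc_map \<pi> G)"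
  unfolding pi_localization_def using loc_grp_local loc_map_hom loc_grp_universal by blast

end

lemma finitely_generated_countable:
  assumes "group G" "finitely_generated G"
  shows "countable (carrier G)"
proof -
  interpret group G by fact
  obtain S where S: "finite S" "S \<subseteq> carrier G" "generate G S = carrier G"
    using assms(2) by (auto simp: finitely_generated_def)
  define f where "f = rec_list \<one>\<^bsub>G\<^esub> (\<lambda>x _ y. x \<otimes>\<^bsub>G\<^esub> y)"
  have f: "f [] = \<one>\<^bsub>G\<^esub>" "f (x # xs) = x \<otimes>\<^bsub>G\<^esub> f xs" for x xs by (simp_all add: f_def)
  let ?T = "S \<union> m_inv G ` S"
  have T: "?T \<subseteq> carrier G" using S(2) by auto
  have fc: "f xs \<in> carrier G" if "set xs \<subseteq> ?T" for xs
    using that T by (induction xs) (auto simp: f)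
  have app: "f (xs @ ys) = f xs \<otimes>\<^bsub>G\<^esub> f ys" if "set xs \<subseteq> ?T" "set ys \<subseteq> ?T" for xs ys
    using that(1) fc[OF that(2)]
  proof (induction xs)
    case (Cons a xs)
    have "a \<in> carrier G" "f xs \<in> carrier G" using Cons.prems T fc by auto
    with Cons show ?case by (simp add: f m_assoc)
  qed (simp add: f)
  have "x \<in> f ` lists ?T" if "x \<in> generate G S" for x
    using that
  proof (induction rule: generate.induct)
    case one then show ?case by (intro image_eqI[of _ _ "[]"]) (auto simp: f)
  next
    case (incl h) then show ?case
      using S(2) by (intro image_eqI[of _ _ "[h]"]) (auto simp: f)
  next
    case (inv h) then show ?case
      using S(2) by (intro image_eqI[of _ _ "[inv\<^bsub>G\<^esub> h]"]) (auto simp: f)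
  next
    case (eng h1 h2)
    then obtain xs ys where "xs \<in> lists ?T" "ys \<in> lists ?T" "h1 = f xs" "h2 = f ys" by auto
    then show ?case using app[of xs ys] by (intro image_eqI[of _ _ "xs @ ys"]) (auto simp: lists_eq_set)
  qed
  moreover have "countable (f ` lists ?T)"
    using S(1) by (intro countable_image countable_lists countable_finite) auto
  ultimately show ?thesis using S(3) by (metis countable_subset subsetI)
qed

theorem pi_localization_exists:
  assumes "group G" "countable (carrier G)"
  shows "\<exists>(L :: ('b::infinite) monoid) \<phi>. pi_localization \<pi> G L \<phi>"
  using loc_grp_localization[OF assms] by blast

theorem pi_localization_universal:
  fixes L :: "('b::infinite) monoid" and H :: "('c, 'n) monoid_scheme"
  assumes G: "group G" "countable (carrier G)" and L: "pi_localization \<pi> G L \<phi>"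
    and H: "pi_local \<pi> H" "\<theta> \<in> hom G H"
  shows "\<exists>!\<psi>. \<psi> \<in> hom L H \<and> \<psi> \<in> extensional (carrier L) \<and> (\<forall>x\<in>carrier G. \<psi> (\<phi> x) = \<theta> x)"
proof -
  let ?U = "loc_grp \<pi> G :: 'b monoid" and ?u = "loc_map \<pi> G :: _ \<Rightarrow> 'b"
  have locL: "pi_local \<pi> L" "\<phi> \<in> hom G L" using L by (auto simp: pi_localization_def)
  interpret L: group L using locL by (simp add: pi_local_def)
  have u: "?u \<in> hom G ?U" by (rule loc_map_hom[OF G])
  obtain a where a: "a \<in> hom L ?U" "\<And>x. x \<in> carrier G \<Longrightarrow> a (\<phi> x) = ?u x"
    using L loc_grp_local[of \<pi> G] u unfolding pi_localization_def by blast
  obtain b where b: "b \<in> hom ?U L" "\<And>x. x \<in> carrier G \<Longrightarrow> b (?u x) = \<phi> x"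
    using loc_grp_factor[OF G locL] by blast
  have uniqL: "\<rho> y = y" if "\<rho> \<in> hom L L" "\<And>x. x \<in> carrier G \<Longrightarrow> \<rho> (\<phi> x) = \<phi> x" "y \<in> carrier L"
    for \<rho> y
  proof -
    have 1: "restrict \<rho> (carrier L) \<in> hom L L" "restrict (\<lambda>x. x) (carrier L) \<in> hom L L"
      using that(1) by (auto simp: hom_def)
    have 2: "\<phi> x \<in> carrier L" if "x \<in> carrier G" for x
      using locL(2) that by (auto simp: hom_def)
    have "\<exists>!\<psi>. \<psi> \<in> hom L L \<and> \<psi> \<in> extensional (carrier L) \<and> (\<forall>x\<in>carrier G. \<psi> (\<phi> x) = \<phi> x)"
      using L locL unfolding pi_localization_def by blast
    then have "restrict \<rho> (carrier L) = restrict (\<lambda>x. x) (carrier L)"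
      by (rule ex1E) (use 1 2 that(2) in \<open>metis restrict_apply' restrict_extensional\<close>)
    then show ?thesis using that(3) by (metis restrict_apply')
  qed
  have ba: "b (a y) = y" if "y \<in> carrier L" for y
    using uniqL[of "b \<circ> a", OF hom_compose[OF a(1) b(1)]] a(2) b(2) that by simp
  obtain c where c: "c \<in> hom ?U H" "\<forall>x\<in>carrier G. c (?u x) = \<theta> x"
    using loc_grp_factor[OF G H] by blast
  have ca: "c \<circ> a \<in> hom L H" by (rule hom_compose[OF a(1) c(1)])
  have uniq: "\<psi> y = c (a y)"
    if h: "\<psi> \<in> hom L H" "\<forall>x\<in>carrier G. \<psi> (\<phi> x) = \<theta> x" and y: "y \<in> carrier L" for \<psi> y
  proof -
    have "(\<psi> \<circ> b) (a y) = c (a y)"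
      by (rule loc_grp_unique[OF G H hom_compose[OF b(1) h(1)] c(1)])
         (use h b(2) c(2) a(1) y in \<open>auto simp: hom_def\<close>)
    then show ?thesis using ba y by simp
  qed
  show ?thesis
  proof (rule ex1I[of _ "restrict (c \<circ> a) (carrier L)"], intro conjI)
    show "restrict (c \<circ> a) (carrier L) \<in> hom L H" using ca by (auto simp: hom_def)
    show "\<forall>x\<in>carrier G. restrict (c \<circ> a) (carrier L) (\<phi> x) = \<theta> x"
      using a(2) c(2) locL(2) by (auto simp: hom_def)
  next
    fix \<psi> assume "\<psi> \<in> hom L H \<and> \<psi> \<in> extensional (carrier L) \<and> (\<forall>x\<in>carrier G. \<psi> (\<phi> x) = \<theta> x)"
    then show "\<psi> = restrict (c \<circ> a) (carrier L)"
      using uniq[of \<psi>] by (intro extensionalityI[of _ "carrier L"]) auto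
  qed auto
qed

end

theory Submission
  imports Defs "HOL-Library.Poly_Mapping" "HOL-Computational_Algebra.Polynomial"
begin

text \<open>If \<open>G\<close> is virtually nilpotent, the local closure of a nilpotent subgroup of finite index is nilpotent.
Otherwise some factor of the derived series is a module on which no subgroup of finite index acts
nilpotently. Generic freeness (Hall) reduces it to a rank one module over a field \<open>K\<close>: a normal subgroup
\<open>Z\<close> of finite index has a torsion-free character into \<open>K\<close> and a crossed homomorphism nonzero on its kernel,
i.e. acts by affine maps. Placed in different superdiagonal entries, over cosets of roots of one
value of the character, these maps send \<open>Z\<close> into a local group of infinite unitriangular matrices in
which the root closure of the image is insoluble; a wreath product passes from \<open>Z\<close> to \<open>G\<close>.\<close>

text \<open>The target group must have unique \<open>r\<close>-th roots for all primes
  \<open>r\<close> outside \<open>pj\<close> at once. An \<open>r\<close>-th power of an affine map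
  with multiplier \<open>x\<close> multiplies its translation part by
  \<open>1 + x + ... + x^(r-1)\<close>. If the values of the character are torsion-free, this is
  nonzero for \<open>x\<close> other than 1, and at 1 it is \<open>r\<close>; so \<open>tau\<close>
  receives the characteristic of \<open>K\<close>, and also the primes dividing the index of
  \<open>Z\<close>, which disturb roots in the wreath product. The matrices are infinite because no
  derived length may suffice. The image of \<open>Z\<close> is soluble, so its rows cannot interact
  before roots are adjoined: they are supported on different cosets of the value group, and
  conjugation by a \<open>q^i\<close>-th root, \<open>q\<close> a prime outside \<open>pj\<close>,
  moves row \<open>i\<close> to the common point 1. This rests on a value that is no
  \<open>q\<close>-th power, found because the value group is finitely generated, torsion-free and
  nontrivial. The field arises from maximality: if \<open>B\<close> is maximal with no virtually
  nilpotent action on \<open>M / B\<close>, then nonzero endomorphisms of \<open>M / B\<close> are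
  injective.\<close>

lemmas sg_mem = subgroup.mem_carrier and sg_inv = subgroup.m_inv_closed
 and sg_mult = subgroup.m_closed and sg_one = subgroup.one_closed

notation monoid.mult (infixl "**\<index>" 70)

section \<open>Commutators, lower central series and subgroups of finite index\<close>
abbreviation pbij :: "('a, 'm) monoid_scheme => nat => 'a set => bool" where
 "pbij G r S \<equiv> bij_betw (%x. x [^]\<^bsub>G\<^esub> r) S S"

definition comm :: "('a, 'm) monoid_scheme => 'a => 'a => 'a" where
 "comm G x y=x **\<^bsub>G\<^esub> y **\<^bsub>G\<^esub> inv\<^bsub>G\<^esub> x **\<^bsub>G\<^esub> inv\<^bsub>G\<^esub> y"

text \<open>The series of a subgroup is computed in the ambient group, so that the series of
  different subgroups can be compared; \<open>lower_central_consistent\<close> links it with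
  \<open>lower_central\<close>.\<close>

primrec lcs :: "('a, 'm) monoid_scheme => 'a set => nat => 'a set" where
 "lcs G H 0=H"
| "lcs G H (Suc n)=generate G (UN x:lcs G H n. UN y:H. {comm G x y})"

text \<open>The representatives \<open>T\<close> may lie outside \<open>H\<close>. The same
  \<open>T\<close> then serves when \<open>Y\<close> is enlarged inside \<open>H\<close>, as in
  \<open>fidx_enlarge\<close>.\<close>

definition fidx :: "('a, 'm) monoid_scheme => 'a set => 'a set => bool" where
 "fidx G Y H \<longleftrightarrow> subgroup Y G&subgroup H G&Y<=H &
 (EX T. finite T&T<=carrier G&(ALL h:H. EX t:T. h **\<^bsub>G\<^esub> inv\<^bsub>G\<^esub> t:Y))"

context group
begin

lemma inv_cancel_left [simp]:
 "x:carrier G==>y:carrier G==>inv x**(x**y)=y"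
 "x:carrier G==>y:carrier G==>x**(inv x**y)=y"
 by (simp_all flip: m_assoc)

lemma div_eq_one: "x:carrier G==>y:carrier G==>x**inv y=\<one>==>x=y"
 using inv_equality[of x "inv y"] by simp

lemma comm_closed [simp]: "x:carrier G==>y:carrier G==>comm G x y:carrier G"
 by (simp add: comm_def)

lemma comm_mult_left:
 "x:carrier G==>x':carrier G==>y:carrier G ==>
 comm G (x**x') y=(x**comm G x' y**inv x)**comm G x y"
 by (simp add: comm_def m_assoc inv_mult_group)

lemma comm_mult_right:
 "x:carrier G==>y:carrier G==>y':carrier G ==>
 comm G x (y**y')=comm G x y**(y**comm G x y'**inv y)"
 by (simp add: comm_def m_assoc inv_mult_group)

lemma comm_inv_left:
 "x:carrier G==>y:carrier G==>comm G (inv x) y=inv x**inv (comm G x y)**x"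
 by (simp add: comm_def m_assoc inv_mult_group)

lemma comm_inv_right:
 "x:carrier G==>y:carrier G==>comm G x (inv y)=inv y**inv (comm G x y)**y"
 by (simp add: comm_def m_assoc inv_mult_group)

lemma inv_comm: "x:carrier G==>y:carrier G==>inv (comm G x y)=comm G y x"
 by (simp add: comm_def m_assoc inv_mult_group)

lemma conj_eq_comm: "x:carrier G==>g:carrier G==>g**x**inv g=comm G g x**x"
 by (simp add: comm_def m_assoc)

lemma comm_one [simp]: "x:carrier G==>comm G x \<one>=\<one>" "x:carrier G==>comm G \<one> x=\<one>"
 by (simp_all add: comm_def)

lemma conj_mult:
 "x:carrier G==>y:carrier G==>g:carrier G ==>
 g**(x**y)**inv g=(g**x**inv g)**(g**y**inv g)"
 by (simp add: m_assoc)

lemma conj_inv: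
 "x:carrier G==>g:carrier G==>g**inv x**inv g=inv (g**x**inv g)"
 by (simp add: m_assoc inv_mult_group)

lemma conj_pow:
 "x:carrier G==>g:carrier G==>(g**x**inv g) [^] (n::nat)=g**x [^] n**inv g"
 by (induction n) (simp_all add: m_assoc)

lemma subgroup_conj_vimage:
 assumes "subgroup P G" "g:carrier G"
 shows "subgroup {x:carrier G. g**x**inv g:P} G"
proof (rule subgroupI)
 show "{x:carrier G. g**x**inv g:P} ~= {}"
 using assms sg_one[OF assms(1)] by (auto intro!: exI[of _ \<one>])
qed (use assms in "auto simp: conj_mult conj_inv sg_mult sg_inv simp del: inv_mult_group")

lemma normalI_conj:
 assumes "subgroup P G" "!!g x. g:carrier G==>x:P==>g**x**inv g:P"
 shows "P \<lhd> G"
 using assms normal_inv_iff by blast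

lemma lcs_subgroup: "subgroup H G==>subgroup (lcs G H n) G"
proof (induction n)
 case (Suc n)
 have "(UN x:lcs G H n. UN y:H. {comm G x y})<=carrier G"
 using subgroup.subset[OF Suc.IH[OF Suc.prems]] subgroup.subset[OF Suc.prems]
 by (fastforce intro!: comm_closed)
 thus ?case by (simp add: generate_is_subgroup)
qed simp

lemma comm_in_lcs: "x:lcs G H n==>y:H==>comm G x y:lcs G H (Suc n)"
 by (auto intro!: generate.incl)

lemma lcs_subset: "subgroup H G==>lcs G H n<=H"
proof (induction n)
 case (Suc n)
 have "comm G x y:H" if "x:H" "y:H" for x y
 using that Suc.prems by (simp add: comm_def sg_mult sg_inv)
 hence "(UN x:lcs G H n. UN y:H. {comm G x y})<=H"
 using Suc by blast
 thus ?case
 using generate_subgroup_incl[OF _ Suc.prems] by simp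
qed simp

lemma lcs_mono: "subgroup H G==>subgroup K G==>K<=H==>lcs G K n<=lcs G H n"
proof (induction n)
 case (Suc n)
 thus ?case by (simp, intro mono_generate) blast
qed simp

lemma lcs_Suc_subset: "subgroup H G==>lcs G H (Suc n)<=lcs G H n"
proof (induction n)
 case 0 thus ?case using lcs_subset[of H "Suc 0"] by simp
next
 case (Suc n)
 hence "(UN x:lcs G H (Suc n). UN y:H. {comm G x y})<=(UN x:lcs G H n. UN y:H. {comm G x y})"
 by blast
 thus ?case unfolding lcs.simps(2)[of G H "Suc n"] lcs.simps(2)[of G H n] by (rule mono_generate)
qed

lemma lcs_antimono:
 assumes "subgroup H G" "m<=n" shows "lcs G H n<=lcs G H m"
 using assms(2)
proof (induction rule: dec_induct)
 case (step n)
 thus ?case using lcs_Suc_subset[OF assms(1), of n] by blast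
qed simp

lemma lower_central_consistent:
 assumes "subgroup H G"
 shows "lower_central (G\<lparr>carrier := H\<rparr>) n=lcs G H n"
proof (induction n)
 case (Suc n)
 have inH: "lcs G H n<=H" by (rule lcs_subset[OF assms])
 have eq: "(UN x:lcs G H n. UN y:H. {x **\<^bsub>G\<lparr>carrier := H\<rparr>\<^esub> y **\<^bsub>G\<lparr>carrier := H\<rparr>\<^esub> inv\<^bsub>G\<lparr>carrier := H\<rparr>\<^esub> x
 **\<^bsub>G\<lparr>carrier := H\<rparr>\<^esub> inv\<^bsub>G\<lparr>carrier := H\<rparr>\<^esub> y})=(UN x:lcs G H n. UN y:H. {comm G x y})"
 proof (rule SUP_cong[OF HOL.refl], rule SUP_cong[OF HOL.refl])
 fix x y assume "x:lcs G H n" "y:H"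
 hence "inv\<^bsub>G\<lparr>carrier := H\<rparr>\<^esub> x=inv x" "inv\<^bsub>G\<lparr>carrier := H\<rparr>\<^esub> y=inv y"
 using m_inv_consistent[OF assms] inH by auto
 thus "{x **\<^bsub>G\<lparr>carrier := H\<rparr>\<^esub> y **\<^bsub>G\<lparr>carrier := H\<rparr>\<^esub> inv\<^bsub>G\<lparr>carrier := H\<rparr>\<^esub> x
 **\<^bsub>G\<lparr>carrier := H\<rparr>\<^esub> inv\<^bsub>G\<lparr>carrier := H\<rparr>\<^esub> y}={comm G x y}"
 by (simp add: comm_def)
 qed
 have "(UN x:lcs G H n. UN y:H. {comm G x y})<=H"
 using lcs_subset[OF assms, of "Suc n"] comm_in_lcs by blast
 from generate_consistent[OF this assms] show ?case
 using Suc eq by simp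
qed simp

lemma nilpotent_subgroup_iff:
 "subgroup H G==>nilpotent (G\<lparr>carrier := H\<rparr>) \<longleftrightarrow> (EX n. lcs G H n={\<one>})"
 by (simp add: nilpotent_def lower_central_consistent)

lemma fidx_refl: "subgroup H G==>fidx G H H"
 unfolding fidx_def by (intro conjI exI[of _ "{\<one>}"]) (auto simp: subgroup.subset sg_mem)

lemma fidxD: "fidx G Y H==>subgroup Y G" "fidx G Y H==>subgroup H G" "fidx G Y H==>Y<=H"
 by (auto simp: fidx_def)

lemma fidx_trans:
 assumes "fidx G Z Y" "fidx G Y H" shows "fidx G Z H"
proof -
 obtain T where T: "finite T" "T<=carrier G" "ALL h:Y. EX t:T. h**inv t:Z"
 using assms(1) by (auto simp: fidx_def)
 obtain U where U: "finite U" "U<=carrier G" "ALL h:H. EX t:U. h**inv t:Y"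
 using assms(2) by (auto simp: fidx_def)
 have "EX s:(%(t, u). t**u) ` (T \<times> U). h**inv s:Z" if h: "h:H" for h
 proof -
 have hc: "h:carrier G" using h fidxD(2)[OF assms(2)] sg_mem by metis
 obtain u where u: "u:U" "h**inv u:Y" using U h by blast
 obtain t where t: "t:T" "(h**inv u)**inv t:Z" using T u by blast
 have "h**inv (t**u)=(h**inv u)**inv t"
 using t(1) u(1) T(2) U(2) hc subsetD[OF T(2)] subsetD[OF U(2)] by (simp add: inv_mult_group m_assoc)
 thus ?thesis using t u by (intro bexI[of _ "t**u"]) auto
 qed
 moreover have "(%(t, u). t**u) ` (T \<times> U)<=carrier G" using T(2) U(2) by auto
 moreover have "finite ((%(t, u). t**u) ` (T \<times> U))" using T(1) U(1) by simp
 ultimately show ?thesis using assms unfolding fidx_def by (metis order_trans)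
qed

text \<open>A coset of \<open>Y\<close> that meets \<open>K\<close> meets it in a single coset of
  \<open>Y Int K\<close>; \<open>rep\<close> picks an element of \<open>K\<close> there.\<close>

lemma fidx_inter_subgroup:
 assumes "fidx G Y H" "subgroup K G" "K<=H" shows "fidx G (Y Int K) K"
proof -
 obtain T where T: "finite T" "T<=carrier G" "ALL h:H. EX t:T. h**inv t:Y"
 using assms(1) by (auto simp: fidx_def)
 define rep where "rep t=(SOME k. k:K&k**inv t:Y)" for t
 define U where "U=rep ` {t:T. EX k. k:K&k**inv t:Y}"
 have rep: "rep t:K&rep t**inv t:Y" if "EX k. k:K&k**inv t:Y" for t
 unfolding rep_def by (rule someI_ex[OF that])
 have sY: "subgroup Y G" using assms by (simp add: fidx_def)
 have "EX s:U. h**inv s:Y Int K" if h: "h:K" for h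
 proof -
 obtain t where t: "t:T" "h**inv t:Y" using T h assms(3) by blast
 let ?s = "rep t"
 have s: "?s:K" "?s**inv t:Y" using rep[of t] h t(2) by blast+
 have c: "h:carrier G" "?s:carrier G" "t:carrier G"
 using h s(1) t(1) T(2) subgroup.subset[OF assms(2)] by auto
 have "h**inv ?s=(h**inv t)**inv (?s**inv t)"
 using c by (simp add: inv_mult_group m_assoc)
 hence "h**inv ?s:Y" using t(2) s(2) sg_mult[OF sY] sg_inv[OF sY] by simp
 moreover have "h**inv ?s:K" using h s(1) sg_mult[OF assms(2)] sg_inv[OF assms(2)] by simp
 moreover have "?s:U" using t h by (auto simp: U_def)
 ultimately show ?thesis by blast
 qed
 moreover have "finite U" using T(1) by (simp add: U_def)
 moreover have "U<=carrier G" using rep subgroup.subset[OF assms(2)] by (auto simp: U_def)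
 moreover have "subgroup (Y Int K) G" using sY assms(2) by (rule subgroups_Inter_pair)
 ultimately show ?thesis using assms(2) unfolding fidx_def by blast
qed

lemma fidx_inter:
 assumes "fidx G Y H" "fidx G Z H" shows "fidx G (Y Int Z) H"
 using fidx_trans[OF fidx_inter_subgroup[OF assms(1) fidxD(1)[OF assms(2)] fidxD(3)[OF assms(2)]] assms(2)] .

text \<open>The core is the intersection of the conjugates of \<open>Y\<close> by the finitely many
  representatives, since \<open>g\<close> and its representative yield the same conjugate.
  Maximality among the normal subgroups inside \<open>Y\<close> later keeps a given normal subgroup
  below the core.\<close>

lemma fidx_core:
 assumes "fidx G Y (carrier G)"
 shows "EX Z. Z \<lhd> G&Z<=Y&fidx G Z (carrier G)
&(ALL A. A \<lhd> G-->A<=Y-->A<=Z)"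
proof -
 obtain T where T: "finite T" "T<=carrier G" "ALL h:carrier G. EX t:T. h**inv t:Y"
 using assms(1) by (auto simp: fidx_def)
 have sY: "subgroup Y G" by (rule fidxD(1)[OF assms])
 define C where "C t={x:carrier G. t**x**inv t:Y}" for t
 have C: "fidx G (C t) (carrier G)" if t: "t:carrier G" for t
 proof -
 have "EX s:(%s. inv t**s**t) ` T. h**inv s:C t" if h: "h:carrier G" for h
 proof -
 obtain s where s: "s:T" "(t**h**inv t)**inv s:Y" using T(3) h t by blast
 have "t**(h**inv (inv t**s**t))**inv t=(t**h**inv t)**inv s"
 using h t s(1) T(2) subsetD[OF T(2)] by (simp add: m_assoc inv_mult_group)
 thus ?thesis using s h t T(2) by (intro bexI[of _ "inv t**s**t"]) (auto simp: C_def)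
 qed
 moreover have "(%s. inv t**s**t) ` T<=carrier G" using T(2) t by auto
 moreover have "subgroup (C t) G" unfolding C_def by (rule subgroup_conj_vimage[OF sY t])
 ultimately show ?thesis
 using T(1) subgroup_self unfolding fidx_def C_def by (intro conjI exI[of _ "(%s. inv t**s**t) ` T"]) auto
 qed
 define Z where "Z={x:carrier G. ALL g:carrier G. g**x**inv g:Y}"
 have "fidx G (carrier G Int \<Inter>(C ` F)) (carrier G)" if "finite F" "F<=carrier G" for F
 using that
 proof (induction F rule: finite_induct)
 case (insert t F)
 have "carrier G Int \<Inter>(C ` insert t F)=C t Int (carrier G Int \<Inter>(C ` F))" by auto
 thus ?case using fidx_inter[OF C[of t] insert.IH] insert.prems by simp
 qed (simp add: fidx_refl subgroup_self)
 hence "fidx G (carrier G Int \<Inter>(C ` T)) (carrier G)" using T by blast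
 moreover have "carrier G Int \<Inter>(C ` T)=Z"
 proof (intro equalityI subsetI)
 fix x assume x: "x:carrier G Int \<Inter>(C ` T)"
 have "g**x**inv g:Y" if g: "g:carrier G" for g
 proof -
 obtain t where t: "t:T" "g**inv t:Y" using T(3) g by blast
 have xt: "t**x**inv t:Y" using x t by (auto simp: C_def)
 have "g**x**inv g=(g**inv t)**(t**x**inv t)**inv (g**inv t)"
 using g t(1) x T(2) subsetD[OF T(2)] by (simp add: m_assoc inv_mult_group)
 thus ?thesis using t(2) xt sY sg_mult sg_inv by metis
 qed
 thus "x:Z" using x by (simp add: Z_def)
 qed (use T(2) in "auto simp: Z_def C_def")
 ultimately have Z: "fidx G Z (carrier G)" by simp
 have "Z \<lhd> G"
 proof (rule normalI_conj)
 show "subgroup Z G" by (rule fidxD(1)[OF Z])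
 fix g x assume g: "g:carrier G" and x: "x:Z"
 have "h**(g**x**inv g)**inv h=(h**g)**x**inv (h**g)" if "h:carrier G" for h
 using that g x by (simp add: Z_def m_assoc inv_mult_group)
 thus "g**x**inv g:Z" using g x by (simp add: Z_def)
 qed
 moreover have "Z<=Y"
 proof
 fix x assume "x:Z"
 hence "\<one>**x**inv \<one>:Y" "x:carrier G" unfolding Z_def by blast+
 thus "x:Y" by simp
 qed
 moreover have "A<=Z" if "A \<lhd> G" "A<=Y" for A
 proof
 fix x assume "x:A"
 thus "x:Z" using that unfolding normal_inv_iff Z_def
 by (auto dest: sg_mem)
 qed
 ultimately show ?thesis using Z by blast
qed

lemma fidx_finite_rcosets:
 "fidx G Y (carrier G) \<longleftrightarrow> subgroup Y G&finite (rcosets\<^bsub>G\<^esub> Y)"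
proof
 assume *: "fidx G Y (carrier G)"
 then obtain T where T: "finite T" "T<=carrier G" "ALL h:carrier G. EX t:T. h**inv t:Y"
 by (auto simp: fidx_def)
 have sY: "subgroup Y G" by (rule fidxD(1)[OF *])
 have "rcosets\<^bsub>G\<^esub> Y<=(%t. Y #> t) ` T"
 proof
 fix c assume "c:rcosets\<^bsub>G\<^esub> Y"
 then obtain h where h: "h:carrier G" "c=Y #> h" by (auto simp: RCOSETS_def)
 obtain t where t: "t:T" "h**inv t:Y" using T h by blast
 have "h:Y #> t" using t h T(2) by (auto simp: r_coset_def m_assoc intro!: bexI[of _ "h**inv t"])
 hence "Y #> t=c" using repr_independence[OF _ _ sY, of h t] h t(1) T(2) by auto
 thus "c:(%t. Y #> t) ` T" using t by blast
 qed
 thus "subgroup Y G&finite (rcosets\<^bsub>G\<^esub> Y)" using T(1) sY finite_surj by blast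
next
 assume *: "subgroup Y G&finite (rcosets\<^bsub>G\<^esub> Y)"
 define T where "T=(%c. SOME x. x:c) ` (rcosets\<^bsub>G\<^esub> Y)"
 have rep: "(SOME x. x:c):c" if "c:rcosets\<^bsub>G\<^esub> Y" for c
 using that subgroup.rcosets_non_empty[of Y G c] * by (metis equals0I someI_ex)
 have "T<=carrier G"
 using rep * subgroup.rcosets_carrier[of Y G] is_group by (fastforce simp: T_def)
 moreover have "EX t:T. h**inv t:Y" if h: "h:carrier G" for h
 proof -
 let ?c = "Y #> h"
 have c: "?c:rcosets\<^bsub>G\<^esub> Y" using h by (auto simp: RCOSETS_def)
 obtain y where y: "y:Y" "(SOME x. x:?c)=y**h" using rep[OF c] by (auto simp: r_coset_def)
 have "y:carrier G" using y * sg_mem by metis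
 hence "h**inv (y**h)=inv y" using h by (simp add: inv_mult_group)
 thus ?thesis using y * c sg_inv[of Y G y] by (auto simp: T_def intro!: bexI[of _ ?c])
 qed
 ultimately show "fidx G Y (carrier G)"
 using * subgroup_self subgroup.subset[of Y G] unfolding fidx_def by (auto simp: T_def intro!: exI[of _ T])
qed

section \<open>Groups with unique roots\<close>

lemma int_pow_commute:
 assumes c: "x:carrier G" "y:carrier G" "x**y=y**x"
 shows "x [^] (a::int)**y [^] (b::int)=y [^] b**x [^] a"
proof -
 have cent: "subgroup {w:carrier G. w**z=z**w} G" if z: "z:carrier G" for z
 proof (rule subgroupI)
 show "{w:carrier G. w**z=z**w} ~= {}" using z by (auto intro!: exI[of _ \<one>])
 fix w assume "w:{w:carrier G. w**z=z**w}"
 hence w: "w:carrier G" "w**z=z**w" by auto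
 hence "inv w**(w**z)**inv w=inv w**(z**w)**inv w" by simp
 hence "z**inv w=inv w**z" using w(1) z by (simp add: m_assoc)
 thus "inv w:{w:carrier G. w**z=z**w}" using w(1) by simp
 fix w' assume "w':{w:carrier G. w**z=z**w}"
 hence w': "w':carrier G" "w'**z=z**w'" by auto
 have "(w**w')**z=w**(z**w')" using w w' z by (simp add: m_assoc)
 also have "\<dots>=z**(w**w')" using w w' z by (simp flip: m_assoc)
 finally show "w**w':{w:carrier G. w**z=z**w}" using w w' by simp
 qed auto
 have "x [^] a**y=y**x [^] a"
 using subgroup_int_pow_closed[OF cent[OF c(2)], of x a] c by simp
 thus ?thesis
 using subgroup_int_pow_closed[OF cent, of "x [^] a" y b] c by simp
qed

text \<open>The unique root of \<open>x\<^sup>m\<close> in \<open>N\<close> commutes with \<open>x\<close>, so Bezout provides a root of \<open>x\<close>.\<close>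

lemma pow_bij_extension:
 assumes N: "N \<lhd> G" "pbij G r N"
 and fin: "!!x. x:carrier G==>EX m>0. coprime m r&x [^] (m::nat):N"
 shows "pbij G r (carrier G)"
proof -
 have sN: "subgroup N G" using N(1) normal_inv_iff by blast
 have Nc: "!!x. x:N==>x:carrier G" using sN sg_mem by metis
 have bez: "EX a b :: int. a * int m + b * int r=1" if "coprime m r" for m :: nat
 using bezout_int[of "int m" "int r"] that by (simp add: coprime_int_iff)
 have split: "x=(x [^] m) [^] a**(x [^] r) [^] b"
 if "x:carrier G" "a * int m + b * int r=1" for x a b and m :: nat
 proof -
 have "x=x [^] (int m * a + int r * b)" using that by (simp add: mult.commute)
 thus ?thesis using that(1) by (simp only: int_pow_mult int_pow_pow[symmetric] int_pow_int)
 qed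
 have "inj_on (%x. x [^] r) (carrier G)"
 proof (rule inj_onI)
 fix x y assume c: "x:carrier G" "y:carrier G" and e: "x [^] r=y [^] r"
 obtain k l where k: "coprime k r" "x [^] k:N" and l: "coprime l r" "y [^] l:N"
 using fin c by meson
 \<comment> \<open>A common exponent prime to \<open>r\<close> puts both powers into
   \<open>N\<close>, where roots are unique; Bezout then recovers \<open>x\<close> and
   \<open>y\<close> from their powers with exponents \<open>?m\<close> and \<open>r\<close>.\<close>
 let ?m = "k * l"
 have m: "x [^] ?m:N" "y [^] ?m:N"
 using sN k l c subgroup_int_pow_closed[OF sN] by (metis int_pow_int nat_pow_pow mult.commute)+
 have "(x [^] ?m) [^] r=(x [^] r) [^] ?m" using c by (simp add: nat_pow_pow mult.commute)
 also have "\<dots>=(y [^] ?m) [^] r" unfolding e using c by (simp add: nat_pow_pow mult.commute)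
 finally have me: "x [^] ?m=y [^] ?m"
 using bij_betw_imp_inj_on[OF N(2)] m by (auto simp: inj_on_def)
 have "coprime ?m r" using k l by simp
 then obtain a b :: int where "a * int ?m + b * int r=1" using bez by blast
 thus "x=y" using split[of x a ?m b] split[of y a ?m b] c e me by metis
 qed
 moreover have "x:(%x. x [^] r) ` carrier G" if x: "x:carrier G" for x
 proof -
 obtain m where m: "coprime m r" "x [^] m:N" using fin x by blast
 obtain z where z: "z:N" "z [^] r=x [^] m"
 using bij_betw_imp_surj_on[OF N(2)] m(2) by (metis imageE)
 have "x**z**inv x:N" using N(1) x z(1) normal_inv_iff by blast
 moreover have "(x**z**inv x) [^] r=x**x [^] m**inv x"
 using conj_pow[of z x r] x z Nc by simp
 moreover have "\<dots>=x [^] m" using x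
 by (metis inv_solve_right' nat_pow_closed nat_pow_comm nat_pow_eone m_closed)
 ultimately have "x**z**inv x=z"
 using bij_betw_imp_inj_on[OF N(2)] z by (auto simp: inj_on_def)
 hence "x**z=z**x" using x z(1) Nc by (metis inv_solve_right' m_closed)
 hence cm: "z [^] a**x [^] b=x [^] b**z [^] a" for a b :: int
 using int_pow_commute[of z x] Nc[OF z(1)] x by metis
 obtain a b :: int where ab: "a * int m + b * int r=1" using bez[OF m(1)] by blast
 have "(z [^] a**x [^] b) [^] r=(z [^] a) [^] r**(x [^] b) [^] r"
 using pow_mult_distrib[of "z [^] a" "x [^] b" r] cm x Nc[OF z(1)] by simp
 also have "\<dots>=(z [^] r) [^] a**(x [^] r) [^] b"
 using x Nc[OF z(1)] by (simp only: int_pow_int[symmetric] int_pow_pow mult.commute)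
 also have "\<dots>=x" using split[OF x ab] z(2) by simp
 finally show ?thesis using x Nc[OF z(1)] by (metis imageI int_pow_closed m_closed)
 qed
 ultimately show ?thesis by (auto simp: bij_betw_def)
qed

text \<open>Isolated subgroups. If \<open>G\<close> has unique \<open>r\<close>-th roots for
  \<open>r\<close> in \<open>Q\<close>, these are the subgroups with the same property
  (\<open>isol_pbij\<close>, \<open>pbij_isol\<close>); the form as a closure condition passes
  directly to intersections and conjugates.\<close>

definition isol :: "nat set => 'a set => bool" where
 "isol Q P \<longleftrightarrow> subgroup P G&(ALL r:Q. ALL x:carrier G. x [^] r:P-->x:P)"

lemma isol_pbij:
 assumes "!!r. r:Q==>pbij G r (carrier G)" "isol Q P" "r:Q" shows "pbij G r P"
proof -
 have sP: "subgroup P G" using assms(2) by (simp add: isol_def)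
 have "inj_on (%x. x [^] r) P"
 using assms(1)[OF assms(3)] inj_on_subset subgroup.subset[OF sP] by (auto simp: bij_betw_def)
 moreover have "x [^] r:P" if "x:P" for x
 using that subgroup_int_pow_closed[OF sP, of x "int r"] by (simp add: int_pow_int)
 moreover have "x:(%x. x [^] r) ` P" if x: "x:P" for x
 proof -
 have xc: "x:carrier G" using sg_mem[OF sP x] .
 obtain y where y: "y:carrier G" "x=y [^] r"
 using bij_betw_imp_surj_on[OF assms(1)[OF assms(3)]] xc by (metis imageE)
 hence "y:P" using assms(2,3) x by (auto simp: isol_def)
 thus ?thesis using y by blast
 qed
 ultimately show ?thesis by (auto simp: bij_betw_def)
qed

lemma pbij_isol:
 assumes "!!r. r:Q==>pbij G r (carrier G)" "subgroup P G" "!!r. r:Q==>pbij G r P"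
 shows "isol Q P"
proof -
 have "x:P" if r: "r:Q" and x: "x:carrier G" "x [^] r:P" for r x
 proof -
 obtain y where y: "y:P" "x [^] r=y [^] r"
 using bij_betw_imp_surj_on[OF assms(3)[OF r]] x(2) by (metis imageE)
 hence "y:carrier G" using sg_mem[OF assms(2)] by blast
 hence "x=y" using y x bij_betw_imp_inj_on[OF assms(1)[OF r]] by (auto simp: inj_on_def)
 thus ?thesis using y by simp
 qed
 thus ?thesis using assms(2) by (auto simp: isol_def)
qed

primrec ucs :: "nat => 'a set" where
 "ucs 0={\<one>}"
| "ucs (Suc n)={x:carrier G. ALL y:carrier G. comm G x y:ucs n}"

lemma ucs_normal: "ucs n \<lhd> G"
proof (induction n)
 case 0 thus ?case
 by (intro normalI_conj) (auto simp: triv_subgroup)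
next
 case (Suc n)
 have s: "subgroup (ucs n) G" and cj: "!!g x. g:carrier G==>x:ucs n==>g**x**inv g:ucs n"
 using Suc normal_inv_iff by blast+
 have cj': "inv g**x**g:ucs n" if "g:carrier G" "x:ucs n" for g x
 using cj[of "inv g" x] that by simp
 show ?case
 proof (rule normalI_conj)
 show "subgroup (ucs (Suc n)) G"
 proof (rule subgroupI)
 show "ucs (Suc n) ~= {}" using sg_one[OF s] by (auto intro!: exI[of _ \<one>])
 qed (auto simp: comm_mult_left comm_inv_left sg_mult[OF s] sg_inv[OF s] cj cj')
 fix g x assume g: "g:carrier G" and x: "x:ucs (Suc n)"
 have "comm G (g**x**inv g) y:ucs n" if y: "y:carrier G" for y
 proof -
 have "comm G (g**x**inv g) y=g**comm G x (inv g**y**g)**inv g"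
 using x y g by (simp add: comm_def m_assoc inv_mult_group)
 thus ?thesis using cj[OF g] x y g by simp
 qed
 thus "g**x**inv g:ucs (Suc n)" using g x by simp
 qed
qed

text \<open>The claim is uniqueness of roots modulo \<open>ucs n\<close>. In the step,
  \<open>z = u^r v^-r\<close> is central modulo \<open>ucs n\<close>, and so is its root
  \<open>w\<close>, because conjugates of \<open>w\<close> have the same \<open>r\<close>-th power
  there. Hence \<open>w v\<close> and \<open>u\<close> have the same power modulo
  \<open>ucs n\<close> and agree there, while \<open>w\<close> lies in
  \<open>ucs (Suc n)\<close>.\<close>

lemma ucs_unique_roots:
 assumes loc: "pbij G r (carrier G)"
 shows "u:carrier G==>v:carrier G==>u [^] r**inv (v [^] r):ucs n==>u**inv v:ucs n"
proof (induction n arbitrary: u v)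
 case 0
 hence "u [^] r**inv (v [^] r)=\<one>" by simp
 hence "u [^] r=v [^] r" using div_eq_one[of "u [^] r" "v [^] r"] 0 by blast
 hence "u=v" using bij_betw_imp_inj_on[OF loc] 0(1,2) by (auto simp: inj_on_def)
 thus ?case using 0(2) by simp
next
 case (Suc n)
 let ?W = "ucs n"
 interpret W: normal ?W G by (rule ucs_normal)
 interpret Q: group "G Mod ?W" by (rule W.factorgroup_is_group)
 let ?h = "%x. ?W #> x"
 have h: "?h:hom G (G Mod ?W)" by (rule W.r_coset_hom_Mod)
 interpret h: group_hom G "G Mod ?W" ?h by unfold_locales (rule h)
 have heq: "?h x=?h y \<longleftrightarrow> x**inv y:?W" if "x:carrier G" "y:carrier G" for x y
 proof
 assume "?h x=?h y"
 hence "x:?W #> y" using rcos_self[OF that(1) W.subgroup_axioms] by simp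
 then obtain w where "w:?W" "x=w**y" by (auto simp: r_coset_def)
 thus "x**inv y:?W" using that by (simp add: m_assoc)
 next
 assume w: "x**inv y:?W"
 have "x=(x**inv y)**y" using that by (simp add: m_assoc)
 hence "x:?W #> y" using w unfolding r_coset_def by blast
 thus "?h x=?h y" using repr_independence[OF _ _ W.subgroup_axioms] that by metis
 qed
 have inj: "?h x=?h y" if "x:carrier G" "y:carrier G" "?h x [^]\<^bsub>G Mod ?W\<^esub> r=?h y [^]\<^bsub>G Mod ?W\<^esub> r" for x y
 using that Suc.IH[of x y] heq[of "x [^] r" "y [^] r"] heq[of x y] by (simp add: h.hom_nat_pow)
 define z where "z=u [^] r**inv (v [^] r)"
 have z: "z:ucs (Suc n)" "z:carrier G" using Suc.prems by (auto simp: z_def)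
 obtain w where w: "w:carrier G" "w [^] r=z"
 using bij_betw_imp_surj_on[OF loc] z(2) by (metis imageE)
 have cw: "comm G w y:?W" if y: "y:carrier G" for y
 proof -
 have "comm G z y:?W" using z y by simp
 hence "?h z=?h (y**z**inv y)"
 using heq[of z "y**z**inv y"] y z(2) unfolding comm_def by (simp only: inv_closed m_closed m_assoc inv_mult_group inv_inv)
 hence "?h w [^]\<^bsub>G Mod ?W\<^esub> r=?h (y**w**inv y) [^]\<^bsub>G Mod ?W\<^esub> r"
 using w y h.hom_nat_pow[of w r] h.hom_nat_pow[of "y**w**inv y" r] conj_pow[of w y r]
 by (metis inv_closed m_closed)
 hence "?h w=?h (y**w**inv y)" by (rule inj[OF w(1), rotated]) (use w y in simp)
 hence "w**inv (y**w**inv y):?W" using heq[of w "y**w**inv y"] w y by blast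
 thus ?thesis using w y by (simp add: comm_def m_assoc inv_mult_group)
 qed
 hence wS: "w:ucs (Suc n)" using w by simp
 have hc: "?h w **\<^bsub>G Mod ?W\<^esub> ?h v=?h v **\<^bsub>G Mod ?W\<^esub> ?h w"
 proof -
 have "?h (w**v)=?h (v**w)"
 using heq[of "w**v" "v**w"] cw[of v] w Suc.prems by (simp add: comm_def m_assoc inv_mult_group)
 thus ?thesis using w Suc.prems by simp
 qed
 have "?h (w**v) [^]\<^bsub>G Mod ?W\<^esub> r=?h w [^]\<^bsub>G Mod ?W\<^esub> r **\<^bsub>G Mod ?W\<^esub> ?h v [^]\<^bsub>G Mod ?W\<^esub> r"
 using Q.pow_mult_distrib[OF hc] w Suc.prems by simp
 also have "\<dots>=?h (z**v [^] r)" using w Suc.prems z by (simp flip: h.hom_nat_pow)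
 also have "z**v [^] r=u [^] r" using Suc.prems by (simp add: z_def m_assoc)
 finally have "?h u=?h (w**v)" using inj[of u "w**v"] w Suc.prems by (simp add: h.hom_nat_pow)
 hence 1: "u**inv v**inv w:?W"
 using heq[of u "w**v"] w Suc.prems by (simp add: m_assoc inv_mult_group)
 have sS: "subgroup (ucs (Suc n)) G" using ucs_normal normal_inv_iff by blast
 have "comm G x y:?W" if "x:?W" "y:carrier G" for x y
 proof -
 have "x:carrier G" using that W.mem_carrier by blast
 hence "comm G x y=x**(y**inv x**inv y)" using that by (simp add: comm_def m_assoc)
 thus ?thesis using that W.inv_op_closed2[of y "inv x"] by simp
 qed
 hence "?W<=ucs (Suc n)" using W.mem_carrier by auto
 hence "(u**inv v**inv w)**w:ucs (Suc n)" using 1 wS sg_mult[OF sS] by blast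
 thus ?case using w Suc.prems by (simp add: m_assoc)
qed

lemma isol_ucs:
 assumes loc: "!!r. r:Q==>pbij G r (carrier G)" shows "isol Q (ucs n)"
 unfolding isol_def
proof (intro conjI ballI impI)
 show "subgroup (ucs n) G" using ucs_normal normal_inv_iff by blast
 fix r x assume "r:Q" "x:carrier G" "x [^] r:ucs n"
 thus "x:ucs n" using ucs_unique_roots[OF loc, of r x \<one> n] by simp
qed

text \<open>Adjoining roots does not raise the class. For suitable \<open>x\<close> the elements
  \<open>y\<close> with \<open>comm G x y\<close> in \<open>ucs i\<close> form a subgroup, isolated
  by uniqueness of roots modulo \<open>ucs i\<close>; as it contains \<open>N\<close>, it is
  everything. This pushes the lower central series of \<open>N\<close> into the upper central series
  of \<open>G\<close>.\<close>

lemma local_closure_nilpotent: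
 assumes loc: "!!r. r:Q==>pbij G r (carrier G)"
 and N: "subgroup N G" "lcs G N c={\<one>}"
 and cl: "!!P. isol Q P==>N<=P==>P=carrier G"
 shows "lcs G (carrier G) c={\<one>}"
proof -
 have *: "lcs G N (c - i)<=ucs i" if "i<=c" for i
 using that
 proof (induction i)
 case 0 thus ?case using N by simp
 next
 case (Suc i)
 have sw: "subgroup (ucs i) G" and cj: "!!g x. g:carrier G==>x:ucs i==>g**x**inv g:ucs i"
 using ucs_normal normal_inv_iff by blast+
 show ?case
 proof
 fix x assume x: "x:lcs G N (c - Suc i)"
 have xc: "x:carrier G" using x lcs_subgroup[OF N(1)] sg_mem by metis
 define P where "P={y:carrier G. comm G x y:ucs i}"
 have "isol Q P" unfolding isol_def
 proof (intro conjI ballI impI)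
 show "subgroup P G"
 proof (rule subgroupI)
 show "P ~= {}" using xc sg_one[OF sw] by (auto simp: P_def intro!: exI[of _ \<one>])
 fix y assume "y:P"
 thus "inv y:P" using xc cj[of "inv y" "inv (comm G x y)"] sg_inv[OF sw]
 by (simp add: P_def comm_inv_right)
 next
 fix y y' assume "y:P" "y':P"
 thus "y**y':P" using xc cj sg_mult[OF sw]
 by (simp add: P_def comm_mult_right)
 qed (auto simp: P_def)
 fix r y assume r: "r:Q" and y: "y:carrier G" "y [^] r:P"
 have "(x**y**inv x) [^] r**inv (y [^] r):ucs i"
 using y xc by (simp add: P_def comm_def conj_pow)
 from ucs_unique_roots[OF loc[OF r] _ _ this] show "y:P" using xc y by (simp add: P_def comm_def)
 qed
 moreover have "N<=P"
 proof
 fix y assume y: "y:N"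
 have "comm G x y:lcs G N (Suc (c - Suc i))" by (rule comm_in_lcs[OF x y])
 hence "comm G x y:lcs G N (c - i)" using Suc.prems by (simp only: Suc_diff_Suc Suc_le_eq)
 thus "y:P" using Suc y sg_mem[OF N(1)] by (auto simp: P_def)
 qed
 ultimately have "P=carrier G" by (rule cl)
 thus "x:ucs (Suc i)" using xc by (auto simp: P_def)
 qed
 qed
 have "N<=ucs c" using *[of c] by simp
 hence full: "ucs c=carrier G" using cl[OF isol_ucs[OF loc]] by blast
 have "lcs G (carrier G) i<=ucs (c - i)" if "i<=c" for i
 using that
 proof (induction i)
 case 0 thus ?case using full by simp
 next
 case (Suc i)
 have sw: "subgroup (ucs (c - Suc i)) G" using ucs_normal normal_inv_iff by blast
 have "lcs G (carrier G) i<=ucs (Suc (c - Suc i))" using Suc by (simp only: Suc_diff_Suc Suc_le_eq)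
 hence "(UN x:lcs G (carrier G) i. UN y:carrier G. {comm G x y})<=ucs (c - Suc i)" by auto
 thus ?case using generate_subgroup_incl[OF _ sw] by simp
 qed
 from this[of c] show ?thesis
 using sg_one[OF lcs_subgroup[OF subgroup_self]] by auto
qed
end

section \<open>Localization of virtually nilpotent groups\<close>

abbreviation copr :: "nat set => nat set" where
 "copr pj \<equiv> {q. prime q&q ~: pj}"

lemma pi_local_iff:
 "pi_local pj G \<longleftrightarrow> group G&(ALL r:copr pj. pbij G r (carrier G))"
 by (auto simp: pi_local_def)

context group
begin

lemma pi_local_subgroup:
 assumes "pi_local pj G" "isol (copr pj) P" shows "pi_local pj (G\<lparr>carrier := P\<rparr>)"
proof -
 have sP: "subgroup P G" using assms(2) by (simp add: isol_def)
 have "pbij G r P" if "r:copr pj" for r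
 by (rule isol_pbij[OF _ assms(2) that]) (use assms(1) in "auto simp: pi_local_iff")
 thus ?thesis
 using subgroup.subgroup_is_group[OF sP is_group] by (simp add: pi_local_iff nat_pow_consistent[symmetric])
qed

lemma isol_Inter: "\<P> ~= {}==>(!!P. P:\<P>==>isol Q P)==>isol Q (\<Inter>\<P>)"
 by (auto simp: isol_def intro!: subgroups_Inter)

lemma isol_conj:
 assumes "isol Q P" "g:carrier G" shows "isol Q {x:carrier G. g**x**inv g:P}"
 unfolding isol_def
proof (intro conjI ballI impI)
 show "subgroup {x:carrier G. g**x**inv g:P} G"
 using assms subgroup_conj_vimage by (simp add: isol_def)
 fix r x assume r: "r:Q" and x: "x:carrier G" "x [^] r:{x:carrier G. g**x**inv g:P}"
 hence "(g**x**inv g) [^] r:P" using conj_pow[of x g r] assms(2) by simp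
 thus "x:{x:carrier G. g**x**inv g:P}" using assms r x by (simp add: isol_def)
qed

text \<open>Factors \<open>r\<close> of the exponent \<open>k\<close> can be stripped one by one,
  because \<open>P\<close> is closed under \<open>r\<close>-th roots.\<close>

lemma pow_in_subgroup_exponent:
 assumes loc: "!!r. r:Q==>prime r" and P: "isol Q P" and r: "r:Q"
 and x: "x:carrier G" "x [^] k:P" "0 < (k::nat)"
 shows "EX m>0. coprime m r&x [^] (m::nat):P"
 using x(2,3)
proof (induction k rule: less_induct)
 case (less k)
 show ?case
 proof (cases "r dvd k")
 case False
 thus ?thesis using less.prems loc[OF r] prime_imp_coprime[of r k] by (auto simp: coprime_commute)
 next
 case True
 then obtain l where l: "k=l * r" by (auto simp: dvd_def mult.commute)
 have "(x [^] l) [^] r:P" using less.prems(1) x(1) by (simp add: l nat_pow_pow)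
 hence "x [^] l:P" using P r x(1) by (auto simp: isol_def)
 moreover have "0 < l" "l < k" using less.prems(2) l prime_gt_1_nat[OF loc[OF r]] by auto
 ultimately show ?thesis using less.IH by blast
 qed
qed

text \<open>By the pigeonhole principle two powers of \<open>x\<close> share a
  representative.\<close>

lemma fidx_pow:
 assumes "fidx G Y H" "x:H" shows "EX k>0. x [^] (k::nat):Y"
proof -
 obtain T where T: "finite T" "T<=carrier G" "ALL h:H. EX t:T. h**inv t:Y"
 using assms(1) by (auto simp: fidx_def)
 have sH: "subgroup H G" and sY: "subgroup Y G" using assms(1) by (auto simp: fidx_def)
 have xc: "x:carrier G" using assms(2) sg_mem[OF sH] by blast
 have pw: "x [^] k:H" for k :: nat
 using subgroup_int_pow_closed[OF sH assms(2), of "int k"] by (simp add: int_pow_int)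
 hence "EX t:T. x [^] k**inv t:Y" for k :: nat using T by blast
 then obtain f where f: "!!k :: nat. f k:T&x [^] k**inv (f k):Y" by metis
 have "~ inj f"
 using T(1) f finite_subset[of "range f" T] finite_imageD[of f UNIV] infinite_UNIV_nat by blast
 then obtain i j where ij: "i < j" "f i=f j" by (metis injI nat_neq_iff)
 have tc: "f j:carrier G" using f[of j] T(2) by blast
 have "x [^] j=x [^] (j - i)**x [^] i" using ij xc by (simp add: nat_pow_mult)
 hence "(x [^] j**inv (f j))**inv (x [^] i**inv (f j))=x [^] (j - i)"
 using xc tc by (simp add: inv_mult_group m_assoc)
 moreover have "(x [^] j**inv (f j))**inv (x [^] i**inv (f j)):Y"
 using f[of j] f[of i] ij(2) sg_mult[OF sY] sg_inv[OF sY] by metis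
 ultimately show ?thesis using ij(1) by (intro exI[of _ "j - i"]) simp
qed
end

text \<open>\<open>P\<close> is itself a local test group on the type of \<open>L\<close>, so the
  localization map factors through it. Uniqueness of the factorization, applied to endomorphisms of
  \<open>L\<close>, makes the induced map from \<open>L\<close> to \<open>P\<close> the
  identity.\<close>

lemma localization_minimal:
 assumes L: "pi_localization pj G L fi" and P: "group.isol L (copr pj) P" and fi: "fi ` carrier G<=P"
 shows "P=carrier L"
proof -
 have loc: "pi_local pj L" and ph: "fi:hom G L" using L by (auto simp: pi_localization_def)
 interpret L: group L using loc by (simp add: pi_local_def)
 have sP: "subgroup P L" using P by (simp add: L.isol_def)
 let ?P = "L\<lparr>carrier := P\<rparr>"
 have "pi_local pj ?P" by (rule L.pi_local_subgroup[OF loc P])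
 moreover have "fi:hom G ?P" using ph fi by (auto simp: hom_def)
 ultimately obtain ps where ps: "ps:hom L ?P" "ALL x:carrier G. ps (fi x)=fi x"
 using L unfolding pi_localization_def by meson
 have uniq: "\<exists>!rh. rh:hom L L&rh:extensional (carrier L)&(ALL x:carrier G. rh (fi x)=fi x)"
 using L loc ph unfolding pi_localization_def by blast
 have fic: "!!x. x:carrier G==>fi x:carrier L" using ph by (auto simp: hom_def)
 have "restrict ps (carrier L):hom L L" using ps(1) subgroup.subset[OF sP] by (auto simp: hom_def)
 moreover have "restrict (%x. x) (carrier L):hom L L" by (auto simp: hom_def)
 ultimately have "restrict ps (carrier L)=restrict (%x. x) (carrier L)"
 using uniq ps(2) fic by (metis restrict_apply' restrict_extensional)
 hence "x=ps x" if "x:carrier L" for x using that by (metis restrict_apply')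
 hence "carrier L<=P" using ps(1) by (auto simp: hom_def Pi_iff)
 thus ?thesis using subgroup.subset[OF sP] by blast
qed

lemma hom_lcs:
 assumes "group G" "group L" "fi:hom G L" "subgroup N G"
 shows "lcs L (fi ` N) n=fi ` lcs G N n"
proof -
 interpret h: group_hom G L fi using assms by (simp add: group_hom_def group_hom_axioms_def)
 have c: "lcs G N n<=carrier G" for n
 using subgroup.subset[OF group.lcs_subgroup[OF assms(1,4)]] .
 show ?thesis
 proof (induction n)
 case (Suc n)
 have "fi (comm G x y)=comm L (fi x) (fi y)" if "x:lcs G N n" "y:N" for x y
 using that c[of n] c[of 0] by (simp add: comm_def subset_iff)
 hence "(UN x:fi ` lcs G N n. UN y:fi ` N. {comm L x y})=fi ` (UN x:lcs G N n. UN y:N. {comm G x y})"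
 by (auto simp: image_iff) (metis comm_def)+
 moreover have "(UN x:lcs G N n. UN y:N. {comm G x y})<=carrier G"
 using c[of n] c[of 0] by (auto simp: subset_iff)
 ultimately show ?case using Suc h.generate_img by simp
 qed simp
qed

theorem virtually_nilpotent_localization:
 fixes L :: "('b::infinite) monoid"
 assumes G: "group G" and vn: "virtually_nilpotent G" and L: "pi_localization pj G L fi"
 shows "virtually_nilpotent L"
proof -
 interpret G: group G by (rule G)
 have loc: "pi_local pj L" and ph: "fi:hom G L" using L by (auto simp: pi_localization_def)
 interpret L: group L using loc by (simp add: pi_local_def)
 interpret h: group_hom G L fi by unfold_locales (rule ph)
 let ?Q = "copr pj"
 have Lb: "!!r. r:?Q==>pbij L r (carrier L)" using loc by (auto simp: pi_local_iff)
 have Qp: "!!r. r:?Q==>prime r" by simp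
 obtain N0 where N0: "subgroup N0 G" "finite (rcosets\<^bsub>G\<^esub> N0)" "nilpotent (G\<lparr>carrier := N0\<rparr>)"
 using vn by (auto simp: virtually_nilpotent_def)
 hence "fidx G N0 (carrier G)" by (simp add: G.fidx_finite_rcosets)
 then obtain N where N: "N \<lhd> G" "N<=N0" "fidx G N (carrier G)" using G.fidx_core by blast
 have sN: "subgroup N G" using N(3) by (simp add: fidx_def)
 obtain c where c0: "lcs G N0 c={\<one>\<^bsub>G\<^esub>}" using N0(1,3) G.nilpotent_subgroup_iff by blast
 have c: "lcs G N c={\<one>\<^bsub>G\<^esub>}"
 using G.lcs_mono[OF N0(1) sN N(2), of c] c0 sg_one[OF G.lcs_subgroup[OF sN]] by blast
 let ?N = "fi ` N"
 have sN': "subgroup ?N L" by (rule h.subgroup_img_is_subgroup[OF sN])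
 have Nc: "?N<=carrier L" by (rule subgroup.subset[OF sN'])
 \<comment> \<open>The isolated closure of the image of \<open>N\<close>. Being smallest, it
   inherits nilpotency from \<open>N\<close> and invariance under the image of
   \<open>G\<close>.\<close>
 define M where "M=\<Inter>{P. L.isol ?Q P&?N<=P}"
 have isolL: "L.isol ?Q (carrier L)" by (auto simp: L.isol_def L.subgroup_self)
 have iM: "L.isol ?Q M" unfolding M_def by (rule L.isol_Inter) (use isolL Nc in auto)
 have NM: "?N<=M" by (auto simp: M_def)
 have sM: "subgroup M L" using iM by (simp add: L.isol_def)
 let ?M = "L\<lparr>carrier := M\<rparr>"
 interpret M: group ?M by (rule subgroup.subgroup_is_group[OF sM L.is_group])
 have Mloc: "pi_local pj ?M" by (rule L.pi_local_subgroup[OF loc iM])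
 \<comment> \<open>Since \<open>M\<close> is isolated in \<open>L\<close>, isolation inside
   \<open>M\<close> is isolation in \<open>L\<close>. Hence \<open>M\<close> has no proper isolated
   subgroup over the image of \<open>N\<close>, as \<open>local_closure_nilpotent\<close>
   requires.\<close>
 have isolM: "L.isol ?Q P" if "M.isol ?Q P" for P
 proof -
 have "subgroup P L" using that L.incl_subgroup[OF sM] by (simp add: M.isol_def)
 moreover have "x:P" if "r:?Q" "x:carrier L" "x [^]\<^bsub>L\<^esub> r:P" for r x
 proof -
 have "x [^]\<^bsub>L\<^esub> r:M" using that(3) `M.isol ?Q P` subgroup.subset[of P ?M] by (auto simp: M.isol_def)
 hence "x:M" using iM that by (auto simp: L.isol_def)
 thus ?thesis using `M.isol ?Q P` that by (auto simp: M.isol_def L.nat_pow_consistent[symmetric])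
 qed
 ultimately show ?thesis by (auto simp: L.isol_def)
 qed
 have sNM: "subgroup ?N ?M" by (rule L.subgroup_incl[OF sN' sM NM])
 have lcsM: "lcs ?M K n=lcs L K n" if "subgroup K ?M" for K n
 proof -
 have K: "subgroup K L" by (rule L.incl_subgroup[OF sM that])
 show ?thesis using M.lower_central_consistent[OF that, of n] L.lower_central_consistent[OF K, of n] by simp
 qed
 have "lcs ?M (carrier ?M) c={\<one>\<^bsub>?M\<^esub>}"
 proof (rule M.local_closure_nilpotent[of ?Q])
 show "pbij ?M r (carrier ?M)" if "r:?Q" for r using Mloc that by (simp add: pi_local_iff)
 show "subgroup ?N ?M" by (rule sNM)
 show "lcs ?M ?N c={\<one>\<^bsub>?M\<^esub>}"
 using lcsM[OF sNM] hom_lcs[OF G L.is_group ph sN, of c] c by simp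
 show "P=carrier ?M" if "M.isol ?Q P" "?N<=P" for P
 proof -
 have "M<=P" using isolM[OF that(1)] that(2) by (auto simp: M_def)
 thus ?thesis using that(1) subgroup.subset[of P ?M] by (auto simp: M.isol_def)
 qed
 qed
 hence Mnil: "lcs L M c={\<one>\<^bsub>L\<^esub>}" using lcsM[OF M.subgroup_self] by simp
 have Mconj: "fi g **\<^bsub>L\<^esub> x **\<^bsub>L\<^esub> inv\<^bsub>L\<^esub> (fi g):M" if g: "g:carrier G" and x: "x:M" for g x
 proof -
 let ?C = "{x:carrier L. fi g **\<^bsub>L\<^esub> x **\<^bsub>L\<^esub> inv\<^bsub>L\<^esub> (fi g):M}"
 have "?N<=?C"
 proof
 fix y assume "y:?N"
 then obtain n where n: "n:N" "y=fi n" by blast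
 hence nc: "n:carrier G" using sg_mem[OF sN] by blast
 have "g **\<^bsub>G\<^esub> n **\<^bsub>G\<^esub> inv\<^bsub>G\<^esub> g:N" using N(1) g n(1) G.normal_inv_iff by blast
 hence "fi (g **\<^bsub>G\<^esub> n **\<^bsub>G\<^esub> inv\<^bsub>G\<^esub> g):M" using NM by blast
 thus "y:?C" using g nc n by simp
 qed
 hence "M<=?C" using L.isol_conj[OF iM h.hom_closed[OF g]] unfolding M_def by blast
 thus ?thesis using x by blast
 qed
 \<comment> \<open>A finite extension of \<open>M\<close> that contains the image of
   \<open>G\<close>; it is \<open>L\<close> as soon as it is known to be isolated.\<close>
 define P where "P=M <#>\<^bsub>L\<^esub> fi ` carrier G"
 have sG': "subgroup (fi ` carrier G) L" by (rule h.subgroup_img_is_subgroup[OF G.subgroup_self])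
 have Mc: "!!x. x:M==>x:carrier L" using sg_mem[OF sM] by blast
 have PI: "m **\<^bsub>L\<^esub> fi g:P" if "m:M" "g:carrier G" for m g
 using that by (auto simp: P_def set_mult_def)
 have PE: "EX m g. m:M&g:carrier G&x=m **\<^bsub>L\<^esub> fi g" if "x:P" for x
 using that by (auto simp: P_def set_mult_def)
 have PMul: "(m **\<^bsub>L\<^esub> fi g) **\<^bsub>L\<^esub> (m' **\<^bsub>L\<^esub> fi g')
=(m **\<^bsub>L\<^esub> (fi g **\<^bsub>L\<^esub> m' **\<^bsub>L\<^esub> inv\<^bsub>L\<^esub> (fi g))) **\<^bsub>L\<^esub> fi (g **\<^bsub>G\<^esub> g')"
 if "m:M" "m':M" "g:carrier G" "g':carrier G" for m m' g g'
 using that Mc by (simp add: L.m_assoc)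
 have sP: "subgroup P L"
 proof (rule L.subgroupI)
 show "P<=carrier L" using PE Mc by force
 show "P ~= {}" using PI[OF sg_one[OF sM] G.one_closed] by blast
 fix x assume "x:P"
 then obtain m g where x: "m:M" "g:carrier G" "x=m **\<^bsub>L\<^esub> fi g" using PE by blast
 have "inv\<^bsub>L\<^esub> x=(fi (inv\<^bsub>G\<^esub> g) **\<^bsub>L\<^esub> inv\<^bsub>L\<^esub> m **\<^bsub>L\<^esub> inv\<^bsub>L\<^esub> (fi (inv\<^bsub>G\<^esub> g))) **\<^bsub>L\<^esub> fi (inv\<^bsub>G\<^esub> g)"
 using x Mc by (simp add: L.inv_mult_group L.m_assoc)
 thus "inv\<^bsub>L\<^esub> x:P"
 using PI[OF Mconj[OF G.inv_closed[OF x(2)] sg_inv[OF sM x(1)]] G.inv_closed[OF x(2)]] by simp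
 fix y assume "y:P"
 then obtain m' g' where y: "m':M" "g':carrier G" "y=m' **\<^bsub>L\<^esub> fi g'" using PE by blast
 show "x **\<^bsub>L\<^esub> y:P"
 unfolding x(3) y(3) PMul[OF x(1) y(1) x(2) y(2)]
 by (rule PI[OF sg_mult[OF sM x(1) Mconj[OF x(2) y(1)]] G.m_closed[OF x(2) y(2)]])
 qed
 have MP: "M<=P"
 proof
 fix m assume "m:M"
 thus "m:P" using PI[of m "\<one>\<^bsub>G\<^esub>"] Mc by simp
 qed
 have GP: "fi ` carrier G<=P" using PI[OF sg_one[OF sM]] by auto
 obtain T where T: "finite T" "T<=carrier G" "ALL h:carrier G. EX t:T. h **\<^bsub>G\<^esub> inv\<^bsub>G\<^esub> t:N"
 using N(3) by (auto simp: fidx_def)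
 have fP: "fidx L M P"
 unfolding fidx_def
 proof (intro conjI exI[of _ "fi ` T"] ballI)
 fix x assume "x:P"
 then obtain m g where x: "m:M" "g:carrier G" "x=m **\<^bsub>L\<^esub> fi g" using PE by blast
 obtain t where t: "t:T" "g **\<^bsub>G\<^esub> inv\<^bsub>G\<^esub> t:N" using T x(2) by blast
 have tc: "t:carrier G" using t T by blast
 have "x **\<^bsub>L\<^esub> inv\<^bsub>L\<^esub> (fi t)=m **\<^bsub>L\<^esub> fi (g **\<^bsub>G\<^esub> inv\<^bsub>G\<^esub> t)"
 using x tc Mc by (simp add: L.m_assoc)
 moreover have "\<dots>:M" using NM t x sg_mult[OF sM] by blast
 ultimately show "EX t:fi ` T. x **\<^bsub>L\<^esub> inv\<^bsub>L\<^esub> t:M" using t(1) by (intro bexI[of _ "fi t"]) simp_all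
 qed (use sM sP MP T in auto)
 let ?P = "L\<lparr>carrier := P\<rparr>"
 interpret P: group ?P by (rule subgroup.subgroup_is_group[OF sP L.is_group])
 have MnP: "M \<lhd> ?P"
 proof (rule P.normalI_conj)
 show "subgroup M ?P" by (rule L.subgroup_incl[OF sM sP MP])
 fix x y assume "x:carrier ?P" and y: "y:M"
 hence xP: "x:P" by simp
 obtain m g where x: "m:M" "g:carrier G" "x=m **\<^bsub>L\<^esub> fi g" using PE[OF xP] by blast
 have "x **\<^bsub>L\<^esub> y **\<^bsub>L\<^esub> inv\<^bsub>L\<^esub> x=m **\<^bsub>L\<^esub> (fi g **\<^bsub>L\<^esub> y **\<^bsub>L\<^esub> inv\<^bsub>L\<^esub> (fi g)) **\<^bsub>L\<^esub> inv\<^bsub>L\<^esub> m"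
 using x y Mc by (simp add: L.m_assoc L.inv_mult_group)
 also have "\<dots>:M" using Mconj[OF x(2) y] x(1) sg_mult[OF sM] sg_inv[OF sM] by simp
 finally show "x **\<^bsub>?P\<^esub> y **\<^bsub>?P\<^esub> inv\<^bsub>?P\<^esub> x:M" using L.m_inv_consistent[OF sP xP] by simp
 qed
 \<comment> \<open>Each element of \<open>P\<close> has a power in \<open>M\<close>, with exponent
   prime to \<open>r\<close> because \<open>M\<close> is isolated; so unique roots extend from
   \<open>M\<close> to \<open>P\<close>.\<close>
 have "pbij L r P" if r: "r:?Q" for r
 proof -
 have "pbij ?P r (carrier ?P)"
 proof (rule P.pow_bij_extension[OF MnP])
 show "pbij ?P r M" using L.isol_pbij[OF Lb iM r] by (simp add: L.nat_pow_consistent[symmetric])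
 fix x assume x: "x:carrier ?P"
 then obtain k where k: "k > 0" "x [^]\<^bsub>L\<^esub> (k::nat):M" using L.fidx_pow[OF fP] by auto
 show "EX m>0. coprime m r&x [^]\<^bsub>?P\<^esub> (m::nat):M"
 using L.pow_in_subgroup_exponent[OF Qp iM r _ k(2,1)] x sg_mem[OF sP, of x]
 by (simp add: L.nat_pow_consistent[symmetric])
 qed
 thus ?thesis by (simp add: L.nat_pow_consistent[symmetric])
 qed
 hence "L.isol ?Q P" using L.pbij_isol[OF Lb sP] by blast
 hence "P=carrier L" by (rule localization_minimal[OF L _ GP])
 hence "fidx L M (carrier L)" using fP by simp
 moreover have "nilpotent (L\<lparr>carrier := M\<rparr>)" using L.nilpotent_subgroup_iff[OF sM] Mnil by blast
 ultimately show ?thesis using L.fidx_finite_rcosets sM by (auto simp: virtually_nilpotent_def)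
qed

section \<open>Finitely generated and polycyclic subgroups\<close>

context group
begin

definition fg :: "'a set => bool" where
 "fg H \<longleftrightarrow> (EX S. finite S&S<=carrier G&generate G S=H)"

lemma fgE: "fg H==>(!!S. finite S==>S<=carrier G==>S<=H==>generate G S=H==>thesis)==>thesis"
 unfolding fg_def by (auto intro: generate.incl)

lemma fg_subgroup: "fg H==>subgroup H G"
 unfolding fg_def using generate_is_subgroup by blast

lemma subgroup_closed:
 assumes "subgroup H G"
 shows "\<one>:H" "x:H==>x:carrier G" "x:H==>y:H==>x**y:H" "x:H==>inv x:H"
 "x:H==>x [^] (i::int):H" "x:H==>x [^] (n::nat):H" "x:H==>y:H==>comm G x y:H"
 using assms subgroup_int_pow_closed[OF assms, of x i] subgroup_int_pow_closed[OF assms, of x "int n"]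
 by (auto simp: sg_one sg_mem sg_mult sg_inv
 comm_def int_pow_int)

text \<open>Words grow on the right only. The induction over \<open>generate\<close> needs the
  stronger claim that right multiplication by \<open>x\<close> preserves \<open>P\<close> on the
  whole generated subgroup.\<close>

lemma generate_right_induct [consumes 2, case_names one mult inv]:
 assumes x: "x:generate G S" and S: "S<=carrier G"
 and one: "P \<one>"
 and mult: "!!h s. h:generate G S==>s:S==>P h==>P (h**s)"
 and inv: "!!h s. h:generate G S==>s:S==>P h==>P (h**inv s)"
 shows "P x"
proof -
 have sG: "subgroup (generate G S) G" by (rule generate_is_subgroup[OF S])
 note gc = subgroup_closed[OF sG]
 from x have "ALL h:generate G S. P h-->P (h**x)"
 proof (induction rule: generate.induct)
 case one thus ?case using gc by simp
 next
 case (incl s) thus ?case using mult by blast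
 next
 case (inv s) thus ?case using assms(5) by blast
 next
 case (eng a b)
 show ?case
 proof (intro ballI impI)
 fix h assume h: "h:generate G S" "P h"
 have "P ((h**a)**b)" using eng h gc(3) by blast
 thus "P (h**(a**b))" using h eng gc(2) by (simp add: m_assoc)
 qed
 qed
 thus ?thesis using one gc(1,2) x by force
qed

text \<open>Schreier's lemma. All products \<open>t s t'^-1\<close> that fall into \<open>Y\<close>
  are taken as generators, so that the union of the cosets of \<open>N\<close> by \<open>U\<close>
  is closed under right multiplication by generators of \<open>H\<close>. Including
  \<open>U Int Y\<close> turns this covering of \<open>H\<close> into \<open>Y <= N\<close>.\<close>

lemma fg_fidx:
 assumes Y: "fidx G Y H" and H: "fg H" shows "fg Y"
proof -
 have sY: "subgroup Y G" and sH: "subgroup H G" and YH: "Y<=H" using Y by (auto simp: fidx_def)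
 note Yc = subgroup_closed[OF sY] and Hc = subgroup_closed[OF sH]
 obtain T where T: "finite T" "T<=carrier G" "ALL h:H. EX t:T. h**inv t:Y"
 using Y by (auto simp: fidx_def)
 obtain S where S: "finite S" "S<=carrier G" "S<=H" "generate G S=H" using fgE[OF H] by metis
 define S' where "S'=S Un m_inv G ` S"
 have S': "finite S'" "S'<=H" using S Hc by (auto simp: S'_def)
 define U where "U=insert \<one> (T Int H)"
 have U: "finite U" "U<=H" using T Hc by (auto simp: U_def)
 have rep: "EX t:U. h**inv t:Y" if h: "h:H" for h
 proof -
 obtain t where t: "t:T" "h**inv t:Y" using T h by blast
 have tc: "t:carrier G" "h:carrier G" using t T h Hc by auto
 have "inv (h**inv t)**h:H" using t YH Hc h by blast
 hence "t:H" using tc by (simp add: inv_mult_group m_assoc)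
 thus ?thesis using t by (auto simp: U_def)
 qed
 define XX where "XX=((%(t, s, t'). t**s**inv t') ` (U \<times> S' \<times> U) Int Y) Un (U Int Y)"
 have XX: "finite XX" "XX<=Y" using U(1) S'(1) by (auto simp: XX_def)
 have Xc: "XX<=carrier G" using XX Yc by auto
 define N where "N=generate G XX"
 have sN: "subgroup N G" unfolding N_def by (rule generate_is_subgroup[OF Xc])
 note Nc = subgroup_closed[OF sN]
 have NY: "N<=Y" unfolding N_def by (rule generate_subgroup_incl[OF XX(2) sY])
 have XN: "XX<=N" by (auto simp: N_def intro: generate.incl)
 have step: "EX t:U. (h**s)**inv t:N" if h: "h:H" "EX t:U. h**inv t:N" and s: "s:S'" for h s
 proof -
 obtain t where t: "t:U" "h**inv t:N" using h by blast
 have ts: "t:H" "s:H" using t U s S' by auto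
 obtain t' where t': "t':U" "(t**s)**inv t':Y" using rep[of "t**s"] ts Hc by blast
 have "(t**s)**inv t':XX" unfolding XX_def using t t' s by force
 hence "(h**inv t)**((t**s)**inv t'):N" using t XN Nc by blast
 moreover have "(h**inv t)**((t**s)**inv t')=(h**s)**inv t'"
 using h(1) ts t' U Hc subsetD[OF U(2) t'(1)] by (simp add: m_assoc)
 ultimately show ?thesis using t' by auto
 qed
 have "EX t:U. h**inv t:N" if h: "h:generate G S" for h
 using h S(2)
 proof (induction rule: generate_right_induct)
 case one thus ?case using Nc by (auto simp: U_def)
 next
 case (mult h s) thus ?case using step[of h s] S(4) by (auto simp: S'_def)
 next
 case (inv h s) thus ?case using step[of h "inv s"] S(4) by (auto simp: S'_def)
 qed
 hence all: "EX t:U. h**inv t:N" if "h:H" for h using that S(4) by blast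
 have "Y<=N"
 proof
 fix y assume y: "y:Y"
 obtain t where t: "t:U" "y**inv t:N" using all y YH by blast
 have c: "y:carrier G" "t:carrier G" using y t U Yc Hc by auto
 have "inv (y**inv t)**y:Y" using t NY y Yc by blast
 hence "t:Y" using c by (simp add: inv_mult_group m_assoc)
 hence "t:N" using t XN by (auto simp: XX_def)
 hence "(y**inv t)**t:N" using t Nc by blast
 thus "y:N" using c by (simp add: m_assoc)
 qed
 hence "N=Y" using NY by blast
 thus ?thesis using XX(1) Xc unfolding fg_def N_def by blast
qed

text \<open>Commutators are bilinear modulo the next term of the series, so a factor is generated by
  commutators of generators of the preceding factor with generators of \<open>H\<close>.\<close>

lemma lcs_fg:
 assumes H: "fg H"
 shows "EX S. finite S&S<=lcs G H n&lcs G H n<=generate G (S Un lcs G H (Suc n))"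
proof (induction n)
 case 0
 obtain S where S: "finite S" "S<=H" "generate G S=H" using fgE[OF H] by metis
 have "generate G S<=generate G (S Un lcs G H (Suc 0))" by (rule mono_generate) simp
 thus ?case using S by auto
next
 case (Suc n)
 then obtain S where S: "finite S" "S<=lcs G H n" "lcs G H n<=generate G (S Un lcs G H (Suc n))" by blast
 obtain S0 where S0: "finite S0" "S0<=H" "generate G S0=H" using fgE[OF H] by metis
 have sH: "subgroup H G" by (rule fg_subgroup[OF H])
 note Hc = subgroup_closed[OF sH]
 have sl: "subgroup (lcs G H k) G" for k by (rule lcs_subgroup[OF sH])
 have lH: "lcs G H k<=H" for k by (rule lcs_subset[OF sH])
 define XX where "XX=(%(x, s). comm G x s) ` (S \<times> S0)"
 have XX: "finite XX" "XX<=lcs G H (Suc n)"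
 using S S0 comm_in_lcs[of _ H n] by (auto simp: XX_def subset_iff simp del: lcs.simps)
 \<comment> \<open>\<open>W\<close> lies between two consecutive terms of the series and is
   therefore normalized by \<open>H\<close>. So the elements whose commutators fall into
   \<open>W\<close> form subgroups, first in the right and then in the left argument.\<close>
 define W where "W=generate G (XX Un lcs G H (Suc (Suc n)))"
 have XW: "XX Un lcs G H (Suc (Suc n))<=lcs G H (Suc n)" using XX lcs_Suc_subset[OF sH] by blast
 have sW: "subgroup W G" unfolding W_def
 by (rule generate_is_subgroup) (use XW subgroup.subset[OF sl[of "Suc n"]] in blast)
 note Wc = subgroup_closed[OF sW]
 have Wl: "W<=lcs G H (Suc n)" unfolding W_def by (rule generate_subgroup_incl[OF XW sl])
 have lW: "lcs G H (Suc (Suc n))<=W" by (auto simp: W_def simp del: lcs.simps intro: generate.incl)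
 have Wconj: "h**w**inv h:W" if "h:H" "w:W" for h w
 proof -
 have "comm G w h:lcs G H (Suc (Suc n))" using comm_in_lcs[of w H "Suc n" h] that Wl by blast
 hence "inv (comm G w h):W" using lW Wc by blast
 hence "comm G h w:W" using inv_comm that Hc Wc by metis
 thus ?thesis using conj_eq_comm[of w h] that Hc Wc by auto
 qed
 have Wconj': "inv h**w**h:W" if "h:H" "w:W" for h w
 using Wconj[of "inv h" w] that Hc by simp
 have 1: "comm G x y:W" if x: "x:S" and y: "y:H" for x y
 proof -
 have xc: "x:carrier G" "x:H" using x S(2) lH[of n] Hc(2) by blast+
 have "subgroup {y:H. comm G x y:W} G"
 proof (rule subgroupI)
 show "{y:H. comm G x y:W} ~= {}" using Hc Wc xc by (auto intro!: exI[of _ \<one>])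
 qed (use Hc Wc xc Wconj Wconj' in "auto simp: comm_mult_right comm_inv_right")
 moreover have "S0<={y:H. comm G x y:W}"
 using S0 x by (auto simp: W_def XX_def intro!: generate.incl)
 ultimately have "generate G S0<={y:H. comm G x y:W}" by (rule generate_subgroup_incl[rotated])
 thus ?thesis using y S0 by blast
 qed
 have 2: "comm G x y:W" if x: "x:lcs G H n" and y: "y:H" for x y
 proof -
 have yc: "y:carrier G" using y Hc by blast
 have lnc: "!!x. x:lcs G H n==>x:H" using lH by blast
 note lc = subgroup_closed[OF sl[of n]]
 have "subgroup {x:lcs G H n. comm G x y:W} G"
 proof (rule subgroupI)
 show "{x:lcs G H n. comm G x y:W} ~= {}" using lc Wc yc by (auto intro!: exI[of _ \<one>])
 qed (use lc Wc yc Wconj Wconj' lnc in "auto simp: comm_mult_left comm_inv_left")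
 moreover have "S Un lcs G H (Suc n)<={x:lcs G H n. comm G x y:W}"
 proof
 fix x assume "x:S Un lcs G H (Suc n)"
 thus "x:{x:lcs G H n. comm G x y:W}"
 proof
 assume "x:S" thus ?thesis using 1 y S by blast
 next
 assume x: "x:lcs G H (Suc n)"
 hence "comm G x y:W" using comm_in_lcs[OF x y] lW by blast
 thus ?thesis using x lcs_Suc_subset[OF sH] by blast
 qed
 qed
 ultimately have "generate G (S Un lcs G H (Suc n))<={x:lcs G H n. comm G x y:W}"
 by (rule generate_subgroup_incl[rotated])
 thus ?thesis using x S(3) by blast
 qed
 hence "(UN x:lcs G H n. UN y:H. {comm G x y})<=W" by blast
 hence "lcs G H (Suc n)<=W" using generate_subgroup_incl[OF _ sW] by simp
 thus ?case using XX unfolding W_def by blast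
qed

section \<open>Cyclic extensions and polycyclic series over a fixed subgroup\<close>

definition cext :: "'a set => 'a => 'a set" where
 "cext N y={n**y [^] (i::int) | n i. n:N}"

text \<open>Both inclusions are demanded: in an infinite group \<open>y N y^-1\<close> can be a
  proper subgroup of \<open>N\<close>.\<close>

definition nrml :: "'a => 'a set => bool" where
 "nrml y N \<longleftrightarrow> y:carrier G&(ALL n:N. y**n**inv y:N&inv y**n**y:N)"

lemma nrml_pow:
 assumes "nrml y N" "N<=carrier G" "n:N" shows "y [^] (i::int)**n**inv (y [^] i):N"
proof -
 have yc: "y:carrier G" using assms by (simp add: nrml_def)
 have *: "y [^] k**n**inv (y [^] k):N&inv (y [^] k)**n**y [^] k:N" for k :: nat
 proof (induction k)
 case 0 thus ?case using assms by auto
 next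
 case (Suc k)
 let ?a = "y [^] k**n**inv (y [^] k)" and ?b = "inv (y [^] k)**n**y [^] k"
 have "y**?a**inv y:N" "inv y**?b**y:N" using Suc assms(1) by (auto simp: nrml_def)
 moreover have "y**?a**inv y=y [^] Suc k**n**inv (y [^] Suc k)"
 unfolding nat_pow_Suc2[OF yc] using yc subsetD[OF assms(2,3)] by (simp add: m_assoc inv_mult_group del: nat_pow_Suc)
 moreover have "inv y**?b**y=inv (y [^] Suc k)**n**y [^] Suc k"
 using yc subsetD[OF assms(2,3)] by (simp add: m_assoc inv_mult_group)
 ultimately show ?case by simp
 qed
 show ?thesis
 proof (cases "i >= 0")
 case True
 thus ?thesis using *[of "nat i"] yc by (metis int_pow_int nat_0_le)
 next
 case False
 hence "i=- int (nat (- i))" by simp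
 then obtain k where "i=- int k" by metis
 thus ?thesis using *[of k] yc by (simp add: int_pow_neg int_pow_int)
 qed
qed

text \<open>The exponent is a level of \<open>a\<close>. It is ambiguous when a power of
  \<open>y\<close> lies in \<open>N\<close>, so it is kept as a relation, which is still additive
  under products (\<open>lv_mult\<close>).\<close>

definition lv :: "'a set => 'a => 'a => int => bool" where "lv N y a i \<longleftrightarrow> (EX n:N. a=n**y [^] i)"

lemma cext_lv: "a:cext N y \<longleftrightarrow> (EX i. lv N y a i)" by (auto simp: cext_def lv_def)

lemma lv_mult:
 assumes N: "subgroup N G" and y: "nrml y N" and a: "lv N y a i" "lv N y b j" shows "lv N y (a**b) (i + j)"
proof -
 obtain n m where n: "n:N" "a=n**y [^] i" "m:N" "b=m**y [^] j" using a by (auto simp: lv_def)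
 have c: "y:carrier G" "n:carrier G" "m:carrier G" using y n sg_mem[OF N] by (auto simp: nrml_def)
 have "n**(y [^] i**m**inv (y [^] i)):N"
 by (intro sg_mult[OF N] n(1) nrml_pow[OF y subgroup.subset[OF N] n(3)])
 moreover have "a**b=(n**(y [^] i**m**inv (y [^] i)))**y [^] (i + j)" using n c by (simp add: m_assoc int_pow_mult)
 ultimately show ?thesis by (auto simp: lv_def)
qed

lemma lv_inv:
 assumes N: "subgroup N G" and y: "nrml y N" and a: "lv N y a i" shows "lv N y (inv a) (- i)"
proof -
 obtain n where n: "n:N" "a=n**y [^] i" using a by (auto simp: lv_def)
 have c: "y:carrier G" "n:carrier G" using y n sg_mem[OF N] by (auto simp: nrml_def)
 have "y [^] (- i)**inv n**inv (y [^] (- i)):N"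
 by (intro nrml_pow[OF y subgroup.subset[OF N]] sg_inv[OF N n(1)])
 moreover have "inv a=(y [^] (- i)**inv n**inv (y [^] (- i)))**y [^] (- i)"
 using n c by (simp add: inv_mult_group m_assoc int_pow_neg)
 ultimately show ?thesis by (auto simp: lv_def)
qed

lemma lv_0: assumes N: "subgroup N G" and y: "nrml y N" shows "lv N y a 0 \<longleftrightarrow> a:N"
 using y sg_mem[OF N] by (auto simp: lv_def nrml_def)

lemma lv_int_pow:
 assumes N: "subgroup N G" and y: "nrml y N" and a: "lv N y a i" shows "lv N y (a [^] (j::int)) (i * j)"
proof -
 have ac: "a:carrier G" using a y sg_mem[OF N] by (auto simp: lv_def nrml_def)
 have *: "lv N y (a [^] (int k)) (i * int k)" for k
 proof (induction k)
 case 0 thus ?case using lv_0[OF N y] sg_one[OF N] by simp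
 next
 case (Suc k)
 have "a [^] int (Suc k)=a [^] int k**a" using ac by (simp only: int_pow_int nat_pow_Suc)
 moreover have "i * int (Suc k)=i * int k + i" by (simp add: distrib_left)
 ultimately show ?case using lv_mult[OF N y Suc a] by (simp only:)
 qed
 show ?thesis
 proof (cases "0<=j")
 case True thus ?thesis using *[of "nat j"] by simp
 next
 case False thus ?thesis using lv_inv[OF N y *[of "nat (- j)"]] ac by (simp add: int_pow_neg)
 qed
qed

lemma cext_props:
 assumes N: "subgroup N G" and y: "nrml y N"
 shows "subgroup (cext N y) G" "N<=cext N y" "y:cext N y"
 "!!P. subgroup P G==>N<=P==>y:P==>cext N y<=P"
proof -
 have yc: "y:carrier G" using y by (simp add: nrml_def)
 have "lv N y y 1" using yc sg_one[OF N] by (auto simp: lv_def intro!: bexI[of _ \<one>])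
 thus 2: "y:cext N y" unfolding cext_lv by blast
 show "N<=cext N y" unfolding subset_iff cext_lv using lv_0[OF N y] by blast
 show "subgroup (cext N y) G"
 proof (rule subgroupI)
 show "cext N y<=carrier G" using sg_mem[OF N] yc by (auto simp: cext_def)
 show "cext N y ~= {}" using 2 by blast
 fix a assume a: "a:cext N y"
 thus "inv a:cext N y" unfolding cext_lv using lv_inv[OF N y] by blast
 fix b assume "b:cext N y"
 thus "a**b:cext N y" using a lv_mult[OF N y] unfolding cext_lv by blast
 qed
 show "cext N y<=P" if "subgroup P G" "N<=P" "y:P" for P
 using that subgroup_closed[OF that(1)] by (auto simp: cext_def)
qed

text \<open>Polycyclicity relative to \<open>N0\<close>. Each term is normal in the next one,
  \<open>N0\<close> is not assumed normal in \<open>N\<close>, and the cyclic factors may be finite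
  or infinite.\<close>

inductive polyc :: "'a set => 'a set => bool" for N0 where
 base: "polyc N0 N0"
| step: "polyc N0 N==>nrml y N==>polyc N0 (cext N y)"

lemma polyc_subgroup: "polyc N0 N==>subgroup N0 G==>subgroup N G&N0<=N"
 by (induction rule: polyc.induct) (use cext_props in blast)+

lemma polyc_fg: "polyc N0 N==>subgroup N0 G==>EX F. finite F&F<=N&N<=generate G (N0 Un F)"
proof (induction rule: polyc.induct)
 case base thus ?case by (intro exI[of _ "{}"]) (auto intro: generate.incl)
next
 case (step N y)
 then obtain F where F: "finite F" "F<=N" "N<=generate G (N0 Un F)" by blast
 have sN: "subgroup N G" "N0<=N" using polyc_subgroup[OF step.hyps(1) step.prems] by auto
 note e = cext_props[OF sN(1) step.hyps(2)]
 let ?P = "generate G (N0 Un insert y F)"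
 have "N0 Un insert y F<=carrier G" using F sN subgroup.subset[OF sN(1)] step.hyps(2) by (auto simp: nrml_def)
 hence "subgroup ?P G" by (rule generate_is_subgroup)
 moreover have "N<=?P" using F(3) mono_generate[of "N0 Un F" "N0 Un insert y F"] by blast
 moreover have "y:?P" by (auto intro: generate.incl)
 ultimately have "cext N y<=?P" by (rule e(4))
 thus ?case using F e by (intro exI[of _ "insert y F"]) auto
qed

lemma least_pow:
 assumes P: "subgroup P G" and y: "y:carrier G" and ex: "EX i::int. i ~= 0&y [^] i:P"
 obtains m where "0 < m" "y [^] (m::int):P" "!!i. y [^] (i::int):P==>m dvd i"
proof -
 note Pc = subgroup_closed[OF P]
 have ex': "EX k. 0 < k&y [^] int k:P"
 proof -
 obtain i :: int where i: "i ~= 0" "y [^] i:P" using ex by blast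
 have "y [^] \<bar>i\<bar>:P" using Pc(4)[OF i(2)] i(2) y by (cases "i >= 0") (auto simp: int_pow_neg)
 thus ?thesis using i by (intro exI[of _ "nat \<bar>i\<bar>"]) auto
 qed
 define k where "k=(LEAST k. 0 < k&y [^] int k:P)"
 have k: "0 < k" "y [^] int k:P" using LeastI_ex[OF ex'] by (auto simp: k_def)
 have "int k dvd i" if i: "y [^] i:P" for i :: int
 proof (rule ccontr)
 assume nd: "~ int k dvd i"
 let ?r = "nat (i mod int k)"
 have r: "0 < ?r" "?r < k" using nd k(1) by (auto simp: dvd_eq_mod_eq_0 nat_less_iff)
 have "y [^] (int k * (i div int k))=(y [^] int k) [^] (i div int k)"
 using y by (simp add: int_pow_pow)
 hence "y [^] (int k * (i div int k)):P" using k(2) Pc(5) by metis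
 hence "y [^] i**inv (y [^] (int k * (i div int k))):P" using i Pc by blast
 moreover have "y [^] i**inv (y [^] (int k * (i div int k)))=y [^] (i mod int k)"
 using y by (simp add: int_pow_diff[symmetric] minus_mult_div_eq_mod)
 ultimately have "y [^] int ?r:P" using k(1) by simp
 hence "0 < ?r&y [^] int ?r:P" using r(1) by simp
 then obtain rh where rh: "rh=?r" "0 < rh&y [^] int rh:P" by blast
 have "k<=rh" unfolding k_def by (rule Least_le) (rule rh(2))
 hence "k<=?r" using rh(1) by simp
 thus False using r by simp
 qed
 thus thesis using that[of "int k"] k by simp
qed

text \<open>If \<open>Y\<close> meets the cyclic extension in a positive level, an element
  \<open>w\<close> of least positive level generates the intersection over \<open>N Int Y\<close>,
  by division with remainder. If all levels are zero, the intersection lies in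
  \<open>N\<close>.\<close>

lemma polyc_inter:
 assumes "polyc N0 N" "subgroup N0 G" and Y: "subgroup Y G" "N0<=Y" shows "polyc N0 (N Int Y)"
 using assms(1)
proof (induction rule: polyc.induct)
 case base
 have "N0 Int Y=N0" using Y by blast
 thus ?case using polyc.base by simp
next
 case (step N y)
 have sN: "subgroup N G" using polyc_subgroup[OF step.hyps(1) assms(2)] by auto
 note Yc = subgroup_closed[OF Y(1)] and nr = step.hyps(2)
 note e = cext_props[OF sN nr] and l0 = lv_0[OF sN nr]
 show ?case
 proof (cases "EX k. 0 < k&(EX a:Y. lv N y a (int k))")
 case False
 have "i=0" if a: "a:Y" "lv N y a i" for a i
 proof (rule ccontr)
 assume "i ~= 0"
 then consider "0 < i" | "0 < - i" by linarith
 thus False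
 proof cases
 case 1 thus ?thesis using False a by (metis zero_less_imp_eq_int)
 next
 case 2 thus ?thesis using False lv_inv[OF sN nr a(2)] Yc(4)[OF a(1)] by (metis zero_less_imp_eq_int)
 qed
 qed
 hence "cext N y Int Y=N Int Y" using e(2) l0 unfolding set_eq_iff Int_iff cext_lv by metis
 thus ?thesis using step.IH by simp
 next
 case ex: True
 define k where "k=(LEAST k. 0 < k&(EX a:Y. lv N y a (int k)))"
 have k: "0 < k" "EX a:Y. lv N y a (int k)" using LeastI_ex[OF ex] by (auto simp: k_def)
 then obtain w where w: "w:Y" "lv N y w (int k)" by blast
 have red: "a**inv (w [^] (i div int k)):N" if a: "a:Y" "lv N y a i" for a i
 proof -
 let ?r = "nat (i mod int k)" and ?a = "a**inv (w [^] (i div int k))"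
 have "lv N y ?a (i + - (int k * (i div int k)))"
 by (intro lv_mult[OF sN nr a(2)] lv_inv[OF sN nr] lv_int_pow[OF sN nr w(2)])
 hence l: "lv N y ?a (int ?r)" using k(1) by (simp add: minus_mult_div_eq_mod)
 have aY: "?a:Y" by (intro Yc a(1) w(1))
 have "?r < k" using k(1) by (simp add: nat_less_iff)
 hence "~ (0 < ?r&(EX a:Y. lv N y a (int ?r)))" unfolding k_def by (rule not_less_Least)
 moreover have "EX a:Y. lv N y a (int ?r)" using l aY by (rule bexI)
 ultimately have "~ 0 < ?r" by (rule contrapos_nn[OF _ conjI[rotated]])
 hence "?r=0" by (rule iffD1[OF not_gr0])
 hence "lv N y ?a 0" using l by (simp only: of_nat_0)
 thus ?thesis using l0 by blast
 qed
 have wN: "nrml w (N Int Y)" unfolding nrml_def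
 proof (intro conjI ballI IntI)
 fix m assume m: "m:N Int Y"
 hence lm: "lv N y m 0" using l0 by blast
 note wi = lv_inv[OF sN nr w(2)]
 show "w**m**inv w:N" using lv_mult[OF sN nr lv_mult[OF sN nr w(2) lm] wi] l0 by simp
 show "inv w**m**w:N" using lv_mult[OF sN nr lv_mult[OF sN nr wi lm] w(2)] l0 by simp
 show "w**m**inv w:Y" "inv w**m**w:Y" using m w(1) by (intro Yc; blast)+
 qed (rule Yc(2)[OF w(1)])
 have sNY: "subgroup (N Int Y) G" using sN Y(1) by (rule subgroups_Inter_pair)
 note f = cext_props[OF sNY wN]
 have "cext (N Int Y) w=cext N y Int Y"
 proof
 have "w:cext N y" using w(2) cext_lv by blast
 thus "cext (N Int Y) w<=cext N y Int Y"
 using f(4)[OF subgroups_Inter_pair[OF e(1) Y(1)]] e(2) w(1) by blast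
 show "cext N y Int Y<=cext (N Int Y) w"
 proof
 fix a assume a: "a:cext N y Int Y"
 then obtain i where i: "lv N y a i" unfolding Int_iff cext_lv by blast
 let ?b = "w [^] (i div int k)"
 have b: "?b:Y" by (rule Yc(5)[OF w(1)])
 have aY: "a:Y" using a by blast
 have "a**inv ?b:N Int Y" using red[OF aY i] Yc(3)[OF aY Yc(4)[OF b]] by blast
 moreover have "a=a**inv ?b**?b" using Yc(2)[OF aY] Yc(2)[OF b] by (simp add: m_assoc)
 ultimately show "a:cext (N Int Y) w" unfolding cext_def by blast
 qed
 qed
 thus ?thesis using polyc.step[OF step.IH wN] by simp
 qed
qed

text \<open>A cyclic factor killed by \<open>e\<close> has at most \<open>e\<close> elements, and
  indices multiply along the series.\<close>

lemma polyc_torsion_fidx: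
 assumes "polyc N0 N" and N0: "subgroup N0 G" and e: "0 < (e::nat)" "!!x. x:N==>x [^] e:N0" shows "fidx G N0 N"
 using assms(1) e(2)
proof (induction rule: polyc.induct)
 case base show ?case by (rule fidx_refl[OF N0])
next
 case (step N y)
 have sN: "subgroup N G" "N0<=N" using polyc_subgroup[OF step.hyps(1) N0] by auto
 note Nc = subgroup_closed[OF sN(1)] and x = cext_props[OF sN(1) step.hyps(2)]
 have yc: "y:carrier G" using step.hyps(2) by (simp add: nrml_def)
 have ye: "y [^] int e:N" using step.prems[OF x(3)] sN(2) by (auto simp: int_pow_int)
 have "EX t:(%i. y [^] i) ` {0..<int e}. h**inv t:N" if "h:cext N y" for h
 proof -
 obtain n and i :: int where h: "n:N" "h=n**y [^] i" using `h:cext N y` by (auto simp: cext_def)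
 have "h**inv (y [^] (i mod int e))=n**y [^] (i - i mod int e)"
 using h(2) Nc(2)[OF h(1)] yc by (simp add: m_assoc int_pow_diff)
 also have "i - i mod int e=int e * (i div int e)" by (simp add: minus_mod_eq_mult_div)
 also have "y [^] (int e * (i div int e))=(y [^] int e) [^] (i div int e)" using yc by (simp add: int_pow_pow)
 finally have "h**inv (y [^] (i mod int e)):N" using Nc(3)[OF h(1) Nc(5)[OF ye]] by simp
 thus ?thesis using e(1) by (intro bexI[of _ "y [^] (i mod int e)"]) auto
 qed
 hence "fidx G N (cext N y)" unfolding fidx_def using sN(1) x(1,2) yc
 by (intro conjI exI[of _ "(%i. y [^] i) ` {0..<int e}"]) auto
 moreover have "fidx G N0 N" using step.IH step.prems x(2) by blast
 ultimately show ?case by (rule fidx_trans[rotated])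
qed

text \<open>Elements of \<open>lcs G H j\<close> normalize every subgroup of \<open>H\<close> that
  contains \<open>lcs G H (Suc j)\<close>, because \<open>x n x^-1 = [x, n] n\<close>.\<close>

lemma polyc_adjoin:
 assumes sN0: "subgroup N0 G" and N: "polyc N0 N" "N<=H" "lcs G H (Suc j)<=N" and sH: "subgroup H G"
 and F: "finite F" "F<=lcs G H j"
 shows "EX N'. polyc N0 N'&N<=N'&F<=N'&N'<=H"
 using F
proof (induction F rule: finite_induct)
 case empty thus ?case using N by blast
next
 case (insert s F)
 then obtain N' where N': "polyc N0 N'" "N<=N'" "F<=N'" "N'<=H" by auto
 have sN': "subgroup N' G" using polyc_subgroup[OF N'(1) sN0] by auto
 note Nc = subgroup_closed[OF sN'] and Hc = subgroup_closed[OF sH]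
 have s: "s:lcs G H j" "s:H" "s:carrier G" using insert lcs_subset[OF sH, of j] Hc by auto
 have *: "x**n**inv x:N'" if "x:lcs G H j" "n:N'" for x n
 proof -
 have "comm G x n:N'" using comm_in_lcs[OF that(1), of n] that(2) N N' by blast
 moreover have "x:carrier G" using that lcs_subset[OF sH, of j] Hc by blast
 ultimately show ?thesis using conj_eq_comm[of n x] that Nc by simp
 qed
 have nr: "nrml s N'" unfolding nrml_def
 using *[OF s(1)] *[OF subgroup_closed(4)[OF lcs_subgroup[OF sH] s(1)]] s by auto
 note e = cext_props[OF sN' nr]
 have "cext N' s<=H" by (rule e(4)[OF sH N'(4) s(2)])
 thus ?case using polyc.step[OF N'(1) nr] N' e by (intro exI[of _ "cext N' s"]) auto
qed

text \<open>The lower central series of \<open>H\<close> is climbed from term \<open>n\<close> to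
  term 0; at each stage finitely many generators of a factor are adjoined.\<close>

lemma polyc_nilpotent:
 assumes H: "fg H" and N0: "subgroup N0 G" "N0<=H" "lcs G H n<=N0"
 shows "polyc N0 H"
proof -
 have sH: "subgroup H G" by (rule fg_subgroup[OF H])
 have "EX N. polyc N0 N&lcs G H (n - i)<=N&N<=H" if "i<=n" for i
 using that
 proof (induction i)
 case 0 thus ?case using N0 polyc.base by auto
 next
 case (Suc i)
 define j where "j=n - Suc i"
 have j: "n - i=Suc j" using Suc.prems by (simp add: j_def)
 obtain N where N: "polyc N0 N" "lcs G H (Suc j)<=N" "N<=H" using Suc j by auto
 obtain S where S: "finite S" "S<=lcs G H j" "lcs G H j<=generate G (S Un lcs G H (Suc j))"
 using lcs_fg[OF H] by blast
 obtain N' where N': "polyc N0 N'" "N<=N'" "S<=N'" "N'<=H"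
 using polyc_adjoin[OF N0(1) N(1,3,2) sH S(1,2)] by blast
 have sN': "subgroup N' G" using polyc_subgroup[OF N'(1) N0(1)] by auto
 have "generate G (S Un lcs G H (Suc j))<=N'"
 by (rule generate_subgroup_incl[OF _ sN']) (use N N' in blast)
 thus ?case using S(3) N' by (intro exI[of _ N']) (auto simp: j_def)
 qed
 from this[of n] obtain N where "polyc N0 N" "H<=N" "N<=H" by auto
 thus ?thesis by (metis equalityI)
qed

text \<open>This is finiteness of finitely generated abelian groups of bounded exponent, applied to
  \<open>H\<close> modulo \<open>K\<close>.\<close>

lemma fidx_abelian_torsion:
 assumes H: "fg H" and K: "subgroup K G" "K<=H" and ab: "!!x y. x:H==>y:H==>comm G x y:K"
 and e: "0 < (e::nat)" "!!x. x:H==>x [^] e:K"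
 shows "fidx G K H"
proof (rule polyc_torsion_fidx[OF _ K(1) e])
 have "lcs G H (Suc 0)<=K" unfolding lcs.simps
 proof (rule generate_subgroup_incl[OF _ K(1)], intro UN_least)
 show "{comm G x y}<=K" if "x:H" "y:H" for x y using ab[OF that] by simp
 qed
 thus "polyc K H" by (rule polyc_nilpotent[OF H K])
qed

text \<open>Polycyclic groups are finitely presented: a polycyclic presentation of \<open>H / A\<close> needs only
 finitely many relators \<open>R\<close>.\<close>

lemma polyc_relators:
 assumes "polyc A N" and A: "subgroup A G" and sH: "subgroup H G" and "N<=H"
 shows "EX Z R. finite Z&finite R&Z<=N&R<=A &
 (ALL n:N. EX a:A. EX w:generate G Z. n=a**w) &
 (ALL B. subgroup B G-->B<=A-->R<=B-->(ALL h:H. ALL b:B. h**b**inv h:B) -->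
 generate G (Z Un B) Int A<=B)"
 using assms(1,4)
proof (induction rule: polyc.induct)
 case base
 have "EX a:A. EX w:generate G {}. n=a**w" if "n:A" for n
 using that subgroup_closed[OF A] by (intro bexI[of _ n] bexI[of _ \<one>]) (auto intro: generate.one)
 moreover have "generate G ({} Un B) Int A<=B" if "subgroup B G" for B
 using generate_subgroup_incl[OF _ that, of B] by auto
 ultimately show ?case by (intro exI[of _ "{}"]) simp
next
 case (step N y)
 have sN: "subgroup N G" "A<=N" using polyc_subgroup[OF step.hyps(1) A] by auto
 note Nc = subgroup_closed[OF sN(1)] and Ac = subgroup_closed[OF A] and Hc = subgroup_closed[OF sH]
 have yc: "y:carrier G" using step.hyps(2) by (simp add: nrml_def)
 note e = cext_props[OF sN(1) step.hyps(2)]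
 have yH: "y:H" "N<=H" using e step.prems by auto
 obtain Z R where ZR: "finite Z" "finite R" "Z<=N" "R<=A"
 and gen: "!!n. n:N==>EX a:A. EX w:generate G Z. n=a**w"
 and rel: "!!B. subgroup B G==>B<=A==>R<=B==>(ALL h:H. ALL b:B. h**b**inv h:B) ==>
 generate G (Z Un B) Int A<=B"
 using step.IH yH(2) by metis
 obtain al where al: "!!n. n:N==>al n:A&(EX w:generate G Z. n=al n**w)"
 using gen by metis
 \<comment> \<open>Empty or a singleton: the least positive exponent of a power of \<open>y\<close>
   in \<open>N\<close>, if there is one. Infinite and finite cyclic factors are thus treated
   together.\<close>
 define K where "K={k::int. 0 < k&y [^] k:N&(ALL i. y [^] (i::int):N-->k dvd i)}"
 have Kuniq: "k=l" if "k:K" "l:K" for k l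
 proof -
 have "k dvd l" "l dvd k" "k > 0" "l > 0" using that unfolding K_def by blast+
 thus ?thesis using zdvd_antisym_nonneg[of k l] by simp
 qed
 have Kfin: "finite K"
 proof (cases "K={}")
 case False
 then obtain k where "k:K" by blast
 hence "K<={k}" using Kuniq by blast
 thus ?thesis using finite_subset by blast
 qed simp
 \<comment> \<open>The elements of \<open>N\<close> that occur in the defining relations of the
   cyclic step. Written as an element of \<open>A\<close> times a word in \<open>Z\<close>, they
   contribute their \<open>A\<close>-parts \<open>al\<close> as new relators.\<close>
 define XX where "XX=(%z. y**z**inv y) ` Z Un (%z. inv y**z**y) ` Z Un (%k. y [^] k) ` K"
 have XX: "finite XX" "XX<=N" using ZR Kfin step.hyps(2) by (auto simp: XX_def K_def nrml_def)
 have gen': "EX a:A. EX w:generate G (insert y Z). n=a**w" if n: "n:cext N y" for n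
 proof -
 obtain m and i :: int where m: "m:N" "n=m**y [^] i" using n by (auto simp: cext_def)
 obtain a w where a: "a:A" "w:generate G Z" "m=a**w" using gen[OF m(1)] by blast
 have "insert y Z<=carrier G" using yc ZR Nc by auto
 hence sg: "subgroup (generate G (insert y Z)) G" by (rule generate_is_subgroup)
 have "w:generate G (insert y Z)" using a(2) mono_generate[of Z "insert y Z"] by blast
 moreover have "y:generate G (insert y Z)" by (auto intro: generate.incl)
 ultimately have "w**y [^] i:generate G (insert y Z)" using subgroup_closed[OF sg] by blast
 moreover have "n=a**(w**y [^] i)"
 using m a Ac yc subgroup_closed(2)[OF sg `w:generate G (insert y Z)`] by (simp add: m_assoc)
 ultimately show ?thesis using a(1) by blast
 qed
 have rel': "generate G (insert y Z Un B) Int A<=B"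
 if B: "subgroup B G" "B<=A" "R Un al ` XX<=B" "ALL h:H. ALL b:B. h**b**inv h:B" for B
 proof -
 \<comment> \<open>With the new relators in \<open>B\<close>, \<open>D\<close> contains
   \<open>XX\<close>. Hence \<open>y\<close> normalizes \<open>D\<close>, and every power of
   \<open>y\<close> that lies in \<open>N\<close> lies in \<open>D\<close>.\<close>
 define D where "D=generate G (Z Un B)"
 have ZB: "Z Un B<=N" using ZR B sN by blast
 have ZBc: "Z Un B<=carrier G" using ZB Nc by blast
 have sD: "subgroup D G" unfolding D_def by (rule generate_is_subgroup[OF ZBc])
 note Dc = subgroup_closed[OF sD]
 have DN: "D<=N" unfolding D_def by (rule generate_subgroup_incl[OF ZB sN(1)])
 have ZD: "Z<=D" "B<=D" by (auto simp: D_def intro: generate.incl)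
 have gZD: "generate G Z<=D" by (rule generate_subgroup_incl[OF ZD(1) sD])
 have XD: "XX<=D"
 proof
 fix x assume x: "x:XX"
 then obtain w where "w:generate G Z" "x=al x**w" using al XX by blast
 moreover have "al x:D" using x B(3) ZD by blast
 ultimately show "x:D" using gZD Dc by (metis subsetD)
 qed
 have BH: "h**b**inv h:D" if "h:H" "b:B" for h b using that B(4) ZD by blast
 have 1: "D<={d:carrier G. y**d**inv y:D}"
 unfolding D_def
 proof (rule generate_subgroup_incl[OF _ subgroup_conj_vimage[OF _ yc]])
 show "subgroup (generate G (Z Un B)) G" using sD by (simp add: D_def)
 show "Z Un B<={x:carrier G. y**x**inv y:generate G (Z Un B)}"
 using ZBc XD BH[OF yH(1)] by (auto simp: XX_def D_def)
 qed
 have 2: "D<={d:carrier G. inv y**d**inv (inv y):D}"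
 unfolding D_def
 proof (rule generate_subgroup_incl[OF _ subgroup_conj_vimage])
 show "subgroup (generate G (Z Un B)) G" using sD by (simp add: D_def)
 show "Z Un B<={x:carrier G. inv y**x**inv (inv y):generate G (Z Un B)}"
 using ZBc XD BH[OF Hc(4)[OF yH(1)]] yc by (auto simp: XX_def D_def)
 qed (use yc in auto)
 have nD: "nrml y D" using 1 2 yc by (auto simp: nrml_def)
 note f = cext_props[OF sD nD]
 have "generate G (insert y Z Un B)<=cext D y"
 by (rule generate_subgroup_incl[OF _ f(1)]) (use f ZD in auto)
 moreover have "cext D y Int A<=D"
 proof
 fix a assume a: "a:cext D y Int A"
 then obtain d and i :: int where d: "d:D" "a=d**y [^] i" by (auto simp: cext_def)
 have "inv d**a:N" using d DN a sN Nc by blast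
 hence yi: "y [^] i:N" using d Dc yc by simp
 have "y [^] i:D"
 proof (cases "i=0")
 case True thus ?thesis using Dc by simp
 next
 case False
 then obtain m where m: "0 < m" "y [^] (m::int):N" "!!i. y [^] (i::int):N==>m dvd i"
 using least_pow[OF sN(1) yc] yi by blast
 hence "y [^] m:XX" unfolding XX_def K_def by blast
 hence "y [^] m:D" using XD by blast
 moreover obtain j where "i=m * j" using m(3)[OF yi] by (auto simp: dvd_def)
 ultimately show ?thesis using Dc(5) yc by (metis int_pow_pow)
 qed
 thus "a:D" using d Dc by simp
 qed
 moreover have "D Int A<=B" unfolding D_def by (rule rel[OF B(1,2) _ B(4)]) (use B in blast)
 ultimately show ?thesis by blast
 qed
 have "insert y Z<=cext N y" using ZR e by blast
 moreover have "R Un al ` XX<=A" using ZR al XX by blast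
 ultimately show ?case using gen' rel' ZR XX
 by (intro exI[of _ "insert y Z"] exI[of _ "R Un al ` XX"]) auto
qed

text \<open>Because \<open>H\<close> modulo \<open>A\<close> is finitely presented, \<open>A\<close>
  is finitely generated under conjugation by \<open>H\<close>. Besides the relators, the
  \<open>A\<close>-parts of the generators of \<open>H\<close> are taken; they force
  \<open>H <= D\<close>.\<close>

lemma polyc_normal_generators:
 assumes H: "fg H" "polyc A H" and A: "subgroup A G"
 shows "EX XX. finite XX&XX<=A&(ALL B. subgroup B G-->B<=A-->XX<=B -->
 (ALL h:H. ALL b:B. h**b**inv h:B)-->B=A)"
proof -
 have sH: "subgroup H G" by (rule fg_subgroup[OF H(1)])
 have AH: "A<=H" using polyc_subgroup[OF H(2) A] by blast
 obtain Z R where ZR: "finite Z" "finite R" "Z<=H" "R<=A"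
 and gen: "!!n. n:H==>EX a:A. EX w:generate G Z. n=a**w"
 and rel: "!!B. subgroup B G==>B<=A==>R<=B==>(ALL h:H. ALL b:B. h**b**inv h:B) ==>
 generate G (Z Un B) Int A<=B"
 using polyc_relators[OF H(2) A sH order_refl] by metis
 obtain al where al: "!!n. n:H==>al n:A&(EX w:generate G Z. n=al n**w)"
 using gen by metis
 obtain S where S: "finite S" "S<=H" "generate G S=H" using fgE[OF H(1)] by metis
 have "B=A" if B: "subgroup B G" "B<=A" "R Un al ` S<=B" "ALL h:H. ALL b:B. h**b**inv h:B" for B
 proof -
 define D where "D=generate G (Z Un B)"
 have "Z Un B<=carrier G" using ZR B subgroup.subset[OF sH] subgroup.subset[OF A] by blast
 hence sD: "subgroup D G" unfolding D_def by (rule generate_is_subgroup)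
 have ZD: "generate G Z<=D" "B<=D" using mono_generate[of Z "Z Un B"] by (auto simp: D_def intro: generate.incl)
 have "S<=D"
 proof
 fix s assume s: "s:S"
 then obtain w where "w:generate G Z" "s=al s**w" using al S by blast
 moreover have "al s:D" using s B(3) ZD by blast
 ultimately show "s:D" using ZD subgroup_closed[OF sD] by (metis subsetD)
 qed
 hence "H<=D" using generate_subgroup_incl[OF _ sD, of S] S(3) by blast
 moreover have "D Int A<=B" unfolding D_def by (rule rel[OF B(1,2) _ B(4)]) (use B in blast)
 ultimately show ?thesis using AH B(2) by blast
 qed
 thus ?thesis using ZR S al by (intro exI[of _ "R Un al ` S"]) auto
qed
end

section \<open>Modules as subgroups of a free abelian group with operators\<close>

text \<open>All modules will be quotients of subgroups of one free abelian group. Additive maps of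
  this group, compared modulo a submodule, replace maps of quotients, and as a ring type they come
  with sums and powers.\<close>

typedef 'b endo = "{f :: ('b \<Rightarrow>\<^sub>0 int) => ('b \<Rightarrow>\<^sub>0 int). ALL x y. f (x + y)=f x + f y}"
 morphisms app Endo
 by (rule exI[of _ "%x. x"]) simp
setup_lifting type_definition_endo
notation app (infixr "$" 75)

instantiation endo :: (type) ring_1
begin
lift_definition zero_endo :: "'a endo" is "%x. 0" by simp
lift_definition one_endo :: "'a endo" is "%x. x" by simp
lift_definition plus_endo :: "'a endo => 'a endo => 'a endo" is "%f g x. f x + g x" by simp
lift_definition minus_endo :: "'a endo => 'a endo => 'a endo" is "%f g x. f x - g x" by simp
lift_definition uminus_endo :: "'a endo => 'a endo" is "%f x. - f x" by simp
lift_definition times_endo :: "'a endo => 'a endo => 'a endo" is "%f g x. f (g x)" by simp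
instance
proof
 show "(0 :: 'a endo) ~= 1"
 proof (transfer, rule notI)
 assume "(%x :: 'a \<Rightarrow>\<^sub>0 int. 0)=(%x. x)"
 hence "frag_of (undefined :: 'a)=0" by metis
 thus False by simp
 qed
qed (transfer, simp add: algebra_simps)+
end

lemma app_add: "fi$(u + v)=fi$u + fi$v" by transfer simp

lemma app_zero [simp]: "fi$0=0" using app_add[of fi 0 0] by simp

lemma app_minus: "fi$(- v)=- (fi$v)" using app_add[of fi v "- v"] by (simp add: eq_neg_iff_add_eq_0 add.commute)

lemma app_diff: "fi$(u - v)=fi$u - fi$v" using app_add[of fi u "- v"] by (simp add: app_minus)

lemma zero_app [simp]: "0$v=0" by transfer simp

lemma one_app [simp]: "1$v=v" by transfer simp

lemma plus_app: "(fi + ps)$v=fi$v + ps$v" by transfer simp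

lemma minus_app: "(fi - ps)$v=fi$v - ps$v" by transfer simp

lemma uminus_app: "(- fi)$v=- (fi$v)" by transfer simp

lemma times_app [simp]: "(fi * ps)$v=fi$ps$v" by transfer simp

lemma sum_app: "(SUM i:I. f i)$v=(SUM i:I. f i$v)"
 by (induction I rule: infinite_finite_induct) (simp_all add: plus_app)

definition subgp :: "'v::ab_group_add set => bool" where
 "subgp U \<longleftrightarrow> 0:U&(ALL u:U. ALL v:U. u - v:U)"

lemma subgpD:
 assumes "subgp U" shows "0:U" "u:U==>- u:U" "u:U==>v:U==>u + v:U" "u:U==>v:U==>u - v:U"
proof -
 have d: "u - v:U" if "u:U" "v:U" for u v using assms that by (simp add: subgp_def)
 have z: "0:U" using assms by (simp add: subgp_def)
 have m: "- u:U" if "u:U" for u using d[OF z that] by simp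
 show "0:U" by (rule z)
 show "u:U==>- u:U" by (rule m)
 show "u:U==>v:U==>u - v:U" by (rule d)
 show "u:U==>v:U==>u + v:U" using d[OF _ m, of u v] by simp
qed

lemma subgp_sum: "subgp U==>(!!i. i:I==>f i:U)==>(SUM i:I. f i):U"
 by (induction I rule: infinite_finite_induct) (auto intro: subgpD)

lemma of_nat_app_subgp: "subgp U==>u:U==>of_nat n$u:U"
 by (induction n) (auto simp: plus_app intro: subgpD)

lemma of_int_app_subgp: "subgp U==>u:U==>of_int n$u:U"
 by (cases n) (auto simp: of_nat_app_subgp uminus_app minus_app intro!: subgpD of_nat_app_subgp[of U u "Suc _", simplified])

definition ssum :: "'v::ab_group_add set => 'v set => 'v set" where
 "ssum U V={u + v | u v. u:U&v:V}"

lemma ssum_subgp: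
 assumes U: "subgp U" and V: "subgp V" shows "subgp (ssum U V)"
proof -
 have "0 + 0:ssum U V" unfolding ssum_def using subgpD(1)[OF U] subgpD(1)[OF V] by blast
 moreover have "a - b:ssum U V" if ab: "a:ssum U V" "b:ssum U V" for a b
 proof -
 obtain u v u' v' where *: "a=u + v" "b=u' + v'" "u:U" "u':U" "v:V" "v':V"
 using ab by (auto simp: ssum_def)
 have "a - b=(u - u') + (v - v')" using * by simp
 thus ?thesis unfolding ssum_def using * subgpD(4)[OF U] subgpD(4)[OF V] by blast
 qed
 ultimately show ?thesis by (simp add: subgp_def)
qed

lemma ssumI: "u:U==>v:V==>u + v:ssum U V"
 by (auto simp: ssum_def)

lemma ssum_ub: "subgp U==>subgp V==>U<=ssum U V" "subgp U==>subgp V==>V<=ssum U V"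
 using ssumI[of _ U 0 V] ssumI[of 0 U _ V] subgpD(1)[of U] subgpD(1)[of V] by auto

lemma ssum_least: "subgp W==>U<=W==>V<=W==>ssum U V<=W"
 using subgpD(3)[of W] by (auto simp: ssum_def)

locale group_action = group G for G :: "('a, 'm) monoid_scheme" (structure) +
 fixes E :: "'a => 'b endo"
 assumes E_mult: "x:carrier G==>y:carrier G==>E (x**y)=E x * E y"
 and E_one [simp]: "E \<one>=1"
begin

lemma E_inv [simp]: "x:carrier G==>E (inv x)$E x$v=v" "x:carrier G==>E x$E (inv x)$v=v"
 using E_mult[of "inv x" x] E_mult[of x "inv x"] by (simp_all flip: times_app)

lemma E_app: "x:carrier G==>y:carrier G==>E x$E y$v=E (x**y)$v"
 by (simp add: E_mult)

definition sm :: "'a set => ('b \<Rightarrow>\<^sub>0 int) set => bool" where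
 "sm N U \<longleftrightarrow> subgp U&(ALL n:N. ALL u:U. E n$u:U)"

definition span :: "'a set => ('b \<Rightarrow>\<^sub>0 int) set => ('b \<Rightarrow>\<^sub>0 int) set" where
 "span N A=\<Inter>{U. sm N U&A<=U}"

lemma smD: "sm N U==>subgp U" "sm N U==>n:N==>u:U==>E n$u:U"
 by (auto simp: sm_def)

lemma sm_mono: "sm N U==>N'<=N==>sm N' U"
 by (auto simp: sm_def)

lemma sm_span: "sm N (span N A)"
 unfolding sm_def span_def subgp_def by (auto intro: subgpD)

lemma span_ub: "A<=span N A" by (auto simp: span_def)

lemma span_least: "sm N U==>A<=U==>span N A<=U" by (auto simp: span_def)

lemma span_mono: "A<=A'==>span N A<=span N A'" by (auto simp: span_def)

lemma sm_inter: "sm N U==>sm N V==>sm N (U Int V)"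
 by (auto simp: sm_def subgp_def)

lemma sm_ssum: "sm N U==>sm N V==>sm N (ssum U V)"
 unfolding sm_def[of N "ssum U V"]
proof (intro conjI ballI)
 assume U: "sm N U" and V: "sm N V"
 show "subgp (ssum U V)" by (rule ssum_subgp[OF smD(1)[OF U] smD(1)[OF V]])
 fix n w assume "n:N" "w:ssum U V"
 thus "E n$w:ssum U V"
 using smD(2)[OF U] smD(2)[OF V] by (fastforce simp: ssum_def app_add)
qed

lemma sm_Union_chain:
 assumes "!!k::nat. sm N (L k)" "!!k. L k<=L (Suc k)" shows "sm N (UN k. L k)"
proof -
 have mono: "L i<=L j" if "i<=j" for i j by (rule lift_Suc_mono_le[of L, OF assms(2) that])
 have "u - v:(UN k. L k)" if "u:L i" "v:L j" for u v i j
 proof -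
 have "u:L (max i j)" "v:L (max i j)" using that mono[of i "max i j"] mono[of j "max i j"] by auto
 thus ?thesis using subgpD(4)[OF smD(1)[OF assms(1)]] by blast
 qed
 moreover have "0:(UN k. L k)" using subgpD(1)[OF smD(1)[OF assms(1)]] by blast
 moreover have "E n$u:(UN k. L k)" if "n:N" "u:(UN k. L k)" for n u
 using smD(2)[OF assms(1) that(1)] that(2) by blast
 ultimately show ?thesis unfolding sm_def subgp_def by auto
qed

text \<open>Only submodules of finitely generated spans are tested, all of them inside the fixed
  free abelian group, which may itself be far from finitely generated.\<close>

definition noeth :: "'a set => bool" where
 "noeth N \<longleftrightarrow> (ALL A W. finite A-->sm N W-->W<=span N A -->
 (EX A'. finite A'&A'<=W&W<=span N A'))"

lemma noethD: "noeth N==>finite A==>sm N W==>W<=span N A==>EX A'. finite A'&A'<=W&W<=span N A'"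
 by (auto simp: noeth_def)

lemma noeth_chain:
 assumes N: "noeth N" "finite A" and L: "!!k::nat. sm N (L k)" "!!k. L k<=L (Suc k)" "!!k. L k<=span N A"
 shows "EX K. ALL k. L k<=L K"
proof -
 have mono: "L i<=L j" if "i<=j" for i j by (rule lift_Suc_mono_le[of L, OF L(2) that])
 obtain A' where A': "finite A'" "A'<=(UN k. L k)" "(UN k. L k)<=span N A'"
 using noethD[OF N sm_Union_chain[of N L, OF L(1,2)]] L(3) by blast
 have "EX K. F<=L K" if "finite F" "F<=(UN k. L k)" for F
 using that
 proof (induction F rule: finite_induct)
 case (insert x F)
 then obtain K k where "F<=L K" "x:L k" by auto
 hence "insert x F<=L (max K k)" using mono[of K "max K k"] mono[of k "max K k"] by auto
 thus ?case by blast
 qed simp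
 then obtain K where "A'<=L K" using A' by blast
 hence "span N A'<=L K" by (rule span_least[OF L(1)])
 thus ?thesis using A'(3) by blast
qed

lemma int_subgroup_principal:
 assumes "subgp (I :: int set)"
 shows "EX c:I. ALL i:I. c dvd i"
proof (cases "EX i:I. i ~= 0")
 case False thus ?thesis using subgpD(1)[OF assms] by (intro bexI[of _ 0]) auto
next
 case True
 have mult: "c * j:I" if "c:I" for c j
 proof -
 have n: "c * int m:I" for m
 by (induction m) (use that subgpD[OF assms] in "auto simp: algebra_simps")
 show ?thesis using n[of "nat j"] subgpD(2)[OF assms n[of "nat (- j)"]] by (cases "j >= 0") auto
 qed
 have ex: "EX k. 0 < k&int k:I"
 proof -
 obtain i where "i:I" "i ~= 0" using True by blast
 thus ?thesis using subgpD(2)[OF assms, of i] by (cases "i > 0") (auto intro!: exI[of _ "nat \<bar>i\<bar>"])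
 qed
 define k where "k=(LEAST k. 0 < k&int k:I)"
 have k: "0 < k" "int k:I" using LeastI_ex[OF ex] by (auto simp: k_def)
 have "int k dvd i" if i: "i:I" for i
 proof (rule ccontr)
 assume "~ int k dvd i"
 hence "0 < i mod int k" using k(1) by (metis dvd_eq_mod_eq_0 mod_int_pos_iff of_nat_0_less_iff order_le_less)
 moreover obtain r where r: "i mod int k=int r" using k(1) by (metis Euclidean_Rings.pos_mod_sign nonneg_int_cases of_nat_0_less_iff)
 moreover have "i - int k * (i div int k):I" using subgpD(4)[OF assms i mult[OF k(2)]] .
 ultimately have "0 < r&int r:I" by (simp add: minus_mult_div_eq_mod)
 hence "k<=r" unfolding k_def by (rule Least_le)
 moreover have "i mod int k < int k" using k(1) by simp
 ultimately show False using r by simp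
 qed
 thus ?thesis using k by blast
qed

text \<open>Submodules are plain subgroups here. The coefficients of a new generator
  \<open>x\<close> that occur in \<open>W\<close> modulo \<open>span N A\<close> form a principal
  ideal of the integers; an element \<open>w0\<close> realizing its generator is added to generators
  of \<open>W Int span N A\<close>.\<close>

lemma noeth_trivial:
 assumes triv: "!!n. n:N==>E n=1" shows "noeth N"
proof -
 have sm_iff: "sm N U \<longleftrightarrow> subgp U" for U using triv by (auto simp: sm_def)
 have "EX A'. finite A'&A'<=W&W<=span N A'" if "finite A" "sm N W" "W<=span N A" for A W
 using that
 proof (induction A arbitrary: W rule: finite_induct)
 case empty
 have "sm N {0}" by (simp add: sm_def subgp_def)
 hence "span N {}<={0}" by (rule span_least) simp
 thus ?case using empty by (intro exI[of _ "{}"]) (use subgpD(1)[OF smD(1)[OF sm_span]] in auto)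
 next
 case (insert x A)
 note W = subgpD[OF smD(1)[OF insert.prems(1)]]
 have sA: "sm N (span N A)" by (rule sm_span)
 note SA = subgpD[OF smD(1)[OF sA]]
 define I where "I={c::int. EX w:W. w - of_int c$x:span N A}"
 have "subgp I" unfolding subgp_def
 proof (intro conjI ballI)
 show "0:I" using W(1) SA(1) by (auto simp: I_def intro!: bexI[of _ 0])
 fix c d assume "c:I" "d:I"
 then obtain w v where wv: "w:W" "w - of_int c$x:span N A" "v:W" "v - of_int d$x:span N A"
 unfolding I_def by blast
 have "(w - of_int c$x) - (v - of_int d$x)=(w - v) - of_int (c - d)$x"
 by (simp add: minus_app)
 hence "(w - v) - of_int (c - d)$x:span N A" using SA(4)[OF wv(2,4)] by metis
 thus "c - d:I" using W(4)[OF wv(1,3)] unfolding I_def by blast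
 qed
 then obtain c where c: "c:I" "!!i. i:I==>c dvd i" using int_subgroup_principal by blast
 obtain w0 where w0: "w0:W" "w0 - of_int c$x:span N A" using c by (auto simp: I_def)
 obtain A' where A': "finite A'" "A'<=W Int span N A" "W Int span N A<=span N A'"
 using insert.IH[OF sm_inter[OF insert.prems(1) sA]] by auto
 have "subgp {v. EX d::int. v - of_int d$x:span N A}" unfolding subgp_def
 proof (intro conjI ballI)
 show "0:{v. EX d::int. v - of_int d$x:span N A}" using SA(1) by (auto intro!: exI[of _ 0])
 fix u v assume "u:{v. EX d::int. v - of_int d$x:span N A}" "v:{v. EX d::int. v - of_int d$x:span N A}"
 then obtain d e :: int where de: "u - of_int d$x:span N A" "v - of_int e$x:span N A" by blast
 have "(u - of_int d$x) - (v - of_int e$x)=(u - v) - of_int (d - e)$x"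
 by (simp add: minus_app)
 hence "(u - v) - of_int (d - e)$x:span N A" using SA(4)[OF de] by metis
 thus "u - v:{v. EX d::int. v - of_int d$x:span N A}" by blast
 qed
 moreover have "insert x A<={v. EX d::int. v - of_int d$x:span N A}"
 proof
 fix v assume "v:insert x A"
 hence "v - of_int 1$x:span N A | v - of_int 0$x:span N A"
 using SA(1) span_ub[of A N] by auto
 thus "v:{v. EX d::int. v - of_int d$x:span N A}" by blast
 qed
 ultimately have sp: "span N (insert x A)<={v. EX d::int. v - of_int d$x:span N A}"
 by (intro span_least) (simp_all add: sm_iff)
 have s': "sm N (span N (insert w0 A'))" by (rule sm_span)
 note S' = subgpD[OF smD(1)[OF s']]
 have "W<=span N (insert w0 A')"
 proof
 fix w assume w: "w:W"
 then obtain d :: int where d: "w - of_int d$x:span N A" using sp insert.prems(2) by blast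
 hence "d:I" using w by (auto simp: I_def)
 then obtain k where k: "d=c * k" using c(2) by (auto simp: dvd_def)
 have kw0: "of_int k$w0:W" by (rule of_int_app_subgp[OF smD(1)[OF insert.prems(1)] w0(1)])
 have "of_int k$(w0 - of_int c$x):span N A" by (rule of_int_app_subgp[OF smD(1)[OF sA] w0(2)])
 hence "(w - of_int d$x) - of_int k$(w0 - of_int c$x):span N A" using d SA by blast
 moreover have "of_int k$of_int c$x = of_int d$x"
 by (simp add: k mult.commute flip: times_app of_int_mult)
 ultimately have "w - of_int k$w0:span N A" by (simp add: app_diff algebra_simps)
 hence "w - of_int k$w0:W Int span N A" using w kw0 W by blast
 hence 1: "w - of_int k$w0:span N (insert w0 A')" using A'(3) span_mono[of A' "insert w0 A'"] by blast
 have 2: "of_int k$w0:span N (insert w0 A')"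
 by (rule of_int_app_subgp[OF smD(1)[OF s']]) (use span_ub in blast)
 show "w:span N (insert w0 A')" using S'(3)[OF 1 2] by simp
 qed
 thus ?case using A' w0 by (intro exI[of _ "insert w0 A'"]) auto
 qed
 thus ?thesis by (auto simp: noeth_def)
qed
end

section \<open>The Noetherian property of cyclic and polycyclic extensions\<close>

locale cyclic_extension = group_action G E for G :: "('a, 'm) monoid_scheme" (structure) and E :: "'a => 'b endo" +
 fixes N y
 assumes N: "subgroup N G" and y: "nrml y N"
begin

lemma yc: "y:carrier G" using y by (simp add: nrml_def)

lemma Nc: "n:N==>n:carrier G" using sg_mem[OF N] .
abbreviation yp :: "nat => 'b endo" where "yp k \<equiv> E (y [^] k)"
abbreviation yn :: "nat => 'b endo" where "yn k \<equiv> E (inv (y [^] k))"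

lemma yp_add: "yp i$yp j$v=yp (i + j)$v"
 using E_app[of "y [^] i" "y [^] j"] yc by (simp add: nat_pow_mult)

lemma yp_swap: "n:N==>EX n':N. E n$yp k$v=yp k$E n'$v"
 and yp_swap': "n:N==>EX n':N. yp k$E n$v=E n'$yp k$v"
 and yn_swap: "n:N==>EX n':N. E n$yn k$v=yn k$E n'$v"
proof -
 assume n: "n:N"
 have 1: "y [^] k**n**inv (y [^] k):N"
 using nrml_pow[OF y _ n, of "int k"] subgroup.subset[OF N] by (simp add: int_pow_int)
 have 2: "inv (y [^] k)**n**y [^] k:N"
 using nrml_pow[OF y _ n, of "- int k"] subgroup.subset[OF N] yc by (simp add: int_pow_int int_pow_neg)
 have "E n$yp k$v=yp k$E (inv (y [^] k)**n**y [^] k)$v"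
 using Nc[OF n] yc by (simp add: E_app m_assoc)
 thus "EX n':N. E n$yp k$v=yp k$E n'$v" using 2 by blast
 have "yp k$E n$v=E (y [^] k**n**inv (y [^] k))$yp k$v"
 using Nc[OF n] yc by (simp add: E_app m_assoc)
 thus "EX n':N. yp k$E n$v=E n'$yp k$v" using 1 by blast
 have "E n$yn k$v=yn k$E (y [^] k**n**inv (y [^] k))$v"
 using Nc[OF n] yc by (simp add: E_app m_assoc)
 thus "EX n':N. E n$yn k$v=yn k$E n'$v" using 1 by blast
qed

text \<open>Polynomials in \<open>y\<close> of degree below \<open>k\<close>, with coefficients in
  \<open>span N A\<close>; inverse powers of \<open>y\<close> are excluded.\<close>

definition Uk :: "('b \<Rightarrow>\<^sub>0 int) set => nat => ('b \<Rightarrow>\<^sub>0 int) set" where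
 "Uk A k=span N (UN i<k. (%a. yp i$a) ` A)"

lemma Uk_sm: "sm N (Uk A k)" by (simp add: Uk_def sm_span)

lemma Uk_0: "Uk A 0={0}"
proof -
 have "sm N {0}" by (simp add: sm_def subgp_def)
 thus ?thesis using span_least[of N "{0}" "{}"] subgpD(1)[OF smD(1)[OF Uk_sm[of A 0]]] by (auto simp: Uk_def)
qed

lemma Uk_mono: "i<=j==>Uk A i<=Uk A j"
 unfolding Uk_def by (rule span_mono, rule UN_mono) auto

lemma yp_span: "(%a. yp k$a) ` span N A<=span N ((%a. yp k$a) ` A)"
proof -
 let ?S = "span N ((%a. yp k$a) ` A)"
 have s: "sm N ?S" by (rule sm_span)
 have "sm N {v. yp k$v:?S}"
 unfolding sm_def subgp_def
 proof (intro conjI ballI)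
 fix n v assume n: "n:N" and v: "v:{v. yp k$v:?S}"
 obtain n' where "n':N" "yp k$E n$v=E n'$yp k$v" using yp_swap'[OF n] by blast
 thus "E n$v:{v. yp k$v:?S}" using smD(2)[OF s] v by simp
 qed (use subgpD[OF smD(1)[OF s]] in "auto simp: app_diff")
 hence "span N A<={v. yp k$v:?S}" by (rule span_least) (use span_ub in blast)
 thus ?thesis by blast
qed

lemma yp_Uk: "v:Uk A k==>yp j$v:Uk A (j + k)"
proof -
 assume "v:Uk A k"
 hence "yp j$v:span N ((%a. yp j$a) ` (UN i<k. (%a. yp i$a) ` A))"
 using yp_span by (auto simp: Uk_def)
 moreover have "(%a. yp j$a) ` (UN i<k. (%a. yp i$a) ` A)<=(UN i<j + k. (%a. yp i$a) ` A)"
 proof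
 fix w assume "w:(%a. yp j$a) ` (UN i<k. (%a. yp i$a) ` A)"
 then obtain i a where w: "i < k" "a:A" "w=yp j$yp i$a" by blast
 hence "w=yp (j + i)$a" "j + i < j + k" by (simp_all only: yp_add add_less_cancel_left)
 thus "w:(UN i<j + k. (%a. yp i$a) ` A)" using w(2) by blast
 qed
 ultimately show ?thesis unfolding Uk_def using span_mono by blast
qed

lemma Uk_Suc: "v:Uk A (Suc k)==>EX u:span N A. v - yp k$u:Uk A k"
proof -
 let ?S = "{v. EX u:span N A. v - yp k$u:Uk A k}"
 note s = subgpD[OF smD(1)[OF sm_span[of N A]]] and t = subgpD[OF smD(1)[OF Uk_sm[of A k]]]
 have "sm N ?S" unfolding sm_def subgp_def
 proof (intro conjI ballI)
 show "0:?S" using s(1) t(1) by (auto intro!: bexI[of _ 0])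
 fix v w assume "v:?S" "w:?S"
 then obtain u u' where u: "u:span N A" "v - yp k$u:Uk A k" "u':span N A" "w - yp k$u':Uk A k" by auto
 hence "(v - yp k$u) - (w - yp k$u'):Uk A k" using t by blast
 moreover have "(v - yp k$u) - (w - yp k$u')=(v - w) - yp k$(u - u')"
 by (simp add: app_diff)
 ultimately show "v - w:?S" using u s(4) by (auto intro!: bexI[of _ "u - u'"])
 next
 fix n v assume n: "n:N" and "v:?S"
 then obtain u where u: "u:span N A" "v - yp k$u:Uk A k" by auto
 obtain n' where n': "n':N" "E n$yp k$u=yp k$E n'$u" using yp_swap[OF n] by blast
 have "E n$(v - yp k$u):Uk A k" by (rule smD(2)[OF Uk_sm n u(2)])
 hence "E n$v - yp k$E n'$u:Uk A k" using n' by (simp add: app_diff)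
 thus "E n$v:?S" using smD(2)[OF sm_span n'(1) u(1)] by blast
 qed
 moreover have "(UN i<Suc k. (%a. yp i$a) ` A)<=?S"
 proof
 fix v assume "v:(UN i<Suc k. (%a. yp i$a) ` A)"
 then obtain i a where v: "i < Suc k" "a:A" "v=yp i$a" by blast
 show "v:?S"
 proof (cases "i=k")
 case True thus ?thesis using v t(1) span_ub[of A N] by (auto intro!: bexI[of _ a])
 next
 case False
 hence "v:(UN i<k. (%a. yp i$a) ` A)" using v by auto
 hence "v:Uk A k" unfolding Uk_def by (rule subsetD[OF span_ub])
 thus ?thesis using s(1) by (auto intro!: bexI[of _ 0])
 qed
 qed
 ultimately have "Uk A (Suc k)<=?S" unfolding Uk_def by (rule span_least)
 thus "v:Uk A (Suc k)==>EX u:span N A. v - yp k$u:Uk A k" by blast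
qed

lemma yp_Uk_Suc: "u:span N A==>yp k$u:Uk A (Suc k)"
proof -
 assume "u:span N A"
 hence "u:Uk A 1" using yc by (simp add: Uk_def lessThan_Suc)
 thus ?thesis using yp_Uk[of u A 1 k] by simp
qed

lemma sm_cext: "sm N W==>(!!w. w:W==>E y$w:W)==>(!!w. w:W==>E (inv y)$w:W)==>sm (cext N y) W"
proof -
 assume W: "sm N W" "!!w. w:W==>E y$w:W" "!!w. w:W==>E (inv y)$w:W"
 have 1: "subgroup {g:carrier G. ALL w:W. E g$w:W&E (inv g)$w:W} G"
 by (rule subgroupI) (auto simp: E_mult inv_mult_group intro!: exI[of _ \<one>])
 have "N<={g:carrier G. ALL w:W. E g$w:W&E (inv g)$w:W}"
 using smD(2)[OF W(1)] Nc sg_inv[OF N] by auto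
 hence "cext N y<={g:carrier G. ALL w:W. E g$w:W&E (inv g)$w:W}"
 using cext_props(4)[OF N y 1] W yc by simp
 thus "sm (cext N y) W" using smD(1)[OF W(1)] by (auto simp: sm_def)
qed

text \<open>Clearing denominators: a power of \<open>y\<close> turns a Laurent polynomial into a
  polynomial.\<close>

lemma cext_span: "v:span (cext N y) A==>EX j k. yp j$v:Uk A k"
proof -
 let ?S = "{v. EX j k. yp j$v:Uk A k}"
 have up: "EX k. yp j'$v:Uk A k" if "yp j$v:Uk A k" "j<=j'" for v j j' k
 proof -
 have "yp (j' - j)$yp j$v:Uk A ((j' - j) + k)" by (rule yp_Uk[OF that(1)])
 thus ?thesis using that(2) by (auto simp: yp_add)
 qed
 have "sm N ?S" unfolding sm_def subgp_def
 proof (intro conjI ballI)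
 show "0:?S" using subgpD(1)[OF smD(1)[OF Uk_sm]] by auto
 fix v w assume "v:?S" "w:?S"
 then obtain j j' k k' where "yp j$v:Uk A k" "yp j'$w:Uk A k'" by blast
 then obtain k k' where kk: "yp (max j j')$v:Uk A k" "yp (max j j')$w:Uk A k'"
 using up[of j v k "max j j'"] up[of j' w k' "max j j'"] by auto
 hence "yp (max j j')$v:Uk A (max k k')" "yp (max j j')$w:Uk A (max k k')"
 using Uk_mono[of k "max k k'"] Uk_mono[of k' "max k k'"] by auto
 hence "yp (max j j')$(v - w):Uk A (max k k')"
 using subgpD(4)[OF smD(1)[OF Uk_sm]] by (simp add: app_diff)
 thus "v - w:?S" by blast
 next
 fix n v assume n: "n:N" "v:?S"
 then obtain j k where j: "yp j$v:Uk A k" by blast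
 obtain n' where "n':N" "yp j$E n$v=E n'$yp j$v" using yp_swap'[OF n(1)] by blast
 thus "E n$v:?S" using smD(2)[OF Uk_sm _ j] by (metis (mono_tags, lifting) mem_Collect_eq)
 qed
 moreover have "E y$v:?S" if vS: "v:?S" for v
 proof -
 obtain j k where j: "yp j$v:Uk A k" using vS by blast
 have "yp j$E y$v=yp 1$yp j$v" using yp_add[of j 1 v] yp_add[of 1 j v] yc by simp
 hence "yp j$E y$v:Uk A (1 + k)" using yp_Uk[OF j, of 1] by metis
 thus ?thesis by blast
 qed
 moreover have "E (inv y)$v:?S" if vS: "v:?S" for v
 proof -
 obtain j k where j: "yp j$v:Uk A k" using vS by blast
 have "yp (j + 1)$E (inv y)$v=yp j$v" using yp_add[of j 1 "E (inv y)$v"] yc by simp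
 hence "yp (j + 1)$E (inv y)$v:Uk A k" using j by metis
 thus ?thesis by blast
 qed
 ultimately have "sm (cext N y) ?S" by (rule sm_cext)
 moreover have "A<=?S"
 proof
 fix a assume "a:A"
 hence "a:Uk A 1" unfolding Uk_def using yc span_ub[of A N] by auto
 hence "yp 0$a:Uk A 1" by simp
 thus "a:?S" by blast
 qed
 ultimately have "span (cext N y) A<=?S" by (rule span_least)
 thus "v:span (cext N y) A==>EX j k. yp j$v:Uk A k" by blast
qed

lemma Uk_cext: "Uk A k<=span (cext N y) A"
 unfolding Uk_def
proof (rule span_least)
 have Nx: "N<=cext N y" "y:cext N y" using cext_props[OF N y] by auto
 show "sm N (span (cext N y) A)" by (rule sm_mono[OF sm_span Nx(1)])
 have "y [^] i:cext N y" for i :: nat using subgroup_closed(6)[OF cext_props(1)[OF N y] Nx(2)] .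
 thus "(UN i<k. (%a. yp i$a) ` A)<=span (cext N y) A"
 using smD(2)[OF sm_span] span_ub[of A "cext N y"] by blast
qed

text \<open>The coefficient stands to the right of \<open>y^k\<close>. Multiplication by
  \<open>y\<close> then raises the degree without twisting the leading coefficient, so
  \<open>Lk\<close> increases with \<open>k\<close> (\<open>Lk_Suc\<close>).\<close>

definition Lk :: "('b \<Rightarrow>\<^sub>0 int) set => ('b \<Rightarrow>\<^sub>0 int) set => nat => ('b \<Rightarrow>\<^sub>0 int) set" where
 "Lk A W k={u:span N A. EX w:W. w - yp k$u:Uk A k}"

lemma Lk_sm: assumes W: "sm (cext N y) W" shows "sm N (Lk A W k)"
proof -
 note s = subgpD[OF smD(1)[OF sm_span[of N A]]] and t = subgpD[OF smD(1)[OF Uk_sm[of A k]]] and w = subgpD[OF smD(1)[OF W]]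
 show ?thesis unfolding sm_def subgp_def
 proof (intro conjI ballI)
 show "0:Lk A W k" using s(1) t(1) w(1) by (auto simp: Lk_def intro!: bexI[of _ 0])
 fix u u' assume "u:Lk A W k" "u':Lk A W k"
 then obtain v v' where u: "u:span N A" "u':span N A" "v:W" "v':W" "v - yp k$u:Uk A k" "v' - yp k$u':Uk A k"
 by (auto simp: Lk_def)
 have "(v - yp k$u) - (v' - yp k$u')=(v - v') - yp k$(u - u')" by (simp add: app_diff)
 hence "(v - v') - yp k$(u - u'):Uk A k" using t(4) u by metis
 thus "u - u':Lk A W k" using u s(4) w(4) by (auto simp: Lk_def)
 next
 fix n u assume n: "n:N" and "u:Lk A W k"
 then obtain v where u: "u:span N A" "v:W" "v - yp k$u:Uk A k" by (auto simp: Lk_def)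
 have "y [^] k**n**inv (y [^] k):N"
 using nrml_pow[OF y _ n, of "int k"] subgroup.subset[OF N] by (simp add: int_pow_int)
 then obtain n' where n': "n':N" "yp k$E n$u=E n'$yp k$u" using yp_swap'[OF n] by blast
 have "E n'$(v - yp k$u):Uk A k" by (rule smD(2)[OF Uk_sm n'(1) u(3)])
 hence "E n'$v - yp k$E n$u:Uk A k" using n' by (simp add: app_diff)
 moreover have "E n'$v:W" using smD(2)[OF W] n' cext_props(2)[OF N y] u by blast
 ultimately show "E n$u:Lk A W k" using smD(2)[OF sm_span n u(1)] by (auto simp: Lk_def)
 qed
qed

lemma Lk_Suc: assumes W: "sm (cext N y) W" shows "Lk A W k<=Lk A W (Suc k)"
proof
 fix u assume "u:Lk A W k"
 then obtain v where u: "u:span N A" "v:W" "v - yp k$u:Uk A k" by (auto simp: Lk_def)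
 have "yp 1$(v - yp k$u):Uk A (1 + k)" by (rule yp_Uk[OF u(3)])
 hence "yp 1$v - yp (Suc k)$u:Uk A (Suc k)" unfolding app_diff yp_add by simp
 moreover have "yp 1$v:W" using smD(2)[OF W cext_props(3)[OF N y] u(2)] yc by simp
 ultimately show "u:Lk A W (Suc k)" using u by (auto simp: Lk_def)
qed

lemma Lk_stable:
 assumes "noeth N" "finite A" and W: "sm (cext N y) W"
 shows "EX K. ALL k. Lk A W k<=Lk A W K"
 by (rule noeth_chain[of N A "Lk A W", OF assms(1,2) Lk_sm[OF W] Lk_Suc[OF W]]) (auto simp: Lk_def)

text \<open>Hilbert's basis theorem for twisted Laurent polynomials, with \<open>Lk A W k\<close> in the role of
 the leading coefficients of degree \<open>k\<close>.\<close>

lemma noeth_cext: assumes noeth: "noeth N" shows "noeth (cext N y)"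
 unfolding noeth_def
proof (intro allI impI)
 fix A W assume A: "finite A" and W: "sm (cext N y) W" "W<=span (cext N y) A"
 note w = subgpD[OF smD(1)[OF W(1)]]
 have WN: "sm N W" by (rule sm_mono[OF W(1) cext_props(2)[OF N y]])
 have yW: "yp k$v:W" "yn k$v:W" if "v:W" for v k
 proof -
 note c = subgroup_closed[OF cext_props(1)[OF N y]]
 have "y [^] k:cext N y" using c(6)[OF cext_props(3)[OF N y]] .
 thus "yp k$v:W" "yn k$v:W" using smD(2)[OF W(1) _ that] c(4) by blast+
 qed
 obtain K where K: "!!k. Lk A W k<=Lk A W K" using Lk_stable[OF noeth A W(1)] by blast
 \<comment> \<open>Polynomials of degree at most \<open>K\<close> form a finitely generated
   \<open>N\<close>-module, so the part of \<open>W\<close> in these degrees has finitely many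
   generators. They will generate all of \<open>W\<close> over the extension.\<close>
 have fin: "finite (UN i<Suc K. (%a. yp i$a) ` A)" using A by simp
 obtain A' where A': "finite A'" "A'<=W Int Uk A (Suc K)" "W Int Uk A (Suc K)<=span N A'"
 using noethD[OF noeth fin sm_inter[OF WN Uk_sm[of A "Suc K"]]] by (auto simp only: Uk_def Int_lower2)
 let ?P = "span (cext N y) A'"
 have P: "sm (cext N y) ?P" by (rule sm_span)
 note p = subgpD[OF smD(1)[OF P]]
 have NP: "span N A'<=?P" by (rule span_least[OF sm_mono[OF P cext_props(2)[OF N y]] span_ub])
 have yP: "yp k$v:?P" "yn k$v:?P" if "v:?P" for v k
 proof -
 note c = subgroup_closed[OF cext_props(1)[OF N y]]
 have "y [^] k:cext N y" using c(6)[OF cext_props(3)[OF N y]] .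
 thus "yp k$v:?P" "yn k$v:?P" using smD(2)[OF P _ that] c(4) by blast+
 qed
 have main: "W Int Uk A k<=?P" for k
 proof (induction k)
 case 0 thus ?case using p(1) by (auto simp: Uk_0)
 next
 case (Suc k)
 show ?case
 proof (cases "k<=K")
 case True
 hence "Uk A (Suc k)<=Uk A (Suc K)" by (intro Uk_mono) simp
 thus ?thesis using A'(3) NP by blast
 next
 case False
 show ?thesis
 proof
 fix v assume v: "v:W Int Uk A (Suc k)"
 obtain u where u: "u:span N A" "v - yp k$u:Uk A k" using Uk_Suc v by blast
 hence "u:Lk A W k" using v by (auto simp: Lk_def)
 \<comment> \<open>The leading coefficient \<open>u\<close> of \<open>v\<close> already occurs in
   degree \<open>K\<close>; shifting \<open>v'\<close> by \<open>y^(k - K)\<close> cancels the top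
   term of \<open>v\<close>.\<close>
 then obtain v' where v': "v':W" "v' - yp K$u:Uk A K" using K by (auto simp: Lk_def)
 have "v'=(v' - yp K$u) + yp K$u" by simp
 moreover have "v' - yp K$u:Uk A (Suc K)" using v'(2) Uk_mono[of K "Suc K"] by auto
 ultimately have "v':Uk A (Suc K)"
 using yp_Uk_Suc[OF u(1), of K] subgpD(3)[OF smD(1)[OF Uk_sm]] by metis
 hence v'P: "v':?P" using v' A'(3) NP by blast
 have "yp (k - K)$(v' - yp K$u):Uk A ((k - K) + K)" by (rule yp_Uk[OF v'(2)])
 hence "yp (k - K)$v' - yp k$u:Uk A k" using False unfolding app_diff yp_add by simp
 hence "(v - yp k$u) - (yp (k - K)$v' - yp k$u):Uk A k"
 using u(2) subgpD(4)[OF smD(1)[OF Uk_sm]] by blast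
 hence "v - yp (k - K)$v':Uk A k" by simp
 moreover have "v - yp (k - K)$v':W" using v yW(1)[OF v'(1)] w by blast
 ultimately have "v - yp (k - K)$v':?P" using Suc by blast
 hence "(v - yp (k - K)$v') + yp (k - K)$v':?P" using p(3) yP(1)[OF v'P] by blast
 thus "v:?P" by simp
 qed
 qed
 qed
 have "W<=?P"
 proof
 fix v assume v: "v:W"
 then obtain j k where "yp j$v:Uk A k" using W(2) cext_span by blast
 hence "yp j$v:?P" using main yW(1)[OF v] by blast
 hence "yn j$yp j$v:?P" by (rule yP(2))
 thus "v:?P" using yc by simp
 qed
 thus "EX A'. finite A'&A'<=W&W<=span (cext N y) A'" using A' by blast
qed
end

text \<open>Hall's theorem on modules over polycyclic groups, in a form relative to
  \<open>N0\<close>.\<close>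

lemma (in group_action) noeth_polyc:
 assumes "polyc N0 N" "subgroup N0 G" "noeth N0" shows "noeth N"
 using assms(1)
proof (induction rule: polyc.induct)
 case (step N y)
 interpret cyclic_extension G E N y
 by (intro cyclic_extension.intro group_action_axioms cyclic_extension_axioms.intro)
 (use polyc_subgroup[OF step.hyps(1) assms(2)] step.hyps(2) in auto)
 show ?case by (rule noeth_cext[OF step.IH])
qed (rule assms(3))

section \<open>Submodules with virtually nilpotent action\<close>

text \<open>In the application (\<open>derived_section\<close>) \<open>M\<close> modulo
  \<open>R\<close> is the abelianization of \<open>A\<close>, a factor of the derived series, and
  \<open>M_fg\<close> comes from the finite presentation of \<open>H\<close> modulo
  \<open>A\<close>.\<close>

locale module_action = group_action G E for G :: "('a, 'm) monoid_scheme" (structure) and E :: "'a => 'b endo" +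
 fixes A M R
 assumes A: "subgroup A G" and E_A: "a:A==>E a=1"
 and M: "sm (carrier G) M" and R: "sm (carrier G) R" "R<=M"
 and M_fg: "fg H==>A<=H==>lcs G H n<=A==>EX Xs. finite Xs&Xs<=M&M<=ssum (span H Xs) R"
begin

definition adm :: "'a set => bool" where
 "adm H \<longleftrightarrow> fg H&A<=H&(EX n. lcs G H n<=A)"

lemma admD: "adm H==>subgroup H G" "adm H==>A<=H" "adm H==>fg H"
 by (auto simp: adm_def fg_subgroup)

lemma adm_polyc:
 assumes "adm H" "subgroup N G" "A<=N" "N<=H" shows "polyc A N"
proof -
 obtain n where "fg H" "A<=H" "lcs G H n<=A" using assms(1) by (auto simp: adm_def)
 hence "polyc A H" using polyc_nilpotent A by blast
 hence "polyc A (H Int N)" using polyc_inter[OF _ A assms(2,3)] by blast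
 thus ?thesis using assms(4) by (simp add: Int_absorb1)
qed

lemma adm_noeth: "adm H==>subgroup N G==>A<=N==>N<=H==>noeth N"
 using noeth_polyc[OF adm_polyc A noeth_trivial] E_A by blast

lemma adm_fidx: "adm H==>fidx G Y H==>A<=Y==>adm Y"
 unfolding adm_def using fg_fidx lcs_mono[OF fidxD(2) fidxD(1) fidxD(3)] by blast

lemma adm_M_fg: "adm H==>EX Xs. finite Xs&Xs<=M&M<=ssum (span H Xs) R"
 unfolding adm_def using M_fg by blast

definition bm :: "'a set => ('b \<Rightarrow>\<^sub>0 int) set => bool" where
 "bm H B \<longleftrightarrow> sm H B&R<=B&B<=M"

lemma bm_mono: "bm H B==>H'<=H==>bm H' B"
 by (auto simp: bm_def sm_mono)

text \<open>\<open>M\<close> is finitely generated only modulo \<open>R\<close>. Since all members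
  of the chain contain \<open>R\<close>, they are determined by their traces on a finitely generated
  span.\<close>

lemma bm_chain:
 assumes H: "adm H" and L: "!!k::nat. bm H (L k)" "!!k. L k<=L (Suc k)"
 shows "EX K. ALL k. L k<=L K"
proof -
 obtain Xs where Xs: "finite Xs" "M<=ssum (span H Xs) R" using adm_M_fg[OF H] by blast
 have "EX K. ALL k. L k Int span H Xs<=L K Int span H Xs"
 proof (rule noeth_chain[of H Xs "%k. L k Int span H Xs"])
 show "noeth H" using adm_noeth[OF H admD(1)[OF H] admD(2)[OF H]] by blast
 show "sm H (L k Int span H Xs)" for k using L(1)[of k] sm_inter[OF _ sm_span] by (auto simp: bm_def)
 show "L k Int span H Xs<=L (Suc k) Int span H Xs" for k using L(2)[of k] by blast
 qed (use Xs in auto)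
 then obtain K where K: "!!k. L k Int span H Xs<=L K Int span H Xs" by blast
 have "L k<=L K" for k
 proof
 fix v assume v: "v:L k"
 hence "v:M" using L(1)[of k] by (auto simp: bm_def)
 then obtain a r where ar: "v=a + r" "a:span H Xs" "r:R" using Xs(2) by (auto simp: ssum_def)
 have sk: "subgp (L k)" "subgp (L K)" and rk: "r:L k" "r:L K"
 using L(1)[of k] L(1)[of K] ar(3) smD(1)[of H] unfolding bm_def by blast+
 have "v - r:L k" using subgpD(4)[OF sk(1) v rk(1)] .
 hence "a:L K" using ar K[of k] by auto
 thus "v:L K" using subgpD(3)[OF sk(2) _ rk(2)] ar(1) by simp
 qed
 thus ?thesis by blast
qed

text \<open>The \<open>Y\<close>-central series of \<open>M\<close> ascending from \<open>B\<close>,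
  the additive analogue of the upper central series.\<close>

primrec ser :: "'a set => ('b \<Rightarrow>\<^sub>0 int) set => nat => ('b \<Rightarrow>\<^sub>0 int) set" where
 "ser Y B 0=B"
| "ser Y B (Suc k)={v:M. ALL n:Y. E n$v - v:ser Y B k}"

lemma ser_antimono: "Y'<=Y==>ser Y B k<=ser Y' B k"
 by (induction k) auto

lemma ser_comp: "I<=ser Y B k==>ser Y I m<=ser Y B (m + k)"
 by (induction m) auto

lemma bm_ser:
 assumes Y: "subgroup Y G" and B: "bm Y B" shows "bm Y (ser Y B k)" "B<=ser Y B k"
proof -
 have Yc: "!!n. n:Y==>n:carrier G" using sg_mem[OF Y] .
 have *: "bm Y (ser Y B k)&ser Y B k<=ser Y B (Suc k)" for k
 proof (induction k)
 case 0
 show ?case using B smD(2)[of Y B] subgpD(4)[OF smD(1)] by (auto simp: bm_def)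
 next
 case (Suc k)
 hence S: "sm Y (ser Y B k)" "R<=ser Y B k" "ser Y B k<=ser Y B (Suc k)" by (auto simp: bm_def)
 note s = subgpD[OF smD(1)[OF S(1)]] and m = subgpD[OF smD(1)[OF M]]
 have "sm Y (ser Y B (Suc k))" unfolding sm_def subgp_def
 proof (intro conjI ballI)
 show "0:ser Y B (Suc k)" using s(1) m(1) by simp
 fix u v assume uv: "u:ser Y B (Suc k)" "v:ser Y B (Suc k)"
 have eq: "E n$(u - v) - (u - v)=(E n$u - u) - (E n$v - v)" for n by (simp add: app_diff)
 have "(E n$u - u) - (E n$v - v):ser Y B k" if "n:Y" for n
 by (rule s(4)) (use uv that in auto)
 hence "ALL n:Y. E n$(u - v) - (u - v):ser Y B k" unfolding eq by blast
 thus "u - v:ser Y B (Suc k)" using uv m(4) by auto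
 next
 fix h v assume h: "h:Y" and v: "v:ser Y B (Suc k)"
 have "E n$E h$v - E h$v:ser Y B k" if n: "n:Y" for n
 proof -
 have "inv h**n**h:Y" using h n subgroup_closed[OF Y] by simp
 hence "E h$(E (inv h**n**h)$v - v):ser Y B k" using v smD(2)[OF S(1) h] by simp
 moreover have "E h$E (inv h**n**h)$v=E n$E h$v"
 using Yc[OF h] Yc[OF n] by (simp add: E_app m_assoc)
 ultimately show ?thesis by (simp add: app_diff)
 qed
 moreover have "E h$v:M" using v smD(2)[OF M Yc[OF h]] by simp
 ultimately show "E h$v:ser Y B (Suc k)" by simp
 qed
 moreover have "ser Y B (Suc k)<=ser Y B (Suc (Suc k))" using S(3) by auto
 ultimately show ?case using S by (auto simp: bm_def)
 qed
 show "bm Y (ser Y B k)" using * by blast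
 show "B<=ser Y B k" by (induction k) (use * in auto)
qed

definition nilact :: "'a set => ('b \<Rightarrow>\<^sub>0 int) set => bool" where
 "nilact Y B \<longleftrightarrow> (EX k. M<=ser Y B k)"

definition nva :: "'a set => ('b \<Rightarrow>\<^sub>0 int) set => bool" where
 "nva H B \<longleftrightarrow> (ALL Y. fidx G Y H-->A<=Y-->~ nilact Y B)"

text \<open>A substitute for simplicity: every properly larger submodule leaves a quotient on which
  some subgroup of finite index acts nilpotently (\<open>maxm_nilact\<close>).\<close>

definition maxm :: "'a set => ('b \<Rightarrow>\<^sub>0 int) set => bool" where
 "maxm H B \<longleftrightarrow> bm H B&nva H B&(ALL B'. bm H B'-->B \<subset> B'-->~ nva H B')"

lemma nva_fidx: "nva H B==>fidx G Y H==>nva Y B"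
 unfolding nva_def using fidx_trans by blast

lemma maxm_exists:
 assumes H: "adm H" and B0: "bm H B0" "nva H B0"
 shows "EX B. maxm H B&B0<=B"
proof (rule ccontr)
 assume no: "~ (EX B. maxm H B&B0<=B)"
 define P where "P B \<longleftrightarrow> bm H B&nva H B&B0<=B" for B
 have "EX B'. P B'&B \<subset> B'" if "P B" for B
 using that no unfolding P_def maxm_def by (metis order_trans psubset_imp_subset)
 then obtain f where f: "!!B. P B==>P (f B)&B \<subset> f B" by metis
 define L where "L k=(f ^^ k) B0" for k
 have L: "P (L k)" for k by (induction k) (use B0 f in "auto simp: L_def P_def")
 have LS: "L k \<subset> L (Suc k)" for k using f[OF L[of k]] by (simp add: L_def)
 have "EX K. ALL k. L k<=L K"
 by (rule bm_chain[OF H]) (use L LS in "auto simp: P_def")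
 then obtain K where "L (Suc K)<=L K" by blast
 thus False using LS[of K] by blast
qed

text \<open>An endomorphism of the \<open>H\<close>-module \<open>M / B\<close>, represented by an
  operator on the whole free abelian group.\<close>

definition cop :: "'a set => ('b \<Rightarrow>\<^sub>0 int) set => 'b endo => bool" where
 "cop H B s \<longleftrightarrow> (ALL v:M. s$v:M)&(ALL v:B. s$v:B)
&(ALL h:H. ALL v:M. s$E h$v - E h$s$v:B)"

lemma maxm_nilact:
 assumes "maxm H B" "bm H B'" "B<=B'" "B' ~= B"
 obtains Y k where "fidx G Y H" "A<=Y" "M<=ser Y B' k"
 using assms unfolding maxm_def nva_def nilact_def by (metis psubsetI)

lemma bm_kernel:
 assumes B: "bm H B" and s: "cop H B s" and H: "subgroup H G"
 shows "bm H {v:M. s$v:B}" "B<={v:M. s$v:B}"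
proof -
 have Bs: "sm H B" "R<=B" "B<=M" using B by (auto simp: bm_def)
 note b = subgpD[OF smD(1)[OF Bs(1)]] and m = subgpD[OF smD(1)[OF M]]
 show sub: "B<={v:M. s$v:B}" using s Bs by (auto simp: cop_def)
 have "sm H {v:M. s$v:B}" unfolding sm_def subgp_def
 proof (intro conjI ballI)
 fix h v assume h: "h:H" and v: "v:{v:M. s$v:B}"
 have "E h$s$v:B" "s$E h$v - E h$s$v:B" using smD(2)[OF Bs(1) h] v s h by (auto simp: cop_def)
 hence "(s$E h$v - E h$s$v) + E h$s$v:B" using b by blast
 thus "E h$v:{v:M. s$v:B}"
 using v smD(2)[OF M, of h v] h sg_mem[OF H] by simp
 qed (use b m in "auto simp: app_diff")
 thus "bm H {v:M. s$v:B}" using sub Bs by (auto simp: bm_def)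
qed

lemma bm_range:
 assumes B: "bm H B" and s: "cop H B s" and H: "subgroup H G"
 shows "bm H (ssum (($) s ` M) B)" "B<=ssum (($) s ` M) B"
proof -
 have Bs: "sm H B" "R<=B" "B<=M" using B by (auto simp: bm_def)
 note b = subgpD[OF smD(1)[OF Bs(1)]] and m = subgpD[OF smD(1)[OF M]]
 have sI: "subgp (($) s ` M)" unfolding subgp_def
 proof (intro conjI ballI)
 show "0:($) s ` M" using m(1) by (auto intro!: image_eqI[of _ _ 0])
 fix u v assume "u:($) s ` M" "v:($) s ` M"
 then obtain u' v' where "u=s$u'" "v=s$v'" "u':M" "v':M" by blast
 thus "u - v:($) s ` M" using m(4) by (auto simp flip: app_diff)
 qed
 show sub: "B<=ssum (($) s ` M) B" by (rule ssum_ub(2)[OF sI smD(1)[OF Bs(1)]])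
 have "sm H (ssum (($) s ` M) B)" unfolding sm_def
 proof (intro conjI ballI)
 show "subgp (ssum (($) s ` M) B)" by (rule ssum_subgp[OF sI smD(1)[OF Bs(1)]])
 fix h w assume h: "h:H" and "w:ssum (($) s ` M) B"
 then obtain v c where w: "w=s$v + c" "v:M" "c:B" by (auto simp: ssum_def)
 have hv: "E h$v:M" using smD(2)[OF M, of h v] h w sg_mem[OF H] by simp
 have "s$E h$v - E h$s$v:B" "E h$c:B" using s h w smD(2)[OF Bs(1)] by (auto simp: cop_def)
 hence "E h$c - (s$E h$v - E h$s$v):B" using b by blast
 hence "s$E h$v + (E h$c - (s$E h$v - E h$s$v)):ssum (($) s ` M) B"
 using hv by (intro ssumI imageI)
 moreover have "E h$w=s$E h$v + (E h$c - (s$E h$v - E h$s$v))"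
 by (simp add: w app_add)
 ultimately show "E h$w:ssum (($) s ` M) B" by metis
 qed
 moreover have "ssum (($) s ` M) B<=M"
 by (rule ssum_least[OF smD(1)[OF M]]) (use s Bs in "auto simp: cop_def")
 ultimately show "bm H (ssum (($) s ` M) B)" using sub Bs by (auto simp: bm_def)
qed

text \<open>If kernel and image of a central operator are both proper and nonzero modulo \<open>B\<close>, then
 the action on both parts, hence on \<open>M / B\<close>, is virtually nilpotent.\<close>

lemma central_operator:
 assumes H: "subgroup H G" and max: "maxm H B" and s: "cop H B s"
 shows "(ALL v:M. s$v:B) | (ALL v:M. s$v:B-->v:B)"
proof (rule ccontr)
 assume no: "~ ?thesis"
 have B: "bm H B" "nva H B" using max by (auto simp: maxm_def)
 hence Bs: "sm H B" "B<=M" by (auto simp: bm_def)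
 let ?K = "{v:M. s$v:B}" and ?I = "ssum (($) s ` M) B"
 have KI: "?K ~= B" "?I ~= B"
 proof -
 show "?K ~= B" using no by blast
 obtain v where v: "v:M" "s$v ~: B" using no by blast
 hence "s$v + 0:?I" using subgpD(1)[OF smD(1)[OF Bs(1)]] by (intro ssumI) auto
 thus "?I ~= B" using v by auto
 qed
 obtain Y1 k where Y1: "fidx G Y1 H" "A<=Y1" "M<=ser Y1 ?K k"
 using maxm_nilact[OF max bm_kernel[OF B(1) s H] KI(1)] by blast
 obtain Y2 m where Y2: "fidx G Y2 H" "A<=Y2" "M<=ser Y2 ?I m"
 using maxm_nilact[OF max bm_range[OF B(1) s H] KI(2)] by blast
 let ?Y = "Y1 Int Y2"
 have Y: "fidx G ?Y H" "A<=?Y" using fidx_inter[OF Y1(1) Y2(1)] Y1 Y2 by auto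
 have sY: "subgroup ?Y G" "?Y<=H" using Y(1) by (auto simp: fidx_def)
 have bY: "bm ?Y B" by (rule bm_mono[OF B(1) sY(2)])
 \<comment> \<open>Modulo \<open>B\<close>, the operator maps \<open>M / ?K\<close> onto
   \<open>?I / B\<close> compatibly with \<open>H\<close>, so it carries the central series over the
   kernel into the one over \<open>B\<close>.\<close>
 have 1: "s$v:ser ?Y B j" if "v:ser ?Y ?K j" for v j
 using that
 proof (induction j arbitrary: v)
 case (Suc j)
 have sB: "subgp (ser ?Y B j)" using bm_ser(1)[OF sY(1) bY] by (auto simp: bm_def sm_def)
 have "E n$s$v - s$v:ser ?Y B j" if n: "n:?Y" for n
 proof -
 have "s$(E n$v - v):ser ?Y B j" using Suc n by simp
 moreover have "s$E n$v - E n$s$v:ser ?Y B j"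
 proof -
 have "n:H" "v:M" using n sY(2) Suc.prems by auto
 hence "s$E n$v - E n$s$v:B" using s by (simp add: cop_def)
 thus ?thesis using bm_ser(2)[OF sY(1) bY, of j] by blast
 qed
 ultimately have "s$(E n$v - v) - (s$E n$v - E n$s$v):ser ?Y B j"
 using subgpD(4)[OF sB] by blast
 thus ?thesis by (simp add: app_diff)
 qed
 moreover have "s$v:M" using s Suc.prems by (auto simp: cop_def)
 ultimately show ?case by simp
 qed simp
 have "?I<=ser ?Y B k"
 proof (rule ssum_least)
 show "subgp (ser ?Y B k)" using bm_ser(1)[OF sY(1) bY] by (auto simp: bm_def sm_def)
 show "B<=ser ?Y B k" by (rule bm_ser(2)[OF sY(1) bY])
 show "($) s ` M<=ser ?Y B k" using 1 Y1(3) ser_antimono[of ?Y Y1 ?K k] by blast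
 qed
 hence "ser ?Y ?I m<=ser ?Y B (m + k)" by (rule ser_comp)
 hence "M<=ser ?Y B (m + k)" using Y2(3) ser_antimono[of ?Y Y2 ?I m] by blast
 thus False using B(2) Y unfolding nva_def nilact_def by blast
qed

text \<open>If the intersection were \<open>B\<close>, then \<open>M / B\<close> would embed in the
  product of \<open>M / B1\<close> and \<open>M / B2\<close>, and by maximality a common subgroup of
  finite index acts nilpotently on both.\<close>

lemma maxm_uniform:
 assumes max: "maxm H B" and B1: "bm H B1" "B<=B1" "B1 ~= B" and B2: "bm H B2" "B<=B2" "B2 ~= B"
 shows "B1 Int B2 ~= B"
proof
 assume eq: "B1 Int B2=B"
 obtain Y1 k where Y1: "fidx G Y1 H" "A<=Y1" "M<=ser Y1 B1 k"
 using maxm_nilact[OF max B1] by blast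
 obtain Y2 m where Y2: "fidx G Y2 H" "A<=Y2" "M<=ser Y2 B2 m"
 using maxm_nilact[OF max B2] by blast
 let ?Y = "Y1 Int Y2"
 have Y: "fidx G ?Y H" "A<=?Y" using fidx_inter[OF Y1(1) Y2(1)] Y1 Y2 by auto
 have sY: "subgroup ?Y G" "?Y<=H" using Y(1) by (auto simp: fidx_def)
 have int: "ser ?Y B1 j Int ser ?Y B2 j<=ser ?Y B j" for j
 by (induction j) (use eq in auto)
 have up: "ser ?Y B' i<=ser ?Y B' j" if "bm H B'" "i<=j" for B' i j
 using that(2) ser_comp[of B' ?Y B' "j - i" i] bm_ser(2)[OF sY(1) bm_mono[OF that(1) sY(2)], of "j - i"] by simp
 have "M<=ser ?Y B1 (max k m)" "M<=ser ?Y B2 (max k m)"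
 using Y1(3) Y2(3) ser_antimono[of ?Y Y1 B1 k] ser_antimono[of ?Y Y2 B2 m]
 up[OF B1(1), of k "max k m"] up[OF B2(1), of m "max k m"] by auto
 hence "nilact ?Y B" using int unfolding nilact_def by blast
 thus False using max Y unfolding maxm_def nva_def by blast
qed
end

section \<open>Generic freeness\<close>

text \<open>The operators \<open>s n\<close> play the role of the nonzero scalars, the operators \<open>f\<close> that of the
 primes of a principal ideal domain; \<open>N1\<close>-submodules are the modules over this domain.\<close>

locale scalars = module_action G E A M R for G :: "('a, 'm) monoid_scheme" (structure) and E :: "'a => 'b endo" and A M R +
 fixes H B N1 and s :: "nat => 'b endo"
 assumes H: "adm H" and B: "bm H B"
 and N1: "subgroup N1 G" "A<=N1" "N1<=H" "h:H==>g:N1==>h**g**inv h:N1"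
 and s_sub: "sm N1 U==>B<=U==>U<=M==>u:U==>s n$u:U"
 and s_comm: "h:H==>v:M==>s n$E h$v - E h$s n$v:B"
 and s_comp: "sm N1 V==>B<=V==>V<=M==>u:M==>0 < m==>0 < n==>s m$s n$u:V ==>
 EX l>0. s l$u:V"
 and s_mult: "sm N1 V==>B<=V==>V<=M==>u:M==>s n$u:V==>s (m * n)$u:V"
begin

lemma sH: "subgroup H G" by (rule admD(1)[OF H])

lemma Hc: "h:H==>h:carrier G" using sg_mem[OF sH] .

lemma B_sm: "sm H B" "R<=B" "B<=M" using B by (auto simp: bm_def)

definition sbm :: "'a set => ('b \<Rightarrow>\<^sub>0 int) set => bool" where
 "sbm N U \<longleftrightarrow> sm N U&B<=U&U<=M"

lemma sbmD: "sbm N U==>sm N U" "sbm N U==>B<=U" "sbm N U==>U<=M" "sbm N U==>subgp U"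
 by (auto simp: sbm_def sm_def)

lemma sbm_mono: "sbm N U==>N'<=N==>sbm N' U"
 by (auto simp: sbm_def intro: sm_mono)

lemma sbm_span_ssum:
 assumes "N<=H" "Xs<=M" "sbm N V" shows "sbm N (ssum (span N Xs) V)"
proof -
 have "span N Xs<=M" by (rule span_least[OF sm_mono[OF M] assms(2)]) (use assms(1) Hc in auto)
 hence "ssum (span N Xs) V<=M" using ssum_least[OF smD(1)[OF M]] sbmD(3)[OF assms(3)] by blast
 moreover have "V<=ssum (span N Xs) V" by (rule ssum_ub(2)[OF smD(1)[OF sm_span] sbmD(4)[OF assms(3)]])
 ultimately show ?thesis unfolding sbm_def using sm_ssum[OF sm_span sbmD(1)[OF assms(3)]] sbmD(2)[OF assms(3)] by blast
qed

definition tors where "tors U V \<longleftrightarrow> (ALL u:U. EX n>0. s n$u:V)"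

definition frk where
 "frk U V \<longleftrightarrow> (EX Xs. finite Xs&Xs<=U&(ALL u:U. EX n>0. s n$u:ssum (span N1 Xs) V))"

definition fin_quot :: "'b endo => ('b \<Rightarrow>\<^sub>0 int) set => ('b \<Rightarrow>\<^sub>0 int) set => bool" where
 "fin_quot f U V \<longleftrightarrow> (EX Xs. finite Xs&(ALL u:U. EX x:Xs. EX w:U. u - x - f$w:V))"

definition generic :: "'b endo => ('b \<Rightarrow>\<^sub>0 int) set => ('b \<Rightarrow>\<^sub>0 int) set => bool" where
 "generic f U V \<longleftrightarrow> (ALL u:U. f$u:V-->u:V) &
 (tors U V | (EX u:U. ALL w:U. u - f$w ~: V))&(frk U V | ~ fin_quot f U V)"

lemma frk_step:
 assumes U: "sbm N1 U" and W: "sbm N1 W" "W<=U" and V: "sbm N1 V" "V<=W"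
 and 1: "frk U W" and 2: "frk W V" shows "frk U V"
proof -
 obtain X1 where X1: "finite X1" "X1<=U" "!!u. u:U==>EX n>0. s n$u:ssum (span N1 X1) W"
 using 1 by (auto simp: frk_def)
 obtain X2 where X2: "finite X2" "X2<=W" "!!u. u:W==>EX n>0. s n$u:ssum (span N1 X2) V"
 using 2 by (auto simp: frk_def)
 let ?X = "X1 Un X2"
 let ?S = "ssum (span N1 ?X) V"
 have XM: "X1<=M" "?X<=M" using X1(2) X2(2) sbmD(3)[OF U] W(2) by auto
 have S: "sbm N1 ?S" by (rule sbm_span_ssum[OF N1(3) XM(2) V(1)])
 have S1: "sbm N1 (ssum (span N1 X1) V)" by (rule sbm_span_ssum[OF N1(3) XM(1) V(1)])
 have up: "ssum (span N1 X1) V<=?S" "ssum (span N1 X2) V<=?S"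
 using span_mono[of X1 ?X N1] span_mono[of X2 ?X N1] by (auto simp: ssum_def)
 have "EX n>0. s n$u:?S" if u: "u:U" for u
 proof -
 obtain n where n: "n > 0" "s n$u:ssum (span N1 X1) W" using X1(3) u by blast
 then obtain a w where aw: "s n$u=a + w" "a:span N1 X1" "w:W" by (auto simp: ssum_def)
 obtain m where m: "m > 0" "s m$w:ssum (span N1 X2) V" using X2(3) aw by blast
 have "a:ssum (span N1 X1) V" using ssum_ub(1)[OF smD(1)[OF sm_span] sbmD(4)[OF V(1)]] aw by blast
 hence "s m$a:ssum (span N1 X1) V" by (rule s_sub[OF sbmD(1-3)[OF S1]])
 hence "s m$a:?S" "s m$w:?S" using m up by auto
 hence "s m$s n$u:?S" using subgpD(3)[OF sbmD(4)[OF S]] aw by (simp add: app_add)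
 thus ?thesis using s_comp[OF sbmD(1-3)[OF S] _ m(1) n(1)] u sbmD(3)[OF U] by blast
 qed
 thus ?thesis unfolding frk_def using X1 X2 W(2) by (intro exI[of _ ?X]) auto
qed

lemma tors_frk: assumes "tors U V" shows "frk U V"
proof -
 have "EX n>0. s n$u:ssum (span N1 {}) V" if u: "u:U" for u
 proof -
 obtain n where n: "n > 0" "s n$u:V" using assms u by (auto simp: tors_def)
 have "0 + s n$u:ssum (span N1 {}) V" by (rule ssumI[OF subgpD(1)[OF smD(1)[OF sm_span]] n(2)])
 thus ?thesis using n(1) by auto
 qed
 thus ?thesis unfolding frk_def by (intro exI[of _ "{}"]) simp
qed

lemma tors_step:
 assumes U: "sbm N1 U" and W: "sbm N1 W" and V: "sbm N1 V"
 and 1: "tors U W" and 2: "tors W V" shows "tors U V"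
 unfolding tors_def
proof
 fix u assume u: "u:U"
 obtain n where n: "n > 0" "s n$u:W" using 1 u by (auto simp: tors_def)
 obtain m where "m > 0" "s m$s n$u:V" using 2 n by (auto simp: tors_def)
 thus "EX n>0. s n$u:V" using s_comp[OF sbmD(1-3)[OF V]] n u sbmD(3)[OF U] by blast
qed

lemma tors_refl: "sbm N1 U==>tors U U"
 unfolding tors_def using s_sub[OF sbmD(1-3)] by blast

lemma generic_refl: "sbm N1 U==>generic f U U"
 unfolding generic_def using tors_refl tors_frk by blast

text \<open>A factor that is not torsion has an element outside the image of \<open>f\<close>, even
  of the image of the whole union (\<open>nz\<close>), since injectivity on later factors keeps
  preimages low. If the cokernel is finite, infinitely many such factors would give two of these
  elements in one class modulo the image, against the choice of the later one. So almost all factors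
  are torsion, and the union has finite rank.\<close>

lemma generic_Union:
 assumes U: "!!i::nat. sbm N1 (U i)" "!!i. U i<=U (Suc i)" and f_sub: "!!V u. sbm N1 V==>u:V==>f$u:V"
 and g: "!!i. generic f (U (Suc i)) (U i)"
 shows "generic f (UN i. U i) (U 0)"
proof -
 have mono: "U i<=U j" if "i<=j" for i j by (rule lift_Suc_mono_le[of U, OF U(2) that])
 have tf: "u:U i" if "u:U (i + j)" "f$u:U i" for u i j
 using that
 proof (induction j)
 case (Suc j)
 have "f$u:U (i + j)" using Suc.prems mono[of i "i + j"] by auto
 hence "u:U (i + j)" using g[of "i + j"] Suc.prems by (auto simp: generic_def)
 thus ?case using Suc by blast
 qed simp
 have tf': "u:U i" if "u:(UN i. U i)" "f$u:U i" for u i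
 proof -
 obtain j where "u:U j" using `u:(UN i. U i)` by blast
 hence "u:U (i + j)" using mono[of j "i + j"] by auto
 thus ?thesis using tf that by blast
 qed
 have sU: "subgp (U i)" for i using sbmD(4)[OF U(1)] .
 have nz: "EX u:U (Suc i). ALL w:(UN i. U i). u - f$w ~: U i" if nt: "~ tors (U (Suc i)) (U i)" for i
 proof -
 obtain u where u: "u:U (Suc i)" "!!w. w:U (Suc i)==>u - f$w ~: U i"
 using g[of i] nt by (auto simp: generic_def)
 have "u - f$w ~: U i" if w: "w:(UN i. U i)" for w
 proof
 assume d: "u - f$w:U i"
 hence "u - (u - f$w):U (Suc i)" using subgpD(4)[OF sU u(1)] U(2) by blast
 hence "w:U (Suc i)" using tf'[OF w] by simp
 thus False using u(2) d by blast
 qed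
 thus ?thesis using u by blast
 qed
 have tors_all: "tors (UN i. U i) (U j)" if t: "!!i. i >= j==>tors (U (Suc i)) (U i)" for j
 proof -
 have *: "tors (U (j + k)) (U j)" for k
 proof (induction k)
 case 0 thus ?case using tors_refl[OF U(1)] by simp
 next
 case (Suc k)
 have "tors (U (Suc (j + k))) (U (j + k))" by (rule t) simp
 thus ?case using tors_step[OF U(1) U(1) U(1)] Suc by simp
 qed
 show ?thesis unfolding tors_def
 proof
 fix u assume "u:(UN i. U i)"
 then obtain i where "u:U i" by blast
 hence "u:U (j + i)" using mono[of i "j + i"] by auto
 thus "EX n>0. s n$u:U j" using * by (auto simp: tors_def)
 qed
 qed
 have "tors (UN i. U i) (U 0) | (EX u:(UN i. U i). ALL w:(UN i. U i). u - f$w ~: U 0)"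
 proof (cases "ALL i. tors (U (Suc i)) (U i)")
 case True thus ?thesis using tors_all[of 0] by blast
 next
 case False
 then obtain i where "~ tors (U (Suc i)) (U i)" by blast
 then obtain u where "u:U (Suc i)" "ALL w:(UN i. U i). u - f$w ~: U i" using nz by blast
 thus ?thesis using mono[of 0 i] by blast
 qed
 moreover have "frk (UN i. U i) (U 0) | ~ fin_quot f (UN i. U i) (U 0)"
 proof (rule ccontr)
 assume no: "~ ?thesis"
 then obtain Xs where Xs: "finite Xs" "!!u. u:(UN i. U i)==>EX x:Xs. EX w:(UN i. U i). u - x - f$w:U 0"
 by (auto simp: fin_quot_def)
 have UU: "sbm N1 (UN i. U i)"
 unfolding sbm_def using sm_Union_chain[of N1 U, OF sbmD(1)[OF U(1)] U(2)] sbmD(2,3)[OF U(1)] by blast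
 have diff: "EX w:(UN i. U i). u - v - f$w:U 0"
 if "u - x - f$w1:U 0" "v - x - f$w2:U 0" "w1:(UN i. U i)" "w2:(UN i. U i)" for u v x w1 w2
 proof -
 have "(u - x - f$w1) - (v - x - f$w2):U 0" using subgpD(4)[OF sU] that by blast
 hence "u - v - f$(w1 - w2):U 0" by (simp add: app_diff algebra_simps)
 thus ?thesis using subgpD(4)[OF sbmD(4)[OF UU]] that by blast
 qed
 have fr: "frk (U (Suc i)) (U i)" for i
 proof -
 define c where "c x=(SOME u. u:U (Suc i)&(EX w:(UN i. U i). u - x - f$w:U 0))" for x
 have "fin_quot f (U (Suc i)) (U i)" unfolding fin_quot_def
 proof (intro exI[of _ "c ` Xs"] conjI ballI)
 fix u assume u: "u:U (Suc i)"
 then obtain x w where x: "x:Xs" "w:(UN i. U i)" "u - x - f$w:U 0" using Xs(2) by blast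
 have "c x:U (Suc i)&(EX w:(UN i. U i). c x - x - f$w:U 0)"
 unfolding c_def by (rule someI[of _ u]) (use u x in blast)
 then obtain w' where w': "c x:U (Suc i)" "w':(UN i. U i)" "c x - x - f$w':U 0" by blast
 obtain d where d: "d:(UN i. U i)" "u - c x - f$d:U 0" using diff[OF x(3) w'(3) x(2) w'(2)] by blast
 have "u - c x - f$d:U (Suc i)" using d(2) mono[of 0 "Suc i"] by auto
 hence "(u - c x) - (u - c x - f$d):U (Suc i)"
 using subgpD(4)[OF sU] u w'(1) by blast
 hence "d:U (Suc i)" using tf'[OF d(1)] by simp
 thus "EX x:c ` Xs. EX w:U (Suc i). u - x - f$w:U i"
 using d(2) x(1) mono[of 0 i] by auto
 qed (use Xs in auto)
 thus ?thesis using g[of i] by (auto simp: generic_def)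
 qed
 have inf: "EX i>=j. ~ tors (U (Suc i)) (U i)" for j
 proof (rule ccontr)
 assume "~ (EX i>=j. ~ tors (U (Suc i)) (U i))"
 hence t: "frk (UN i. U i) (U j)" using tors_all[of j] tors_frk by blast
 have "frk (U j) (U 0)"
 proof (induction j)
 case 0 thus ?case using tors_frk[OF tors_refl[OF U(1)]] .
 next
 case (Suc j)
 show ?case by (rule frk_step[OF U(1) U(1) U(2) U(1) mono fr Suc.IH]) simp
 qed
 hence "frk (UN i. U i) (U 0)" by (rule frk_step[OF UU U(1) _ U(1) mono t, rotated 2]) auto
 thus False using no by blast
 qed
 define J where "J={i. ~ tors (U (Suc i)) (U i)}"
 have "infinite J" using inf unfolding J_def infinite_nat_iff_unbounded_le by auto
 obtain u where u: "!!i. i:J==>u i:U (Suc i)&(ALL w:(UN i. U i). u i - f$w ~: U i)"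
 using nz unfolding J_def by (metis (mono_tags, lifting) mem_Collect_eq)
 have "EX x. x:Xs&(EX w:(UN i. U i). u i - x - f$w:U 0)" if "i:J" for i
 using Xs(2)[of "u i"] u[OF that] by blast
 then obtain x where x: "!!i. i:J==>x i:Xs&(EX w:(UN i. U i). u i - x i - f$w:U 0)" by metis
 have "~ inj_on x J"
 proof
 assume "inj_on x J"
 hence "finite J" using finite_subset[of "x ` J" Xs] Xs(1) x finite_imageD by blast
 thus False using `infinite J` by blast
 qed
 then obtain i j where ij: "i:J" "j:J" "i < j" "x i=x j"
 unfolding inj_on_def by (metis nat_neq_iff)
 obtain w1 w2 where w: "w1:(UN i. U i)" "u i - x j - f$w1:U 0" "w2:(UN i. U i)" "u j - x j - f$w2:U 0"
 using x[OF ij(1)] x[OF ij(2)] ij(4) by metis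
 obtain d where d: "d:(UN i. U i)" "u j - u i - f$d:U 0" using diff[OF w(4,2,3,1)] by blast
 have "u j - u i - f$d:U j" "u i:U j" using d(2) u[OF ij(1)] mono[of 0 j] mono[of "Suc i" j] ij(3) by auto
 hence "(u j - u i - f$d) + u i:U j" using subgpD(3)[OF sU] by blast
 hence "u j - f$d:U j" by (simp add: algebra_simps)
 thus False using u[OF ij(2)] d(1) by blast
 qed
 moreover have "ALL u:(UN i. U i). f$u:U 0-->u:U 0" using tf' by blast
 ultimately show ?thesis by (simp only: generic_def)
qed

text \<open>A two-step chain, continued constantly, is a special case of the union.\<close>

lemma generic_trans:
 assumes U: "sbm N1 U" "sbm N1 W" "sbm N1 V" "V<=W" "W<=U"
 and f_sub: "!!V u. sbm N1 V==>u:V==>f$u:V"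
 and g: "generic f U W" "generic f W V"
 shows "generic f U V"
proof -
 define L where "L i=(if i=0 then V else if i=1 then W else U)" for i :: nat
 have "generic f (UN i. L i) (L 0)"
 proof (rule generic_Union)
 show "sbm N1 (L i)" "L i<=L (Suc i)" for i using U by (auto simp: L_def)
 show "generic f (L (Suc i)) (L i)" for i using g generic_refl[OF U(1)] by (auto simp: L_def)
 qed (rule f_sub)
 moreover have "(UN i. L i)=U"
 proof
 show "(UN i. L i)<=U" using U by (auto simp: L_def split: if_splits)
 have "L 2<=(UN i. L i)" by blast
 thus "U<=(UN i. L i)" by (simp add: L_def)
 qed
 ultimately show ?thesis by (simp add: L_def)
qed

text \<open>\<open>E h\<close> identifies \<open>U\<close> modulo the preimage of \<open>W\<close>
  with \<open>E h U + W\<close> modulo \<open>W\<close>. It twists the action of \<open>N1\<close>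
  by conjugation, but commutes with \<open>f\<close> and the scalars modulo
  \<open>B\<close>.\<close>

lemma generic_transport:
 assumes h: "h:H" and U: "sbm N1 U" and W: "sbm N1 W"
 and f_sub: "!!V u. sbm N1 V==>u:V==>f$u:V"
 and f_comm: "!!v. v:M==>f$E h$v - E h$f$v:B"
 and g: "generic f U {u:U. E h$u:W}"
 shows "generic f (ssum (($) (E h) ` U) W) W"
proof -
 let ?V = "{u:U. E h$u:W}" and ?U = "ssum (($) (E h) ` U) W"
 note u = subgpD[OF sbmD(4)[OF U]] and w = subgpD[OF sbmD(4)[OF W]]
 have UM: "U<=M" "W<=M" "B<=W" using sbmD(2,3) U W by auto
 have fc: "f$E h$v - E h$f$v:W" if "v:U" for v using f_comm that UM by blast
 have sc: "s n$E h$v - E h$s n$v:W" if "v:U" for n v using s_comm[OF h] that UM by blast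
 have UE: "EX u v. x=E h$u + v&u:U&v:W" if "x:?U" for x using that by (auto simp: ssum_def)
 have UI: "E h$u + v:?U" if "u:U" "v:W" for u v using that by (intro ssumI) auto
 have UI0: "E h$u:?U" if "u:U" for u using UI[OF that w(1)] by simp
 have fU: "f$u:U" if "u:U" for u using f_sub[OF U that] .
 have fW: "f$v:W" if "v:W" for v using f_sub[OF W that] .
 have sU: "s n$u:U" if "u:U" for n u by (rule s_sub[OF sbmD(1-3)[OF U] that])
 have sW: "s n$v:W" if "v:W" for n v by (rule s_sub[OF sbmD(1-3)[OF W] that])
 have key: "E h$(a - f$b):W" if "a:U" "b:U" "v:W" "E h$a - f$(E h$b + v):W" for a b v
 proof -
 have "(E h$a - f$(E h$b + v)) + (f$E h$b - E h$f$b) + f$v:W"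
 using that(4) fc[OF that(2)] fW[OF that(3)] w(3) by blast
 thus ?thesis by (simp add: app_add app_diff algebra_simps)
 qed
 have 1: "x:W" if x: "x:?U" "f$x:W" for x
 proof -
 obtain u v where uv: "x=E h$u + v" "u:U" "v:W" using UE x by blast
 have "E h$0 - f$(E h$u + v):W" using x uv w(2) by simp
 hence "E h$(0 - f$u):W" using key[OF u(1) uv(2,3)] by blast
 hence "- (E h$(0 - f$u)):W" by (rule w(2))
 hence "E h$f$u:W" by (simp add: app_minus)
 hence "f$u:?V" using fU uv by blast
 hence "u:?V" using g uv by (auto simp: generic_def)
 thus ?thesis using uv w(3) by blast
 qed
 have 2: "tors ?U W | (EX u:?U. ALL w:?U. u - f$w ~: W)"
 proof (cases "tors U ?V")
 case True
 have "EX n>0. s n$x:W" if x: "x:?U" for x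
 proof -
 obtain u v where uv: "x=E h$u + v" "u:U" "v:W" using UE x by blast
 obtain n where n: "n > 0" "E h$s n$u:W" using True uv by (auto simp: tors_def)
 have "(s n$E h$u - E h$s n$u) + E h$s n$u + s n$v:W"
 using sc[OF uv(2)] n(2) sW[OF uv(3)] w(3) by blast
 thus ?thesis using n uv by (auto simp: app_add)
 qed
 thus ?thesis by (auto simp: tors_def)
 next
 case False
 then obtain u0 where u0: "u0:U" "!!w. w:U==>u0 - f$w ~: ?V" using g by (auto simp: generic_def)
 have "E h$u0 - f$x ~: W" if x: "x:?U" for x
 proof
 assume c: "E h$u0 - f$x:W"
 obtain u v where uv: "x=E h$u + v" "u:U" "v:W" using UE x by blast
 have "E h$(u0 - f$u):W" using key[OF u0(1) uv(2,3)] c uv(1) by blast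
 moreover have "u0 - f$u:U" using `u0:U` fU[OF uv(2)] u(4) by blast
 ultimately show False using u0(2)[OF uv(2)] by blast
 qed
 thus ?thesis using UI0[OF u0(1)] by blast
 qed
 have 3: "frk ?U W | ~ fin_quot f ?U W"
 proof (cases "frk U ?V")
 case True
 then obtain Xs where Xs: "finite Xs" "Xs<=U" "!!u. u:U==>EX n>0. s n$u:ssum (span N1 Xs) ?V"
 by (auto simp: frk_def)
 let ?X = "($) (E h) ` Xs"
 have hc: "h:carrier G" "inv h:H" using Hc h sg_inv[OF sH] by auto
 have sp: "E h$a:span N1 ?X" if "a:span N1 Xs" for a
 proof -
 have "sm N1 {a. E h$a:span N1 ?X}" unfolding sm_def subgp_def
 proof (intro conjI ballI)
 fix n a assume n: "n:N1" and a: "a:{a. E h$a:span N1 ?X}"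
 have nc: "n:carrier G" using n N1(1) sg_mem by metis
 have "E h$E n$a=E (h**n**inv h)$E h$a" using hc nc by (simp add: E_app m_assoc)
 thus "E n$a:{a. E h$a:span N1 ?X}" using a smD(2)[OF sm_span N1(4)[OF h n]] by simp
 qed (use subgpD[OF smD(1)[OF sm_span[of N1 ?X]]] in "auto simp: app_diff")
 hence "span N1 Xs<={a. E h$a:span N1 ?X}" by (rule span_least) (use span_ub in blast)
 thus ?thesis using that by blast
 qed
 have spU: "sbm N1 (ssum (span N1 ?X) W)"
 proof (rule sbm_span_ssum[OF N1(3) _ W])
 show "?X<=M" using Xs(2) UM(1) smD(2)[OF M hc(1)] by blast
 qed
 have "EX n>0. s n$x:ssum (span N1 ?X) W" if x: "x:?U" for x
 proof -
 obtain u v where uv: "x=E h$u + v" "u:U" "v:W" using UE x by blast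
 obtain n a c where n: "n > 0" "s n$u=a + c" "a:span N1 Xs" "E h$c:W"
 using Xs(3)[OF uv(2)] by (auto simp: ssum_def)
 have "s n$x=E h$a + (E h$c + (s n$E h$u - E h$s n$u) + s n$v)"
 using uv(1) n(2) by (simp add: app_add)
 moreover have "E h$c + (s n$E h$u - E h$s n$u) + s n$v:W"
 using sc[OF uv(2)] n(4) sW[OF uv(3)] w(3) by blast
 ultimately have "s n$x:ssum (span N1 ?X) W" using ssumI[OF sp[OF n(3)]] by metis
 thus ?thesis using n(1) by blast
 qed
 moreover have "?X<=?U" using UI0 Xs(2) by blast
 ultimately show ?thesis unfolding frk_def using Xs(1) by (intro disjI1 exI[of _ ?X]) auto
 next
 case False
 hence nq: "~ fin_quot f U ?V" using g by (auto simp: generic_def)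
 have "~ fin_quot f ?U W"
 proof
 assume "fin_quot f ?U W"
 then obtain Xs where Xs: "finite Xs" "!!u. u:?U==>EX x:Xs. EX w:?U. u - x - f$w:W"
 by (auto simp: fin_quot_def)
 define c where "c x=(SOME u. u:U&(EX w:?U. E h$u - x - f$w:W))" for x
 have "fin_quot f U ?V" unfolding fin_quot_def
 proof (intro exI[of _ "c ` Xs"] conjI ballI)
 fix a assume a: "a:U"
 obtain x r where x: "x:Xs" "r:?U" "E h$a - x - f$r:W" using Xs(2)[OF UI0[OF a]] by blast
 have "c x:U&(EX w:?U. E h$c x - x - f$w:W)"
 unfolding c_def by (rule someI[of _ a]) (use a x in blast)
 then obtain t where t: "c x:U" "t:?U" "E h$c x - x - f$t:W" by blast
 obtain b v where bv: "r=E h$b + v" "b:U" "v:W" using UE x by blast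
 obtain b' v' where bv': "t=E h$b' + v'" "b':U" "v':W" using UE t by blast
 have "(E h$a - x - f$r) - (E h$c x - x - f$t):W" using x t w(4) by blast
 hence "E h$(a - c x) - f$(E h$(b - b') + (v - v')):W"
 unfolding bv(1) bv'(1) by (simp add: app_add app_diff algebra_simps)
 hence "E h$(a - c x - f$(b - b')):W"
 using key[OF u(4)[OF a t(1)] u(4)[OF bv(2) bv'(2)] w(4)[OF bv(3) bv'(3)]] by blast
 moreover have "b - b':U" by (rule u(4)[OF bv(2) bv'(2)])
 moreover have "a - c x - f$(b - b'):U"
 by (rule u(4)[OF u(4)[OF a t(1)] fU[OF u(4)[OF bv(2) bv'(2)]]])
 ultimately show "EX x:c ` Xs. EX w:U. a - x - f$w:?V" using x(1) by blast
 qed (use Xs in auto)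
 thus False using nq by blast
 qed
 thus ?thesis by blast
 qed
 show ?thesis unfolding generic_def using 1 2 3 by blast
qed
end

context group_action
begin

lemma span_ssum_least: "sm N W==>Xs<=W==>V<=W==>ssum (span N Xs) V<=W"
 by (rule ssum_least[OF smD(1) span_least])

lemma span_ssum_ub: "subgp V==>Xs<=ssum (span N Xs) V" "subgp V==>V<=ssum (span N Xs) V"
 using ssum_ub[OF smD(1)[OF sm_span[of N Xs]]] span_ub[of Xs N] by blast+
end

lemma (in cyclic_extension) yn_swap': "n:N==>EX n':N. yn k$E n$v=E n'$yn k$v"
proof -
 assume n: "n:N"
 have 2: "inv (y [^] k)**n**y [^] k:N"
 using nrml_pow[OF y _ n, of "- int k"] subgroup.subset[OF N] yc by (simp add: int_pow_int int_pow_neg)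
 have "yn k$E n$v=E (inv (y [^] k)**n**y [^] k)$yn k$v"
 using Nc[OF n] yc by (simp add: E_app m_assoc)
 thus ?thesis using 2 by blast
qed

context scalars
begin

text \<open>The module is filtered by the degree in \<open>y\<close>. The factors of the polynomial
  part \<open>T\<close> are translates of \<open>U0\<close> modulo the submodules \<open>Vk\<close>
  of leading coefficients, which become stationary, so finitely many exceptional sets suffice. From
  \<open>T\<close> to all Laurent polynomials leads the chain \<open>Tj\<close>, all of whose
  factors are translates of \<open>U0\<close> modulo the one submodule \<open>V'\<close>.\<close>

lemma generic_free_step:
 fixes f :: "nat => 'b endo"
 assumes f_sub: "!!l V u. sbm N1 V==>u:V==>f l$u:V"
 and f_comm: "!!l h v. h:H==>v:M==>f l$E h$v - E h$f l$v:B"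
 and sN: "subgroup N G" "N1<=N" and y: "nrml y N" and NH: "cext N y<=H"
 and IH: "!!V. sbm N V==>EX F. finite F&(ALL l. prime l-->l ~: F-->generic (f l) (ssum (span N Xs) V) V)"
 and Xs: "finite Xs" "Xs<=M" and V: "sbm (cext N y) V"
 shows "EX F. finite F&(ALL l. prime l-->l ~: F-->generic (f l) (ssum (span (cext N y) Xs) V) V)"
proof -
 interpret cyclic_extension G E N y
 by (intro cyclic_extension.intro group_action_axioms cyclic_extension_axioms.intro) (use sN y in auto)
 note ce = cext_props[OF sN(1) y]
 have yH: "y [^] (k::nat):H" "inv (y [^] k):H" "y:H" "inv y:H" for k
 proof -
 have "y:H" using ce(3) NH by blast
 thus "y [^] k:H" "inv (y [^] k):H" "y:H" "inv y:H" using subgroup_closed(4,6)[OF sH] by blast+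
 qed
 have yce: "y [^] (k::nat):cext N y" "inv (y [^] k):cext N y" "y:cext N y" "inv y:cext N y" for k
 using subgroup_closed(4,6)[OF ce(1)] ce(3) by blast+
 have NH': "N<=H" using ce(2) NH by blast
 have VN: "sbm N V" by (rule sbm_mono[OF V ce(2)])
 note v = subgpD[OF sbmD(4)[OF VN]] and m = subgpD[OF smD(1)[OF M]]
 have yV: "yp k$w:V" "yn k$w:V" "E y$w:V" "E (inv y)$w:V" if "w:V" for w k
 using smD(2)[OF sbmD(1)[OF V] _ that] yce by blast+
 have yB: "yp k$w:B" "yn k$w:B" "E y$w:B" "E (inv y)$w:B" if "w:B" for w k
 using smD(2)[OF B_sm(1) _ that] yH by blast+
 have yM: "yp k$w:M" "yn k$w:M" "E y$w:M" "E (inv y)$w:M" if "w:M" for w k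
 using smD(2)[OF M _ that] yc by auto
 define U0 where "U0=ssum (span N Xs) V"
 have U0: "sbm N U0" unfolding U0_def by (rule sbm_span_ssum[OF NH' Xs(2) VN])
 note u0 = subgpD[OF sbmD(4)[OF U0]]
 have VU0: "V<=U0" "Xs<=U0" unfolding U0_def using span_ssum_ub[OF sbmD(4)[OF VN]] by blast+
 have U0_eq: "ssum (span N Xs) W=U0" if W: "sbm N W" "V<=W" "W<=U0" for W
 proof
 show "ssum (span N Xs) W<=U0" by (rule span_ssum_least[OF sbmD(1)[OF U0] VU0(2) W(3)])
 show "U0<=ssum (span N Xs) W" unfolding U0_def using W(2) by (auto simp: ssum_def)
 qed
 define Uc where "Uc k=ssum (Uk Xs k) V" for k
 have XkM: "(UN i<k. (%a. yp i$a) ` Xs)<=M" for k using yM(1) Xs(2) by blast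
 have Uc: "sbm N (Uc k)" for k unfolding Uc_def Uk_def by (rule sbm_span_ssum[OF NH' XkM VN])
 have UcI: "a:Uk Xs k==>b:V==>a + b:Uc k" for a b k unfolding Uc_def by (rule ssumI)
 have UcE: "EX a b. w=a + b&a:Uk Xs k&b:V" if "w:Uc k" for w k using that by (auto simp: Uc_def ssum_def)
 have VUc: "V<=Uc k" "Uk Xs k<=Uc k" for k
 unfolding Uc_def using ssum_ub[OF smD(1)[OF Uk_sm] sbmD(4)[OF VN]] by blast+
 have Uc0: "Uc 0=V" by (auto simp: Uc_def Uk_0 ssum_def)
 have Uc_mono: "Uc k<=Uc (Suc k)" for k using Uk_mono[of k "Suc k" Xs] by (auto simp: Uc_def ssum_def)
 have y_Uc: "yp j$w:Uc (j + k)" if w: "w:Uc k" for w j k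
 proof -
 obtain a b where ab: "w=a + b" "a:Uk Xs k" "b:V" using UcE[OF w] by blast
 show ?thesis unfolding ab(1) app_add by (rule UcI[OF yp_Uk[OF ab(2)] yV(1)[OF ab(3)]])
 qed
 have U0_Uc1: "U0<=Uc 1"
 proof
 fix w assume "w:U0"
 then obtain a b where ab: "w=a + b" "a:span N Xs" "b:V" by (auto simp: U0_def ssum_def)
 have "a:Uk Xs 1" using yp_Uk_Suc[OF ab(2), of 0] by simp
 thus "w:Uc 1" using UcI ab by blast
 qed
 define Vk where "Vk k={u:U0. yp k$u:Uc k}" for k
 have Vk: "sbm N (Vk k)" "V<=Vk k" "Vk k<=U0" for k
 proof -
 note uc = subgpD[OF sbmD(4)[OF Uc[of k]]]
 show "V<=Vk k"
 proof
 fix w assume w: "w:V"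
 have "yp k$w:Uc k" using yV(1)[OF w] VUc(1) by blast
 thus "w:Vk k" using w VU0(1) by (auto simp: Vk_def)
 qed
 show "Vk k<=U0" by (auto simp: Vk_def)
 have "sm N (Vk k)" unfolding sm_def subgp_def
 proof (intro conjI ballI)
 fix n u assume n: "n:N" and u: "u:Vk k"
 obtain n' where "n':N" "yp k$E n$u=E n'$yp k$u" using yp_swap'[OF n] by blast
 thus "E n$u:Vk k" using u smD(2)[OF sbmD(1)[OF Uc]] smD(2)[OF sbmD(1)[OF U0] n] by (simp add: Vk_def)
 qed (use u0 uc in "auto simp: Vk_def app_diff")
 thus "sbm N (Vk k)" using `V <= Vk k` `Vk k <= U0` sbmD(2,3)[OF VN] sbmD(3)[OF U0]
 unfolding sbm_def by blast
 qed
 \<comment> \<open>Up to \<open>V\<close>, \<open>Vk\<close> is the module of leading coefficients,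
   so the Noetherian property leaves only finitely many different \<open>Vk\<close>.\<close>
 have Vk_L: "Vk k=ssum (Lk Xs V k) V" for k
 proof
 show "ssum (Lk Xs V k) V<=Vk k"
 proof (rule ssum_least[OF sbmD(4)[OF Vk(1)] _ Vk(2)])
 show "Lk Xs V k<=Vk k"
 proof
 fix u assume "u:Lk Xs V k"
 then obtain w where u: "u:span N Xs" "w:V" "w - yp k$u:Uk Xs k" by (auto simp: Lk_def)
 have "- (w - yp k$u) + w:Uc k" by (rule UcI[OF subgpD(2)[OF smD(1)[OF Uk_sm] u(3)] u(2)])
 moreover have "u:U0" using u ssum_ub(1)[OF smD(1)[OF sm_span] sbmD(4)[OF VN]] unfolding U0_def by blast
 ultimately show "u:Vk k" by (simp add: Vk_def)
 qed
 qed
 show "Vk k<=ssum (Lk Xs V k) V"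
 proof
 fix u assume u: "u:Vk k"
 hence "u:U0" using Vk(3) by blast
 then obtain a b where ab: "u=a + b" "a:span N Xs" "b:V" unfolding U0_def ssum_def by blast
 have "yp k$u:Uc k" using u by (simp add: Vk_def)
 then obtain c d where cd: "yp k$u=c + d" "c:Uk Xs k" "d:V" using UcE by blast
 have "yp k$a=c + (d - yp k$b)" using ab cd by (simp add: app_add algebra_simps)
 hence "(d - yp k$b) - yp k$a=- c" by simp
 hence "(d - yp k$b) - yp k$a:Uk Xs k" using subgpD(2)[OF smD(1)[OF Uk_sm] cd(2)] by simp
 moreover have "d - yp k$b:V" using v(4)[OF cd(3) yV(1)[OF ab(3)]] .
 ultimately have "a:Lk Xs V k" using ab(2) by (auto simp: Lk_def)
 thus "u:ssum (Lk Xs V k) V" using ab by (auto intro: ssumI)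
 qed
 qed
 have noe: "noeth N" by (rule adm_noeth[OF H sN(1) _ NH']) (use sN(2) N1(2) in blast)
 obtain K where K: "!!k. Lk Xs V k<=Lk Xs V K" using Lk_stable[OF noe Xs(1) sbmD(1)[OF V]] by blast
 have Lmono: "Lk Xs V i<=Lk Xs V j" if "i<=j" for i j
 by (rule lift_Suc_mono_le[of "Lk Xs V", OF Lk_Suc[OF sbmD(1)[OF V]] that])
 have VkK: "Vk k=Vk (min k K)" for k
 proof (cases "k<=K")
 case False
 hence "Lk Xs V k=Lk Xs V K" using K[of k] Lmono[of K k] by auto
 thus ?thesis using False unfolding Vk_L by (simp add: min_def)
 qed (simp add: min_def)
 have "EX F. finite F&(ALL l. prime l-->l ~: F-->generic (f l) U0 (Vk k))" for k
 using IH[OF Vk(1)[of k]] U0_eq[OF Vk[of k]] by simp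
 then obtain F where F: "!!k. finite (F k)" "!!k l. prime l==>l ~: F k==>generic (f l) U0 (Vk k)" by metis
 define F1 where "F1=(UN k<=K. F k)"
 have g1: "generic (f l) (Uc (Suc k)) (Uc k)" if l: "prime l" "l ~: F1" for l k
 proof -
 have "l ~: F (min k K)" using l(2) by (auto simp: F1_def)
 hence gg: "generic (f l) U0 (Vk k)" using F(2)[OF l(1)] VkK[of k] by metis
 have "generic (f l) (ssum (($) (yp k) ` U0) (Uc k)) (Uc k)"
 proof (rule generic_transport[OF yH(1)])
 show "generic (f l) U0 {u:U0. yp k$u:Uc k}" using gg by (simp add: Vk_def)
 qed (use f_sub f_comm[OF yH(1)] sbm_mono[OF U0 sN(2)] sbm_mono[OF Uc sN(2)] in auto)
 moreover have "ssum (($) (yp k) ` U0) (Uc k)=Uc (Suc k)"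
 proof
 show "ssum (($) (yp k) ` U0) (Uc k)<=Uc (Suc k)"
 by (rule ssum_least[OF sbmD(4)[OF Uc] _ Uc_mono]) (use U0_Uc1 y_Uc[of _ 1 k] in auto)
 show "Uc (Suc k)<=ssum (($) (yp k) ` U0) (Uc k)"
 proof
 fix w assume "w:Uc (Suc k)"
 then obtain a b where ab: "w=a + b" "a:Uk Xs (Suc k)" "b:V" using UcE by blast
 obtain u where u: "u:span N Xs" "a - yp k$u:Uk Xs k" using Uk_Suc[OF ab(2)] by blast
 have "u:U0" using u ssum_ub(1)[OF smD(1)[OF sm_span] sbmD(4)[OF VN]] unfolding U0_def by blast
 hence "yp k$u + ((a - yp k$u) + b):ssum (($) (yp k) ` U0) (Uc k)"
 by (intro ssumI imageI UcI[OF u(2) ab(3)])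
 thus "w:ssum (($) (yp k) ` U0) (Uc k)" using ab(1) by (simp add: algebra_simps)
 qed
 qed
 ultimately show ?thesis by simp
 qed
 define T where "T=(UN k. Uc k)"
 have T: "sbm N T" unfolding sbm_def T_def
 using sm_Union_chain[of N Uc, OF sbmD(1)[OF Uc] Uc_mono] sbmD(2,3)[OF Uc] by blast
 note t = subgpD[OF sbmD(4)[OF T]]
 have VT: "V<=T" "U0<=T" using VUc(1) U0_Uc1 by (auto simp: T_def)
 have yT: "yp j$w:T" if "w:T" for w j using that y_Uc by (auto simp: T_def)
 have gT: "generic (f l) T V" if "prime l" "l ~: F1" for l
 proof -
 have "generic (f l) (UN k. Uc k) (Uc 0)"
 by (rule generic_Union) (use sbm_mono[OF Uc sN(2)] Uc_mono f_sub g1[OF that] in auto)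
 thus ?thesis by (simp add: T_def Uc0)
 qed
 \<comment> \<open>A polynomial is its constant term plus \<open>y\<close> times a polynomial; this
   identifies the factors of the chain \<open>Tj\<close>.\<close>
 have T_split: "EX u:U0. EX r:T. w=u + E y$r" if w: "w:T" for w
 proof -
 let ?S = "{w. EX u:U0. EX r:T. w=u + E y$r}"
 have S: "sm N ?S" unfolding sm_def subgp_def
 proof (intro conjI ballI)
 show "0:?S" using u0(1) t(1) by (auto intro!: bexI[of _ 0])
 fix a b assume "a:?S" "b:?S"
 then obtain u r u' r' where ab: "a=u + E y$r" "b=u' + E y$r'" "u:U0" "u':U0" "r:T" "r':T" by blast
 have "a - b=(u - u') + E y$(r - r')" using ab by (simp add: app_diff)
 thus "a - b:?S" using u0(4)[OF ab(3,4)] t(4)[OF ab(5,6)] by blast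
 next
 fix n a assume n: "n:N" and "a:?S"
 then obtain u r where ab: "a=u + E y$r" "u:U0" "r:T" by blast
 obtain n' where n': "n':N" "E n$yp 1$r=yp 1$E n'$r" using yp_swap[OF n] by blast
 have "E n$a=E n$u + E y$E n'$r" using n' ab yc by (simp add: app_add)
 thus "E n$a:?S" using smD(2)[OF sbmD(1)[OF U0] n ab(2)] smD(2)[OF sbmD(1)[OF T] n'(1) ab(3)] by blast
 qed
 obtain k where "w:Uc k" using w by (auto simp: T_def)
 then obtain a b where ab: "w=a + b" "a:Uk Xs k" "b:V" using UcE by blast
 have "(UN i<k. (%a. yp i$a) ` Xs)<=?S"
 proof
 fix c assume "c:(UN i<k. (%a. yp i$a) ` Xs)"
 then obtain i x where c: "x:Xs" "c=yp i$x" by blast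
 have x0: "x:U0" using VU0 c by blast
 show "c:?S"
 proof (cases i)
 case 0
 hence "c=x + E y$0" using c by simp
 thus ?thesis using x0 t(1) by blast
 next
 case (Suc i')
 hence "c=0 + E y$yp i'$x" using c yp_add[of 1 i' x] yc by simp
 moreover have "yp i'$x:T" using yT VT x0 by blast
 ultimately show ?thesis using u0(1) by blast
 qed
 qed
 hence "a:?S" using span_least[OF S] ab(2) unfolding Uk_def by blast
 then obtain u r where "a=u + E y$r" "u:U0" "r:T" by blast
 hence "w=(u + b) + E y$r" "u + b:U0" using ab VU0 u0(3) by auto
 thus ?thesis using `r:T` by blast
 qed
 define Tj where "Tj j={w:M. yp j$w:T}" for j
 have Tj: "sbm N (Tj j)" for j
 proof -
 have "sm N (Tj j)" unfolding sm_def subgp_def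
 proof (intro conjI ballI)
 fix n u assume n: "n:N" and u: "u:Tj j"
 obtain n' where "n':N" "yp j$E n$u=E n'$yp j$u" using yp_swap'[OF n] by blast
 thus "E n$u:Tj j" using u smD(2)[OF sbmD(1)[OF T]] smD(2)[OF M Nc[OF n]] by (simp add: Tj_def)
 qed (use m t in "auto simp: Tj_def app_diff")
 moreover have "B<=Tj j" using B_sm yB sbmD(2)[OF T] by (auto simp: Tj_def)
 ultimately show ?thesis by (auto simp: sbm_def Tj_def)
 qed
 have Tj_mono: "Tj j<=Tj (Suc j)" for j
 proof
 fix w assume "w:Tj j"
 hence wM: "w:M" and wT: "yp j$w:T" by (auto simp: Tj_def)
 have "yp 1$yp j$w:T" by (rule yT[OF wT])
 with wM show "w:Tj (Suc j)" unfolding yp_add by (simp add: Tj_def)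
 qed
 have Tj0: "Tj 0=T" using sbmD(3)[OF T] by (auto simp: Tj_def)
 let ?S = "ssum (span (cext N y) Xs) V"
 have S: "sbm (cext N y) ?S" by (rule sbm_span_ssum[OF NH Xs(2) V])
 have UTj: "(UN j. Tj j)=?S"
 proof
 show "(UN j. Tj j)<=?S"
 proof
 fix w assume "w:(UN j. Tj j)"
 then obtain j k where jk: "w:M" "yp j$w:Uc k" by (auto simp: Tj_def T_def)
 have "Uc k<=?S" unfolding Uc_def using Uk_cext[of Xs k] by (auto simp: ssum_def)
 hence "yn j$yp j$w:?S" using smD(2)[OF sbmD(1)[OF S] yce(2)] jk by blast
 thus "w:?S" using yc by simp
 qed
 show "?S<=(UN j. Tj j)"
 proof
 fix w assume w: "w:?S"
 then obtain a b where ab: "w=a + b" "a:span (cext N y) Xs" "b:V" by (auto simp: ssum_def)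
 obtain j k where "yp j$a:Uk Xs k" using cext_span[OF ab(2)] by blast
 hence "yp j$w:Uc k" unfolding ab(1) app_add by (rule UcI[OF _ yV(1)[OF ab(3)]])
 hence "w:Tj j" using w sbmD(3)[OF S] by (auto simp: Tj_def T_def)
 thus "w:(UN j. Tj j)" by blast
 qed
 qed
 define V' where "V'={u:U0. E (inv y)$u:T}"
 have V': "sbm N V'" "V<=V'" "V'<=U0"
 proof -
 show VV: "V<=V'" "V'<=U0"
 proof -
 show "V'<=U0" by (auto simp: V'_def)
 show "V<=V'"
 proof
 fix w assume w: "w:V"
 have "E (inv y)$w:T" using yV(4)[OF w] VT(1) by blast
 thus "w:V'" using w VU0(1) by (auto simp: V'_def)
 qed
 qed
 have "sm N V'" unfolding sm_def subgp_def
 proof (intro conjI ballI)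
 fix n u assume n: "n:N" and u: "u:V'"
 obtain n' where "n':N" "yn 1$E n$u=E n'$yn 1$u" using yn_swap'[OF n] by blast
 thus "E n$u:V'" using u smD(2)[OF sbmD(1)[OF T]] smD(2)[OF sbmD(1)[OF U0] n] yc by (simp add: V'_def)
 qed (use u0 t in "auto simp: V'_def app_diff")
 thus "sbm N V'" using VV sbmD(2,3)[OF VN] sbmD(3)[OF U0] unfolding sbm_def by blast
 qed
 obtain F2 where F2: "finite F2" "!!l. prime l==>l ~: F2==>generic (f l) U0 V'"
 using IH[OF V'(1)] U0_eq[OF V'] by auto
 have shift: "yp j$yn (Suc j)$w=E (inv y)$w" "yp j$yn (Suc j)$E y$w=w" for j w
 proof -
 have "y [^] j**inv (y [^] Suc j)=inv y"
 unfolding nat_pow_Suc2[OF yc] using yc by (simp add: inv_mult_group flip: m_assoc)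
 hence 1: "yp j$yn (Suc j)$w=E (inv y)$w" for w using yc E_app[of "y [^] j" "inv (y [^] Suc j)"] by simp
 show "yp j$yn (Suc j)$w=E (inv y)$w" by (rule 1)
 show "yp j$yn (Suc j)$E y$w=w" unfolding 1 using yc by simp
 qed
 have g2: "generic (f l) (Tj (Suc j)) (Tj j)" if l: "prime l" "l ~: F2" for l j
 proof -
 have "generic (f l) (ssum (($) (yn (Suc j)) ` U0) (Tj j)) (Tj j)"
 proof (rule generic_transport[OF yH(2)])
 have "{u:U0. yn (Suc j)$u:Tj j}=V'"
 using shift(1)[of j] sbmD(3)[OF U0] yM(2)[of _ "Suc j"] by (auto simp: V'_def Tj_def simp del: nat_pow_Suc)
 thus "generic (f l) U0 {u:U0. yn (Suc j)$u:Tj j}" using F2(2)[OF l] by simp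
 qed (use f_sub f_comm[OF yH(2)] sbm_mono[OF U0 sN(2)] sbm_mono[OF Tj sN(2)] in "blast+")
 moreover have "ssum (($) (yn (Suc j)) ` U0) (Tj j)=Tj (Suc j)"
 proof
 have "($) (yn (Suc j)) ` U0<=Tj (Suc j)"
 proof
 fix w assume "w:($) (yn (Suc j)) ` U0"
 then obtain u where u: "u:U0" "w=yn (Suc j)$u" by blast
 have "yp (Suc j)$w=u" unfolding u(2) using E_inv(2)[of "y [^] Suc j"] yc by simp
 moreover have "w:M" unfolding u(2) using yM(2) sbmD(3)[OF U0] u by blast
 ultimately show "w:Tj (Suc j)" using u VT by (auto simp: Tj_def)
 qed
 thus "ssum (($) (yn (Suc j)) ` U0) (Tj j)<=Tj (Suc j)"
 by (rule ssum_least[OF sbmD(4)[OF Tj] _ Tj_mono])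
 show "Tj (Suc j)<=ssum (($) (yn (Suc j)) ` U0) (Tj j)"
 proof
 fix w assume w: "w:Tj (Suc j)"
 then obtain u r where ur: "u:U0" "r:T" "yp (Suc j)$w=u + E y$r"
 using T_split by (auto simp: Tj_def simp del: nat_pow_Suc) blast
 have "w=yn (Suc j)$yp (Suc j)$w" using E_inv(1)[of "y [^] Suc j"] yc by simp
 hence w_eq: "w=yn (Suc j)$u + yn (Suc j)$E y$r" unfolding ur(3) app_add .
 have "r:M" using ur sbmD(3)[OF T] by blast
 hence "yn (Suc j)$E y$r:M" using yM(2,3) by blast
 hence "yn (Suc j)$E y$r:Tj j" using shift(2)[of j r] ur(2) by (simp add: Tj_def del: nat_pow_Suc)
 thus "w:ssum (($) (yn (Suc j)) ` U0) (Tj j)"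
 using w_eq ur(1) ssumI[of "yn (Suc j)$u" "($) (yn (Suc j)) ` U0"] by blast
 qed
 qed
 ultimately show ?thesis by simp
 qed
 have "generic (f l) ?S V" if l: "prime l" "l ~: F1 Un F2" for l
 proof -
 have "generic (f l) (UN j. Tj j) (Tj 0)"
 by (rule generic_Union) (use sbm_mono[OF Tj sN(2)] Tj_mono f_sub g2[of l] l in auto)
 hence gS: "generic (f l) ?S T" by (simp add: UTj Tj0)
 have TS: "T<=?S" using UTj Tj0 by blast
 have N1c: "N1<=cext N y" using sN(2) ce(2) by blast
 show ?thesis
 by (rule generic_trans[OF sbm_mono[OF S N1c] sbm_mono[OF T sN(2)] sbm_mono[OF V N1c] VT(1) TS f_sub gS gT])
 (use l in auto)
 qed
 moreover have "finite (F1 Un F2)" using F(1) F2(1) by (simp add: F1_def)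
 ultimately show ?thesis by blast
qed

text \<open>Induction along the series from \<open>N1\<close> to \<open>N\<close>. At the bottom,
  generators are added one at a time, so only cyclic modules over the scalar domain have to be
  inspected (\<open>cyc\<close>).\<close>

theorem generic_free:
 fixes f :: "nat => 'b endo"
 assumes f_sub: "!!l V u. sbm N1 V==>u:V==>f l$u:V"
 and f_comm: "!!l h v. h:H==>v:M==>f l$E h$v - E h$f l$v:B"
 and cyc: "!!u V. u:M==>sbm N1 V ==>
 EX F. finite F&(ALL l. prime l-->l ~: F-->generic (f l) (ssum (span N1 {u}) V) V)"
 and N: "polyc N1 N" "N<=H" and Xs: "finite Xs" "Xs<=M" and V: "sbm N V"
 shows "EX F. finite F&(ALL l. prime l-->l ~: F-->generic (f l) (ssum (span N Xs) V) V)"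
 using N Xs V
proof (induction arbitrary: Xs V rule: polyc.induct)
 case base
 from base.prems(2,3,4) show ?case
 proof (induction Xs rule: finite_induct)
 case empty
 have "ssum (span N1 {}) V=V"
 using span_ssum_least[OF sbmD(1)[OF empty(2)], of "{}" V] span_ssum_ub(2)[OF sbmD(4)[OF empty(2)]] by blast
 thus ?case using generic_refl[OF empty(2)] by (intro exI[of _ "{}"]) simp
 next
 case (insert x Xs)
 let ?W = "ssum (span N1 Xs) V"
 have W: "sbm N1 ?W" by (rule sbm_span_ssum[OF N1(3) _ insert.prems(2)]) (use insert.prems in auto)
 obtain F1 where F1: "finite F1" "ALL l. prime l-->l ~: F1-->generic (f l) ?W V"
 using insert.IH insert.prems by auto
 obtain F2 where F2: "finite F2" "ALL l. prime l-->l ~: F2-->generic (f l) (ssum (span N1 {x}) ?W) ?W"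
 using cyc[OF _ W, of x] insert.prems by auto
 let ?U = "ssum (span N1 (insert x Xs)) V"
 have U: "sbm N1 ?U" by (rule sbm_span_ssum[OF N1(3) insert.prems(1,2)])
 have sub: "insert x Xs<=?U" "V<=?U" "Xs<=?W" "V<=?W"
 using span_ssum_ub[OF sbmD(4)[OF insert.prems(2)]] by blast+
 have WU: "?W<=?U" by (rule span_ssum_least[OF sbmD(1)[OF U]]) (use sub in auto)
 have eq: "ssum (span N1 {x}) ?W=?U"
 proof
 show "ssum (span N1 {x}) ?W<=?U" by (rule span_ssum_least[OF sbmD(1)[OF U] _ WU]) (use sub in auto)
 have s: "sm N1 (ssum (span N1 {x}) ?W)" by (rule sm_ssum[OF sm_span sbmD(1)[OF W]])
 have "{x}<=ssum (span N1 {x}) ?W" "?W<=ssum (span N1 {x}) ?W"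
 using span_ssum_ub[OF sbmD(4)[OF W]] by blast+
 thus "?U<=ssum (span N1 {x}) ?W" by (intro span_ssum_least[OF s]) (use sub in auto)
 qed
 have "generic (f l) ?U V" if "prime l" "l ~: F1 Un F2" for l
 by (rule generic_trans[OF U W insert.prems(2) sub(4) WU f_sub]) (use F1 F2 eq that in auto)
 thus ?case using F1 F2 by (intro exI[of _ "F1 Un F2"]) auto
 qed
next
 case (step N y)
 have sN: "subgroup N G" "N1<=N" using polyc_subgroup[OF step.hyps(1) N1(1)] by auto
 have NH: "N<=H" using cext_props(2)[OF sN(1) step.hyps(2)] step.prems(1) by blast
 show ?case
 by (rule generic_free_step[OF f_sub f_comm sN step.hyps(2) step.prems(1) _ step.prems(2-4)])
 (use step.IH[OF NH step.prems(2,3)] in auto)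
qed
end

section \<open>Operators modulo a maximal submodule\<close>

locale maximal_module = module_action G E A M R for G :: "('a, 'm) monoid_scheme" (structure) and E :: "'a => 'b endo" and A M R +
 fixes H B
 assumes H: "adm H" and max: "maxm H B"
begin

lemma B: "bm H B" using max by (simp add: maxm_def)

lemma sH: "subgroup H G" by (rule admD(1)[OF H])

lemma Hc: "h:H==>h:carrier G" using sg_mem[OF sH] .

lemma B_sm: "sm H B" "R<=B" "B<=M" using B by (auto simp: bm_def)

lemma M_sm: "sm H M" by (rule sm_mono[OF M]) (use Hc in auto)
lemmas b = subgpD[OF smD(1)[OF B_sm(1)]] and m = subgpD[OF smD(1)[OF M]]

definition pres :: "'b endo => bool" where
 "pres fi \<longleftrightarrow> (ALL v:M. fi$v:M)&(ALL v:B. fi$v:B)"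

text \<open>Equality of the operators induced on \<open>M / B\<close>. Products respect it only for
  operators that preserve \<open>M\<close> and \<open>B\<close>, whence the side conditions
  \<open>pres\<close>.\<close>

definition eqm :: "'b endo => 'b endo => bool" (infix "=~" 50) where
 "fi =~ ps \<longleftrightarrow> (ALL v:M. fi$v - ps$v:B)"

lemma pres_0 [simp]: "pres 0" and pres_1 [simp]: "pres 1" using b m by (auto simp: pres_def)

lemma pres_add: "pres fi==>pres ps==>pres (fi + ps)"
 and pres_diff: "pres fi==>pres ps==>pres (fi - ps)"
 and pres_minus: "pres fi==>pres (- fi)"
 and pres_mult: "pres fi==>pres ps==>pres (fi * ps)"
 using b m by (auto simp: pres_def plus_app minus_app uminus_app)

lemma pres_sum: "(!!i. i:I==>pres (f i))==>pres (SUM i:I. f i)"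
 by (induction I rule: infinite_finite_induct) (auto intro: pres_add)

lemma pres_E: "h:H==>pres (E h)"
 using smD(2)[OF B_sm(1)] smD(2)[OF M_sm] by (auto simp: pres_def)

lemma pres_of_int: "pres (of_int i)" and pres_of_nat: "pres (of_nat j)"
 using of_int_app_subgp[OF smD(1)] of_nat_app_subgp[OF smD(1)] B_sm(1) M_sm by (auto simp: pres_def)

lemma eqm_refl [simp]: "fi =~ fi" using b by (simp add: eqm_def)

lemma eqm_sym: "fi =~ ps==>ps =~ fi"
proof -
 assume *: "fi =~ ps"
 have "- (fi$v - ps$v):B" if "v:M" for v using b(2) * that unfolding eqm_def by blast
 thus ?thesis by (simp add: eqm_def)
qed

lemma eqm_trans [trans]: "fi =~ ps==>ps =~ kh==>fi =~ kh"
proof -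
 assume *: "fi =~ ps" "ps =~ kh"
 have "(fi$v - ps$v) + (ps$v - kh$v):B" if "v:M" for v using b(3) * that unfolding eqm_def by blast
 thus ?thesis by (simp add: eqm_def)
qed

lemma eqm_add: "fi =~ fi'==>ps =~ ps'==>fi + ps =~ fi' + ps'"
proof -
 assume *: "fi =~ fi'" "ps =~ ps'"
 have "(fi$v - fi'$v) + (ps$v - ps'$v):B" if "v:M" for v using b(3) * that unfolding eqm_def by blast
 thus ?thesis by (simp add: eqm_def plus_app algebra_simps)
qed

lemma eqm_minus: "fi =~ fi'==>- fi =~ - fi'"
proof -
 assume *: "fi =~ fi'"
 have "- (fi$v - fi'$v):B" if "v:M" for v using b(2) * that unfolding eqm_def by blast
 thus ?thesis by (simp add: eqm_def uminus_app algebra_simps)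
qed

lemma eqm_diff: "fi =~ fi'==>ps =~ ps'==>fi - ps =~ fi' - ps'"
 using eqm_add[of fi fi' "- ps" "- ps'"] eqm_minus by simp

lemma eqm_mult_left: "pres fi==>ps =~ ps'==>fi * ps =~ fi * ps'"
 unfolding eqm_def times_app app_diff[symmetric] by (auto simp: pres_def)

lemma eqm_mult_right: "ps =~ ps'==>pres fi==>ps * fi =~ ps' * fi"
 by (auto simp: eqm_def pres_def)

lemma eqm_mult: "fi =~ fi'==>ps =~ ps'==>pres fi==>pres ps'==>fi * ps =~ fi' * ps'"
 using eqm_mult_left eqm_mult_right eqm_trans by blast

lemma eqm_sum: "(!!i. i:I==>f i =~ g i)==>(SUM i:I. f i) =~ (SUM i:I. g i)"
 by (induction I rule: infinite_finite_induct) (auto intro: eqm_add)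

lemma eqm_diff_0: "fi - ps =~ 0 \<longleftrightarrow> fi =~ ps" by (simp add: eqm_def minus_app)

lemma eqm_0_app: "fi =~ 0 \<longleftrightarrow> (ALL v:M. fi$v:B)" by (simp add: eqm_def)

lemma eqm_app: "fi =~ ps==>v:M==>fi$v:B \<longleftrightarrow> ps$v:B"
 using b(4)[of "fi$v" "fi$v - ps$v"] b(3)[of "fi$v - ps$v" "ps$v"] by (auto simp: eqm_def)
abbreviation "cp \<equiv> cop H B"

lemma cp_iff: "cp fi \<longleftrightarrow> pres fi&(ALL h:H. fi * E h =~ E h * fi)"
 by (auto simp: cop_def pres_def eqm_def)

lemma cp_comm: "cp fi==>h:H==>fi * E h =~ E h * fi" and cp_pres: "cp fi==>pres fi"
 by (auto simp: cp_iff)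

lemma cp_0 [simp]: "cp 0" and cp_1 [simp]: "cp 1" by (auto simp: cp_iff)

lemma cp_add: "cp fi==>cp ps==>cp (fi + ps)"
 unfolding cp_iff by (auto simp: distrib_left distrib_right intro: eqm_add pres_add)

lemma cp_diff: "cp fi==>cp ps==>cp (fi - ps)"
 unfolding cp_iff by (auto simp: left_diff_distrib right_diff_distrib intro: eqm_diff pres_diff)

lemma cp_mult: assumes "cp fi" "cp ps" shows "cp (fi * ps)"
 unfolding cp_iff
proof (intro conjI ballI)
 show "pres (fi * ps)" using assms pres_mult by (auto simp: cp_iff)
 fix h assume h: "h:H"
 have "fi * (ps * E h) =~ fi * (E h * ps)" using eqm_mult_left cp_comm cp_pres assms h by blast
 moreover have "fi * E h * ps =~ E h * fi * ps" using eqm_mult_right cp_comm cp_pres assms h by blast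
 ultimately show "fi * ps * E h =~ E h * (fi * ps)" using eqm_trans by (metis mult.assoc)
qed

lemma cp_sum: "(!!i. i:I==>cp (f i))==>cp (SUM i:I. f i)"
 by (induction I rule: infinite_finite_induct) (auto intro: cp_add)

lemma cp_of_nat [simp]: "cp (of_nat j)" and cp_of_int [simp]: "cp (of_int i)"
 by (auto simp: cp_iff pres_of_nat pres_of_int mult_of_nat_commute mult_of_int_commute)

lemma cp_eqm: "cp fi==>pres ps==>fi =~ ps==>cp ps"
 unfolding cp_iff by (meson eqm_mult_left eqm_mult_right eqm_sym eqm_trans pres_E)

text \<open>A weak form of Schur's lemma: nonzero endomorphisms of \<open>M / B\<close> are
  injective, though possibly not onto. It follows that they have no zero divisors.\<close>

lemma cp_cases: "cp s==>~ s =~ 0==>v:M==>s$v:B==>v:B"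
 using central_operator[OF sH max, of s] by (auto simp: eqm_0_app)

lemma cp_cancel: "cp s==>~ s =~ 0==>pres fi==>s * fi =~ 0==>fi =~ 0"
proof -
 assume *: "cp s" "~ s =~ 0" "pres fi" "s * fi =~ 0"
 have "fi$v:B" if v: "v:M" for v
 proof (rule cp_cases[OF *(1,2)])
 show "fi$v:M" using *(3) v by (auto simp: pres_def)
 show "s$fi$v:B" using *(4) v by (auto simp: eqm_0_app)
 qed
 thus ?thesis by (auto simp: eqm_0_app)
qed

lemma one_not_0: "~ 1 =~ 0"
proof
 assume "1 =~ 0"
 hence "M<=ser H B 0" by (auto simp: eqm_0_app)
 hence "nilact H B" unfolding nilact_def by (rule exI)
 moreover have "nva H B" using max by (simp add: maxm_def)
 ultimately show False using fidx_refl[OF sH] admD(2)[OF H] unfolding nva_def by blast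
qed

lemma cp_mult_nz: "cp s==>cp t==>~ s =~ 0==>~ t =~ 0==>~ s * t =~ 0"
 using cp_cancel cp_pres by blast

text \<open>The quotient by the image is finite: it is finitely generated, has bounded exponent, and
 by maximality a subgroup of finite index acts nilpotently.\<close>

lemma finite_quotient:
 assumes fi: "cp fi" "~ fi =~ 0" and p: "0 < (p::nat)" "!!v. v:M==>of_nat p$v:ssum (($) fi ` M) B"
 shows "EX Xs. finite Xs&(ALL u:M. EX x:Xs. EX w:M. u - x - fi$w:B)"
proof -
 let ?I = "ssum (($) fi ` M) B"
 have I: "bm H ?I" "B<=?I" using bm_range[OF B fi(1) sH] by auto
 obtain v where v: "v:M" "fi$v ~: B" using fi(2) by (auto simp: eqm_0_app)
 hence "fi$v + 0:?I" using b(1) by (intro ssumI) auto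
 hence "?I ~= B" using v by auto
 then obtain Y k where Y: "fidx G Y H" "A<=Y" "M<=ser Y ?I k" using maxm_nilact[OF max I] by blast
 have sY: "subgroup Y G" "Y<=H" using Y(1) by (auto simp: fidx_def)
 have bY: "bm Y ?I" by (rule bm_mono[OF I(1) sY(2)])
 have i: "subgp ?I" using I smD by (auto simp: bm_def)
 obtain Xs where Xs: "finite Xs" "Xs<=M" "M<=ssum (span Y Xs) R" using adm_M_fg[OF adm_fidx[OF H Y(1,2)]] by blast
 have noe: "noeth Y" by (rule adm_noeth[OF H sY(1) Y(2) sY(2)])
 define fm where "fm U \<longleftrightarrow> (EX F. finite F&(ALL u:U. EX x:F. u - x:?I))" for U
 \<comment> \<open>\<open>fm\<close> is finiteness modulo the image. Adjoining one element
   \<open>x\<close> multiplies the number of classes by at most \<open>p\<close>, since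
   \<open>p x\<close> lies in the image.\<close>
 have fm_ins: "EX W. subgp W&U<=W&x:W&W<=V&fm W"
 if U: "subgp U" "U<=V" "fm U" and V: "subgp V" "x:V" "V<=M" for U V x
 proof (intro exI[of _ "{of_int c$x + u | c u. u:U}"] conjI)
 let ?W = "{of_int c$x + u | c u. u:U}"
 note u = subgpD[OF U(1)]
 show "U<=?W" using `subgp U` by clarify (rule exI[of _ 0], auto)
 have "of_int 1$x + 0:?W" using u(1) by blast
 thus "x:?W" by simp
 show "?W<=V" using of_int_app_subgp[OF V(1,2)] subgpD(3)[OF V(1)] U(2) by blast
 have "(of_int c$x + u1) - (of_int d$x + u2):?W" if "u1:U" "u2:U" for c d u1 u2
 proof -
 have "(of_int c$x + u1) - (of_int d$x + u2) = of_int (c - d)$x + (u1 - u2)" by (simp add: minus_app)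
 thus ?thesis using u(4)[OF that] by blast
 qed
 moreover have "0:?W" using `U <= ?W` u(1) by blast
 ultimately show "subgp ?W" unfolding subgp_def by blast
 obtain F where F: "finite F" "!!u. u:U==>EX y:F. u - y:?I" using U(3) by (auto simp: fm_def)
 show "fm ?W" unfolding fm_def
 proof (intro exI[of _ "(%(j, y). of_int j$x + y) ` ({0..<int p} \<times> F)"] conjI ballI)
 fix w assume "w:?W"
 then obtain c u where w: "w = of_int c$x + u" "u:U" by blast
 obtain y where y: "y:F" "u - y:?I" using F w by blast
 have "c=c div int p * int p + c mod int p" by simp
 hence "of_int c$x = of_int (c div int p)$of_nat p$x + of_int (c mod int p)$x"
 by (metis of_int_add of_int_mult of_int_of_nat_eq plus_app times_app)
 moreover have "of_int (c div int p)$of_nat p$x:?I" using of_int_app_subgp[OF i p(2)] V by blast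
 ultimately have "w - (of_int (c mod int p)$x + y):?I"
 using subgpD(3)[OF i, of "of_int (c div int p)$of_nat p$x" "u - y"] y(2) w(1) by (simp add: algebra_simps)
 thus "EX y:(%(j, y). of_int j$x + y) ` ({0..<int p} \<times> F). w - y:?I"
 using y(1) p(1) by (auto intro!: bexI[of _ "(c mod int p, y)"])
 qed (use F in auto)
 qed
 \<comment> \<open>Each factor of the central series is a trivial \<open>Y\<close>-module, finitely
   generated by the Noetherian property, so finitely many adjunctions lead from one term to the
   next.\<close>
 have "fm (ser Y ?I j)" for j
 proof (induction j)
 case 0
 show ?case unfolding fm_def by (intro exI[of _ "{0}"]) auto
 next
 case (Suc j)
 let ?S = "ser Y ?I j" and ?T = "ser Y ?I (Suc j)"
 have S: "sm Y ?S" "R<=?S" using bm_ser(1)[OF sY(1) bY, of j] by (auto simp: bm_def)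
 have T: "sm Y ?T" "R<=?T" "?T<=M" using bm_ser(1)[OF sY(1) bY, of "Suc j"] by (auto simp: bm_def)
 have ST: "?S<=?T"
 proof
 fix v assume v: "v:?S"
 moreover have "v:M" using v bm_ser(1)[OF sY(1) bY, of j] by (auto simp: bm_def)
 ultimately show "v:?T" using smD(2)[OF S(1)] subgpD(4)[OF smD(1)[OF S(1)]] by auto
 qed
 obtain X' where X': "finite X'" "X'<=?T Int span Y Xs" "?T Int span Y Xs<=span Y X'"
 using noethD[OF noe Xs(1) sm_inter[OF T(1) sm_span[of Y Xs]] Int_lower2] by (elim exE conjE)
 have "EX W. subgp W&?S<=W&X'<=W&W<=?T&fm W" using X'(1,2)
 proof (induction X' rule: finite_induct)
 case empty
 show ?case using Suc.IH ST smD(1)[OF S(1)] by blast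
 next
 case (insert x X')
 then obtain W where W: "subgp W" "?S<=W" "X'<=W" "W<=?T" "fm W" by auto
 obtain W' where "subgp W'" "W<=W'" "x:W'" "W'<=?T" "fm W'"
 using fm_ins[OF W(1,4,5) smD(1)[OF T(1)] _ T(3)] insert.prems by blast
 thus ?case using W by (intro exI[of _ W']) blast
 qed
 then obtain W where W: "subgp W" "?S<=W" "X'<=W" "W<=?T" "fm W" by blast
 have "sm Y W" unfolding sm_def
 proof (intro conjI ballI)
 fix n w assume n: "n:Y" and w: "w:W"
 have "E n$w - w:?S" using W(4) w n by auto
 hence "(E n$w - w) + w:W" using subgpD(3)[OF W(1)] W(2) w by blast
 thus "E n$w:W" by simp
 qed (rule W)
 have sp: "span Y X'<=W" by (rule span_least[OF `sm Y W` W(3)])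
 have "?T<=W"
 proof
 fix t assume t: "t:?T"
 then obtain a r where ar: "t=a + r" "a:span Y Xs" "r:R" using Xs(3) T(3) by (auto simp: ssum_def)
 have "t - r:?T" using subgpD(4)[OF smD(1)[OF T(1)] t] ar(3) T(2) by blast
 hence "a:W" using ar X'(3) sp by auto
 thus "t:W" using ar(1,3) S(2) W(2) subgpD(3)[OF W(1)] by blast
 qed
 thus ?case using W(5) unfolding fm_def by blast
 qed
 from this[of k] obtain F where F: "finite F" "!!u. u:ser Y ?I k==>EX x:F. u - x:?I" unfolding fm_def by blast
 have "EX x:F. EX w:M. u - x - fi$w:B" if u: "u:M" for u
 proof -
 obtain x where x: "x:F" "u - x:?I" using F(2) u Y(3) by blast
 then obtain w c where "u - x=fi$w + c" "w:M" "c:B" by (auto simp: ssum_def)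
 thus ?thesis using x(1) by (metis add_diff_cancel_left')
 qed
 thus ?thesis using F(1) by blast
qed
end

section \<open>Central elements of infinite order\<close>

text \<open>The quotient of \<open>X^l - 1\<close> by \<open>X - 1\<close>. In positive
  characteristic these polynomials, evaluated at the central element, take the place of the
  primes.\<close>

definition geom :: "nat => int poly" where "geom l=(SUM i<l. monom 1 i)"

lemma coeff_geom: "coeff (geom l) n=(if n < l then 1 else 0)"
 by (simp add: geom_def coeff_sum)

lemma degree_geom: "0 < l==>degree (geom l)=l - 1"
 by (intro antisym degree_le le_degree) (auto simp: coeff_geom)

lemma reduce_poly:
 assumes p: "0 < (p::int)" and P: "~ [:p:] dvd P"
 obtains Q where "[:p:] dvd P - Q" "Q ~= 0" "0 < lead_coeff Q" "lead_coeff Q < p"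
proof
 let ?Q = "map_poly (%a. a mod p) P"
 show d: "[:p:] dvd P - ?Q" by (auto simp: const_poly_dvd_iff coeff_map_poly minus_mod_eq_mult_div)
 show "?Q ~= 0" using d P by auto
 hence "lead_coeff ?Q ~= 0" by simp
 moreover have "0<=lead_coeff ?Q" "lead_coeff ?Q < p" using p by (simp_all add: coeff_map_poly)
 ultimately show "0 < lead_coeff ?Q" "lead_coeff ?Q < p" by linarith+
qed

text \<open>\<open>geom l\<close> is no unit among the Laurent polynomials modulo \<open>p\<close>.
  Its constant term is 1, so powers of \<open>X\<close> can be divided out of an equation
  \<open>X^k = geom l P\<close>, and \<open>1 = geom l P\<close> contradicts the degrees.\<close>

lemma geom_nonunit:
 assumes p: "1 < (p::int)" and l: "1 < l" shows "~ [:p:] dvd monom 1 k - geom l * P"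
proof (induction k arbitrary: P)
 case 0
 show ?case
 proof
 assume *: "[:p:] dvd monom 1 0 - geom l * P"
 show False
 proof (cases "[:p:] dvd P")
 case True
 hence "[:p:] dvd (monom 1 0 - geom l * P) + geom l * P" using * by (intro dvd_add dvd_mult)
 thus False using p const_poly_dvd_iff[of p "monom 1 0"] by (auto dest: spec[of _ 0] simp: zdvd_not_zless)
 next
 case False
 obtain Q where Q: "[:p:] dvd P - Q" "Q ~= 0" "0 < lead_coeff Q" "lead_coeff Q < p"
 using reduce_poly[OF _ False] p by auto
 have "[:p:] dvd (monom 1 0 - geom l * P) + geom l * (P - Q)" using * Q by (intro dvd_add dvd_mult)
 hence d: "[:p:] dvd monom 1 0 - geom l * Q" by (simp add: algebra_simps)
 have g0: "geom l ~= 0" using l coeff_geom[of l 0] by auto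
 let ?n = "degree (geom l * Q)"
 have "?n=l - 1 + degree Q" using g0 Q l by (simp add: degree_mult_eq degree_geom)
 hence "coeff (monom 1 0 - geom l * Q) ?n=- lead_coeff (geom l * Q)" using l by simp
 also have "\<dots>=- lead_coeff Q" using l by (simp add: lead_coeff_mult degree_geom coeff_geom)
 finally have "p dvd - lead_coeff Q" using d unfolding const_poly_dvd_iff by metis
 thus False using Q(3,4) by (auto simp: zdvd_not_zless)
 qed
 qed
next
 case (Suc k)
 obtain a P' where P: "P=pCons a P'" by (cases P)
 show ?case
 proof
 assume *: "[:p:] dvd monom 1 (Suc k) - geom l * P"
 have eq: "monom 1 (Suc k) - geom l * P=pCons 0 (monom 1 k - geom l * P') - smult a (geom l)"
 by (simp add: P monom_Suc mult_pCons_right)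
 have "p dvd coeff (monom 1 (Suc k) - geom l * P) 0" using * unfolding const_poly_dvd_iff by blast
 hence "p dvd a" unfolding eq using l by (simp add: coeff_geom)
 hence "[:p:] dvd smult a (geom l)" by (auto simp: const_poly_dvd_iff)
 hence "[:p:] dvd pCons 0 (monom 1 k - geom l * P')"
 using * unfolding eq by (metis dvd_add diff_add_cancel)
 hence "[:p:] dvd monom 1 k - geom l * P'"
 unfolding const_poly_dvd_iff by (metis coeff_pCons_Suc)
 thus False using Suc.IH by blast
 qed
qed

context maximal_module
begin

lemma cp_power: "cp fi==>cp (fi ^ n)" by (induction n) (auto intro: cp_mult)

lemma cp_inv: assumes "w:H" "cp (E w)" shows "cp (E (inv w))"
 unfolding cp_iff
proof (intro conjI ballI)
 have wi: "inv w:H" "w:carrier G" using assms sg_inv[OF sH] Hc by auto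
 show "pres (E (inv w))" by (rule pres_E[OF wi(1)])
 fix h assume h: "h:H"
 have hc: "h:carrier G" using h Hc by blast
 have "E (inv w) * ((E w * E h) * E (inv w)) =~ E (inv w) * ((E h * E w) * E (inv w))"
 using assms wi pres_E h by (intro eqm_mult_left eqm_mult_right cp_comm) auto
 thus "E (inv w) * E h =~ E h * E (inv w)"
 using wi hc by (simp add: m_assoc flip: E_mult) (simp flip: m_assoc add: eqm_sym)
qed

lemma cp_int_pow: assumes "w:H" "cp (E w)" shows "cp (E (w [^] (i::int)))"
proof -
 have wc: "w:carrier G" using assms Hc by blast
 have *: "cp (E (w' [^] n))" if "w':H" "cp (E w')" for w' and n :: nat
 by (induction n) (use that Hc in "auto simp: E_mult intro: cp_mult")
 show ?thesis
 proof (cases i rule: int_cases2)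
 case (nonneg n)
 thus ?thesis using *[OF assms] by (simp add: int_pow_int)
 next
 case (nonpos n)
 thus ?thesis using *[OF sg_inv[OF sH assms(1)] cp_inv[OF assms]] wc
 by (simp add: int_pow_neg_int nat_pow_inv)
 qed
qed

text \<open>The elements that act on \<open>M / B\<close> like a power of \<open>w\<close>. For
  central \<open>w\<close> this is a normal subgroup of \<open>H\<close> and serves as
  \<open>N1\<close> in generic freeness; for \<open>w = \<one>\<close> it is the kernel of the
  action.\<close>

definition pw :: "'a => 'a set" where "pw w={g:H. EX i::int. E g =~ E (w [^] i)}"

lemma pw:
 assumes w: "w:H" "cp (E w)"
 shows "subgroup (pw w) G" "A<=pw w" "pw w<=H" "h:H==>g:pw w==>h**g**inv h:pw w"
 "g:pw w==>cp (E g)"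
proof -
 have wc: "w:carrier G" using w Hc by blast
 have wi: "w [^] (i::int):H" for i using subgroup_closed(5)[OF sH] w by blast
 show "pw w<=H" by (auto simp: pw_def)
 show "A<=pw w"
 using E_A admD(2)[OF H] by (auto simp: pw_def intro!: exI[of _ "0::int"])
 show cg: "cp (E g)" if "g:pw w" for g
 using that cp_eqm[OF cp_int_pow[OF w]] pres_E eqm_sym by (auto simp: pw_def) blast
 have pi: "pres (E (w [^] (i::int)))" for i by (rule pres_E[OF wi])
 show "subgroup (pw w) G"
 proof (rule subgroupI)
 show "pw w<=carrier G" using Hc by (auto simp: pw_def)
 show "pw w ~= {}" using `A <= pw w` sg_one[OF A] by blast
 fix a assume a: "a:pw w"
 then obtain i :: int where i: "a:H" "E a =~ E (w [^] i)" by (auto simp: pw_def)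
 have ac: "a:carrier G" "inv a:H" using i Hc sg_inv[OF sH] by auto
 have "E (inv a) * (E a * E (w [^] (- i))) =~ E (inv a) * (E (w [^] i) * E (w [^] (- i)))"
 using ac i pi pres_E by (intro eqm_mult_left eqm_mult_right) auto
 hence "E (w [^] (- i)) =~ E (inv a)"
 using ac wc by (simp add: m_assoc int_pow_neg flip: E_mult)
 thus "inv a:pw w" using ac eqm_sym by (auto simp: pw_def)
 fix a' assume "a':pw w"
 then obtain j :: int where j: "a':H" "E a' =~ E (w [^] j)" by (auto simp: pw_def)
 have "E a * E a' =~ E (w [^] i) * E (w [^] j)" using i j pi pres_E by (intro eqm_mult) auto
 hence "E (a**a') =~ E (w [^] (i + j))" using ac j Hc wc by (simp add: int_pow_mult E_mult)
 thus "a**a':pw w" using sg_mult[OF sH i(1) j(1)] by (auto simp: pw_def)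
 qed
 show "h**g**inv h:pw w" if h: "h:H" and g: "g:pw w"
 proof -
 obtain i :: int where i: "g:H" "E g =~ E (w [^] i)" using g by (auto simp: pw_def)
 have hc: "h:carrier G" "g:carrier G" "inv h:H" using h i Hc sg_inv[OF sH] by auto
 have "(E h * E g) * E (inv h) =~ (E g * E h) * E (inv h)"
 using cp_comm[OF cg[OF g] h] hc pres_E eqm_sym by (intro eqm_mult_right) auto
 hence "E (h**g**inv h) =~ E g" using hc by (simp add: m_assoc flip: E_mult)
 hence "E (h**g**inv h) =~ E (w [^] i)" using i(2) by (rule eqm_trans)
 thus ?thesis using i hc h subgroup_closed(3)[OF sH] unfolding pw_def by blast
 qed
qed
end

locale central_element = maximal_module G E A M R H B for G :: "('a, 'm) monoid_scheme" (structure) and E :: "'a => 'b endo" and A M R H B +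
 fixes z
 assumes z: "z:H" and z_cp: "cop H B (E z)" and z_inf: "0 < n==>~ eqm (E z ^ n) 1"
begin
abbreviation "ze \<equiv> E z"

lemma zc: "z:carrier G" using z Hc by blast

lemma zeta_pow: "ze ^ n=E (z [^] n)"
 by (induction n) (simp_all add: E_mult zc power_Suc2 del: power_Suc)

lemma cp_zeta_power: "cp (ze ^ n)" by (rule cp_power[OF z_cp])

text \<open>Generic freeness together with finiteness of the quotient by the image of a suitable \<open>f l\<close>
 bounds the rank of `M / B`.\<close>

lemma finite_rank:
 fixes f :: "nat => 'b endo"
 assumes w: "w:H" "cp (E w)" and sc: "scalars G E A M R H B (pw w) s"
 and f_sub: "!!l V u. scalars.sbm E M B (pw w) V==>u:V==>f l$u:V"
 and f_cp: "!!l. cp (f l)" and f_nz: "!!l. prime l==>~ f l =~ 0"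
 and f_exp: "!!l. prime l==>EX q>0. ALL v:M. of_nat q$v:ssum (($) (f l) ` M) B"
 and cyc: "!!u V. u:M==>scalars.sbm E M B (pw w) V==>EX F. finite F &
 (ALL l. prime l-->l ~: F-->scalars.generic E (pw w) s (f l) (ssum (span (pw w) {u}) V) V)"
 shows "EX Xs. finite Xs&Xs<=M&(ALL u:M. EX n>0. s n$u:ssum (span (pw w) Xs) B)"
proof -
 interpret S: scalars G E A M R H B "pw w" s by (rule sc)
 obtain n where "lcs G H n<=A" using H by (auto simp: adm_def)
 hence pol: "polyc (pw w) H"
 using polyc_nilpotent[OF admD(3)[OF H] pw(1)[OF w] pw(3)[OF w]] pw(2)[OF w] by blast
 obtain Xs where Xs: "finite Xs" "Xs<=M" "M<=ssum (span H Xs) R" using adm_M_fg[OF H] by blast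
 have V: "S.sbm H B" using B_sm by (simp add: S.sbm_def)
 have MU: "ssum (span H Xs) B=M"
 proof
 show "ssum (span H Xs) B<=M" using S.sbmD(3)[OF S.sbm_span_ssum[OF _ Xs(2) V]] by simp
 have "ssum (span H Xs) R<=ssum (span H Xs) B" using B_sm(2) unfolding ssum_def by blast
 thus "M<=ssum (span H Xs) B" using Xs(3) by (rule order_trans[rotated])
 qed
 obtain F where F: "finite F" "!!l. prime l==>l ~: F==>S.generic (f l) M B"
 proof -
 have fc: "f l$E h$v - E h$f l$v:B" if "h:H" "v:M" for l h v
 using cp_comm[OF f_cp that(1)] that(2) by (simp add: eqm_def)
 show thesis using S.generic_free[OF f_sub fc cyc pol order_refl Xs(1,2) V] that unfolding MU by blast
 qed
 \<comment> \<open>Only finitely many primes are exceptional. A good prime has a finite cokernel by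
   \<open>finite_quotient\<close>, and genericity turns this into finite rank.\<close>
 have "infinite {l::nat. prime l}" by (rule primes_infinite)
 then obtain l where l: "prime l" "l ~: F" using F(1) by (metis finite_subset mem_Collect_eq subsetI)
 obtain q where q: "q > 0" "!!v. v:M==>of_nat q$v:ssum (($) (f l) ` M) B" using f_exp[OF l(1)] by blast
 have "S.fin_quot (f l) M B"
 unfolding S.fin_quot_def by (rule finite_quotient[OF f_cp f_nz[OF l(1)] q])
 hence "S.frk M B" using F(2)[OF l] by (simp add: S.generic_def)
 thus ?thesis unfolding S.frk_def .
qed
end

context central_element
begin

text \<open>The common outcome of characteristic 0 and characteristic \<open>p\<close>:
  \<open>M / B\<close> has finite rank over \<open>pw w\<close>, with the \<open>s n\<close> as
  denominators that commute with all central operators.\<close>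

definition finite_rank_over :: "'a => (nat => 'b endo) => bool" where
 "finite_rank_over w s \<longleftrightarrow> w:H&cp (E w)&(ALL n. cp (s n))&(ALL n>0. ~ s n =~ 0)
&(ALL n fi. cp fi-->s n * fi =~ fi * s n)
&(EX Xs. finite Xs&Xs<=M&(ALL u:M. EX n>0. s n$u:ssum (span (pw w) Xs) B))"

text \<open>The scalar domain is the ring of integers, and the kernel \<open>pw \<one>\<close> acts
  trivially, so a cyclic module is a cyclic group. If it is killed by \<open>n\<close>, primes not
  dividing \<open>n\<close> act injectively by Bezout; if it is infinite, every prime is injective
  and not onto.\<close>

lemma finite_rank_char_0:
 assumes nt: "!!n. 0 < n==>~ of_nat n =~ 0"
 shows "finite_rank_over \<one> of_nat"
proof -
 have w: "\<one>:H" "cp (E \<one>)" using sg_one[OF sH] by auto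
 interpret S: scalars G E A M R H B "pw \<one>" of_nat
 proof (intro scalars.intro module_action_axioms scalars_axioms.intro H B pw[OF w])
 show "of_nat n$u:U" if "sm (pw \<one>) U" "u:U" for n u U using of_nat_app_subgp smD(1) that by blast
 show "of_nat n$E h$v - E h$of_nat n$v:B" for h n v
 using b(1) by (simp add: mult_of_nat_commute flip: times_app)
 show "EX l>0. of_nat l$u:V" if "0 < m" "0 < n" "of_nat m$of_nat n$u:V" for m n u V
 using that by (intro exI[of _ "m * n"]) simp
 show "of_nat (m * n)$u:V" if "sm (pw \<one>) V" "of_nat n$u:V" for m n u V
 using of_nat_app_subgp[OF smD(1)] that by simp
 qed auto
 have "EX F. finite F&(ALL l. prime l-->l ~: F-->S.generic (of_nat l) (ssum (span (pw \<one>) {u}) V) V)"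
 if u: "u:M" and V: "S.sbm (pw \<one>) V" for u V
 proof -
 let ?U = "ssum (span (pw \<one>) {u}) V"
 note v = subgpD[OF S.sbmD(4)[OF V]]
 have uU: "u:?U" using ssum_ub(1)[OF smD(1)[OF sm_span] S.sbmD(4)[OF V]] span_ub[of "{u}"] by blast
 have U: "EX c. x - of_int c$u:V" if x: "x:?U" for x
 proof -
 have "sm (pw \<one>) {x. EX c. x - of_int c$u:V}" unfolding sm_def subgp_def
 proof (intro conjI ballI)
 show "0:{x. EX c. x - of_int c$u:V}" using v(1) by (auto intro!: exI[of _ 0])
 fix x assume "x:{x. EX c. x - of_int c$u:V}"
 then obtain c where c: "x - of_int c$u:V" by blast
 show "x - y:{x. EX c. x - of_int c$u:V}" if y: "y:{x. EX c. x - of_int c$u:V}" for y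
 proof -
 obtain d where "y - of_int d$u:V" using y by blast
 hence "(x - of_int c$u) - (y - of_int d$u):V" using c v(4) by blast
 hence "(x - y) - of_int (c - d)$u:V" by (simp add: minus_app algebra_simps)
 thus ?thesis by blast
 qed
 fix g assume g: "g:pw \<one>"
 have "of_int c$u:M" using of_int_app_subgp[OF smD(1)[OF M]] u by blast
 hence "E g$of_int c$u - of_int c$u:V"
 using g S.sbmD(2)[OF V] by (auto simp: pw_def eqm_def)
 moreover have "E g$(x - of_int c$u):V" by (rule smD(2)[OF S.sbmD(1)[OF V] g c])
 ultimately have "(E g$of_int c$u - of_int c$u) + E g$(x - of_int c$u):V" by (rule v(3))
 hence "E g$x - of_int c$u:V" by (simp add: app_diff)
 thus "E g$x:{x. EX c. x - of_int c$u:V}" by blast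
 qed
 moreover have "u:{x. EX c. x - of_int c$u:V}" using v(1) by (auto intro!: exI[of _ 1])
 ultimately have "span (pw \<one>) {u}<={x. EX c. x - of_int c$u:V}" by (intro span_least) auto
 moreover obtain a r where ar: "x=a + r" "a:span (pw \<one>) {u}" "r:V"
 using x unfolding ssum_def by blast
 ultimately obtain c where "x=a + r" "r:V" "a - of_int c$u:V" by blast
 hence "x - of_int c$u:V" using v(3)[of "a - of_int c$u" r] by (simp add: algebra_simps)
 thus ?thesis by blast
 qed
 have frk: "S.frk ?U V" unfolding S.frk_def using uU by (intro exI[of _ "{u}"]) (auto intro!: exI[of _ 1])
 show ?thesis
 proof (cases "EX n>0. of_nat n$u:V")
 case True
 then obtain n :: nat where n: "n > 0" "of_nat n$u:V" by blast
 have nU: "of_nat n$x:V" if x: "x:?U" for x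
 proof -
 obtain c where c: "x - of_int c$u:V" using U[OF x] by blast
 have "of_nat n$of_int c$u = of_int c$of_nat n$u" by (simp add: mult_of_nat_commute flip: times_app)
 hence "of_nat n$of_int c$u:V" using of_int_app_subgp[OF S.sbmD(4)[OF V] n(2)] by simp
 moreover have "of_nat n$(x - of_int c$u):V" by (rule of_nat_app_subgp[OF S.sbmD(4)[OF V] c])
 ultimately have "of_nat n$(x - of_int c$u) + of_nat n$of_int c$u:V" by (intro v(3))
 thus ?thesis by (simp add: app_diff)
 qed
 have "S.generic (of_nat l) ?U V" if l: "prime l" "~ l dvd n" for l
 proof -
 have "coprime l n" using l by (simp add: prime_imp_coprime)
 hence "gcd (int l) (int n)=1" by simp
 then obtain i j :: int where ij: "i * int l + j * int n=1" using bezout_int[of "int l" "int n"] by auto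
 have "x:V" if x: "x:?U" "of_nat l$x:V" for x
 proof -
 have "of_int i$of_nat l$x + of_int j$of_nat n$x:V"
 using of_int_app_subgp[OF S.sbmD(4)[OF V]] x nU v(3) by blast
 moreover have "of_int i * of_nat l + of_int j * of_nat n=(1 :: 'b endo)"
 using arg_cong[OF ij, of "of_int :: int => 'b endo"] by simp
 ultimately show ?thesis by (metis one_app plus_app times_app)
 qed
 thus ?thesis using frk n nU by (auto simp: S.generic_def S.tors_def)
 qed
 thus ?thesis using n by (intro exI[of _ "{l. l dvd n}"]) auto
 next
 case False
 have c0: "c=0" if "of_int c$u:V" for c
 proof (rule ccontr)
 assume "c ~= 0"
 have "of_nat (nat \<bar>c\<bar>)$u:V"
 using v(2)[OF that] that by (cases "c < 0") (auto simp flip: uminus_app of_int_minus)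
 thus False using False `c ~= 0` by (metis zero_less_abs_iff zero_less_nat_eq)
 qed
 have "S.generic (of_nat l) ?U V" if l: "prime l" for l
 proof -
 have l2: "int l ~= 0" "1 ~= int l * c" for c using prime_gt_1_nat[OF l] zmult_eq_1_iff[of "int l" c] by auto
 have *: "of_int d$u - of_nat l$of_int c$u:V" if "of_int d$u - of_nat l$x:V" "x - of_int c$u:V" for c d x
 using v(3)[OF that(1) of_nat_app_subgp[OF S.sbmD(4)[OF V] that(2), where n = l]] by (simp add: app_diff)
 have **: "of_int (d - int l * c)$u:V" if "of_int d$u - of_nat l$x:V" "x - of_int c$u:V" for c d x
 using *[OF that] by (simp add: minus_app)
 have "x:V" if x: "x:?U" "of_nat l$x:V" for x
 proof -
 obtain c where c: "x - of_int c$u:V" using U[OF x(1)] by blast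
 have o: "of_int 0$u - of_nat l$x:V" using v(2)[OF x(2)] by simp
 hence "c=0" using c0[OF **[OF o c]] l2(1) by simp
 thus ?thesis using c by simp
 qed
 moreover have "u - of_nat l$x ~: V" if x: "x:?U" for x
 proof
 assume "u - of_nat l$x:V"
 hence *: "of_int 1$u - of_nat l$x:V" by simp
 obtain c where c: "x - of_int c$u:V" using U[OF x] by blast
 show False using c0[OF **[OF * c]] l2(2)[of c] by simp
 qed
 ultimately show ?thesis using frk uU unfolding S.generic_def by blast
 qed
 thus ?thesis by blast
 qed
 qed
 hence "EX Xs. finite Xs&Xs<=M&(ALL u:M. EX n>0. of_nat n$u:ssum (span (pw \<one>) Xs) B)"
 proof (intro finite_rank[OF w S.scalars_axioms, of of_nat])
 show "of_nat l$u:V" if "S.sbm (pw \<one>) V" "u:V" for l V u using of_nat_app_subgp[OF S.sbmD(4)] that by blast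
 show "~ of_nat l =~ 0" if "prime l" for l using nt prime_gt_0_nat[OF that] by blast
 show "EX q>0. ALL v:M. of_nat q$v:ssum (($) (of_nat l) ` M) B" if l: "prime l" for l
 proof (intro exI[of _ l] conjI ballI)
 fix v assume "v:M"
 hence "of_nat l$v + 0:ssum (($) (of_nat l) ` M) B" using b(1) by (intro ssumI) auto
 thus "of_nat l$v:ssum (($) (of_nat l) ` M) B" by simp
 qed (rule prime_gt_0_nat[OF l])
 qed auto
 thus ?thesis unfolding finite_rank_over_def using w nt by (auto simp: mult_of_nat_commute)
qed

definition zeval :: "int poly => 'b endo" where
 "zeval P=fold_coeffs (%a fi. of_int a + ze * fi) P 0"

lemma zeval_0 [simp]: "zeval 0=0" by (simp add: zeval_def)

lemma zeval_pCons [simp]: "zeval (pCons a P) = of_int a + ze * zeval P"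
 by (cases "P=0&a=0") (auto simp: zeval_def fold_coeffs_pCons_eq)

lemma zeval_add: "zeval (P + Q)=zeval P + zeval Q"
 by (induction P Q rule: poly_induct2) (simp_all add: algebra_simps)

lemma zeval_smult: "zeval (smult c P) = of_int c * zeval P"
proof (induction P)
 case (pCons a P)
 have "ze * (of_int c * zeval P) = of_int c * (ze * zeval P)" by (metis mult.assoc mult_of_int_commute)
 thus ?case using pCons by (simp add: distrib_left)
qed simp

lemma zeval_mult: "zeval (P * Q)=zeval P * zeval Q"
 by (induction P) (simp_all add: zeval_add zeval_smult distrib_right mult.assoc)

lemma zeval_diff: "zeval (P - Q)=zeval P - zeval Q"
 using zeval_add[of "P - Q" Q] by simp

lemma zeval_monom: "zeval (monom 1 k)=ze ^ k"
 by (induction k) (simp_all add: monom_Suc monom_0)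

lemma zeval_geom: "zeval (geom l)=(SUM i<l. ze ^ i)"
 by (induction l) (simp_all add: geom_def zeval_add zeval_monom)
end

context central_element
begin

lemma z_pw: "z:pw z" "inv z:pw z"
proof -
 have "ze =~ E (z [^] (1::int))" using zc by simp
 thus "z:pw z" using z unfolding pw_def by blast
 thus "inv z:pw z" by (rule sg_inv[OF pw(1)[OF z z_cp]])
qed

lemma zeta_stable:
 assumes V: "sm (pw z) V"
 shows "v:V==>ze ^ k$v:V" "ze ^ k$v:V==>v:V" "v:V==>zeval P$v:V"
proof -
 have 1: "ze$v:V" if "v:V" for v by (rule smD(2)[OF V z_pw(1) that])
 have 2: "v:V" if "ze$v:V" for v using smD(2)[OF V z_pw(2) that] zc by simp
 show "v:V==>ze ^ k$v:V" by (induction k) (auto intro: 1)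
 show "ze ^ k$v:V==>v:V" by (induction k) (auto dest: 2)
 show "zeval P$v:V" if "v:V"
 by (induction P) (use that 1 of_int_app_subgp[OF smD(1)[OF V]] subgpD[OF smD(1)[OF V]] in "auto simp: plus_app")
qed

lemma zeval_M: "v:M==>zeval P$v:M"
 by (rule zeta_stable(3)[OF sm_mono[OF M]]) (use pw(3)[OF z z_cp] Hc in auto)

lemma zeta_pow_cong:
 assumes V: "sm (pw z) V" and n: "ze ^ n$u - u:V"
 shows "ze ^ (n * i)$u - (u + of_nat i$(ze ^ n$u - u)):V"
proof (induction i)
 case 0 thus ?case using subgpD(1)[OF smD(1)[OF V]] by simp
next
 case (Suc i)
 note v = subgpD[OF smD(1)[OF V]]
 have 1: "ze ^ (n * i)$(ze ^ n$u - u):V" by (rule zeta_stable(1)[OF V n])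
 have 2: "of_nat j$(ze ^ n$u - u):V" for j by (rule of_nat_app_subgp[OF smD(1)[OF V] n])
 have 3: "ze ^ (n * i)$u - u:V" using v(3)[OF Suc.IH 2[of i]] by simp
 have "ze ^ (n * i)$(ze ^ n$u - u) + (ze ^ (n * i)$u - u) - of_nat (Suc i)$(ze ^ n$u - u):V"
 using 1 2 3 v(3,4) by blast
 moreover have "ze ^ (n * Suc i)$u=ze ^ (n * i)$ze ^ n$u"
 by (metis add.commute mult_Suc_right power_add times_app)
 ultimately show ?case by (simp add: app_diff plus_app algebra_simps)
qed
end

section \<open>Positive characteristic: the central element as an indeterminate\<close>

locale central_element_char = central_element G E A M R H B z for G :: "('a, 'm) monoid_scheme" (structure) and E :: "'a => 'b endo" and A M R H B z +
 fixes p :: nat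
 assumes p: "prime p" and char: "eqm (of_nat p) 0"
begin

lemma zeval_dvd:
 assumes V: "subgp V" "B<=V" and u: "u:M" and d: "[:int p:] dvd P - Q"
 shows "zeval P$u:V \<longleftrightarrow> zeval Q$u:V"
proof -
 obtain K where "P - Q=[:int p:] * K" using d by (elim dvdE)
 hence "P=Q + smult (int p) K" by (simp add: algebra_simps)
 hence eq: "zeval P$u=zeval Q$u + of_nat p$zeval K$u" by (simp add: zeval_add zeval_smult plus_app)
 have w: "of_nat p$zeval K$u:V" using char V(2) zeval_M[OF u] by (auto simp: eqm_0_app)
 show ?thesis using eq subgpD(3)[OF V(1) _ w] subgpD(4)[OF V(1) _ w] by force
qed

text \<open>If a nonzero polynomial modulo \<open>p\<close> in \<open>ze\<close> maps \<open>u\<close> into \<open>V\<close>, then the powers of \<open>ze\<close> take only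
 finitely many values on \<open>u\<close> modulo \<open>V\<close>.\<close>

lemma zeta_torsion:
 assumes V: "sm (pw z) V" "B<=V" and u: "u:M" and P: "~ [:int p:] dvd P" "zeval P$u:V"
 shows "EX n>0. ze ^ n$u - u:V"
proof -
 have p0: "0 < int p" using prime_gt_0_nat[OF p] by simp
 note v = subgpD[OF smD(1)[OF V(1)]]
 obtain Q where Q: "[:int p:] dvd P - Q" "Q ~= 0" "0 < lead_coeff Q" "lead_coeff Q < int p"
 by (rule reduce_poly[OF p0 P(1)])
 have Qu: "zeval Q$u:V" using zeval_dvd[OF smD(1)[OF V(1)] V(2) u Q(1)] P(2) by simp
 let ?d = "degree Q"
 have "~ p dvd nat (lead_coeff Q)" using Q(3,4) by (auto dest: dvd_imp_le)
 hence "coprime p (nat (lead_coeff Q))" using p by (simp add: prime_imp_coprime)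
 hence "gcd (lead_coeff Q) (int p)=1" using Q(3) by (metis coprime_commute coprime_iff_gcd_eq_1 coprime_int_iff int_nat_eq less_imp_le)
 then obtain c e where ce: "c * lead_coeff Q + e * int p=1" using bezout_int[of "lead_coeff Q" "int p"] by auto
 \<comment> \<open>A monic version of \<open>Q\<close>: \<open>c\<close> inverts the leading
   coefficient modulo \<open>p\<close>, and the monomial, a multiple of \<open>p\<close>, corrects
   the product to exactly 1. Division with remainder then works over the integers.\<close>
 define P1 where "P1=smult c Q + monom (e * int p) ?d"
 have P1: "degree P1=?d" "lead_coeff P1=1"
 proof -
 have c: "coeff P1 ?d=1" using ce by (simp add: P1_def)
 have "degree P1<=?d" unfolding P1_def by (intro degree_add_le degree_smult_le degree_monom_le)
 thus "degree P1=?d" using c le_degree[of P1 ?d] by simp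
 thus "lead_coeff P1=1" using c by simp
 qed
 have "[:int p:] dvd P1 - smult c Q" by (auto simp: P1_def const_poly_dvd_iff)
 moreover have "zeval (smult c Q)$u:V" using of_int_app_subgp[OF smD(1)[OF V(1)] Qu] by (simp add: zeval_smult)
 ultimately have P1u: "zeval P1$u:V" using zeval_dvd[OF smD(1)[OF V(1)] V(2) u] by blast
 \<comment> \<open>Coefficient lists of remainders modulo \<open>P1\<close>, reduced modulo
   \<open>p\<close>. There are finitely many, so two powers of \<open>ze\<close> act on
   \<open>u\<close> in the same way.\<close>
 define L where "L={xs :: int list. set xs<={0..<int p}&length xs=?d}"
 have "finite L" unfolding L_def by (rule finite_lists_length_eq) simp
 have "EX xs:L. ze ^ i$u - zeval (Poly xs)$u:V" for i
 proof -
 define q r where "q=fst (pseudo_divmod (monom 1 i) P1)" and "r=snd (pseudo_divmod (monom 1 i) P1)"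
 have qr: "monom 1 i=P1 * q + r" "r=0 | degree r < ?d"
 proof -
 have "P1 ~= 0" using P1(2) by auto
 thus "monom 1 i=P1 * q + r" "r=0 | degree r < ?d"
 using pseudo_divmod[of P1 "monom 1 i" q r] P1 by (auto simp: q_def r_def)
 qed
 define xs where "xs=map (%j. coeff r j mod int p) [0..<?d]"
 have xs: "xs:L" using p0 by (auto simp: L_def xs_def)
 have r0: "coeff r j=0" if "~ j < ?d" for j using qr(2) that coeff_eq_0[of r j] by auto
 have "[:int p:] dvd r - Poly xs"
 unfolding const_poly_dvd_iff using r0 by (auto simp: xs_def nth_default_def minus_mod_eq_mult_div)
 hence "[:int p:] dvd (r - Poly xs) - 0" by simp
 hence "zeval (r - Poly xs)$u:V" using zeval_dvd[OF smD(1)[OF V(1)] V(2) u] v(1) by (metis zero_app zeval_0)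
 moreover have "zeval q$zeval P1$u:V" by (rule zeta_stable(3)[OF V(1) P1u])
 moreover have "zeval (P1 * q)=zeval q * zeval P1" by (metis mult.commute zeval_mult)
 ultimately have "zeval (P1 * q)$u + zeval (r - Poly xs)$u:V" using v(3) by simp
 moreover have "ze ^ i=zeval (P1 * q) + zeval r" by (metis qr(1) zeval_add zeval_monom)
 ultimately have "ze ^ i$u - zeval (Poly xs)$u:V" by (simp add: zeval_diff plus_app minus_app add_diff_eq)
 thus ?thesis using xs by blast
 qed
 then obtain x where x: "!!i. x i:L" "!!i. ze ^ i$u - zeval (Poly (x i))$u:V" by metis
 have "~ inj_on x UNIV"
 using `finite L` x(1) infinite_UNIV_nat finite_imageD finite_subset[of "range x" L] by blast
 then obtain i j where ij: "i < j" "x i=x j" unfolding inj_on_def by (metis nat_neq_iff)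
 have "(ze ^ j$u - zeval (Poly (x j))$u) - (ze ^ i$u - zeval (Poly (x i))$u):V" by (intro v(4) x(2))
 moreover have "ze ^ j$u=ze ^ i$ze ^ (j - i)$u" using ij(1) by (simp flip: times_app power_add)
 ultimately have "ze ^ i$(ze ^ (j - i)$u - u):V" using ij(2) by (simp add: app_diff)
 thus ?thesis using zeta_stable(2)[OF V(1)] ij(1) by (intro exI[of _ "j - i"]) auto
qed

text \<open>Elements of \<open>pw z\<close> act as powers of \<open>z\<close> modulo
  \<open>B\<close>; the negative ones are cleared by \<open>ze^k\<close>.\<close>

lemma span_zeta:
 assumes V: "sm (pw z) V" "B<=V" "V<=M" and u: "u:M" and x: "x:ssum (span (pw z) {u}) V"
 shows "EX k P. ze ^ k$x - zeval P$u:V"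
proof -
 note v = subgpD[OF smD(1)[OF V(1)]]
 let ?S = "{x\<in>M. EX k P. ze ^ k$x - zeval P$u:V}"
 have pz: "subgroup (pw z) G" "pw z<=H" using pw[OF z z_cp] by blast+
 have pc: "g:carrier G" if "g:pw z" for g using that pz Hc by blast
 have up: "ze ^ (j + k)$x - zeval (monom 1 j * P)$u:V" if "ze ^ k$x - zeval P$u:V" for j k x P
 using zeta_stable(1)[OF V(1) that, of j] by (simp add: zeval_mult zeval_monom app_diff power_add)
 have "sm (pw z) ?S" unfolding sm_def subgp_def
 proof (intro conjI ballI)
 show "0:?S" using v(1) m(1) by (auto intro!: exI[of _ 0])
 fix x assume x: "x:?S"
 then obtain k P where kP: "ze ^ k$x - zeval P$u:V" "x:M" by blast
 show "x - y:?S" if y: "y:?S" for y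
 proof -
 obtain j Q where jQ: "ze ^ j$y - zeval Q$u:V" "y:M" using y by blast
 have "(ze ^ (j + k)$x - zeval (monom 1 j * P)$u) - (ze ^ (k + j)$y - zeval (monom 1 k * Q)$u):V"
 using v(4)[OF up[OF kP(1)] up[OF jQ(1)]] .
 hence "ze ^ (j + k)$(x - y) - zeval (monom 1 j * P - monom 1 k * Q)$u:V"
 by (simp add: add.commute app_diff zeval_diff minus_app algebra_simps)
 thus ?thesis using m(4) kP jQ by blast
 qed
 fix g assume g: "g:pw z"
 then obtain i :: int where i: "E g =~ E (z [^] i)" by (auto simp: pw_def)
 have gM: "E g$x:M" using smD(2)[OF M pc[OF g] kP(2)] .
 have gx: "ze ^ l$(E g$x - E (z [^] i)$x):V" for l
 by (rule zeta_stable(1)[OF V(1)]) (use i kP(2) V(2) in "auto simp: eqm_def")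
 show "E g$x:?S"
 proof (cases i rule: int_cases2)
 case (nonneg n)
 have "ze ^ (n + k)$x=ze ^ k$E (z [^] i)$x"
 by (simp add: nonneg zeta_pow add.commute int_pow_int power_add flip: times_app zeta_pow)
 hence "ze ^ k$E g$x - zeval (monom 1 n * P)$u:V"
 using v(3)[OF gx[of k] up[OF kP(1), of n]] by (simp add: app_diff)
 thus ?thesis using gM by blast
 next
 case (nonpos n)
 have "ze ^ (k + n)$E (z [^] i)$x=ze ^ k$x"
 using zc by (simp add: nonpos power_add int_pow_neg_int zeta_pow)
 hence "ze ^ (k + n)$E g$x - zeval P$u:V"
 using v(3)[OF gx[of "k + n"] kP(1)] by (simp add: app_diff)
 thus ?thesis using gM by blast
 qed
 qed
 moreover have "ze ^ 0$u - zeval 1$u:V" using v(1) by (simp add: one_pCons)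
 hence "u:?S" using u by blast
 ultimately have "span (pw z) {u}<=?S" by (intro span_least) auto
 then obtain a r k P where ar: "x=a + r" "r:V" "ze ^ k$a - zeval P$u:V"
 using x unfolding ssum_def by blast
 have "(ze ^ k$a - zeval P$u) + ze ^ k$r:V" by (rule v(3)[OF ar(3) zeta_stable(1)[OF V(1) ar(2)]])
 thus ?thesis using ar(1) by (intro exI[of _ k] exI[of _ P]) (simp add: app_add algebra_simps)
qed
end

context central_element_char
begin

text \<open>The domain is the Laurent polynomial ring over the field with \<open>p\<close> elements.
  Each nonzero element divides some \<open>X^n - 1\<close>, so the operators \<open>ze^n - 1\<close>
  suffice as scalars. If \<open>ze^n\<close> fixes \<open>u\<close> modulo \<open>V\<close>, take a
  prime \<open>l\<close> that does not divide \<open>n\<close> and differs from \<open>p\<close>: an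
  \<open>x\<close> killed by \<open>geom l\<close> is fixed by \<open>ze^l\<close> and
  \<open>ze^n\<close>, hence by \<open>ze\<close>, so \<open>l x\<close> and \<open>p x\<close>
  vanish and with them \<open>x\<close>. If no \<open>ze^n\<close> fixes \<open>u\<close>, the
  cyclic module is free and \<open>geom l\<close> is injective but no unit.\<close>

lemma finite_rank_char_p: "finite_rank_over z (%n. ze ^ n - 1)"
proof -
 let ?s = "%n. ze ^ n - 1" and ?f = "%l. zeval (geom l)"
 have s: "?s n$u=ze ^ n$u - u" for n u by (simp add: minus_app)
 have z_cp': "cp (?s n)" for n by (intro cp_diff cp_zeta_power cp_1)
 have fs: "(ze - 1) * ?f l=?s l" for l
 proof (induction l)
 case (Suc l)
 have "?f (Suc l)=?f l + ze ^ l" by (simp add: zeval_geom)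
 hence "(ze - 1) * ?f (Suc l)=?s l + (ze - 1) * ze ^ l" using Suc.IH by (simp add: distrib_left)
 thus ?case by (simp add: left_diff_distrib)
 qed (simp add: zeval_geom)
 have pt: "of_nat p$v:B" if "v:M" for v using char that by (simp add: eqm_0_app)
 interpret S: scalars G E A M R H B "pw z" ?s
 proof (intro scalars.intro module_action_axioms scalars_axioms.intro H B pw[OF z z_cp])
 show "?s n$u:U" if "sm (pw z) U" "u:U" for n u U
 unfolding s using zeta_stable(1)[OF that] subgpD(4)[OF smD(1)[OF that(1)]] that(2) by blast
 show "?s n$E h$v - E h$?s n$v:B" if "h:H" "v:M" for h n v
 using cp_comm[OF z_cp' that(1)] that(2) by (simp add: eqm_def)
 show mult: "?s (m * n)$u:V" if V: "sm (pw z) V" and u: "?s n$u:V" for m n u V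
 proof -
 note v = subgpD[OF smD(1)[OF V]]
 have "ze ^ (n * m)$u - (u + of_nat m$(ze ^ n$u - u)):V" "of_nat m$(ze ^ n$u - u):V"
 using zeta_pow_cong[OF V] of_nat_app_subgp[OF smD(1)[OF V]] u by (simp_all add: s)
 from v(3)[OF this] show ?thesis by (simp add: s mult.commute)
 qed
 show "EX l>0. ?s l$u:V"
 if V: "sm (pw z) V" "B<=V" "V<=M" and u: "u:M" and mn: "0 < m" "0 < n" "?s m$?s n$u:V" for m n u V
 proof -
 let ?q = "m * n"
 note v = subgpD[OF smD(1)[OF V(1)]]
 have c: "?s i$?s j$w=?s j$?s i$w" for i j w
 proof -
 have "?s i * ?s j=?s j * ?s i"
 by (simp add: left_diff_distrib right_diff_distrib add.commute flip: power_add)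
 thus ?thesis by (metis times_app)
 qed
 have "?s (n * m)$?s n$u:V" by (rule mult[OF V(1) mn(3)])
 hence "?s n$?s ?q$u:V" by (simp add: c[of n] mult.commute)
 hence "?s ?q$?s ?q$u:V" by (rule mult[OF V(1)])
 hence q: "ze ^ ?q$(ze ^ ?q$u - u) - (ze ^ ?q$u - u):V" by (simp add: s)
 let ?W = "{w\<in>M. ze ^ ?q$w - w:V}" and ?d = "ze ^ ?q$u - u"
 \<comment> \<open>Modulo \<open>V\<close>, \<open>ze^?q\<close> fixes the difference
   \<open>?d\<close>, so its powers move \<open>u\<close> linearly in the exponent \<open>i\<close>;
   at \<open>i = p\<close> the displacement vanishes.\<close>
 have zq: "ze ^ (?q * i)$u - (u + of_nat i$?d):V" for i
 proof (induction i)
 case 0 thus ?case using v(1) by simp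
 next
 case (Suc i)
 have "ze ^ ?q$(ze ^ (?q * i)$u - (u + of_nat i$?d)):V" by (rule zeta_stable(1)[OF V(1) Suc.IH])
 moreover have "of_nat i$(ze ^ ?q$?d - ?d):V" by (rule of_nat_app_subgp[OF smD(1)[OF V(1)] q])
 ultimately have "ze ^ ?q$(ze ^ (?q * i)$u - (u + of_nat i$?d)) + of_nat i$(ze ^ ?q$?d - ?d):V"
 by (rule v(3))
 moreover have "ze ^ ?q$of_nat i$?d = of_nat i$ze ^ ?q$?d" by (metis mult_of_nat_commute times_app)
 moreover have "ze ^ (?q * Suc i)$u=ze ^ ?q$ze ^ (?q * i)$u" by (simp add: power_add)
 ultimately show ?case by (simp add: app_diff app_add plus_app algebra_simps)
 qed
 have "?d:M" using u cp_zeta_power m(4) by (simp add: cp_iff pres_def)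
 hence "of_nat p$?d:V" using pt V(2) by blast
 from v(3)[OF zq[of p] this] have "?s (?q * p)$u:V" by (simp add: s)
 thus ?thesis using mn prime_gt_0_nat[OF p] by (intro exI[of _ "?q * p"]) simp
 qed
 qed
 have "EX F. finite F&(ALL l. prime l-->l ~: F-->S.generic (?f l) (ssum (span (pw z) {u}) V) V)"
 if u: "u:M" and V: "S.sbm (pw z) V" for u V
 proof -
 let ?U = "ssum (span (pw z) {u}) V"
 have Vs: "sm (pw z) V" "B<=V" "V<=M" using S.sbmD[OF V] by blast+
 note v = subgpD[OF smD(1)[OF Vs(1)]]
 have uU: "u:?U" using ssum_ub(1)[OF smD(1)[OF sm_span] S.sbmD(4)[OF V]] span_ub[of "{u}"] by blast
 have UU: "S.sbm (pw z) ?U" by (rule S.sbm_span_ssum[OF pw(3)[OF z z_cp] _ V]) (use u in simp)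
 have UM: "?U<=M" by (rule S.sbmD(3)[OF UU])
 have frk: "S.frk ?U V" unfolding S.frk_def
 proof (intro exI[of _ "{u}"] conjI ballI)
 fix w assume "w:?U"
 hence "?s 1$w:?U" by (rule S.s_sub[OF S.sbmD(1-3)[OF UU]])
 thus "EX n>0. ?s n$w:?U" by (rule exI[of _ 1, OF conjI, rotated]) simp
 qed (use uU in auto)
 show ?thesis
 proof (cases "EX n>0. ze ^ n$u - u:V")
 case True
 then obtain n where n: "n > 0" "ze ^ n$u - u:V" by blast
 have nU: "ze ^ n$x - x:V" if x: "x:?U" for x
 proof -
 obtain k P where kP: "ze ^ k$x - zeval P$u:V" using span_zeta[OF Vs u x] by blast
 let ?r = "ze ^ k$x - zeval P$u" and ?n = "monom 1 n :: int poly"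
 have "zeval P$(ze ^ n$u - u):V" by (rule zeta_stable(3)[OF Vs(1) n(2)])
 moreover have "ze ^ n$?r - ?r:V" using v(4) zeta_stable(1)[OF Vs(1) kP] kP by blast
 ultimately have "(ze ^ n$?r - ?r) + zeval P$(ze ^ n$u - u):V" by (intro v(3))
 moreover have "ze ^ n$zeval P$u=zeval P$ze ^ n$u"
 unfolding zeval_monom[symmetric] times_app[symmetric] zeval_mult[symmetric] by (simp add: mult.commute)
 moreover have "ze ^ n$ze ^ k$x=ze ^ k$ze ^ n$x" by (metis add.commute power_add times_app)
 ultimately have "ze ^ k$(ze ^ n$x - x):V" by (simp add: app_diff algebra_simps)
 thus ?thesis by (rule zeta_stable(2)[OF Vs(1)])
 qed
 have "S.generic (?f l) ?U V" if l: "prime l" "~ l dvd n" "l ~= p" for l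
 proof -
 have "x:V" if x: "x:?U" "?f l$x:V" for x
 proof -
 have "zeval [:-1, 1:]=ze - 1" by simp
 hence 1: "ze ^ l$x - x:V"
 using zeta_stable(3)[OF Vs(1) x(2), of "[:-1, 1:]"] unfolding s[symmetric] fs[symmetric] by simp
 have "coprime l n" using l by (simp add: prime_imp_coprime)
 then obtain i j where ij: "l * i=n * j + 1" using bezout_nat[of l n] prime_gt_0_nat[OF l(1)] by auto
 have pw1: "ze ^ (e * i)$x - x:V" if "ze ^ e$x - x:V" for e i
 using v(3)[OF zeta_pow_cong[OF Vs(1) that, of i] of_nat_app_subgp[OF smD(1)[OF Vs(1)] that, of i]] by simp
 have "ze$(ze ^ (n * j)$x - x):V" using zeta_stable(1)[OF Vs(1) pw1[OF nU[OF x(1)]], of 1] by simp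
 hence "ze ^ (l * i)$x - ze$x:V" by (simp add: ij app_diff)
 hence "(ze ^ (l * i)$x - x) - (ze ^ (l * i)$x - ze$x):V" using pw1[OF 1] v(4) by blast
 hence zx: "ze ^ 1$x - x:V" by simp
 have "(SUM i<l. ze ^ i$x - x):V" using pw1[OF zx] by (intro subgp_sum[OF smD(1)[OF Vs(1)]]) simp
 moreover have "(SUM i<k. x) = of_nat k$x" for k by (induction k) (simp_all add: plus_app)
 ultimately have "?f l$x - of_nat l$x:V"
 by (simp add: zeval_geom sum_app sum_subtractf del: sum_constant)
 hence lx: "of_nat l$x:V" using v(4)[OF x(2)] by force
 have "coprime l p" using l p by (simp add: primes_coprime)
 hence "gcd (int l) (int p)=1" by simp
 then obtain i j :: int where ij: "i * int l + j * int p=1" using bezout_int[of "int l" "int p"] by auto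
 have "of_nat p$x:V" using pt x UM Vs(2) by blast
 hence "of_int i$of_nat l$x + of_int j$of_nat p$x:V"
 using of_int_app_subgp[OF smD(1)[OF Vs(1)]] lx v(3) by blast
 moreover have "of_int i * of_nat l + of_int j * of_nat p=(1 :: 'b endo)"
 using arg_cong[OF ij, of "of_int :: int => 'b endo"] by simp
 ultimately show ?thesis by (metis one_app plus_app times_app)
 qed
 thus ?thesis using frk n nU by (auto simp: S.generic_def S.tors_def s)
 qed
 thus ?thesis using n by (intro exI[of _ "insert p {l. l dvd n}"]) auto
 next
 case False
 have pd: "[:int p:] dvd P" if "zeval P$u:V" for P
 using zeta_torsion[OF Vs(1,2) u _ that] False by blast
 have "S.generic (?f l) ?U V" if l: "prime l" for l
 proof -
 have l1: "1 < l" using prime_gt_1_nat[OF l] .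
 have fx: "zeval (monom 1 k * Q - geom l * P)$u:V"
 if "zeval Q$u - ?f l$x:V" "ze ^ k$x - zeval P$u:V" for x k P Q
 proof -
 have "ze ^ k$(zeval Q$u - ?f l$x) + ?f l$(ze ^ k$x - zeval P$u):V"
 using v(3)[OF zeta_stable(1)[OF Vs(1) that(1)] zeta_stable(3)[OF Vs(1) that(2)]] .
 moreover have "ze ^ k$?f l$x=?f l$ze ^ k$x"
 unfolding zeval_monom[symmetric] times_app[symmetric] zeval_mult[symmetric] by (simp add: mult.commute)
 ultimately show ?thesis by (simp add: app_diff zeval_diff zeval_mult zeval_monom minus_app)
 qed
 have "x:V" if x: "x:?U" "?f l$x:V" for x
 proof -
 obtain k P where kP: "ze ^ k$x - zeval P$u:V" using span_zeta[OF Vs u x(1)] by blast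
 have "zeval 0$u - ?f l$x:V" using v(2)[OF x(2)] by simp
 from pd[OF fx[OF this kP]] have "[:int p:] dvd geom l * P" by simp
 moreover have "prime_elem [:int p:]" using p prime_elem_const_poly_iff[of "int p"] by simp
 ultimately have "[:int p:] dvd geom l | [:int p:] dvd P" by (simp add: prime_elem_dvd_mult_iff)
 moreover have "~ [:int p:] dvd geom l"
 unfolding const_poly_dvd_iff using l1 prime_gt_1_nat[OF p] by (auto simp: coeff_geom intro!: exI[of _ 0])
 ultimately have "[:int p:] dvd P - 0" by simp
 hence "zeval P$u:V" using zeval_dvd[OF smD(1)[OF Vs(1)] Vs(2) u] v(1) by (metis zero_app zeval_0)
 from v(3)[OF kP this] have "ze ^ k$x:V" by simp
 thus ?thesis by (rule zeta_stable(2)[OF Vs(1)])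
 qed
 moreover have "u - ?f l$x ~: V" if x: "x:?U" for x
 proof
 assume "u - ?f l$x:V"
 hence 1: "zeval 1$u - ?f l$x:V" by (simp add: one_pCons)
 obtain k P where kP: "ze ^ k$x - zeval P$u:V" using span_zeta[OF Vs u x] by blast
 show False using pd[OF fx[OF 1 kP]] geom_nonunit[of "int p" l k P] prime_gt_1_nat[OF p] l1 by simp
 qed
 ultimately show ?thesis using frk uU unfolding S.generic_def by blast
 qed
 thus ?thesis by blast
 qed
 qed
 moreover have "cp (?f l)" for l unfolding zeval_geom by (intro cp_sum cp_zeta_power)
 moreover have f_nz: "~ ?f l =~ 0" if "prime l" for l
 proof
 assume "?f l =~ 0"
 hence "(ze - 1) * ?f l =~ (ze - 1) * 0" using z_cp cp_pres by (intro eqm_mult_left pres_diff) auto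
 thus False unfolding fs using z_inf[OF prime_gt_0_nat[OF that]] by (simp add: eqm_diff_0)
 qed
 ultimately have "EX Xs. finite Xs&Xs<=M&(ALL u:M. EX n>0. ?s n$u:ssum (span (pw z) Xs) B)"
 proof (intro finite_rank[OF z z_cp S.scalars_axioms, of ?f])
 show "?f l$u:V" if "S.sbm (pw z) V" "u:V" for l V u using zeta_stable(3)[OF S.sbmD(1)] that by blast
 show "EX q>0. ALL v:M. of_nat q$v:ssum (($) (?f l) ` M) B" for l
 proof (intro exI[of _ p] conjI ballI)
 fix v assume v: "v:M"
 have "?f l$0 + of_nat p$v:ssum (($) (?f l) ` M) B" by (intro ssumI imageI m(1) pt[OF v])
 thus "of_nat p$v:ssum (($) (?f l) ` M) B" by simp
 qed (rule prime_gt_0_nat[OF p])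
 qed auto
 moreover have "?s n * fi =~ fi * ?s n" if "cp fi" for n fi
 proof -
 have "z [^] n:H" using subgroup_closed(6)[OF sH] z by blast
 hence "ze ^ n * fi - fi =~ fi * ze ^ n - fi"
 using cp_comm[OF that] eqm_sym unfolding zeta_pow by (intro eqm_diff) auto
 thus ?thesis by (simp add: left_diff_distrib right_diff_distrib)
 qed
 ultimately show ?thesis unfolding finite_rank_over_def using z z_cp z_cp' z_inf by (auto simp: eqm_diff_0)
qed
end

section \<open>Algebraic relations over central operators, and central commutators\<close>

context central_element
begin

text \<open>\<open>W k\<close> collects the elements that some multiplier carries into the
  combinations of \<open>a, x a, ..., x^(k-1) a\<close> modulo \<open>B\<close>. The traces of these
  modules on a finitely generated span become stationary. A multiple of \<open>x^K a\<close> lies in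
  that span modulo \<open>B\<close>, hence in \<open>W K\<close>, and this is the relation.\<close>

lemma relation_at:
 assumes fr: "finite_rank_over w s" and x: "x:H" and a: "a:M"
 obtains k c where "!!i. cp (c i)" "~ c k =~ 0" "(SUM i<=k. c i * E x ^ i)$a:B"
proof -
 have w: "w:H" "cp (E w)" and s: "!!n. cp (s n)" "!!n. n > 0==>~ s n =~ 0"
 "!!n fi. cp fi==>s n * fi =~ fi * s n" using fr by (auto simp: finite_rank_over_def)
 obtain Xs where Xs: "finite Xs" "Xs<=M" "!!u. u:M==>EX n>0. s n$u:ssum (span (pw w) Xs) B"
 using fr by (auto simp: finite_rank_over_def)
 let ?N = "pw w"
 note N = pw[OF w]
 \<comment> \<open>Multipliers must commute with all central operators, besides \<open>H\<close>, so
   that two of them can be exchanged when fractions are subtracted in \<open>W k\<close>.\<close>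
 define ce where "ce c \<longleftrightarrow> cp c&~ c =~ 0&(ALL fi. cp fi-->c * fi =~ fi * c)" for c
 define W where "W k={u\<in>M. EX c d. ce c&(ALL i. cp (d i))&c$u - (SUM i<k. d i * E x ^ i)$a:B}" for k
 have WI: "u:W k" if "u:M" "ce c" "!!i. cp (d i)" "c$u - (SUM i<k. d i * E x ^ i)$a:B" for u k c d
 using that unfolding W_def by blast
 have presx: "pres (E x ^ i)" for i using pres_E[OF x] by (induction i) (auto intro: pres_mult)
 have xi: "E x ^ i$a:M" for i using presx a by (auto simp: pres_def)
 have smW: "sm ?N (W k)" for k unfolding sm_def subgp_def
 proof (intro conjI ballI)
 show "0:W k" using m(1) b(1) one_not_0
 by (intro WI[where c = 1 and d = "%_. 0"]) (auto simp: ce_def)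
 fix u assume u: "u:W k"
 then obtain c d where c: "u:M" "ce c" "!!i. cp (d i)" "c$u - (SUM i<k. d i * E x ^ i)$a:B"
 by (auto simp: W_def)
 show "u - v:W k" if v: "v:W k" for v
 proof -
 obtain c' d' where c': "v:M" "ce c'" "!!i. cp (d' i)" "c'$v - (SUM i<k. d' i * E x ^ i)$a:B"
 using v by (auto simp: W_def)
 have cc: "ce (c' * c)" unfolding ce_def
 proof (intro conjI allI impI)
 have "cp c" "cp c'" "~ c =~ 0" "~ c' =~ 0" using c c' by (auto simp: ce_def)
 thus "cp (c' * c)" "~ c' * c =~ 0" using cp_mult cp_mult_nz by blast+
 fix fi assume fi: "cp fi"
 have "c' * (c * fi) =~ c' * (fi * c)" "c' * fi * c =~ fi * c' * c"
 using c c' fi by (auto simp: ce_def intro!: eqm_mult_left eqm_mult_right cp_pres)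
 thus "c' * c * fi =~ fi * (c' * c)" by (metis eqm_trans mult.assoc)
 qed
 have pc: "pres c" "pres c'" using c c' by (auto simp: ce_def cp_pres)
 have 1: "(c' * c)$v - (c * c')$v:B" using c(2) c'(1,2) by (auto simp: ce_def eqm_def)
 define D D' where "D=(SUM i<k. d i * E x ^ i)" and "D'=(SUM i<k. d' i * E x ^ i)"
 have 2: "c'$(c$u - D$a):B" "c$(c'$v - D'$a):B"
 using pc c(4) c'(4) by (auto simp: pres_def D_def D'_def)
 have "c'$(c$u - D$a) - c$(c'$v - D'$a) - ((c' * c)$v - (c * c')$v):B"
 by (rule b(4)[OF b(4)[OF 2] 1])
 hence "(c' * c)$(u - v) - (c' * D - c * D')$a:B" by (simp add: app_diff minus_app algebra_simps)
 moreover have "(SUM i<k. (c' * d i - c * d' i) * E x ^ i)=c' * D - c * D'"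
 by (simp add: sum_subtractf left_diff_distrib sum_distrib_left mult.assoc D_def D'_def)
 ultimately have "(c' * c)$(u - v) - (SUM i<k. (c' * d i - c * d' i) * E x ^ i)$a:B" by simp
 moreover have "cp (c' * d i - c * d' i)" for i using c c' by (auto simp: ce_def intro: cp_mult cp_diff)
 moreover have "u - v:M" using m(4) c c' by blast
 ultimately show ?thesis using cc by (intro WI[where c = "c' * c" and d = "%i. c' * d i - c * d' i"])
 qed
 fix g assume g: "g:?N"
 have gH: "g:H" using N(3) g by blast
 have "E g$(c$u - (SUM i<k. d i * E x ^ i)$a):B" using pres_E[OF gH] c(4) by (auto simp: pres_def)
 moreover have "c$E g$u - E g$c$u:B" using cp_comm[OF _ gH, of c] c(1,2) by (auto simp: ce_def eqm_def)
 ultimately have "(c$E g$u - E g$c$u) + E g$(c$u - (SUM i<k. d i * E x ^ i)$a):B" by (intro b(3))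
 moreover have "(SUM i<k. (E g * d i) * E x ^ i)=E g * (SUM i<k. d i * E x ^ i)" by (simp add: sum_distrib_left mult.assoc)
 ultimately have "c$E g$u - (SUM i<k. (E g * d i) * E x ^ i)$a:B" by (simp add: app_diff)
 moreover have "cp (E g * d i)" for i using c N(5)[OF g] by (intro cp_mult)
 moreover have "E g$u:M" using pres_E[OF gH] c(1) by (auto simp: pres_def)
 ultimately show "E g$u:W k" using c(2) by (intro WI[where c = c and d = "%i. E g * d i"])
 qed
 have WS: "W k<=W (Suc k)" for k
 proof
 fix u assume "u:W k"
 then obtain c d where c: "u:M" "ce c" "!!i. cp (d i)" "c$u - (SUM i<k. d i * E x ^ i)$a:B"
 by (auto simp: W_def)
 have "(SUM i<Suc k. (if i < k then d i else 0) * E x ^ i)=(SUM i<k. d i * E x ^ i)" by simp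
 moreover have "cp (if i < k then d i else 0)" for i using c by simp
 ultimately show "u:W (Suc k)" using c by (intro WI[where c = c and d = "%i. if i < k then d i else 0"]) auto
 qed
 have "EX K. ALL k. W k Int span ?N Xs<=W K Int span ?N Xs"
 by (rule noeth_chain[of ?N Xs "%k. W k Int span ?N Xs"])
 (use adm_noeth[OF H N(1-3)] Xs(1) sm_inter[OF smW sm_span] WS in auto)
 then obtain K where K: "W (Suc K) Int span ?N Xs<=W K" by blast
 obtain n where n: "n > 0" "s n$E x ^ K$a:ssum (span ?N Xs) B" using Xs(3)[OF xi] by blast
 then obtain q r where qr: "s n$E x ^ K$a=q + r" "q:span ?N Xs" "r:B" unfolding ssum_def by blast
 have "span ?N Xs<=M" by (rule span_least[OF sm_mono[OF M_sm N(3)] Xs(2)])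
 moreover have "(SUM i<Suc K. (if i=K then s n else 0) * E x ^ i)$a=q + r" using qr(1) by simp
 hence "1$q - (SUM i<Suc K. (if i=K then s n else 0) * E x ^ i)$a:B" using b(2)[OF qr(3)] by simp
 moreover have "ce 1" using one_not_0 by (simp add: ce_def)
 moreover have "cp (if i=K then s n else 0)" for i using s(1) by simp
 ultimately have "q:W (Suc K)" using qr(2)
 by (intro WI[where c = 1 and d = "%i. if i=K then s n else 0"]) auto
 hence "q:W K" using K qr(2) by blast
 then obtain c d where c: "ce c" "!!i. cp (d i)" "c$q - (SUM i<K. d i * E x ^ i)$a:B" by (auto simp: W_def)
 show ?thesis
 proof (rule that[of "%i. if i < K then - d i else c * s n" K])
 have cs: "cp (c * s n)" using c(1) s(1) by (auto simp: ce_def intro: cp_mult)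
 have "cp (- d i)" for i using cp_diff[OF cp_0 c(2)[of i]] by simp
 thus "cp (if i < K then - d i else c * s n)" for i using cs by simp
 have "~ c * s n =~ 0" using c(1) s(1)[of n] s(2)[OF n(1)] unfolding ce_def by (intro cp_mult_nz) blast+
 thus "~ (if K < K then - d K else c * s n) =~ 0" by simp
 have "c$r:B" using c(1) qr(3) by (auto simp: ce_def cp_iff pres_def)
 hence "(c$q - (SUM i<K. d i * E x ^ i)$a) + c$r:B" by (rule b(3)[OF c(3)])
 hence "(c * s n * E x ^ K - (SUM i<K. d i * E x ^ i))$a:B"
 by (simp add: minus_app qr(1) app_add algebra_simps)
 moreover have "(SUM i<=K. (if i < K then - d i else c * s n) * E x ^ i)=c * s n * E x ^ K - (SUM i<K. d i * E x ^ i)"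
 by (simp add: sum_negf flip: lessThan_Suc_atMost)
 ultimately show "(SUM i<=K. (if i < K then - d i else c * s n) * E x ^ i)$a:B" by simp
 qed
qed

text \<open>The coefficients commute with \<open>x\<close> modulo \<open>B\<close>, so relations
  multiply like polynomials; the leading coefficient stays nonzero since central operators have no
  zero divisors.\<close>

lemma relation_mult:
 assumes x: "x:H" and c: "!!i. cp (c i)" "~ c k =~ 0" and d: "!!i. cp (d i)" "~ d l =~ 0"
 obtains e where "!!i. cp (e i)" "~ e (k + l) =~ 0"
 "(SUM i<=k + l. e i * E x ^ i) =~ (SUM i<=k. c i * E x ^ i) * (SUM i<=l. d i * E x ^ i)"
proof (rule that[of "%n. \<Sum>(i, j) | (i, j):{..k} \<times> {..l}&i + j=n. c i * d j"])
 have presx: "pres (E x ^ i)" for i using pres_E[OF x] by (induction i) (auto intro: pres_mult)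
 show "cp (\<Sum>(i, j) | (i, j):{..k} \<times> {..l}&i + j=n. c i * d j)" for n
 using c d by (intro cp_sum) (auto intro: cp_mult)
 have "{(i, j). (i, j):{..k} \<times> {..l}&i + j=k + l}={(k, l)}" by auto
 thus "~ (\<Sum>(i, j) | (i, j):{..k} \<times> {..l}&i + j=k + l. c i * d j) =~ 0"
 using cp_mult_nz c d by simp
 have xd: "E x ^ i * d j =~ d j * E x ^ i" for i j
 proof (induction i)
 case (Suc i)
 have "E x * (E x ^ i * d j) =~ E x * (d j * E x ^ i)" by (rule eqm_mult_left[OF pres_E[OF x] Suc.IH])
 also have "\<dots> =~ d j * E x * E x ^ i"
 using eqm_mult_right[OF eqm_sym[OF cp_comm[OF d(1) x]] presx] by (simp add: mult.assoc)
 finally show ?case by (simp add: mult.assoc)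
 qed simp
 have "(SUM n<=k + l. (\<Sum>(i, j) | (i, j):{..k} \<times> {..l}&i + j=n. c i * d j) * E x ^ n)
=(SUM n<=k + l. \<Sum>(i, j) | (i, j):{..k} \<times> {..l}&i + j=n. c i * d j * E x ^ (i + j))"
 by (auto simp: sum_distrib_right intro!: sum.cong)
 also have "\<dots>=(\<Sum>(i, j)\<in>{..k} \<times> {..l}. c i * d j * E x ^ (i + j))"
 proof -
 have "(%(i, j). i + j) ` ({..k} \<times> {..l})<={..k + l}" by auto
 from sum.group[OF _ _ this, of "%(i, j). c i * d j * E x ^ (i + j)"] show ?thesis
 by (simp add: case_prod_unfold mem_Times_iff)
 qed
 also have "\<dots> =~ (\<Sum>(i, j)\<in>{..k} \<times> {..l}. (c i * E x ^ i) * (d j * E x ^ j))"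
 proof (rule eqm_sum, clarify)
 fix i j
 have "c i * (d j * E x ^ i * E x ^ j) =~ c i * (E x ^ i * d j * E x ^ j)"
 using xd c presx by (intro eqm_mult_left eqm_mult_right) (auto intro: cp_pres eqm_sym)
 thus "c i * d j * E x ^ (i + j) =~ c i * E x ^ i * (d j * E x ^ j)" by (simp add: mult.assoc power_add)
 qed
 also have "\<dots>=(SUM i<=k. c i * E x ^ i) * (SUM i<=l. d i * E x ^ i)"
 by (simp add: sum_product sum.cartesian_product)
 finally show "(SUM n<=k + l. (\<Sum>(i, j) | (i, j):{..k} \<times> {..l}&i + j=n. c i * d j) * E x ^ n)
 =~ (SUM i<=k. c i * E x ^ i) * (SUM i<=l. d i * E x ^ i)" .
qed

text \<open>Relations for the finitely many generators are multiplied together. The resulting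
  operator commutes with \<open>pw w\<close> and with the denominators \<open>s n\<close>; the
  latter are injective, so it vanishes on all of \<open>M / B\<close>.\<close>

lemma relation_all:
 assumes fr: "finite_rank_over w s" and x: "x:H"
 obtains k c where "!!i. cp (c i)" "~ c k =~ 0" "(SUM i<=k. c i * E x ^ i) =~ 0"
proof -
 have w: "w:H" "cp (E w)" and s: "!!n. cp (s n)" "!!n. n > 0==>~ s n =~ 0"
 "!!n fi. cp fi==>s n * fi =~ fi * s n" using fr by (auto simp: finite_rank_over_def)
 obtain Xs where Xs: "finite Xs" "Xs<=M" "!!u. u:M==>EX n>0. s n$u:ssum (span (pw w) Xs) B"
 using fr by (auto simp: finite_rank_over_def)
 have presx: "pres (E x ^ i)" for i using pres_E[OF x] by (induction i) (auto intro: pres_mult)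
 have presP: "pres (SUM i<=k. c i * E x ^ i)" if "!!i. cp (c i)" for k c
 using that by (intro pres_sum pres_mult presx) (auto intro: cp_pres)
 have "EX k c. (ALL i. cp (c i))&~ c k =~ 0&(ALL a:Xs. (SUM i<=k. c i * E x ^ i)$a:B)"
 using Xs(1,2)
 proof (induction Xs rule: finite_induct)
 case empty
 show ?case using one_not_0 by (intro exI[of _ 0] exI[of _ "%_. 1"]) auto
 next
 case (insert a Xs)
 have "Xs<=M" using insert.prems by blast
 from insert.IH[OF this] obtain k c where c: "!!i. cp (c i)" "~ c k =~ 0"
 "!!a. a:Xs==>(SUM i<=k. c i * E x ^ i)$a:B" by (elim exE conjE) blast
 let ?P = "SUM i<=k. c i * E x ^ i"
 have "?P$a:M" using presP[where c = c and k = k, OF c(1)] insert.prems by (auto simp: pres_def)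
 then obtain l d where d: "!!i. cp (d i)" "~ d l =~ 0" "(SUM i<=l. d i * E x ^ i)$?P$a:B"
 by (rule relation_at[OF fr x]) (rule that, assumption+)
 let ?Q = "SUM i<=l. d i * E x ^ i"
 obtain e where e: "!!i. cp (e i)" "~ e (l + k) =~ 0" "(SUM i<=l + k. e i * E x ^ i) =~ ?Q * ?P"
 by (rule relation_mult[of x d l c k, OF x d(1,2) c(1,2)]) (rule that, assumption+)
 have "(SUM i<=l + k. e i * E x ^ i)$v:B" if v: "v:insert a Xs" for v
 proof -
 have "v:M" using v insert.prems by blast
 moreover have "?Q$?P$v:B" using v d(3) c(3) presP[where c = d and k = l, OF d(1)] unfolding pres_def by blast
 ultimately show ?thesis using eqm_app[OF e(3)] by simp
 qed
 thus ?case using e by blast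
 qed
 then obtain k c where c: "!!i. cp (c i)" "~ c k =~ 0" "!!a. a:Xs==>(SUM i<=k. c i * E x ^ i)$a:B" by blast
 define P where "P=(SUM i<=k. c i * E x ^ i)"
 have pP: "pres P" unfolding P_def by (rule presP[where c = c and k = k, OF c(1)])
 have comm: "P * fi =~ fi * P" if fi: "cp fi" "!!i. c i * fi =~ fi * c i" for fi
 proof -
 have xfi: "E x ^ i * fi =~ fi * E x ^ i" for i
 proof (induction i)
 case (Suc i)
 have "E x * (E x ^ i * fi) =~ E x * (fi * E x ^ i)" by (rule eqm_mult_left[OF pres_E[OF x] Suc.IH])
 also have "\<dots> =~ fi * E x * E x ^ i"
 using eqm_mult_right[OF eqm_sym[OF cp_comm[OF fi(1) x]] presx] by (simp add: mult.assoc)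
 finally show ?case by (simp add: mult.assoc)
 qed simp
 have "(SUM i<=k. c i * (E x ^ i * fi)) =~ (SUM i<=k. fi * (c i * E x ^ i))"
 proof (rule eqm_sum)
 fix i
 have "c i * (E x ^ i * fi) =~ c i * (fi * E x ^ i)" by (rule eqm_mult_left[OF cp_pres[OF c(1)] xfi])
 also have "\<dots> =~ fi * c i * E x ^ i" using eqm_mult_right[OF fi(2) presx] by (simp add: mult.assoc)
 finally show "c i * (E x ^ i * fi) =~ fi * (c i * E x ^ i)" by (simp add: mult.assoc)
 qed
 thus ?thesis unfolding P_def by (simp add: sum_distrib_left sum_distrib_right mult.assoc)
 qed
 let ?K = "{v\<in>M. P$v:B}"
 have "sm (pw w) ?K" unfolding sm_def subgp_def
 proof (intro conjI ballI)
 show "0:?K" using m(1) b(1) by simp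
 fix v assume v: "v:?K"
 show "v - v':?K" if "v':?K" for v' using v that m(4) b(4) by (auto simp: app_diff)
 fix g assume g: "g:pw w"
 have gH: "g:H" using pw(3)[OF w] g by blast
 have "E g$v:M" "E g$P$v:B" using pres_E[OF gH] v by (auto simp: pres_def)
 moreover have "P * E g =~ E g * P" by (rule comm[OF pw(5)[OF w g] cp_comm[OF c(1) gH]])
 ultimately show "E g$v:?K" using eqm_app[of "P * E g" "E g * P" v] v by auto
 qed
 hence sp: "span (pw w) Xs<=?K" by (rule span_least) (use c(3) Xs(2) in "auto simp: P_def")
 have "P$u:B" if u: "u:M" for u
 proof -
 obtain n q r where n: "n > 0" "s n$u=q + r" "q:span (pw w) Xs" "r:B"
 using Xs(3)[OF u] unfolding ssum_def by blast
 have "P$q + P$r:B" using sp n pP by (intro b(3)) (auto simp: pres_def)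
 hence "(P * s n)$u:B" by (simp add: n app_add)
 moreover have "P * s n =~ s n * P" by (rule comm[OF s(1) eqm_sym[OF s(3)[OF c(1)]]])
 ultimately have "s n$P$u:B" using eqm_app[of "P * s n" "s n * P" u] u by simp
 thus ?thesis using cp_cases[OF s(1) s(2)[OF n(1)]] pP u by (auto simp: pres_def)
 qed
 thus ?thesis using that[of c k, OF c(1,2)] by (simp add: eqm_0_app P_def)
qed

text \<open>Conjugating a minimal relation \<open>\<Sum> c\<^sub>i x\<^sup>i =~ 0\<close> by \<open>y\<close> multiplies \<open>c\<^sub>i\<close> by \<open>ze\<^sup>i\<close>, and so yields a
 shorter relation.\<close>

lemma no_relation:
 assumes x: "x:H" and y: "y:H" and zxy: "x**y=z**(y**x)"
 and c: "!!i. cp (c i)" "~ c k =~ 0" "(SUM i<=k. c i * E x ^ i) =~ 0"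
 shows False
 using c
proof (induction k arbitrary: c rule: less_induct)
 case (less k)
 note c = less.prems
 have xyc: "x:carrier G" "y:carrier G" "inv y:H" using x y Hc sg_inv[OF sH] by auto
 have presx: "pres (E x ^ i)" for i using pres_E[OF x] by (induction i) (auto intro: pres_mult)
 have pz: "pres (ze ^ i)" for i by (rule cp_pres[OF cp_zeta_power])
 have xy: "E x ^ i * E y =~ ze ^ i * (E y * E x ^ i)" for i
 proof (induction i)
 case (Suc i)
 have "E x * (E x ^ i * E y) =~ E x * (ze ^ i * (E y * E x ^ i))" by (rule eqm_mult_left[OF pres_E[OF x] Suc.IH])
 also have "\<dots>=E x * ze ^ i * (E y * E x ^ i)" by (simp add: mult.assoc)
 also have "\<dots> =~ ze ^ i * E x * (E y * E x ^ i)"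
 by (rule eqm_mult_right[OF eqm_sym[OF cp_comm[OF cp_zeta_power x]] pres_mult[OF pres_E[OF y] presx]])
 also have "\<dots>=ze ^ i * (E (x**y) * E x ^ i)" using xyc by (simp add: E_mult mult.assoc)
 also have "\<dots>=ze ^ i * (ze * E y * E x * E x ^ i)" using xyc zc unfolding zxy by (simp add: E_mult mult.assoc)
 also have "\<dots>=ze ^ Suc i * (E y * E x ^ Suc i)" by (metis mult.assoc power_Suc power_Suc2)
 finally show ?case by (simp add: mult.assoc)
 qed simp
 have "(SUM i<=k. c i * E x ^ i) * E y =~ 0 * E y" by (rule eqm_mult_right[OF c(3) pres_E[OF y]])
 hence "(SUM i<=k. c i * (E x ^ i * E y)) =~ 0" by (simp add: sum_distrib_right mult.assoc)
 moreover have "(SUM i<=k. c i * (E x ^ i * E y)) =~ (SUM i<=k. E y * (c i * ze ^ i * E x ^ i))"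
 proof (rule eqm_sum)
 fix i
 have "c i * (E x ^ i * E y) =~ c i * (ze ^ i * (E y * E x ^ i))" by (rule eqm_mult_left[OF cp_pres[OF c(1)] xy])
 also have "\<dots>=c i * ze ^ i * E y * E x ^ i" by (simp add: mult.assoc)
 also have "\<dots> =~ E y * (c i * ze ^ i) * E x ^ i"
 by (rule eqm_mult_right[OF cp_comm[OF cp_mult[OF c(1) cp_zeta_power] y] presx])
 finally show "c i * (E x ^ i * E y) =~ E y * (c i * ze ^ i * E x ^ i)" by (simp add: mult.assoc)
 qed
 ultimately have "E y * (SUM i<=k. c i * ze ^ i * E x ^ i) =~ 0"
 unfolding sum_distrib_left using eqm_sym eqm_trans by blast
 hence "E (inv y) * (E y * (SUM i<=k. c i * ze ^ i * E x ^ i)) =~ E (inv y) * 0"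
 by (rule eqm_mult_left[OF pres_E[OF xyc(3)]])
 moreover have "E (inv y) * (E y * fi)=fi" for fi using xyc by (metis E_mult E_one inv_closed l_inv mult.assoc mult_1)
 ultimately have 1: "(SUM i<=k. c i * ze ^ i * E x ^ i) =~ 0" by simp
 have "ze ^ k * (SUM i<=k. c i * E x ^ i) =~ ze ^ k * 0" by (rule eqm_mult_left[OF pz c(3)])
 from eqm_diff[OF 1 this]
 have 2: "(SUM i<=k. (c i * ze ^ i - ze ^ k * c i) * E x ^ i) =~ 0"
 by (simp add: sum_distrib_left sum_subtractf left_diff_distrib mult.assoc)
 define e where "e i=c i * ze ^ i - ze ^ k * c i" for i
 have e: "cp (e i)" for i unfolding e_def by (intro cp_diff cp_mult c(1) cp_zeta_power)
 have cz: "c i * ze ^ j =~ ze ^ j * c i" for i j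
 using cp_comm[OF c(1), of "z [^] j"] subgroup_closed(6)[OF sH z] by (simp add: zeta_pow)
 have ek: "e k =~ 0" using cz[of k k] by (simp add: e_def eqm_diff_0)
 have top: "(SUM i<=j. e i * E x ^ i) =~ 0" if "!!i. j < i==>i<=k==>e i =~ 0" "j<=k" for j
 proof -
 have "(SUM i:{j<..k}. e i * E x ^ i) =~ (SUM i:{j<..k}. 0 * E x ^ i)"
 by (intro eqm_sum eqm_mult_right presx) (use that in auto)
 hence "(SUM i<=k. e i * E x ^ i) - (SUM i:{j<..k}. e i * E x ^ i) =~ 0 - 0"
 using 2 by (intro eqm_diff) (simp_all add: e_def)
 moreover have "{..k}={..j} Un {j<..k}" "{..j} Int {j<..k}={}" using that(2) by auto
 ultimately show ?thesis by (simp add: sum.union_disjoint)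
 qed
 show False
 proof (cases "EX i<=k. ~ e i =~ 0")
 case True
 define j where "j=Max {i. i<=k&~ e i =~ 0}"
 have fin: "finite {i. i<=k&~ e i =~ 0}" by simp
 have j: "j<=k" "~ e j =~ 0" using Max_in[OF fin] True by (auto simp: j_def)
 have "e i =~ 0" if "j < i" "i<=k" for i using Max_ge[OF fin, of i] that unfolding j_def by fastforce
 hence "(SUM i<=j. e i * E x ^ i) =~ 0" using top j by blast
 moreover have "j < k" using j ek by (metis le_neq_implies_less)
 ultimately show False using less.IH[of j e, OF _ e j(2)] by blast
 next
 case False
 \<comment> \<open>No shorter relation arises, so every \<open>c i\<close> is annihilated by
   \<open>ze^i - ze^k\<close>, which is nonzero because \<open>ze\<close> has infinite order. The
   relation shrinks to its top term, against invertibility of \<open>x\<close>.\<close>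
 have "c i =~ 0" if i: "i < k" for i
 proof -
 have "~ ze ^ i - ze ^ k =~ 0"
 proof
 assume "ze ^ i - ze ^ k =~ 0"
 hence "ze ^ i * (1 - ze ^ (k - i)) =~ 0" using i by (simp add: right_diff_distrib flip: power_add)
 moreover have "~ ze ^ i =~ 0"
 proof (induction i)
 case (Suc i)
 have "~ ze =~ 0"
 proof
 assume "ze =~ 0"
 from eqm_mult_left[OF pres_E[OF sg_inv[OF sH z]] this] show False
 using one_not_0 zc by (simp flip: E_mult)
 qed
 thus ?case using cp_mult_nz[OF z_cp cp_zeta_power _ Suc.IH] by simp
 qed (use one_not_0 in simp)
 ultimately have "1 - ze ^ (k - i) =~ 0" using cp_cancel[OF cp_zeta_power] pres_diff pz pres_1 by blast
 thus False using z_inf[of "k - i"] i eqm_sym by (simp add: eqm_diff_0)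
 qed
 moreover have "(ze ^ i - ze ^ k) * c i =~ e i"
 unfolding e_def left_diff_distrib by (intro eqm_diff eqm_refl eqm_sym[OF cz])
 hence "(ze ^ i - ze ^ k) * c i =~ 0" using False i eqm_trans by (meson less_imp_le)
 ultimately show ?thesis using cp_cancel[OF cp_diff[OF cp_zeta_power cp_zeta_power]] cp_pres[OF c(1)] by blast
 qed
 hence "(SUM i<k. c i * E x ^ i) =~ (SUM i<k. 0 * E x ^ i)" by (intro eqm_sum eqm_mult_right presx) auto
 from eqm_diff[OF c(3) this] have "c k * E x ^ k =~ 0" by (simp flip: lessThan_Suc_atMost)
 moreover have xk: "E x ^ k=E (x [^] k)" by (induction k) (simp_all add: E_mult xyc power_Suc2 del: power_Suc)
 moreover have xi: "x [^] k:H" "inv (x [^] k):H" "x [^] k:carrier G"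
 using subgroup_closed(4,6)[OF sH] x xyc by blast+
 ultimately have "c k * E (x [^] k) * E (inv (x [^] k)) =~ 0 * E (inv (x [^] k))"
 by (intro eqm_mult_right pres_E) auto
 hence "c k =~ 0" using xi by (simp add: mult.assoc flip: E_mult)
 thus False using c(2) by blast
 qed
qed

text \<open>If some positive integer vanishes on \<open>M / B\<close>, the least one is prime, as
  there are no zero divisors. So one of the two finite rank results applies and provides a relation
  for \<open>x\<close>, which cannot exist.\<close>

theorem central_commutator_finite_order:
 assumes x: "x:H" and y: "y:H" and zxy: "z=comm G x y"
 shows False
proof -
 have xyc: "x:carrier G" "y:carrier G" using x y Hc by auto
 have xy: "x**y=z**(y**x)" using xyc by (simp add: zxy comm_def m_assoc inv_solve_left')
 have "EX w s. finite_rank_over w s"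
 proof (cases "EX n::nat>0. of_nat n =~ 0")
 case False
 thus ?thesis using finite_rank_char_0 by blast
 next
 case True
 define p where "p=(LEAST n::nat. n > 0&of_nat n =~ 0)"
 have p: "p > 0" "of_nat p =~ 0" using LeastI_ex[OF True] by (auto simp: p_def)
 have min: "~ of_nat n =~ 0" if "0 < n" "n < p" for n using not_less_Least that unfolding p_def by blast
 have "p ~= 1" using p(2) one_not_0 by auto
 moreover have "d=1 | d=p" if d: "d dvd p" for d
 proof (rule ccontr)
 assume no: "~ ?thesis"
 obtain e where e: "p=d * e" using d by blast
 have "d < p" "e < p" "0 < d" "0 < e" using no e p(1) by (auto simp: nat_neq_iff)
 hence "~ of_nat d * of_nat e =~ 0" using min by (intro cp_mult_nz) auto
 thus False using p(2) e by simp
 qed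
 ultimately have "prime p" using p(1) by (auto simp: prime_nat_iff)
 then interpret central_element_char G E A M R H B z p by unfold_locales (use p in auto)
 show ?thesis using finite_rank_char_p by blast
 qed
 thus False using relation_all x no_relation[OF x y xy] by metis
qed
end

section \<open>Reduction to abelian action\<close>

context maximal_module
begin

lemma ker_eq: "pw \<one>={g:H. E g =~ 1}"
 by (auto simp: pw_def)

lemma ker_subgroup: "subgroup {g:H. E g =~ 1} G"
 using pw(1)[of \<one>] sg_one[OF sH] by (simp add: ker_eq)

lemma comm_ker: "a:H==>b:H==>E (comm G a b) =~ 1==>E a * E b =~ E b * E a"
proof -
 assume *: "a:H" "b:H" "E (comm G a b) =~ 1"
 have "a**b=comm G a b**(b**a)" using *(1,2) Hc by (simp add: comm_def m_assoc inv_solve_left')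
 hence "E a * E b=E (comm G a b) * (E b * E a)" using *(1,2) Hc by (simp flip: E_mult)
 also have "\<dots> =~ 1 * (E b * E a)" by (rule eqm_mult_right[OF *(3) pres_mult[OF pres_E pres_E]]) (rule *)+
 finally show ?thesis by simp
qed

lemma comm_ker': "a:H==>b:H==>E a * E b =~ E b * E a==>E (comm G a b) =~ 1"
proof -
 assume *: "a:H" "b:H" "E a * E b =~ E b * E a"
 have i: "inv a:H" "inv b:H" "a:carrier G" "b:carrier G" using * Hc sg_inv[OF sH] by auto
 have "E a * E b * (E (inv a) * E (inv b)) =~ E b * E a * (E (inv a) * E (inv b))"
 by (rule eqm_mult_right[OF *(3) pres_mult[OF pres_E pres_E]]) (rule i)+
 moreover have "E b * E a * (E (inv a) * E (inv b))=1" using i by (simp add: m_assoc flip: E_mult)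
 moreover have "E a * E b * (E (inv a) * E (inv b))=E (comm G a b)" using i by (simp add: comm_def m_assoc flip: E_mult)
 ultimately show ?thesis by simp
qed

lemma E_pow_ker: "x:carrier G==>E (x [^] (n::nat))=E x ^ n"
 by (induction n) (simp_all add: E_mult power_Suc2 del: power_Suc)

lemma pres_power: "pres fi==>pres (fi ^ i)"
 by (induction i) (auto intro: pres_mult)

lemma eqm_power_comm: "pres fi==>pres ps==>fi * ps =~ ps * fi==>ps ^ i * fi =~ fi * ps ^ i"
proof (induction i)
 case (Suc i)
 have "ps * (ps ^ i * fi) =~ ps * (fi * ps ^ i)" using Suc by (intro eqm_mult_left) blast+
 also have "\<dots> =~ fi * ps * ps ^ i"
 using eqm_mult_right[OF eqm_sym[OF Suc.prems(3)] pres_power[OF Suc.prems(2)]] by (simp add: mult.assoc)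
 finally show ?case by (simp add: mult.assoc)
qed simp

lemma eqm_power_mult:
 assumes "pres fi" "pres ps" "fi * ps =~ ps * fi" shows "(fi * ps) ^ i =~ fi ^ i * ps ^ i"
proof (induction i)
 case (Suc i)
 have "(fi * ps) ^ i * (fi * ps) =~ fi ^ i * ps ^ i * (fi * ps)"
 by (rule eqm_mult_right[OF Suc.IH pres_mult]) (rule assms)+
 also have "\<dots>=fi ^ i * (ps ^ i * fi * ps)" by (simp add: mult.assoc)
 also have "\<dots> =~ fi ^ i * (fi * ps ^ i * ps)"
 by (intro eqm_mult_left eqm_mult_right pres_power eqm_power_comm assms)
 also have "\<dots>=fi ^ Suc i * ps ^ Suc i" by (simp add: power_Suc2 mult.assoc del: power_Suc)
 finally show ?case by (simp only: power_Suc2)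
qed simp

lemma eqm_one_power: "pres fi==>fi ^ n =~ 1==>fi ^ (n * i) =~ 1"
proof (induction i)
 case (Suc i)
 hence "fi ^ n * fi ^ (n * i) =~ 1 * 1" by (intro eqm_mult pres_power) auto
 thus ?case by (simp add: power_add)
qed simp

lemma commutator_finite_order:
 assumes x: "x:H" "y:H" and z: "!!h. h:H==>E (comm G (comm G x y) h) =~ 1"
 shows "EX n>0. E (comm G x y) ^ n =~ 1"
proof (rule ccontr)
 assume no: "~ ?thesis"
 have zH: "comm G x y:H" using x subgroup_closed(7)[OF sH] by blast
 have zcp: "cp (E (comm G x y))" using comm_ker[OF zH _ z] pres_E[OF zH] by (auto simp: cp_iff)
 interpret central_element G E A M R H B "comm G x y"
 by (intro central_element.intro maximal_module_axioms central_element_axioms.intro zH zcp) (use no in blast)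
 show False by (rule central_commutator_finite_order[OF x]) simp
qed

text \<open>One step of the descent: the centralizer, modulo the kernel, of the term \<open>lcs G H d\<close> has finite
 index, and its own lower central series becomes trivial one step earlier.\<close>

lemma class_reduction:
 assumes T: "!!g. g:lcs G H (Suc (Suc d))==>E g =~ 1"
 shows "EX Y. fidx G Y H&A<=Y&(ALL g:lcs G Y (Suc d). E g =~ 1)"
proof -
 let ?C = "lcs G H (Suc d)"
 have C: "subgroup ?C G" "?C<=H" using lcs_subgroup[OF sH] lcs_subset[OF sH] by blast+
 have central: "E (comm G c h) =~ 1" if "c:?C" "h:H" for c h using T comm_in_lcs[OF that] by blast
 have K: "subgroup {g:?C. E g ^ e =~ 1} G" for e
 proof (rule subgroupI)
 show "{g:?C. E g ^ e =~ 1} ~= {}" using sg_one[OF C(1)] by (auto intro!: exI[of _ \<one>])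
 show "{g:?C. E g ^ e =~ 1}<=carrier G" using C(2) Hc by blast
 fix g assume g: "g:{g:?C. E g ^ e =~ 1}"
 have gc: "g:carrier G" "g:H" using g C(2) Hc by blast+
 have gn: "inv g [^] e:H" "g [^] e:carrier G" using gc(2) subgroup_closed(4,6)[OF sH] Hc by blast+
 have "E (inv g [^] e) * E (g [^] e) =~ E (inv g [^] e) * 1"
 using g gc by (intro eqm_mult_left pres_E gn) (simp add: E_pow_ker)
 moreover have "E (inv g [^] e) * E (g [^] e)=1" using gc by (simp add: nat_pow_inv flip: E_mult)
 ultimately have "E (inv g) ^ e =~ 1" using gc by (simp add: eqm_sym E_pow_ker)
 thus "inv g:{g:?C. E g ^ e =~ 1}" using g sg_inv[OF C(1)] by blast
 fix h assume h: "h:{g:?C. E g ^ e =~ 1}"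
 have gH: "g:H" "h:H" using g h C(2) by auto
 have "(E g * E h) ^ e =~ E g ^ e * E h ^ e"
 by (rule eqm_power_mult[OF pres_E pres_E comm_ker[OF gH central]]) (use g gH in auto)
 also have "\<dots> =~ 1 * 1" using g h gH by (intro eqm_mult pres_power pres_E) auto
 finally have "E (g**h) ^ e =~ 1" using gH Hc by (simp add: E_mult)
 thus "g**h:{g:?C. E g ^ e =~ 1}" using g h sg_mult[OF C(1)] by blast
 qed
 have up: "E g ^ (k * l) =~ 1" "E g ^ (l * k) =~ 1" if "g:?C" "E g ^ k =~ 1" for g k l
 using eqm_one_power[OF pres_E that(2)] C(2) that(1) by (auto simp: mult.commute[of l])
 let ?F = "{g:?C. EX n>0. E g ^ n =~ 1}"
 have F: "subgroup ?F G"
 proof (rule subgroupI)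
 show "?F ~= {}" using sg_one[OF C(1)] by (auto intro!: exI[of _ \<one>])
 show "?F<=carrier G" using C(2) Hc by blast
 show "inv g:?F" if "g:?F" for g using that sg_inv[OF K] by blast
 fix g h assume "g:?F" "h:?F"
 then obtain k l where kl: "g:?C" "h:?C" "k > 0" "E g ^ k =~ 1" "l > 0" "E h ^ l =~ 1" by blast
 have "g**h:{g:?C. E g ^ (k * l) =~ 1}"
 by (rule sg_mult[OF K]) (use kl up in auto)
 thus "g**h:?F" using kl by (auto intro!: exI[of _ "k * l"])
 qed
 have "(UN x:lcs G H d. UN y:H. {comm G x y})<=?F"
 proof clarify
 fix x y assume xy: "x:lcs G H d" "y:H"
 have "x:H" using xy lcs_subset[OF sH] by blast
 hence "EX n>0. E (comm G x y) ^ n =~ 1"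
 by (rule commutator_finite_order) (use xy central comm_in_lcs in blast)+
 thus "comm G x y:?C&(EX n>0. E (comm G x y) ^ n =~ 1)" using comm_in_lcs[OF xy] by blast
 qed
 hence fin: "?C<=?F" using generate_subgroup_incl[OF _ F] by simp
 obtain S where S: "finite S" "S<=?C" "?C<=generate G (S Un lcs G H (Suc (Suc d)))"
 using lcs_fg[OF admD(3)[OF H], of "Suc d"] by (elim exE conjE) (rule that)
 have "ALL g:S. EX n>0. E g ^ n =~ 1" using fin S(2) by blast
 then obtain n where n: "!!g. g:S==>n g > 0&E g ^ n g =~ 1" by metis
 \<comment> \<open>A common exponent of \<open>?C\<close> modulo the kernel; it exists because
   \<open>?C\<close> is finitely generated modulo the next term, which acts trivially.\<close>
 define e where "e=(\<Prod>g\<in>S. n g)"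
 have e0: "e > 0" using n by (auto simp: e_def intro!: prod_pos)
 have "S Un lcs G H (Suc (Suc d))<={g:?C. E g ^ e =~ 1}"
 proof
 fix g assume "g:S Un lcs G H (Suc (Suc d))"
 then consider "g:S" | "g:lcs G H (Suc (Suc d))" by blast
 thus "g:{g:?C. E g ^ e =~ 1}"
 proof cases
 case 1
 then obtain q where q: "e=n g * q" using dvd_prodI[OF S(1), of g n] by (auto simp: e_def elim: dvdE)
 thus ?thesis using up n S(2) 1 by auto
 next
 case 2
 hence "g:?C" using lcs_Suc_subset[OF sH] by blast
 moreover have "E g ^ 1 =~ 1" using T 2 by simp
 ultimately show ?thesis using up(1)[of g 1 e] by simp
 qed
 qed
 hence e: "E g ^ e =~ 1" if "g:?C" for g
 using generate_subgroup_incl[OF _ K] S(3) that by blast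
 \<comment> \<open>Modulo the kernel, \<open>comm G x g\<close> is multiplicative in
   \<open>g\<close> with commuting values of exponent \<open>e\<close>. Hence \<open>H\<close>
   modulo \<open>Y\<close> is abelian of exponent dividing \<open>e\<close>, and so finite.\<close>
 define Y where "Y={g:H. ALL x:lcs G H d. E (comm G x g) =~ 1}"
 have xH: "x:H" "x:carrier G" if "x:lcs G H d" for x using that lcs_subset[OF sH] Hc by blast+
 have cm: "E (comm G x (g**h)) =~ E (comm G x g) * E (comm G x h)" if x: "x:lcs G H d" and gh: "g:H" "h:H" for x g h
 proof -
 have cH: "comm G x g:H" "comm G x h:H" using xH[OF x] gh subgroup_closed(7)[OF sH] by blast+
 have c: "comm G x g:?C" "comm G x h:?C" using comm_in_lcs x gh by blast+
 have i: "inv g:H" using gh sg_inv[OF sH] by blast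
 have "E g * E (comm G x h) * E (inv g) =~ E (comm G x h) * E g * E (inv g)"
 by (rule eqm_mult_right[OF eqm_sym[OF comm_ker[OF cH(2) gh(1) central[OF c(2) gh(1)]]] pres_E[OF i]])
 hence "E (g**comm G x h**inv g) =~ E (comm G x h)" using gh cH Hc by (simp add: m_assoc flip: E_mult)
 from eqm_mult_left[OF pres_E[OF cH(1)] this] show ?thesis
 using xH(2)[OF x] gh Hc by (simp add: comm_mult_right flip: E_mult)
 qed
 have one: "E (comm G x \<one>) =~ 1" if "x:lcs G H d" for x using xH(2)[OF that] by simp
 have Ysub: "subgroup Y G"
 proof (rule subgroupI)
 show "Y<=carrier G" using Hc by (auto simp: Y_def)
 show "Y ~= {}" using one sg_one[OF sH] unfolding Y_def by blast
 show "g**h:Y" if gh: "g:Y" "h:Y" for g h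
 proof -
 have "E (comm G x (g**h)) =~ 1" if x: "x:lcs G H d" for x
 proof -
 have gH: "g:H" "h:H" using gh by (auto simp: Y_def)
 have "E (comm G x g) * E (comm G x h) =~ 1 * 1" using gh x xH[OF x] gH subgroup_closed(7)[OF sH]
 by (intro eqm_mult pres_E) (auto simp: Y_def)
 thus ?thesis using eqm_trans[OF cm[OF x gH]] by simp
 qed
 thus ?thesis using gh sg_mult[OF sH] by (auto simp: Y_def)
 qed
 show "inv g:Y" if g: "g:Y" for g
 proof -
 have gH: "g:H" "inv g:H" "g:carrier G" using g sg_inv[OF sH] Hc by (auto simp: Y_def)
 have "E (comm G x (inv g)) =~ 1" if x: "x:lcs G H d" for x
 proof -
 have "E (comm G x g) * E (comm G x (inv g)) =~ 1 * E (comm G x (inv g))"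
 using g x xH(1)[OF x] gH subgroup_closed(7)[OF sH] by (intro eqm_mult_right pres_E) (auto simp: Y_def)
 moreover have "E (comm G x (g**inv g)) =~ E (comm G x g) * E (comm G x (inv g))" by (rule cm[OF x gH(1,2)])
 ultimately show ?thesis using xH(2)[OF x] gH eqm_trans eqm_sym by (metis comm_one(1) E_one mult_1 r_inv)
 qed
 thus ?thesis using gH by (auto simp: Y_def)
 qed
 qed
 have AY: "A<=Y"
 proof
 fix a assume a: "a:A"
 have aH: "a:H" "a:carrier G" "E a=1" using a admD(2)[OF H] Hc E_A by blast+
 have "E (comm G x a) =~ 1" if "x:lcs G H d" for x
 by (rule comm_ker'[OF xH(1)[OF that] aH(1)]) (simp add: aH)
 thus "a:Y" using aH by (simp add: Y_def)
 qed
 have "fidx G Y H"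
 proof (rule fidx_abelian_torsion[OF admD(3)[OF H] Ysub _ _ e0])
 show "Y<=H" by (auto simp: Y_def)
 show "comm G g h:Y" if gh: "g:H" "h:H" for g h
 proof -
 have cH: "comm G g h:H" "h**g:H" using gh subgroup_closed(3,7)[OF sH] by blast+
 have "E (comm G x (comm G g h)) =~ 1" if x: "x:lcs G H d" for x
 proof -
 have c: "comm G x g:?C" "comm G x h:?C" using comm_in_lcs x gh by blast+
 have xg: "comm G x g:H" "comm G x h:H" "comm G x (comm G g h):H" "comm G x (h**g):H"
 using C(2) c xH(1)[OF x] cH subgroup_closed(7)[OF sH] by blast+
 have "comm G g h**(h**g)=g**h" using gh Hc by (simp add: comm_def m_assoc inv_solve_left')
 hence 1: "E (comm G x (g**h)) =~ E (comm G x (comm G g h)) * E (comm G x (h**g))"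
 using cm[OF x cH] by simp
 have 2: "E (comm G x (g**h)) =~ E (comm G x (h**g))"
 using cm[OF x gh] comm_ker[OF xg(1,2) central[OF c(1) xg(2)]] cm[OF x gh(2,1)] eqm_trans eqm_sym by meson
 have i: "inv (comm G x (h**g)):H" using xg sg_inv[OF sH] by blast
 have "E (comm G x (comm G g h)) * E (comm G x (h**g)) * E (inv (comm G x (h**g)))
 =~ E (comm G x (h**g)) * E (inv (comm G x (h**g)))"
 using 1 2 eqm_trans eqm_sym by (intro eqm_mult_right pres_E[OF i]) blast
 thus ?thesis using xg Hc by (simp add: m_assoc flip: E_mult)
 qed
 thus ?thesis using cH by (simp add: Y_def)
 qed
 show "g [^] e:Y" if g: "g:H" for g
 proof -
 have gn: "g [^] (i::nat):H" for i using g subgroup_closed(6)[OF sH] by blast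
 have "E (comm G x (g [^] e)) =~ 1" if x: "x:lcs G H d" for x
 proof -
 have c: "comm G x g:?C" using comm_in_lcs x g by blast
 have "E (comm G x (g [^] (i::nat))) =~ E (comm G x g) ^ i" for i
 proof (induction i)
 case (Suc i)
 have "E (comm G x (g [^] i**g)) =~ E (comm G x (g [^] i)) * E (comm G x g)" by (rule cm[OF x gn g])
 also have "\<dots> =~ E (comm G x g) ^ i * E (comm G x g)"
 using C(2) c by (intro eqm_mult_right[OF Suc.IH] pres_E) blast
 finally show ?case by (simp add: power_Suc2 del: power_Suc)
 qed (use one[OF x] in simp)
 thus ?thesis using e[OF c] eqm_trans by blast
 qed
 thus ?thesis using gn by (simp add: Y_def)
 qed
 qed
 moreover have "E g =~ 1" if "g:lcs G Y (Suc d)" for g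
 proof -
 have YH: "lcs G Y d<=lcs G H d" by (rule lcs_mono[OF sH Ysub]) (auto simp: Y_def)
 have "(UN x:lcs G Y d. UN y:Y. {comm G x y})<={g:H. E g =~ 1}"
 using YH xH(1) subgroup_closed(7)[OF sH] by (fastforce simp: Y_def)
 from generate_subgroup_incl[OF this ker_subgroup] show ?thesis using that by auto
 qed
 ultimately show ?thesis using AY by blast
qed
end

text \<open>Shrinking the group may destroy the maximality of \<open>B\<close>, so a larger maximal
  submodule is chosen at each stage, while the class of the action drops until the action is
  abelian.\<close>

theorem (in module_action) abelian_reduction:
 assumes "adm H" "bm H B0" "nva H B0" "!!g v. g:lcs G H c==>v:M==>E g$v - v:B0"
 obtains Y B where "fidx G Y H" "A<=Y" "B0<=B" "maxm Y B" "!!g v. g:lcs G Y 1==>v:M==>E g$v - v:B"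
proof -
 have "EX Y B. fidx G Y H&A<=Y&B0<=B&maxm Y B&(ALL g:lcs G Y 1. ALL v:M. E g$v - v:B)"
 using assms
 proof (induction c arbitrary: H B0 rule: less_induct)
 case (less c)
 note sH = admD(1)[OF less.prems(1)]
 obtain B where BB: "maxm H B" "B0<=B" using maxm_exists[OF less.prems(1-3)] by blast
 interpret maximal_module G E A M R H B by unfold_locales (use BB less.prems in auto)
 show ?case
 proof (cases "c<=1")
 case True
 have "lcs G H 1<=lcs G H c" by (rule lcs_antimono[OF sH True])
 hence "ALL g:lcs G H 1. ALL v:M. E g$v - v:B" using less.prems(4) BB(2) by blast
 thus ?thesis using BB fidx_refl[OF sH] admD(2)[OF less.prems(1)] by blast
 next
 case False
 then obtain d where d: "c=Suc (Suc d)" by (cases c; cases "c - 1") auto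
 obtain Y where Y: "fidx G Y H" "A<=Y" "!!g. g:lcs G Y (Suc d)==>eqm (E g) 1"
 using class_reduction[of d] less.prems(4) BB(2) unfolding d eqm_def by force
 have bn: "bm Y B" "nva Y B"
 using BB(1) bm_mono[OF _ fidxD(3)[OF Y(1)]] nva_fidx[OF _ Y(1)] by (simp_all add: maxm_def)
 have "EX Y' B'. fidx G Y' Y&A<=Y'&B<=B'&maxm Y' B'&(ALL g:lcs G Y' 1. ALL v:M. E g$v - v:B')"
 by (rule less.IH[OF _ adm_fidx[OF less.prems(1) Y(1,2)] bn, of "Suc d"]) (use Y(3) in "auto simp: d eqm_def")
 then obtain Y' B' where Y': "fidx G Y' Y" "A<=Y'" "B<=B'" "maxm Y' B'" "ALL g:lcs G Y' 1. ALL v:M. E g$v - v:B'"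
 by (elim exE conjE) (rule that)
 have "fidx G Y' H" using fidx_trans Y(1) Y'(1) by blast
 thus ?thesis using Y' BB(2) by blast
 qed
 qed
 thus ?thesis using that by blast
qed

section \<open>Fields of fractions inside a ring type\<close>

text \<open>The fields needed below depend on hypotheses, so they cannot be types. The product of all
 commutative rings with carrier in a given type is a type, however, and each of these rings is
 a subset of it, with its own unit element.\<close>

typedef 'x cprod = "{f :: 'x set ring => 'x set. ALL F. (cring F-->f F:carrier F)&(~ cring F-->f F={})}"
 by (rule exI[of _ "%F. if cring F then \<zero>\<^bsub>F\<^esub> else {}"])
 (auto intro: abelian_group.axioms(1) abelian_monoid.zero_closed ring.axioms(1) cring.axioms(1))
setup_lifting type_definition_cprod

text \<open>The Boolean ring of all subsets provides one nonzero factor, which gives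
  \<open>0 ~= 1\<close> in the product.\<close>

lemma bool_cring: "cring \<lparr>carrier=UNIV, monoid.mult=(Int), one=UNIV, ring.zero={}, ring.add=(%x y. (x - y) Un (y - x)) :: 'x set => _\<rparr>"
 by (intro cringI abelian_groupI comm_monoidI) auto

lemma cring_facts:
 assumes "cring F"
 shows "\<zero>\<^bsub>F\<^esub>:carrier F" "\<one>\<^bsub>F\<^esub>:carrier F" "x:carrier F==>\<ominus>\<^bsub>F\<^esub> x:carrier F"
 "x:carrier F==>y:carrier F==>x \<oplus>\<^bsub>F\<^esub> y:carrier F"
 "x:carrier F==>y:carrier F==>x **\<^bsub>F\<^esub> y:carrier F"
proof -
 interpret cring F by (rule assms)
 show "\<zero>\<^bsub>F\<^esub>:carrier F" "\<one>\<^bsub>F\<^esub>:carrier F" "x:carrier F==>\<ominus>\<^bsub>F\<^esub> x:carrier F"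
 "x:carrier F==>y:carrier F==>x \<oplus>\<^bsub>F\<^esub> y:carrier F"
 "x:carrier F==>y:carrier F==>x **\<^bsub>F\<^esub> y:carrier F" by auto
qed

instantiation cprod :: (type) comm_ring_1
begin
lift_definition zero_cprod :: "'a cprod" is "%F. if cring F then \<zero>\<^bsub>F\<^esub> else {}" by (simp add: cring_facts)
lift_definition one_cprod :: "'a cprod" is "%F. if cring F then \<one>\<^bsub>F\<^esub> else {}" by (simp add: cring_facts)
lift_definition uminus_cprod :: "'a cprod => 'a cprod" is "%f F. if cring F then \<ominus>\<^bsub>F\<^esub> f F else {}" by (simp add: cring_facts)
lift_definition plus_cprod :: "'a cprod => 'a cprod => 'a cprod" is "%f g F. if cring F then f F \<oplus>\<^bsub>F\<^esub> g F else {}"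
 by (simp add: cring_facts)
lift_definition times_cprod :: "'a cprod => 'a cprod => 'a cprod" is "%f g F. if cring F then f F **\<^bsub>F\<^esub> g F else {}"
 by (simp add: cring_facts)

definition minus_cprod :: "'a cprod => 'a cprod => 'a cprod" where "minus_cprod a b=a + - b"
instance
proof
 fix a b c :: "'a cprod"
 show "a + b + c=a + (b + c)" by transfer (auto simp: fun_eq_iff cring_def ring_def abelian_group_def abelian_monoid.a_assoc)
 show "a + b=b + a" by transfer (auto simp: fun_eq_iff cring_def ring_def abelian_group_def abelian_monoid.a_comm)
 show "0 + a=a" by transfer (auto simp: fun_eq_iff cring_def ring_def abelian_group_def abelian_monoid.l_zero)
 show "- a + a=0" by transfer (auto simp: fun_eq_iff cring_def ring_def abelian_group.l_neg)
 show "a - b=a + - b" by (rule minus_cprod_def)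
 show "a * b * c=a * (b * c)" by transfer (auto simp: fun_eq_iff cring_def ring_def monoid.m_assoc)
 show "a * b=b * a" by transfer (auto simp: fun_eq_iff cring_def comm_monoid.m_comm)
 show "1 * a=a" by transfer (auto simp: fun_eq_iff cring_def ring_def monoid.l_one)
 show "(a + b) * c=a * c + b * c" by transfer (auto simp: fun_eq_iff cring_def ring.ring_simprules(10) ring_def[unfolded ring_axioms_def])
 show "(0 :: 'a cprod) ~= 1"
 by transfer (use bool_cring[where 'x = 'a] in "auto simp: fun_eq_iff intro!: exI")
qed
end
text \<open>Embedding of one factor, zero in all others. Sums and products are preserved, but the
  unit goes to an idempotent of the product; hence the separate unit \<open>e\<close> in the locales
  below.\<close>

lift_definition cemb :: "'x set ring => 'x set => 'x cprod" is
 "%F x F'. if ~ cring F' then {} else if F'=F&x:carrier F then x else \<zero>\<^bsub>F'\<^esub>" by (simp add: cring_facts)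

lemma cemb:
 assumes F: "cring F" and x: "x:carrier F" and y: "y:carrier F"
 shows "cemb F (x \<oplus>\<^bsub>F\<^esub> y)=cemb F x + cemb F y" "cemb F (x **\<^bsub>F\<^esub> y)=cemb F x * cemb F y"
 "cemb F \<zero>\<^bsub>F\<^esub>=0" "cemb F x=cemb F y \<longleftrightarrow> x=y"
proof -
 note c = cring_facts[OF F]
 have z: "\<zero>\<^bsub>F'\<^esub> \<oplus>\<^bsub>F'\<^esub> \<zero>\<^bsub>F'\<^esub>=\<zero>\<^bsub>F'\<^esub>" "\<zero>\<^bsub>F'\<^esub> **\<^bsub>F'\<^esub> \<zero>\<^bsub>F'\<^esub>=\<zero>\<^bsub>F'\<^esub>" if "cring F'" for F' :: "'a set ring"
 proof -
 interpret cring F' by (rule that)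
 show "\<zero>\<^bsub>F'\<^esub> \<oplus>\<^bsub>F'\<^esub> \<zero>\<^bsub>F'\<^esub>=\<zero>\<^bsub>F'\<^esub>" "\<zero>\<^bsub>F'\<^esub> **\<^bsub>F'\<^esub> \<zero>\<^bsub>F'\<^esub>=\<zero>\<^bsub>F'\<^esub>" by auto
 qed
 show "cemb F (x \<oplus>\<^bsub>F\<^esub> y)=cemb F x + cemb F y" "cemb F (x **\<^bsub>F\<^esub> y)=cemb F x * cemb F y"
 using F x y c z by (transfer, auto simp: fun_eq_iff)+
 show "cemb F \<zero>\<^bsub>F\<^esub>=0" using F by transfer (auto simp: fun_eq_iff)
 show "cemb F x=cemb F y \<longleftrightarrow> x=y" using F x y by transfer (auto simp: fun_eq_iff)
qed

locale domain_set =
 fixes D :: "'k::comm_ring_1 set" and e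
 assumes D: "subgp D" "x:D==>y:D==>x * y:D"
 and e: "e:D" "e ~= 0" "x:D==>e * x=x"
 and no_zero_div: "x:D==>y:D==>x * y=0==>x=0 | y=0"
begin

lemma cancel: "x:D==>y:D==>z:D==>z ~= 0==>z * x=z * y \<longleftrightarrow> x=y"
 using no_zero_div[of z "x - y"] subgpD(4)[OF D(1), of x y] by (auto simp: right_diff_distrib)

lemma nz: "x:D==>y:D==>x ~= 0==>y ~= 0==>x * y ~= 0"
 using no_zero_div by blast

lemma mult_nz: "x:D - {0}==>y:D - {0}==>x * y:D - {0}"
 using D no_zero_div by blast
end

locale field_set = domain_set +
 assumes inverse: "x:D==>x ~= 0==>EX y:D. x * y=e"

context domain_set
begin

definition cl :: "'k => 'k => ('k \<times> 'k) set" where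
 "cl s t={(s', t'). s':D&t':D - {0}&s * t'=s' * t}"

definition rep :: "('k \<times> 'k) set => 'k \<times> 'k" where "rep Q1=(SOME p. p:Q1)"

lemma cl_eq:
 assumes "s:D" "t:D - {0}" "s':D" "t':D - {0}" shows "cl s t=cl s' t' \<longleftrightarrow> s * t'=s' * t"
proof
 assume "cl s t=cl s' t'"
 moreover have "(s', t'):cl s' t'" using assms by (simp add: cl_def)
 ultimately have "(s', t'):cl s t" by simp
 thus "s * t'=s' * t" by (simp add: cl_def)
next
 assume eq: "s * t'=s' * t"
 have "s * t''=s'' * t \<longleftrightarrow> s' * t''=s'' * t'" if "s'':D" "t'':D - {0}" for s'' t''
 proof -
 have "t' * (s * t'')=t * (s' * t'')" using arg_cong[OF eq, of "%x. t'' * x"] by (simp add: mult_ac)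
 hence "s * t''=s'' * t \<longleftrightarrow> t * (s' * t'')=t * (s'' * t')"
 using cancel[of "s * t''" "s'' * t" t'] assms that D(2) by (simp add: mult_ac)
 thus ?thesis using cancel[of "s' * t''" "s'' * t'" t] assms that D(2) by simp
 qed
 thus "cl s t=cl s' t'" unfolding cl_def by blast
qed

lemma rep_cl:
 assumes "s:D" "t:D - {0}"
 obtains s' t' where "rep (cl s t)=(s', t')" "s':D" "t':D - {0}" "s * t'=s' * t"
proof -
 have "(s, t):cl s t" using assms by (simp add: cl_def)
 hence "rep (cl s t):cl s t" unfolding rep_def by (rule someI)
 thus ?thesis using that by (cases "rep (cl s t)") (auto simp: cl_def)
qed

text \<open>Fractions are encoded as sets of pairs, so that \<open>frac\<close> is a ring on a type
  of sets and can be embedded in \<open>cprod\<close>.\<close>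

definition frac :: "('k \<times> 'k) set ring" where
 "frac=\<lparr>carrier={cl s t | s t. s:D&t:D - {0}},
 monoid.mult=(%Q1 Q2. cl (fst (rep Q1) * fst (rep Q2)) (snd (rep Q1) * snd (rep Q2))), one=cl e e, ring.zero=cl 0 e,
 ring.add=(%Q1 Q2. cl (fst (rep Q1) * snd (rep Q2) + fst (rep Q2) * snd (rep Q1)) (snd (rep Q1) * snd (rep Q2)))\<rparr>"

lemma frac_mult:
 assumes "s:D" "t:D - {0}" "s':D" "t':D - {0}"
 shows "cl s t **\<^bsub>frac\<^esub> cl s' t'=cl (s * s') (t * t')"
proof -
 obtain a b where ab: "rep (cl s t)=(a, b)" "a:D" "b:D - {0}" "s * b=a * t" using rep_cl assms by metis
 obtain c d where cd: "rep (cl s' t')=(c, d)" "c:D" "d:D - {0}" "s' * d=c * t'" using rep_cl assms by metis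
 have "(a * c) * (t * t')=(s * s') * (b * d)" using ab(4) cd(4) by (metis mult.assoc mult.left_commute)
 thus ?thesis using cl_eq[of "a * c" "b * d" "s * s'" "t * t'"] assms ab cd mult_nz D(2) by (simp add: frac_def)
qed

lemma frac_add:
 assumes "s:D" "t:D - {0}" "s':D" "t':D - {0}"
 shows "cl s t \<oplus>\<^bsub>frac\<^esub> cl s' t'=cl (s * t' + s' * t) (t * t')"
proof -
 obtain a b where ab: "rep (cl s t)=(a, b)" "a:D" "b:D - {0}" "s * b=a * t" using rep_cl assms by metis
 obtain c d where cd: "rep (cl s' t')=(c, d)" "c:D" "d:D - {0}" "s' * d=c * t'" using rep_cl assms by metis
 have "(a * d + c * b) * (t * t')=(a * t) * (d * t') + (c * t') * (b * t)" by (simp add: algebra_simps)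
 also have "\<dots>=(s * t' + s' * t) * (b * d)" unfolding ab(4)[symmetric] cd(4)[symmetric] by (simp add: algebra_simps)
 finally show ?thesis
 using cl_eq[of "a * d + c * b" "b * d" "s * t' + s' * t" "t * t'"] assms ab cd mult_nz D(2) subgpD(3)[OF D(1)]
 by (simp add: frac_def)
qed

lemma e_nz: "e:D - {0}" using e by simp

lemma frac_carrier: "Q1:carrier frac \<longleftrightarrow> (EX s t. s:D&t:D - {0}&Q1=cl s t)"
 by (auto simp: frac_def)

lemma frac_I: "s:D==>t:D - {0}==>cl s t:carrier frac" unfolding frac_carrier by blast

lemma frac_cring: "cring frac"
proof (intro cringI abelian_groupI comm_monoidI)
 note d = D(2) subgpD[OF D(1)] mult_nz e_nz e(1) nz
 have o: "\<one>\<^bsub>frac\<^esub>=cl e e" "\<zero>\<^bsub>frac\<^esub>=cl 0 e" by (auto simp: frac_def)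
 show "\<one>\<^bsub>frac\<^esub>:carrier frac" "\<zero>\<^bsub>frac\<^esub>:carrier frac" unfolding o by (intro frac_I d e_nz)+
 fix Q1 Q2 assume "Q1:carrier frac" "Q2:carrier frac"
 then obtain s t s' t' where Q1: "Q1=cl s t" "s:D" "t:D - {0}" and Q2: "Q2=cl s' t'" "s':D" "t':D - {0}"
 unfolding frac_carrier by blast
 show "Q1 **\<^bsub>frac\<^esub> Q2:carrier frac" "Q1 \<oplus>\<^bsub>frac\<^esub> Q2:carrier frac"
 unfolding Q1(1) Q2(1) frac_mult[OF Q1(2,3) Q2(2,3)] frac_add[OF Q1(2,3) Q2(2,3)]
 using Q1 Q2 by (auto intro!: frac_I d(4) d(1) simp: nz)
 show "Q1 **\<^bsub>frac\<^esub> Q2=Q2 **\<^bsub>frac\<^esub> Q1" "Q1 \<oplus>\<^bsub>frac\<^esub> Q2=Q2 \<oplus>\<^bsub>frac\<^esub> Q1"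
 unfolding Q1(1) Q2(1) frac_mult[OF Q1(2,3) Q2(2,3)] frac_add[OF Q1(2,3) Q2(2,3)] frac_mult[OF Q2(2,3) Q1(2,3)] frac_add[OF Q2(2,3) Q1(2,3)]
 by (simp_all add: mult.commute add.commute)
 show "\<one>\<^bsub>frac\<^esub> **\<^bsub>frac\<^esub> Q1=Q1" unfolding o Q1(1) frac_mult[OF e(1) e_nz Q1(2,3)] using e(3) Q1 by simp
 have "0 * t + s * e=s" using e(3)[OF Q1(2)] by (simp add: mult.commute)
 thus "\<zero>\<^bsub>frac\<^esub> \<oplus>\<^bsub>frac\<^esub> Q1=Q1"
 unfolding o Q1(1) frac_add[OF d(2) e_nz Q1(2,3)] using e(3) Q1 by simp
 have ms: "- s:D" using d Q1 by blast
 have "cl (- s) t \<oplus>\<^bsub>frac\<^esub> cl s t=cl 0 (t * t)" unfolding frac_add[OF ms Q1(3,2,3)] by simp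
 also have "\<dots>=cl 0 e" using cl_eq[of 0 "t * t" 0 e] d Q1 by simp
 finally show "EX Q2:carrier frac. Q2 \<oplus>\<^bsub>frac\<^esub> Q1=\<zero>\<^bsub>frac\<^esub>" unfolding o Q1(1) using frac_I[OF ms Q1(3)] by blast
 fix Q3 assume "Q3:carrier frac"
 then obtain s'' t'' where Q3: "Q3=cl s'' t''" "s'':D" "t'':D - {0}" unfolding frac_carrier by blast
 note m = frac_mult[OF _ _ _ _] and a = frac_add[OF _ _ _ _]
 show "Q1 **\<^bsub>frac\<^esub> Q2 **\<^bsub>frac\<^esub> Q3=Q1 **\<^bsub>frac\<^esub> (Q2 **\<^bsub>frac\<^esub> Q3)"
 unfolding Q1(1) Q2(1) Q3(1) using Q1 Q2 Q3 d by (simp add: frac_mult mult.assoc)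
 show "Q1 \<oplus>\<^bsub>frac\<^esub> Q2 \<oplus>\<^bsub>frac\<^esub> Q3=Q1 \<oplus>\<^bsub>frac\<^esub> (Q2 \<oplus>\<^bsub>frac\<^esub> Q3)"
 unfolding Q1(1) Q2(1) Q3(1) using Q1 Q2 Q3 d by (simp add: frac_add algebra_simps)
 have "(Q1 \<oplus>\<^bsub>frac\<^esub> Q2) **\<^bsub>frac\<^esub> Q3=cl ((s * t' + s' * t) * s'') (t * t' * t'')"
 unfolding Q1(1) Q2(1) Q3(1) using Q1 Q2 Q3 d by (simp add: frac_add frac_mult)
 moreover have "Q1 **\<^bsub>frac\<^esub> Q3 \<oplus>\<^bsub>frac\<^esub> Q2 **\<^bsub>frac\<^esub> Q3=cl (s * s'' * (t' * t'') + s' * s'' * (t * t'')) (t * t'' * (t' * t''))"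
 unfolding Q1(1) Q2(1) Q3(1) using Q1 Q2 Q3 d by (simp add: frac_add frac_mult)
 moreover have "cl ((s * t' + s' * t) * s'') (t * t' * t'')=cl (s * s'' * (t' * t'') + s' * s'' * (t * t'')) (t * t'' * (t' * t''))"
 using cl_eq[of "(s * t' + s' * t) * s''" "t * t' * t''" "s * s'' * (t' * t'') + s' * s'' * (t * t'')" "t * t'' * (t' * t'')"] Q1 Q2 Q3 d
 by (simp add: algebra_simps)
 ultimately show "(Q1 \<oplus>\<^bsub>frac\<^esub> Q2) **\<^bsub>frac\<^esub> Q3=Q1 **\<^bsub>frac\<^esub> Q3 \<oplus>\<^bsub>frac\<^esub> Q2 **\<^bsub>frac\<^esub> Q3" by simp
qed

definition fr :: "'k => 'k => ('k \<times> 'k) cprod" where "fr s t=cemb frac (cl s t)"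

lemma fr:
 assumes "s:D" "t:D - {0}" "s':D" "t':D - {0}"
 shows "fr s t * fr s' t'=fr (s * s') (t * t')" "fr s t + fr s' t'=fr (s * t' + s' * t) (t * t')"
 "fr s t=fr s' t' \<longleftrightarrow> s * t'=s' * t" "fr s t=0 \<longleftrightarrow> s=0"
proof -
 have c: "cl s t:carrier frac" "cl s' t':carrier frac" "cl 0 e:carrier frac"
 by (intro frac_I assms e_nz subgpD(1)[OF D(1)])+
 show "fr s t * fr s' t'=fr (s * s') (t * t')" "fr s t + fr s' t'=fr (s * t' + s' * t) (t * t')"
 unfolding fr_def frac_mult[OF assms, symmetric] frac_add[OF assms, symmetric] using cemb[OF frac_cring c(1,2)] by simp_all
 show "fr s t=fr s' t' \<longleftrightarrow> s * t'=s' * t" unfolding fr_def cemb(4)[OF frac_cring c(1,2)] by (rule cl_eq[OF assms])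
 have "0=cemb frac (cl 0 e)" using cemb(3)[OF frac_cring c(1,1)] by (simp add: frac_def)
 hence "fr s t=0 \<longleftrightarrow> cl s t=cl 0 e" unfolding fr_def using cemb(4)[OF frac_cring c(1,3)] by simp
 also have "\<dots> \<longleftrightarrow> s=0" using cl_eq[of s t 0 e] assms e e_nz subgpD(1)[OF D(1)] by (simp add: mult.commute)
 finally show "fr s t=0 \<longleftrightarrow> s=0" .
qed

lemma fr_field: "field_set {fr s t | s t. s:D&t:D - {0}} (fr e e)"
proof
 note d = D(2) subgpD[OF D(1)] mult_nz e_nz e(1) nz
 let ?K = "{fr s t | s t. s:D&t:D - {0}}"
 have KI: "fr s t:?K" if "s:D" "t:D - {0}" for s t using that by blast
 have z: "fr 0 e=0" using fr(4)[OF d(2) e_nz e(1) e_nz] by simp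
 have neg: "- fr s t=fr (- s) t" if st: "s:D" "t:D - {0}" for s t
 proof -
 have "fr s t + fr (- s) t=fr (s * t + - s * t) (t * t)" using fr(2)[of s t "- s" t] st d by blast
 also have "\<dots>=0" using fr(4)[of "s * t + - s * t" "t * t" s t] st d by simp
 finally show ?thesis by (simp add: neg_eq_iff_add_eq_0)
 qed
 show "subgp ?K" unfolding subgp_def
 proof (intro conjI ballI)
 show "0:?K" using KI[OF d(2) e_nz] z by simp
 fix x y assume "x:?K" "y:?K"
 then obtain s t s' t' where x: "x=fr s t" "s:D" "t:D - {0}" and y: "y=fr s' t'" "s':D" "t':D - {0}" by blast
 have "x - y=fr s t + fr (- s') t'" using neg[OF y(2,3)] x y by simp
 also have "\<dots>=fr (s * t' + - s' * t) (t * t')" using fr(2)[OF x(2,3) d(3)[OF y(2)] y(3)] by simp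
 also have "\<dots>:?K" using x y by (intro KI d(4) d(1) d(3) mult_nz) auto
 finally show "x - y:?K" .
 qed
 show "fr e e:?K" by (rule KI[OF e(1) e_nz])
 show "fr e e ~= 0" using fr(4)[OF e(1) e_nz e(1) e_nz] e by simp
 fix x assume "x:?K"
 then obtain s t where x: "x=fr s t" "s:D" "t:D - {0}" by blast
 show "fr e e * x=x" unfolding x(1) fr(1)[OF e(1) e_nz x(2,3)] using e(3) x by simp
 show "EX y:?K. x * y=fr e e" if "x ~= 0"
 proof -
 have s: "s:D - {0}" using that fr(4)[OF x(2,3) x(2,3)] x by simp
 have "x * fr t s=fr (s * t) (t * s)" unfolding x(1) using fr(1)[OF x(2,3) _ s] x by blast
 also have "\<dots>=fr e e" using fr(3)[of "s * t" "t * s" e e] x s d by (simp add: mult_ac)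
 finally show ?thesis using KI[OF _ s, of t] x by blast
 qed
 fix y assume "y:?K"
 then obtain s' t' where y: "y=fr s' t'" "s':D" "t':D - {0}" by blast
 have xy: "x * y=fr (s * s') (t * t')" unfolding x(1) y(1) by (rule fr(1)[OF x(2,3) y(2,3)])
 show "x * y:?K" unfolding xy using x y by (intro KI d(1) mult_nz) auto
 show "x=0 | y=0" if "x * y=0"
 proof -
 have "s * s'=0"
 using that fr(4)[OF d(1)[OF x(2) y(2)] mult_nz[OF x(3) y(3)] x(2,3)] unfolding xy by simp
 hence "s=0 | s'=0" by (rule no_zero_div[OF x(2) y(2)])
 thus ?thesis using fr(4)[OF x(2,3) x(2,3)] fr(4)[OF y(2,3) x(2,3)] unfolding x(1) y(1) by simp
 qed
qed
end

section \<open>Abelian action: rank one over a domain of operators\<close>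

locale abelian_module = maximal_module G E A M R H B for G :: "('a, 'm) monoid_scheme" (structure) and E :: "'a => 'b endo" and A M R H B +
 assumes comm_H: "g:H==>h:H==>E g * E h =~ E h * E g"
begin
text \<open>The ring generated by the operators of \<open>H\<close>. It becomes a commutative domain
  only modulo \<open>B\<close>, through the classes in \<open>SB\<close>.\<close>

inductive_set S :: "'b endo set" where
 S_E: "h:H==>E h:S"
| S_diff: "s:S==>t:S==>s - t:S"
| S_mult: "s:S==>t:S==>s * t:S"

lemma S_cp: "s:S==>cp s"
proof (induction rule: S.induct)
 case (S_E h)
 thus ?case using pres_E comm_H by (auto simp: cp_iff)
qed (auto intro: cp_diff cp_mult)

lemma S_pres: "s:S==>pres s" using S_cp cp_pres by blast

lemma S_comm: "s:S==>t:S==>s * t =~ t * s"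
proof (induction s rule: S.induct)
 case (S_E h)
 thus ?case using cp_comm[OF S_cp] eqm_sym by blast
next
 case (S_diff s s')
 thus ?case using eqm_diff by (simp add: left_diff_distrib right_diff_distrib)
next
 case (S_mult s s')
 have "s * (s' * t) =~ s * (t * s')" using S_mult S_pres by (intro eqm_mult_left) auto
 also have "\<dots>=s * t * s'" by (simp add: mult.assoc)
 also have "\<dots> =~ t * s * s'" using S_mult S_pres by (intro eqm_mult_right) auto
 finally show ?case by (simp add: mult.assoc)
qed

lemma S_one: "1:S" using S_E[of \<one>] sg_one[OF sH] by simp

lemma S_zero: "0:S" using S_diff[OF S_one S_one] by simp

lemma S_neg: "s:S==>- s:S" using S_diff[OF S_zero] by simp

lemma S_add: "s:S==>t:S==>s + t:S" using S_diff[OF _ S_neg] by fastforce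

definition cls :: "'b endo => 'b endo set" where "cls s={t. s =~ t}"

definition srep :: "'b endo set => 'b endo" where "srep U=(SOME s. s:S&s:U)"

lemma cls_eq: "cls s=cls t \<longleftrightarrow> s =~ t"
 unfolding cls_def using eqm_sym eqm_trans eqm_refl by blast

lemma srep: "s:S==>srep (cls s):S" "s:S==>srep (cls s) =~ s"
 using someI[of "%t. t:S&t:cls s" s] eqm_sym by (auto simp: srep_def cls_def)

definition SB :: "'b endo set ring" where
 "SB=\<lparr>carrier=cls ` S, monoid.mult=(%U V. cls (srep U * srep V)), one=cls 1, ring.zero=cls 0,
 ring.add=(%U V. cls (srep U + srep V))\<rparr>"

lemma SB_ops:
 assumes "s:S" "t:S"
 shows "cls s **\<^bsub>SB\<^esub> cls t=cls (s * t)" "cls s \<oplus>\<^bsub>SB\<^esub> cls t=cls (s + t)"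
 using srep[OF assms(1)] srep[OF assms(2)] S_pres assms
 by (auto simp: SB_def cls_eq intro!: eqm_mult eqm_add)

lemma SB_cring: "cring SB"
proof (intro cringI abelian_groupI comm_monoidI)
 have o: "\<one>\<^bsub>SB\<^esub>=cls 1" "\<zero>\<^bsub>SB\<^esub>=cls 0" and c: "carrier SB=cls ` S" by (auto simp: SB_def)
 show "\<one>\<^bsub>SB\<^esub>:carrier SB" "\<zero>\<^bsub>SB\<^esub>:carrier SB" unfolding o c using S_one S_zero by blast+
 fix U V assume "U:carrier SB" "V:carrier SB"
 then obtain s t where U: "U=cls s" "s:S" and V: "V=cls t" "t:S" unfolding c by blast
 show "U **\<^bsub>SB\<^esub> V:carrier SB" "U \<oplus>\<^bsub>SB\<^esub> V:carrier SB" "U **\<^bsub>SB\<^esub> V=V **\<^bsub>SB\<^esub> U" "U \<oplus>\<^bsub>SB\<^esub> V=V \<oplus>\<^bsub>SB\<^esub> U"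
 "\<one>\<^bsub>SB\<^esub> **\<^bsub>SB\<^esub> U=U" "\<zero>\<^bsub>SB\<^esub> \<oplus>\<^bsub>SB\<^esub> U=U"
 unfolding o c U(1) V(1) using U V S_one S_zero S_mult S_add S_comm by (auto simp: SB_ops cls_eq add.commute)
 have "cls (- s) \<oplus>\<^bsub>SB\<^esub> cls s=cls 0" using U S_neg by (simp add: SB_ops)
 thus "EX V:carrier SB. V \<oplus>\<^bsub>SB\<^esub> U=\<zero>\<^bsub>SB\<^esub>" unfolding o c U(1) using S_neg[OF U(2)] by blast
 fix W assume "W:carrier SB"
 then obtain r where W: "W=cls r" "r:S" unfolding c by blast
 show "U **\<^bsub>SB\<^esub> V **\<^bsub>SB\<^esub> W=U **\<^bsub>SB\<^esub> (V **\<^bsub>SB\<^esub> W)" "U \<oplus>\<^bsub>SB\<^esub> V \<oplus>\<^bsub>SB\<^esub> W=U \<oplus>\<^bsub>SB\<^esub> (V \<oplus>\<^bsub>SB\<^esub> W)"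
 "(U \<oplus>\<^bsub>SB\<^esub> V) **\<^bsub>SB\<^esub> W=U **\<^bsub>SB\<^esub> W \<oplus>\<^bsub>SB\<^esub> V **\<^bsub>SB\<^esub> W"
 unfolding U(1) V(1) W(1) using U V W S_mult S_add by (simp_all add: SB_ops mult.assoc add.assoc distrib_right)
qed

definition sc :: "'b endo => 'b endo cprod" where "sc s=cemb SB (cls s)"

lemma sc:
 assumes "s:S" "t:S"
 shows "sc (s * t)=sc s * sc t" "sc (s + t)=sc s + sc t" "sc s=sc t \<longleftrightarrow> s =~ t" "sc s=0 \<longleftrightarrow> s =~ 0" "sc (- s)=- sc s"
proof -
 have c: "cls s:carrier SB" "cls t:carrier SB" "cls 0:carrier SB" "cls (- s):carrier SB"
 using assms S_zero S_neg by (auto simp: SB_def)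
 note ce = cemb[OF SB_cring]
 show "sc (s * t)=sc s * sc t" "sc (s + t)=sc s + sc t" "sc s=sc t \<longleftrightarrow> s =~ t"
 unfolding sc_def using ce(1,2,4)[OF c(1,2)] assms by (simp_all add: SB_ops cls_eq)
 have z: "cemb SB (cls 0)=0" using ce(3)[OF c(1,1)] by (simp add: SB_def)
 thus "sc s=0 \<longleftrightarrow> s =~ 0" unfolding sc_def using ce(4)[OF c(1,3)] by (simp add: cls_eq)
 have "sc (- s) + sc s=sc (- s + s)"
 unfolding sc_def using ce(1)[OF c(4,1)] assms S_neg by (simp add: SB_ops)
 thus "sc (- s)=- sc s" using z by (simp add: sc_def eq_neg_iff_add_eq_0)
qed

lemma sc_domain: "domain_set (sc ` S) (sc 1)"
proof
 show "subgp (sc ` S)" unfolding subgp_def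
 proof (intro conjI ballI)
 have "sc 0=0" using sc(4)[OF S_zero S_zero] by simp
 thus "0:sc ` S" using S_zero by force
 fix x y assume "x:sc ` S" "y:sc ` S"
 then obtain s t where "x=sc s" "s:S" "y=sc t" "t:S" by blast
 hence "x - y=sc (s + - t)" "s + - t:S" using sc(2)[of s "- t"] sc(5) S_neg S_diff by simp_all
 thus "x - y:sc ` S" by blast
 qed
 show "sc 1:sc ` S" using S_one by blast
 show "sc 1 ~= 0" using sc(4)[OF S_one S_one] one_not_0 by simp
 fix x assume "x:sc ` S"
 then obtain s where x: "x=sc s" "s:S" by blast
 thus "sc 1 * x=x" using sc(1)[OF S_one x(2)] by simp
 fix y assume "y:sc ` S"
 then obtain t where y: "y=sc t" "t:S" by blast
 show "x * y:sc ` S" using x y sc(1)[OF x(2) y(2)] S_mult by force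
 show "x=0 | y=0" if "x * y=0"
 proof -
 have "s * t =~ 0" using that sc(1)[OF x(2) y(2)] sc(4)[OF S_mult[OF x(2) y(2)] x(2)] x y by simp
 thus ?thesis using cp_cancel[OF S_cp[OF x(2)] _ S_pres[OF y(2)]] sc(4) x y by blast
 qed
qed

text \<open>By uniformity \<open>M / B\<close> has rank one over the domain \<open>S\<close> modulo \<open>B\<close>.\<close>

lemma rank_one:
 assumes a0: "a0:M" "a0 ~: B" and v: "v:M"
 shows "EX s:S. EX t:S. ~ t =~ 0&t$v - s$a0:B"
proof (cases "v:B")
 case True
 thus ?thesis using S_zero S_one one_not_0 by (intro bexI[of _ 0] bexI[of _ 1]) auto
next
 case False
 have cyc: "bm H (ssum ((%s. s$u) ` S) B)" "B<=ssum ((%s. s$u) ` S) B" "u:ssum ((%s. s$u) ` S) B"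
 if u: "u:M" for u
 proof -
 let ?U = "(%s. s$u) ` S"
 have U: "sm H ?U" unfolding sm_def subgp_def
 proof (intro conjI ballI)
 show "0:?U" using S_zero by (auto intro!: image_eqI[of _ _ 0])
 show "x - y:?U" if "x:?U" "y:?U" for x y
 using that S_diff by (auto simp flip: minus_app)
 show "E h$x:?U" if "h:H" "x:?U" for h x using that S_mult[OF S_E] by (auto simp flip: times_app)
 qed
 show BU: "B<=ssum ?U B" by (rule ssum_ub(2)[OF smD(1)[OF U] smD(1)[OF B_sm(1)]])
 have "?U<=M" using S_pres u by (auto simp: pres_def)
 hence "ssum ?U B<=M" using ssum_least[OF smD(1)[OF M]] B_sm(3) by blast
 thus "bm H (ssum ?U B)" using sm_ssum[OF U B_sm(1)] BU B_sm(2) by (auto simp: bm_def)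
 have "1$u + 0:ssum ?U B" by (intro ssumI imageI S_one b(1))
 thus "u:ssum ?U B" by simp
 qed
 let ?B1 = "ssum ((%s. s$v) ` S) B" and ?B2 = "ssum ((%s. s$a0) ` S) B"
 have "?B1 Int ?B2 ~= B"
 by (rule maxm_uniform[OF max cyc(1,2)[OF v] _ cyc(1,2)[OF a0(1)]]) (use cyc(3) v a0 False in auto)
 moreover have "B<=?B1 Int ?B2" using cyc(2) v a0 by blast
 ultimately obtain w where "w:?B1" "w:?B2" "w ~: B" by blast
 then obtain s t c d where w: "w=t$v + c" "w=s$a0 + d" "t:S" "s:S" "c:B" "d:B" "w ~: B"
 unfolding ssum_def by blast
 have "~ t =~ 0" using w(1,5,7) b(3)[of "t$v" c] v by (auto simp: eqm_0_app)
 moreover have "t$v - s$a0=d - c" using w(1,2) by (simp add: algebra_simps)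
 ultimately show ?thesis using w(3,4) b(4)[OF w(6,5)] by metis
qed

theorem character_exists:
 "EX (K :: ('b endo cprod \<times> 'b endo cprod) cprod set) e kh rh. field_set K e
&(ALL g:H. kh g:K - {0})&(ALL g:H. ALL h:H. kh (g**h)=kh g * kh h)&(ALL g:H. kh g=e \<longleftrightarrow> E g =~ 1)
&(ALL v:M. rh v:K&(rh v=0 \<longleftrightarrow> v:B))&(ALL u:M. ALL v:M. rh (u + v)=rh u + rh v)
&(ALL g:H. ALL v:M. rh (E g$v)=kh g * rh v)"
proof -
 interpret D: domain_set "sc ` S" "sc 1" by (rule sc_domain)
 have dI: "sc s:sc ` S" if "s:S" for s using that by blast
 have dN: "sc s:sc ` S - {0}" if "s:S" "~ s =~ 0" for s using that sc(4) by blast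
 note d1 = dN[OF S_one one_not_0]
 obtain a0 where a0: "a0:M" "a0 ~: B" using one_not_0 by (auto simp: eqm_0_app)
 define kh where "kh g=D.fr (sc (E g)) (sc 1)" for g
 define K where "K={D.fr s t | s t. s:sc ` S&t:sc ` S - {0}}"
 have KI: "D.fr s t:K" if "s:sc ` S" "t:sc ` S - {0}" for s t using that unfolding K_def by blast
 \<comment> \<open>The pair \<open>(s, t)\<close> says that \<open>v\<close> has the coordinate
   \<open>s / t\<close> with respect to \<open>a0\<close>; \<open>inj\<close> shows that the
   coordinate does not depend on the pair.\<close>
 define P where "P v p \<longleftrightarrow> fst p:S&snd p:S&~ snd p =~ 0&snd p$v - fst p$a0:B" for v p
 define rh where "rh v=(let p=SOME p. P v p in D.fr (sc (fst p)) (sc (snd p)))" for v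
 have inj: "s * t' =~ s' * t" if "P v (s, t)" "P v (s', t')" "v:M" for v s t s' t'
 proof -
 note st = that[unfolded P_def, simplified]
 have "t'$(t$v - s$a0):B" "t$(t'$v - s'$a0):B" using st S_pres unfolding pres_def by blast+
 moreover have "(t' * t)$v - (t * t')$v:B" using S_comm[of t' t] st by (auto simp: eqm_def)
 ultimately have "((t' * t)$v - (t * t')$v) - t'$(t$v - s$a0) + t$(t'$v - s'$a0):B"
 using b(3,4) by blast
 hence 1: "(t' * s - t * s')$a0:B" by (simp add: app_diff minus_app algebra_simps)
 have "cp (t' * s - t * s')" using st by (intro S_cp S_diff S_mult) auto
 hence "t' * s - t * s' =~ 0" using cp_cases[OF _ _ a0(1) 1] a0(2) by blast
 hence "t' * s =~ t * s'" by (simp add: eqm_diff_0)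
 thus ?thesis using S_comm[of s t'] S_comm[of t s'] st eqm_trans by blast
 qed
 have l: "rh v=D.fr (sc s) (sc t)" if v: "v:M" and st: "P v (s, t)" for v s t
 proof -
 obtain s' t' where p: "(SOME p. P v p)=(s', t')" by (cases "SOME p. P v p") auto
 have P': "P v (s', t')" unfolding p[symmetric] by (rule someI[of "P v", OF st])
 have "sc s' * sc t=sc s * sc t'"
 using sc(1,3) inj[OF P' st v] st P' S_mult unfolding P_def by (metis fst_conv snd_conv)
 hence "D.fr (sc s') (sc t')=D.fr (sc s) (sc t)"
 using D.fr(3)[OF dI dN dI dN] st P' by (simp add: P_def)
 thus ?thesis by (simp add: rh_def p Let_def)
 qed
 have ex: "EX s t. P v (s, t)" if "v:M" for v using rank_one[OF a0 that] by (auto simp: P_def)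
 have E0: "~ E g =~ 0" if g: "g:H" for g
 proof
 assume "E g =~ 0"
 from eqm_mult_left[OF pres_E[OF sg_inv[OF sH g]] this] show False
 using one_not_0 Hc[OF g] by (simp flip: E_mult)
 qed
 have chi: "kh g:K - {0}" if "g:H" for g
 using KI[OF dI d1] D.fr(4)[OF dI d1 dI d1] sc(4) E0[OF that] S_E[OF that] by (auto simp: kh_def)
 have "kh (g**h)=kh g * kh h" if "g:H" "h:H" for g h
 using D.fr(1)[OF dI[OF S_E] d1 dI[OF S_E] d1, OF that] sc(1)[OF S_E S_E, OF that] sc(1)[OF S_one S_one] that Hc
 by (simp add: kh_def E_mult)
 moreover have "kh g=D.fr (sc 1) (sc 1) \<longleftrightarrow> E g =~ 1" if "g:H" for g
 using D.fr(3)[OF dI[OF S_E[OF that]] d1 dI[OF S_one] d1] sc(3)[OF S_E[OF that] S_one] D.e(3)[OF dI[OF S_E[OF that]]]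
 D.e(3)[OF dI[OF S_one]] by (simp add: kh_def mult.commute)
 moreover have "rh v:K&(rh v=0 \<longleftrightarrow> v:B)" if v: "v:M" for v
 proof -
 obtain s t where st: "P v (s, t)" using ex[OF v] by blast
 have q: "s:S" "t:S" "~ t =~ 0" "t$v - s$a0:B" using st by (auto simp: P_def)
 have "rh v=0 \<longleftrightarrow> s =~ 0"
 unfolding l[OF v st] using D.fr(4)[OF dI[OF q(1)] dN[OF q(2,3)] dI[OF q(1)] dN[OF q(2,3)]] sc(4)[OF q(1,1)] by simp
 also have "\<dots> \<longleftrightarrow> v:B"
 proof
 assume "s =~ 0"
 hence "s$a0:B" using a0(1) by (simp add: eqm_0_app)
 from b(3)[OF q(4) this] show "v:B" using cp_cases[OF S_cp[OF q(2)] q(3) v] by simp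
 next
 assume "v:B"
 hence "t$v:B" using S_pres[OF q(2)] by (simp add: pres_def)
 from b(4)[OF this q(4)] have "s$a0:B" by simp
 thus "s =~ 0" using cp_cases[OF S_cp[OF q(1)] _ a0(1)] a0(2) by blast
 qed
 finally show ?thesis using KI[OF dI[OF q(1)] dN[OF q(2,3)]] l[OF v st] by simp
 qed
 moreover have "rh (u + v)=rh u + rh v" if u: "u:M" and v: "v:M" for u v
 proof -
 obtain s t where st: "P u (s, t)" using ex[OF u] by blast
 obtain s' t' where st': "P v (s', t')" using ex[OF v] by blast
 have q: "s:S" "t:S" "~ t =~ 0" "t$u - s$a0:B" using st by (auto simp: P_def)
 have q': "s':S" "t':S" "~ t' =~ 0" "t'$v - s'$a0:B" using st' by (auto simp: P_def)
 have c: "(t * t')$w - (t' * t)$w:B" "(t' * s)$w - (s * t')$w:B" "(t * s')$w - (s' * t)$w:B" if "w:M" for w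
 using S_comm q q' that unfolding eqm_def by blast+
 have 1: "t'$(t$u - s$a0):B" "t$(t'$v - s'$a0):B" using S_pres q q' unfolding pres_def by blast+
 have "(((t * t')$u - (t' * t)$u) + t'$(t$u - s$a0) + ((t' * s)$a0 - (s * t')$a0))
 + (t$(t'$v - s'$a0) + ((t * s')$a0 - (s' * t)$a0)):B"
 by (rule b(3)[OF b(3)[OF b(3)[OF c(1)[OF u] 1(1)] c(2)[OF a0(1)]] b(3)[OF 1(2) c(3)[OF a0(1)]]])
 hence "(t * t')$(u + v) - (s * t' + s' * t)$a0:B"
 by (simp add: app_diff app_add plus_app algebra_simps)
 moreover have "~ t * t' =~ 0" using cp_mult_nz S_cp q q' by blast
 ultimately have P: "P (u + v) (s * t' + s' * t, t * t')" using q q' by (simp add: P_def S_add S_mult)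
 have "rh (u + v)=D.fr (sc (s * t' + s' * t)) (sc (t * t'))" by (rule l[OF m(3)[OF u v] P])
 also have "\<dots>=D.fr (sc s) (sc t) + D.fr (sc s') (sc t')"
 using D.fr(2)[OF dI[OF q(1)] dN[OF q(2,3)] dI[OF q'(1)] dN[OF q'(2,3)]] q q' by (simp add: sc S_mult)
 finally show ?thesis using l[OF u st] l[OF v st'] by simp
 qed
 moreover have "rh (E g$v)=kh g * rh v" if g: "g:H" and v: "v:M" for g v
 proof -
 obtain s t where st: "P v (s, t)" using ex[OF v] by blast
 have q: "s:S" "t:S" "~ t =~ 0" "t$v - s$a0:B" using st by (auto simp: P_def)
 have gv: "E g$v:M" "E g$(t$v - s$a0):B" using pres_E[OF g] v q by (auto simp: pres_def)
 have "t$E g$v - E g$t$v:B" using cp_comm[OF S_cp[OF q(2)] g] v by (simp add: eqm_def)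
 from b(3)[OF this gv(2)] have "t$E g$v - (E g * s)$a0:B" by (simp add: app_diff)
 hence P: "P (E g$v) (E g * s, t)" using q g by (simp add: P_def S_mult S_E)
 have "rh (E g$v)=D.fr (sc (E g * s)) (sc t)" by (rule l[OF gv(1) P])
 also have "\<dots>=kh g * D.fr (sc s) (sc t)"
 using D.fr(1)[OF dI[OF S_E[OF g]] d1 dI[OF q(1)] dN[OF q(2,3)]] sc(1)[OF S_E[OF g] q(1)] D.e(3)[OF dI[OF q(2)]]
 by (simp add: kh_def)
 finally show ?thesis using l[OF v st] by simp
 qed
 moreover have "field_set K (D.fr (sc 1) (sc 1))" unfolding K_def by (rule D.fr_field)
 ultimately show ?thesis using chi by (intro exI[of _ K] exI[of _ "D.fr (sc 1) (sc 1)"] exI[of _ kh] exI[of _ rh]) simp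
qed
end

section \<open>Crossed homomorphisms into a field\<close>

locale character = group G + field_set K e for G (structure) and K :: "'k::comm_ring_1 set" and e +
 fixes Y and kh :: "'a => 'k"
 assumes Y: "subgroup Y G" and chi: "g:Y==>kh g:K - {0}"
 and chi_mult: "g:Y==>h:Y==>kh (g**h)=kh g * kh h"
begin

lemma Yc: "g:Y==>g:carrier G" using sg_mem[OF Y] .
lemmas Y_closed = subgroup_closed(1,3,4,7)[OF Y]

lemma chi_K: "g:Y==>kh g:K" "g:Y==>kh g ~= 0" using chi by auto

lemma e_mult: "x:K==>e * x=x" "x:K==>x * e=x"
 using e(3)[of x] by (auto simp: mult.commute[of x])

lemma chi_one [simp]: "kh \<one>=e"
proof -
 have "kh \<one> * kh \<one>=kh \<one> * e" using chi_mult[of \<one> \<one>] chi_K[of \<one>] e_mult Y_closed(1) by simp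
 thus ?thesis using cancel[of "kh \<one>" e "kh \<one>"] chi_K[of \<one>] e(1) Y_closed(1) by simp
qed

lemma chi_inv: "g:Y==>kh g * kh (inv g)=e"
 using chi_mult[of g "inv g"] Y_closed(3) Yc by simp

lemma chi_inv_eq: "kh g=kh h==>g:Y==>h:Y==>kh (inv g)=kh (inv h)"
 using chi_inv[of g] chi_inv[of h] cancel[of "kh (inv g)" "kh (inv h)" "kh g"] chi_K Y_closed(3) by simp

lemma chi_comm_mult: "g:Y==>h:Y==>kh (g**h)=kh (h**g)" by (simp add: chi_mult mult.commute)

lemma chi_comm [simp]: "g:Y==>h:Y==>kh (comm G g h)=e"
proof -
 assume gh: "g:Y" "h:Y"
 have "comm G g h**(h**g)=g**h" using gh Yc by (simp add: comm_def m_assoc inv_solve_left')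
 hence "kh (comm G g h) * kh (h**g)=kh (g**h)" using chi_mult gh Y_closed by metis
 hence "kh (h**g) * kh (comm G g h)=kh (h**g) * e"
 using chi_comm_mult[OF gh] e_mult(2)[OF chi_K(1)[OF Y_closed(2)[OF gh(2,1)]]] by (simp add: mult.commute)
 thus ?thesis using cancel[of "kh (comm G g h)" e "kh (h**g)"] chi_K e(1) gh Y_closed by simp
qed

lemma ker_subgroup: "subgroup {g:Y. kh g=e} G"
proof (rule subgroupI)
 show "{g:Y. kh g=e} ~= {}" using Y_closed(1) by auto
 show "{g:Y. kh g=e}<=carrier G" using Yc by auto
 fix g assume g: "g:{g:Y. kh g=e}"
 hence "kh (g**inv g)=e * kh (inv g)" using chi_mult[of g "inv g"] Y_closed by simp
 thus "inv g:{g:Y. kh g=e}" using g Yc Y_closed chi_K e_mult by simp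
 fix h assume "h:{g:Y. kh g=e}"
 thus "g**h:{g:Y. kh g=e}" using g Y_closed chi_mult e_mult e(1) by simp
qed

definition equivariant :: "'a set => ('a => 'k) => bool" where
 "equivariant A l \<longleftrightarrow> subgroup A G&A<=Y&(ALL g:Y. ALL a:A. g**a**inv g:A)&(ALL a:A. kh a=e&l a:K)
&(ALL a:A. ALL b:A. l (a**b)=l a + l b)&(ALL g:Y. ALL a:A. l (g**a**inv g)=kh g * l a)"

text \<open>Equivalently, \<open>g\<close> acts on \<open>K\<close> by the affine map that sends
  \<open>x\<close> to \<open>kh g x + dl g\<close>, and this is a homomorphism.\<close>

definition crossed :: "('a => 'k) => bool" where
 "crossed dl \<longleftrightarrow> (ALL g:Y. dl g:K)&(ALL g:Y. ALL h:Y. dl (g**h)=dl g + kh g * dl h)"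

text \<open>If \<open>Y / A\<close> is nilpotent and \<open>kh \<noteq> 1\<close>, then the relevant first and second cohomology vanishes;
 hence \<open>l\<close> extends.\<close>

theorem split_extension:
 assumes t: "t:Y" "kh t ~= e" and A: "equivariant A l" and n: "lcs G Y n<=A"
 shows "EX dl. crossed dl&(ALL a:A. dl a=l a)"
 using A n
proof (induction n arbitrary: A l)
 case (0 A l)
 hence "kh t=e" using t(1) by (auto simp: equivariant_def)
 thus ?case using t(2) by blast
next
 case (Suc n A l)
 have A: "subgroup A G" "A<=Y" and Aconj: "!!g a. g:Y==>a:A==>g**a**inv g:A"
 and chiA: "!!a. a:A==>kh a=e" and l: "!!a. a:A==>l a:K"
 "!!a b. a:A==>b:A==>l (a**b)=l a + l b" "!!g a. g:Y==>a:A==>l (g**a**inv g)=kh g * l a"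
 using Suc.prems(1) by (auto simp: equivariant_def)
 have lone: "l \<one>=0" using l(2)[of \<one> \<one>] sg_one[OF A(1)] by simp
 have linv: "l (inv a)=- l a" if "a:A" for a
 using l(2)[of a "inv a"] that lone sg_inv[OF A(1)] sg_mem[OF A(1)]
 by (simp add: eq_neg_iff_add_eq_0 add.commute)
 have A_comm: "comm G g a:A" "l (comm G g a)=(kh g - e) * l a" "comm G a g:A" if "g:Y" "a:A" for g a
 proof -
 have ai: "inv a:A" "a:carrier G" "g:carrier G" "a:Y" using that A Yc sg_inv[OF A(1)] by auto
 show 1: "comm G g a:A" unfolding comm_def using Aconj[OF that] ai sg_mult[OF A(1)] by blast
 show "l (comm G g a)=(kh g - e) * l a"
 unfolding comm_def using l(2)[OF Aconj[OF that] ai(1)] l(3)[OF that] linv[OF that(2)] e_mult l(1)[OF that(2)]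
 by (simp add: left_diff_distrib)
 show "comm G a g:A" using sg_inv[OF A(1) 1] ai by (simp add: inv_comm)
 qed
 let ?L = "lcs G Y n"
 have L: "subgroup ?L G" "?L<=Y" using lcs_subgroup[OF Y] lcs_subset[OF Y] by blast+
 \<comment> \<open>The centre of \<open>Y\<close> modulo \<open>A\<close>. It contains
   \<open>?L\<close>, so the induction can continue with \<open>C\<close> and \<open>n\<close> once
   \<open>l\<close> has been extended to \<open>C\<close>.\<close>
 define C where "C={c:Y. ALL g:Y. comm G c g:A}"
 have AC: "A<=C" using A_comm A by (auto simp: C_def)
 have LC: "?L<=C" using L(2) comm_in_lcs Suc.prems(2) by (fastforce simp: C_def)
 have CY: "c:Y" "c:carrier G" if "c:C" for c using that Yc by (auto simp: C_def)
 have Cg: "comm G c g:A" "comm G g c:A" if "c:C" "g:Y" for c g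
 proof -
 show 1: "comm G c g:A" using that by (simp add: C_def)
 show "comm G g c:A" using sg_inv[OF A(1) 1] that CY Yc by (simp add: inv_comm)
 qed
 have C: "subgroup C G"
 proof (rule subgroupI)
 show "C<=carrier G" using CY by blast
 show "C ~= {}" using AC sg_one[OF A(1)] by blast
 fix c assume c: "c:C"
 have "comm G (inv c) g:A" if g: "g:Y" for g
 proof -
 have "inv c**inv (comm G c g)**inv (inv c):A"
 using c g CY Cg sg_inv[OF A(1)] Y_closed by (intro Aconj) auto
 thus ?thesis using c g CY Yc by (simp add: comm_inv_left)
 qed
 thus "inv c:C" using Y_closed(3)[OF CY(1)[OF c]] unfolding C_def by blast
 fix d assume d: "d:C"
 have "comm G (c**d) g:A" if g: "g:Y" for g
 using comm_mult_left[of c d g] c d g CY Yc Cg Aconj sg_mult[OF A(1)] by simp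
 thus "c**d:C" using Y_closed(2)[OF CY(1)[OF c] CY(1)[OF d]] unfolding C_def by blast
 qed
 have Kd: "x - y:K" "x + y:K" "x * y:K" if "x:K" "y:K" for x y using that by (simp_all add: subgpD(3,4)[OF D(1)] D(2))
 show ?case
 proof (cases "EX z:C. kh z ~= e")
 case True
 then obtain z where z: "z:C" "kh z ~= e" by blast
 obtain i where i: "i:K" "(kh z - e) * i=e" using inverse[of "kh z - e"] z Kd(1) chi_K CY e(1) by auto
 \<comment> \<open>As \<open>z\<close> is central modulo \<open>A\<close>, commutators with
   \<open>z\<close> lie in \<open>A\<close> and give a crossed homomorphism; on \<open>A\<close> it
   is \<open>kh z - e\<close> times \<open>l\<close>, whence the factor \<open>i\<close>.\<close>
 have "crossed (%g. i * l (comm G z g))" unfolding crossed_def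
 proof (intro conjI ballI)
 show "i * l (comm G z g):K" if "g:Y" for g using i l(1) Cg[OF z(1) that] Kd by simp
 fix g h assume gh: "g:Y" "h:Y"
 have "l (comm G z (g**h))=l (comm G z g) + kh g * l (comm G z h)"
 using comm_mult_right[of z g h] z gh CY Yc l(2)[OF Cg(1)[OF z(1) gh(1)] Aconj[OF gh(1) Cg(1)[OF z(1) gh(2)]]]
 l(3)[OF gh(1) Cg(1)[OF z(1) gh(2)]] by simp
 thus "i * l (comm G z (g**h))=i * l (comm G z g) + kh g * (i * l (comm G z h))" by (simp add: algebra_simps)
 qed
 moreover have "i * l (comm G z a)=l a" if a: "a:A" for a
 using A_comm(2)[OF CY(1)[OF z(1)] a] i(2) e_mult l(1)[OF a] by (metis mult.assoc mult.commute)
 ultimately show ?thesis by blast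
 next
 case False
 hence chiC: "kh c=e" if "c:C" for c using that by blast
 have te: "kh t - e:K" "kh t - e ~= 0" using t Kd chi_K e(1) by auto
 obtain i where i: "i:K" "(kh t - e) * i=e" using inverse[OF te] by blast
 \<comment> \<open>The only possible extension: \<open>comm G t c\<close> is the product of
   \<open>t c t^-1\<close> and \<open>c^-1\<close>, which forces the value
   \<open>(kh t - e) l1 c\<close> of \<open>l\<close> there.\<close>
 define l1 where "l1 c=i * l (comm G t c)" for c
 have tl1: "(kh t - e) * l1 c=l (comm G t c)" if "c:C" for c
 proof -
 have "(kh t - e) * l1 c=((kh t - e) * i) * l (comm G t c)" by (simp only: l1_def mult.assoc)
 thus ?thesis using e_mult(1)[OF l(1)[OF Cg(2)[OF that t(1)]]] by (simp only: i(2))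
 qed
 have l1K: "l1 c:K" if "c:C" for c using i l(1) Cg[OF that t(1)] Kd by (simp add: l1_def)
 have l1A: "l1 a=l a" if a: "a:A" for a
 unfolding l1_def A_comm(2)[OF t(1) a] using i(2) e_mult l(1)[OF a] by (metis mult.assoc mult.commute)
 have l1_mult: "l1 (c**d)=l1 c + l1 d" if cd: "c:C" "d:C" for c d
 proof -
 have "l (comm G t (c**d))=l (comm G t c) + kh c * l (comm G t d)"
 using comm_mult_right[of t c d] t cd CY Yc l(2)[OF Cg(2)[OF cd(1) t(1)] Aconj[OF CY(1)[OF cd(1)] Cg(2)[OF cd(2) t(1)]]]
 l(3)[OF CY(1)[OF cd(1)] Cg(2)[OF cd(2) t(1)]] by simp
 thus ?thesis using chiC[OF cd(1)] e_mult l(1)[OF Cg(2)[OF cd(2) t(1)]] by (simp add: l1_def distrib_left)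
 qed
 have l1_conj: "l1 (g**c**inv g)=kh g * l1 c" if g: "g:Y" and c: "c:C" for g c
 proof -
 define bt where "bt h=l (comm G h c)" for h
 have bA: "comm G h c:A" if "h:Y" for h using Cg(2)[OF c that] .
 have bK: "bt h:K" if "h:Y" for h using l(1)[OF bA[OF that]] by (simp add: bt_def)
 have b_mult: "bt (h**h')=bt h + kh h * bt h'" if "h:Y" "h':Y" for h h'
 using comm_mult_left[of h h' c] that c CY Yc l(2)[OF Aconj[OF that(1) bA[OF that(2)]] bA[OF that(1)]]
 l(3)[OF that(1) bA[OF that(2)]] by (simp add: bt_def add.commute)
 have swap: "bt (comm G h h')=(bt h + kh h * bt h') - (bt h' + kh h' * bt h)" if h: "h:Y" "h':Y" for h h'
 proof -
 have "comm G h h'**(h'**h)=h**h'" using h Yc by (simp add: comm_def m_assoc inv_solve_left')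
 hence "bt (h**h')=bt (comm G h h') + e * bt (h'**h)" using b_mult[of "comm G h h'" "h'**h"] h Y_closed by simp
 hence "bt (h**h')=bt (comm G h h') + bt (h'**h)" using e_mult(1)[OF bK[OF Y_closed(2)[OF h(2,1)]]] by simp
 thus ?thesis unfolding b_mult[OF h] b_mult[OF h(2,1)] by (simp add: algebra_simps)
 qed
 \<comment> \<open>For \<open>h\<close> in the kernel of \<open>kh\<close>, passing to
   \<open>comm G h t\<close> multiplies \<open>bt h\<close> by the nonzero factor
   \<open>e - kh t\<close>. So vanishing climbs from \<open>A\<close> up the lower central series;
   for \<open>comm G t g\<close> it determines \<open>bt g\<close>.\<close>
 have zero: "bt h=0" if "h:lcs G Y (Suc n - j)" "kh h=e" "j<=Suc n" for h j
 using that
 proof (induction j arbitrary: h)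
 case 0
 hence hA: "h:A" using Suc.prems(2) by auto
 have "l (comm G c h)=0" using A_comm(2)[OF CY(1)[OF c] hA] chiC[OF c] by simp
 moreover have "comm G h c=inv (comm G c h)" using hA A Yc CY c by (auto simp: inv_comm)
 ultimately show ?case using linv[OF A_comm(1)[OF CY(1)[OF c] hA]] by (simp add: bt_def)
 next
 case (Suc j)
 have hY: "h:Y" using Suc.prems lcs_subset[OF Y] by blast
 have "comm G h t:lcs G Y (Suc (Suc n - Suc j))" by (rule comm_in_lcs[OF Suc.prems(1) t(1)])
 moreover have "Suc (Suc n - Suc j)=Suc n - j" using Suc.prems(3) by simp
 ultimately have "comm G h t:lcs G Y (Suc n - j)" by metis
 hence "bt (comm G h t)=0" by (rule Suc.IH) (use Suc.prems(3) hY t(1) in auto)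
 hence "(bt h + bt t) - (bt t + kh t * bt h)=0"
 using swap[OF hY t(1)] Suc.prems(2) e_mult(1)[OF bK[OF t(1)]] by simp
 hence "(kh t - e) * bt h=0" using e_mult(1)[OF bK[OF hY]] by (simp add: left_diff_distrib)
 thus ?case using no_zero_div[OF te(1) bK[OF hY]] te(2) by blast
 qed
 have "comm G t g:lcs G Y 0" using t g Y_closed by simp
 hence "bt (comm G t g)=0" using zero[of "comm G t g" "Suc n"] t g by simp
 hence "(kh t - e) * bt g=(kh g - e) * bt t"
 using swap[OF t(1) g] e_mult(1)[OF bK[OF g]] e_mult(1)[OF bK[OF t(1)]] by (simp add: left_diff_distrib algebra_simps)
 also have "\<dots>=(kh t - e) * ((kh g - e) * l1 c)" unfolding bt_def tl1[OF c, symmetric] by (simp only: mult_ac)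
 finally have bg: "bt g=(kh g - e) * l1 c"
 using cancel[OF bK[OF g] _ te, of "(kh g - e) * l1 c"] Kd chi_K g e(1) l1K[OF c] by simp
 have "g**c**inv g=comm G g c**c" using g c Yc CY by (simp add: comm_def m_assoc)
 moreover have "comm G g c:C" using bA[OF g] AC by blast
 ultimately have "l1 (g**c**inv g)=bt g + l1 c" using l1_mult c l1A[OF bA[OF g]] by (simp add: bt_def)
 thus ?thesis using bg e_mult l1K[OF c] by (simp add: left_diff_distrib)
 qed
 have Cconj: "g**c**inv g:C" if "g:Y" "c:C" for g c
 proof -
 have "g**c**inv g=comm G g c**c" using that Yc CY by (simp add: comm_def m_assoc)
 thus ?thesis using Cg(2)[OF that(2,1)] AC sg_mult[OF C _ that(2)] by auto
 qed
 have "equivariant C l1"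
 unfolding equivariant_def using C CY Cconj chiC l1K l1_mult l1_conj by blast
 from Suc.IH[OF this LC] obtain dl :: "'a => 'k" where dl: "crossed dl" "!!c. c:C==>dl c=l1 c" by blast
 have "ALL a:A. dl a=l a" using dl(2) l1A AC by auto
 hence "EX dl. crossed dl&(ALL a:A. dl a=l a)" using dl(1) by blast
 thus ?thesis .
 qed
qed

section \<open>Torsion and divisibility in the value group\<close>

lemma e_power: "e * e ^ n=e"
 by (induction n) (simp_all add: e_mult e(1) mult.left_commute)

lemma chi_pow: "g:Y==>kh (g [^] (n::nat))=e * kh g ^ n"
proof (induction n)
 case (Suc n)
 have "g [^] n:Y" using subgroup_closed(6)[OF Y] Suc by blast
 hence "kh (g [^] n**g)=kh (g [^] n) * kh g" using chi_mult Suc by blast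
 thus ?case using Suc by (simp add: mult_ac)
qed (simp add: e_mult e(1))

lemma power_character: "character G K e Y (%g. kh (g [^] (N::nat)))"
proof (intro character.intro is_group field_set_axioms character_axioms.intro Y)
 have gN: "g [^] N:Y" if "g:Y" for g using subgroup_closed(6)[OF Y that] .
 show "kh (g [^] N):K - {0}" if "g:Y" for g using chi gN[OF that] by blast
 fix g h assume gh: "g:Y" "h:Y"
 have "kh ((g**h) [^] N)=e * (kh g * kh h) ^ N" using chi_pow chi_mult gh Y_closed(2) by simp
 also have "\<dots>=(e * e) * (kh g * kh h) ^ N" using e_mult(1)[OF e(1)] by simp
 also have "\<dots>=(e * kh g ^ N) * (e * kh h ^ N)" by (simp only: power_mult_distrib mult_ac)
 finally show "kh ((g**h) [^] N)=kh (g [^] N) * kh (h [^] N)" using chi_pow gh by simp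
qed

lemma chi_pow_mult: "g:Y==>kh (g [^] (n::nat))=e==>kh (g [^] (n * k))=e"
 using chi_pow[OF subgroup_closed(6)[OF Y], of g n k] Yc e_power by (simp add: nat_pow_pow)

lemma uniform_exponent:
 assumes F: "finite F" "F<=Y" "T<=generate G (A Un F)" and A: "A<=Y" "!!a. a:A==>kh a=e"
 and tor: "!!g. g:F==>EX n::nat>0. kh (g [^] n)=e"
 obtains N :: nat where "N > 0" "!!g. g:T==>kh (g [^] N)=e"
proof -
 obtain n where n: "!!g. g:F==>n g > (0::nat)&kh (g [^] n g)=e" using tor by metis
 define N where "N=(\<Prod>g\<in>F. n g)"
 interpret N: character G K e Y "%g. kh (g [^] N)" by (rule power_character)
 have "A Un F<={g:Y. kh (g [^] N)=e}"
 proof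
 fix g assume "g:A Un F"
 then consider "g:A" | "g:F" by blast
 thus "g:{g:Y. kh (g [^] N)=e}"
 proof cases
 case 1
 hence "kh (g [^] (1 * N))=e" using A Yc by (intro chi_pow_mult) auto
 thus ?thesis using 1 A(1) by auto
 next
 case 2
 then obtain k where "N=n g * k" using dvd_prodI[OF F(1), of g n] by (auto simp: N_def elim: dvdE)
 thus ?thesis using chi_pow_mult n[OF 2] 2 F(2) by auto
 qed
 qed
 hence "T<={g:Y. kh (g [^] N)=e}" using generate_subgroup_incl[OF _ N.ker_subgroup] F(3) by blast
 moreover have "N > 0" using n by (auto simp: N_def intro!: prod_pos)
 ultimately show ?thesis using that by blast
qed

lemma ker_fidx:
 assumes fg: "fg Y" and tor: "!!g. g:Y==>EX n::nat>0. kh (g [^] n)=e"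
 shows "fidx G {g:Y. kh g=e} Y"
proof -
 obtain S where S: "finite S" "S<=Y" "generate G S=Y" using fgE[OF fg] by metis
 obtain N :: nat where N: "N > 0" "!!g. g:Y==>kh (g [^] N)=e"
 by (rule uniform_exponent[of S Y "{}"]) (use S tor in auto)
 show ?thesis
 by (rule fidx_abelian_torsion[OF fg ker_subgroup _ _ N(1)]) (use N(2) Y_closed(4) subgroup_closed(6)[OF Y] in auto)
qed

text \<open>The elements with torsion values are finitely generated over \<open>A\<close>, so one
  \<open>N\<close> kills all torsion values. The values that are \<open>N\<close>-th powers are then
  torsion-free, and \<open>Y1\<close> has finite index because \<open>Y\<close> is finitely
  generated.\<close>

lemma torsion_free_subgroup:
 assumes fg: "fg Y" and A: "subgroup A G" "!!a. a:A==>kh a=e" and pol: "polyc A Y"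
 obtains Y1 where "fidx G Y1 Y" "A<=Y1" "!!g n. g:Y1==>(0::nat) < n==>kh (g [^] n)=e==>kh g=e"
proof -
 have AY: "A<=Y" using polyc_subgroup[OF pol A(1)] by blast
 let ?T = "{g:Y. EX n::nat>0. kh (g [^] n)=e}"
 have kN: "subgroup {g:Y. kh (g [^] (N::nat))=e} G" for N
 using character.ker_subgroup[OF power_character] .
 have T: "subgroup ?T G"
 proof (rule subgroupI)
 show "?T<=carrier G" using Yc by blast
 show "?T ~= {}" using Y_closed(1) by (auto intro!: exI[of _ \<one>] exI[of _ "1::nat"])
 show "inv g:?T" if "g:?T" for g using that sg_inv[OF kN] by blast
 fix g h assume "g:?T" "h:?T"
 then obtain k l :: nat where kl: "g:Y" "h:Y" "k > 0" "l > 0" "kh (g [^] k)=e" "kh (h [^] l)=e" by blast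
 have "g**h:{g:Y. kh (g [^] (k * l))=e}"
 using chi_pow_mult[OF kl(1,5), of l] chi_pow_mult[OF kl(2,6), of k] kl(1,2)
 by (intro sg_mult[OF kN]) (auto simp: mult.commute)
 thus "g**h:?T" using kl(3,4) by (auto intro!: exI[of _ "k * l"])
 qed
 have AT: "A<=?T" using A AY Yc by (auto intro!: exI[of _ "1::nat"])
 have "polyc A (Y Int ?T)" by (rule polyc_inter[OF pol A(1) T AT])
 moreover have "Y Int ?T=?T" by blast
 ultimately have "polyc A ?T" by simp
 from polyc_fg[OF this A(1)] obtain F where F: "finite F" "F<=?T" "?T<=generate G (A Un F)"
 by (elim exE conjE) (rule that)
 obtain N :: nat where N: "N > 0" "!!g. g:?T==>kh (g [^] N)=e"
 by (rule uniform_exponent[OF F(1) _ F(3) AY A(2)]) (use F(2) in blast)+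
 let ?Y1 = "{g:Y. EX h:Y. kh g=kh (h [^] N)}"
 interpret N: character G K e Y "%g. kh (g [^] N)" by (rule power_character)
 have Y1: "subgroup ?Y1 G"
 proof (rule subgroupI)
 show "?Y1<=carrier G" using Yc by blast
 have "kh \<one>=kh (\<one> [^] N)" by simp
 thus "?Y1 ~= {}" using Y_closed(1) by blast
 fix g assume "g:?Y1"
 then obtain h where h: "g:Y" "h:Y" "kh g=kh (h [^] N)" by blast
 have hN: "h [^] N:Y" using subgroup_closed(6)[OF Y h(2)] .
 have "kh (inv g)=kh (inv h [^] N)" using chi_inv_eq[OF h(3,1) hN] Yc h by (simp add: nat_pow_inv)
 thus "inv g:?Y1" using h Y_closed(3) by blast
 fix g' assume "g':?Y1"
 then obtain h' where h': "g':Y" "h':Y" "kh g'=kh (h' [^] N)" by blast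
 have "kh (g**g')=kh ((h**h') [^] N)" using chi_mult[OF h(1) h'(1)] N.chi_mult[OF h(2) h'(2)] h(3) h'(3) by simp
 thus "g**g':?Y1" using h h' Y_closed(2) by blast
 qed
 have sub: "{g:Y. kh g=e}<=?Y1"
 proof
 fix g assume g: "g:{g:Y. kh g=e}"
 have "e=kh (\<one> [^] N)" by simp
 thus "g:?Y1" using g Y_closed(1) by force
 qed
 have "fidx G ?Y1 Y"
 proof (rule fidx_abelian_torsion[OF fg Y1 _ _ N(1)])
 show "comm G g h:?Y1" if "g:Y" "h:Y" for g h using sub chi_comm that Y_closed(4) by blast
 show "g [^] N:?Y1" if "g:Y" for g using that subgroup_closed(6)[OF Y that] by blast
 qed blast
 moreover have "A<=?Y1" using sub A AY by blast
 moreover have "kh g=e" if g: "g:?Y1" and n: "0 < n" "kh (g [^] n)=e" for g and n :: nat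
 proof -
 obtain h where h: "g:Y" "h:Y" "kh g=kh (h [^] N)" using g by blast
 have hN: "h [^] N:Y" using subgroup_closed(6)[OF Y h(2)] .
 have "kh (h [^] (N * n))=kh (g [^] n)" using chi_pow[OF hN, of n] chi_pow[OF h(1), of n] h(3) Yc[OF h(2)] by (simp add: nat_pow_pow)
 hence "h:?T" using n N(1) h(2) by (auto intro!: exI[of _ "N * n"])
 thus ?thesis using N(2) h(3) by simp
 qed
 ultimately show ?thesis using that by blast
qed

text \<open>A nontrivial finitely generated torsion-free abelian group is not
  \<open>q\<close>-divisible. The elements some \<open>q^k\<close>-th power of which has the value
  of a power of \<open>t\<close> are finitely generated over \<open>A\<close>, so one
  \<open>k = m\<close> serves for all. Applied to an iterated root of order \<open>q^(m+1)\<close>,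
  this gives \<open>kh t = kh (t^(i q))\<close>, impossible since \<open>i q ~= 1\<close>.\<close>

lemma not_all_powers:
 assumes A: "subgroup A G" "!!a. a:A==>kh a=e" and pol: "polyc A Y"
 and tf: "!!g n. g:Y==>(0::nat) < n==>kh (g [^] n)=e==>kh g=e"
 and t: "t:Y" "kh t ~= e" and q: "1 < (q::nat)"
 obtains g0 where "g0:Y" "!!g. g:Y==>kh (g [^] q) ~= kh g0"
proof (rule ccontr)
 assume no: "~ thesis"
 have AY: "A<=Y" using polyc_subgroup[OF pol A(1)] by blast
 have pY: "g [^] (n::nat):Y" "g [^] (i::int):Y" if "g:Y" for g n i using subgroup_closed(5,6)[OF Y that] by auto
 have "EX g'. g:Y-->g':Y&kh (g' [^] q)=kh g" for g using no that by metis
 then obtain r where r: "!!g. g:Y==>r g:Y" "!!g. g:Y==>kh (r g [^] q)=kh g" by metis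
 define T where "T k={g:Y. EX m::int. kh (g [^] (q ^ k))=kh (t [^] m)}" for k :: nat
 have T: "subgroup (T k) G" for k
 proof (rule subgroupI)
 interpret k: character G K e Y "%g. kh (g [^] (q ^ k))" by (rule power_character)
 show "T k<=carrier G" using Yc by (auto simp: T_def)
 show "T k ~= {}" using Y_closed(1) by (auto simp: T_def intro!: exI[of _ \<one>] exI[of _ "0::int"])
 fix g assume g: "g:T k"
 then obtain i :: int where i: "g:Y" "kh (g [^] (q ^ k))=kh (t [^] i)" by (auto simp: T_def)
 have "kh (inv g [^] (q ^ k))=kh (t [^] (- i))"
 using chi_inv_eq[OF i(2) pY(1)[OF i(1)] pY(2)[OF t(1)]] Yc i t(1) by (simp add: nat_pow_inv int_pow_neg)
 thus "inv g:T k" using i Y_closed(3) unfolding T_def by blast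
 fix h assume "h:T k"
 then obtain j :: int where j: "h:Y" "kh (h [^] (q ^ k))=kh (t [^] j)" by (auto simp: T_def)
 have "kh ((g**h) [^] (q ^ k))=kh (t [^] (i + j))"
 using k.chi_mult[OF i(1) j(1)] i j chi_mult[OF pY(2)[OF t(1)] pY(2)[OF t(1)]] Yc t(1) by (simp add: int_pow_mult)
 thus "g**h:T k" using i j Y_closed(2) unfolding T_def by blast
 qed
 have Tmono: "T k<=T (k + l)" for k l
 proof
 fix g assume "g:T k"
 then obtain i :: int where i: "g:Y" "kh (g [^] (q ^ k))=kh (t [^] i)" by (auto simp: T_def)
 have "kh (g [^] (q ^ (k + l)))=kh ((g [^] (q ^ k)) [^] (q ^ l))" using Yc[OF i(1)] by (simp add: nat_pow_pow power_add)
 also have "\<dots>=kh ((t [^] i) [^] (q ^ l))" using chi_pow[OF pY(1)[OF i(1)]] chi_pow[OF pY(2)[OF t(1)]] i(2) by simp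
 also have "\<dots>=kh (t [^] (i * int (q ^ l)))" using Yc[OF t(1)] by (simp add: int_pow_pow flip: int_pow_int)
 finally show "g:T (k + l)" using i(1) unfolding T_def by blast
 qed
 have Tle: "T k<=T l" if "k<=l" for k l using Tmono[of k "l - k"] that by simp
 let ?R = "UN k. T k"
 have R: "subgroup ?R G"
 proof (rule subgroupI)
 show "?R<=carrier G" using Yc by (auto simp: T_def)
 show "?R ~= {}" using sg_one[OF T] by blast
 show "inv g:?R" if "g:?R" for g using that sg_inv[OF T] by blast
 fix g h assume "g:?R" "h:?R"
 then obtain k l where "g:T k" "h:T l" by blast
 hence "g:T (max k l)" "h:T (max k l)" using Tle[of k "max k l"] Tle[of l "max k l"] by auto
 thus "g**h:?R" using sg_mult[OF T] by blast
 qed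
 have A0: "A<=T 0" using A(2) AY Yc by (auto simp: T_def intro!: exI[of _ "0::int"])
 have "polyc A (Y Int ?R)" by (rule polyc_inter[OF pol A(1) R]) (use A0 in blast)
 from polyc_fg[OF this A(1)] obtain F where F: "finite F" "F<=Y Int ?R" "Y Int ?R<=generate G (A Un F)"
 by (elim exE conjE) (rule that)
 obtain k where k: "!!g. g:F==>g:T (k g)" using F(2) by (metis IntD2 UN_E subsetD)
 define m where "m=(SUM g:F. k g)"
 have "A Un F<=T m"
 proof
 fix g assume "g:A Un F"
 thus "g:T m" using A0 Tle[of 0 m] k[of g] member_le_sum[of g F k] F(1) Tle[of "k g" m] by (auto simp: m_def)
 qed
 hence RT: "Y Int ?R<=T m" using generate_subgroup_incl[OF _ T] F(3) by blast
 have ri: "(r ^^ i) t:Y&kh ((r ^^ i) t [^] (q ^ i))=kh t" for i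
 proof (induction i)
 case (Suc i)
 let ?g = "(r ^^ i) t"
 have g: "?g:Y" "r ?g:Y" using Suc r(1) by auto
 have "kh (r ?g [^] (q ^ Suc i))=kh ((r ?g [^] q) [^] (q ^ i))" using Yc[OF g(2)] by (simp add: nat_pow_pow)
 also have "\<dots>=kh (?g [^] (q ^ i))" using chi_pow[OF pY(1)[OF g(2)]] chi_pow[OF g(1)] r(2)[OF g(1)] by simp
 finally show ?case using Suc g by simp
 qed (use t Yc in auto)
 let ?g = "(r ^^ Suc m) t"
 have g: "?g:Y" "kh (?g [^] (q ^ Suc m))=kh t" using ri[of "Suc m"] by auto
 have "kh (?g [^] (q ^ Suc m))=kh (t [^] (1::int))" using g(2) Yc[OF t(1)] by simp
 hence "?g:T (Suc m)" using g(1) unfolding T_def by blast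
 hence "?g:T m" using RT g(1) by blast
 then obtain i :: int where i: "kh (?g [^] (q ^ m))=kh (t [^] i)" by (auto simp: T_def)
 have "kh t=kh ((?g [^] (q ^ m)) [^] q)" using g Yc[OF g(1)] by (simp add: nat_pow_pow mult.commute)
 also have "\<dots>=kh ((t [^] i) [^] q)" using chi_pow[OF pY(1)[OF g(1)]] chi_pow[OF pY(2)[OF t(1)]] i by simp
 also have "\<dots>=kh (t [^] (i * int q))" using Yc[OF t(1)] by (simp add: int_pow_pow flip: int_pow_int)
 finally have tq: "kh t=kh (t [^] (i * int q))" .
 define d where "d=i * int q - 1"
 have "d ~= 0" using q zmult_eq_1_iff[of i "int q"] by (auto simp: d_def)
 have "kh (t [^] d) * kh t=kh (t [^] (d + 1))"
 using chi_mult[OF pY(2)[OF t(1)] t(1), of d] Yc[OF t(1)] by (simp add: int_pow_mult)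
 hence "kh t * kh (t [^] d)=kh t * e" using tq e_mult(2)[OF chi_K(1)[OF t(1)]] by (simp add: d_def mult.commute)
 hence d: "kh (t [^] d)=e" using cancel[of "kh (t [^] d)" e "kh t"] chi_K pY(2) t(1) e(1) by simp
 have "kh (t [^] nat \<bar>d\<bar>)=e"
 proof (cases "d >= 0")
 case True thus ?thesis using d by (simp flip: int_pow_int)
 next
 case False
 have "kh (inv (t [^] d))=kh (inv \<one>)" using d pY(2)[OF t(1)] Y_closed(1) by (intro chi_inv_eq) auto
 thus ?thesis using False Yc[OF t(1)] by (simp flip: int_pow_int add: int_pow_neg)
 qed
 thus False using tf[OF t(1), of "nat \<bar>d\<bar>"] `d ~= 0` t(2) by simp
qed
end

section \<open>The module of a derived quotient\<close>
lift_definition basis_map :: "('b => 'b) => 'b endo" is "%f. frag_extend (frag_of \<circ> f)"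
 by (simp add: frag_extend_add)

lemma basis_map_of [simp]: "basis_map f$frag_of c=frag_of (f c)" by transfer simp

lemma basis_map_comp: "basis_map (f \<circ> g)=basis_map f * basis_map g"
 by transfer (simp add: fun_eq_iff frag_extend_compose comp_assoc)

lemma basis_map_id: "basis_map id=1"
 by transfer (simp add: fun_eq_iff flip: frag_expansion)

lemma keys_basis_map: "Poly_Mapping.keys v<=Q==>f ` Q<=Q==>Poly_Mapping.keys (basis_map f$v)<=Q"
 by transfer (use keys_frag_extend in fastforce)

text \<open>The abelianization \<open>A / A'\<close> is realized as \<open>M\<close> modulo
  \<open>R\<close>: \<open>M\<close> is free abelian on the cosets of \<open>A'\<close> in
  \<open>A\<close>, and \<open>R\<close> is the kernel of the evaluation \<open>evl\<close> in
  \<open>A / A'\<close>.\<close>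

locale derived_section = group G for G (structure) +
 fixes A
 assumes normal_A: "A \<lhd> G"
begin
abbreviation "A' \<equiv> derived G A"

lemma A_sub: "subgroup A G" using normal_A by (rule normal_imp_subgroup)

lemma normal_A': "A' \<lhd> G" by (rule derived_is_normal[OF normal_A])

lemma A'_sub: "subgroup A' G" using normal_A' by (rule normal_imp_subgroup)

lemma A'_A: "A'<=A" by (rule derived_incl[OF subset_refl A_sub])

lemma Ac: "a:A==>a:carrier G" using sg_mem[OF A_sub] .

lemma A'_comm: "a:A==>b:A==>comm G a b:A'"
 unfolding derived_def comm_def by (rule generate.incl) auto

lemma A_conj: "g:carrier G==>a:A==>g**a**inv g:A" using normal_A by (rule normal.inv_op_closed2)

lemma A'_conj: "g:carrier G==>a:A'==>g**a**inv g:A'" using normal_A' by (rule normal.inv_op_closed2)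
lemmas A_closed = subgroup_closed(1,3,4,7)[OF A_sub]
lemmas A'_closed = subgroup_closed(1,3,4,7)[OF A'_sub]
abbreviation "co a \<equiv> A' #> a"

lemma co_eq: "a:carrier G==>b:carrier G==>co a=co b \<longleftrightarrow> a**inv b:A'"
 using repr_independence[OF _ _ A'_sub, of a b] subgroup.rcos_module[OF A'_sub is_group, of b a]
 rcos_self[OF _ A'_sub, of a] by auto

definition "Q=co ` A"

text \<open>Being the identity off \<open>Q\<close>, \<open>cj\<close> is a homomorphism into the
  maps of the whole basis type and induces operators on the full free abelian group.\<close>

definition cj :: "'a => 'a set => 'a set" where "cj g c=(if c:Q then (%x. g**x**inv g) ` c else c)"

lemma cj_co: "g:carrier G==>a:A==>cj g (co a)=co (g**a**inv g)"
proof -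
 assume g: "g:carrier G" and a: "a:A"
 have "(%x. g**x**inv g) ` co a=co (g**a**inv g)"
 proof (rule equalityI; rule subsetI)
 fix x assume "x:(%x. g**x**inv g) ` co a"
 then obtain h where h: "h:A'" "x=g**(h**a)**inv g" by (auto simp: r_coset_def)
 hence "x=(g**h**inv g)**(g**a**inv g)" using g Ac[OF a] sg_mem[OF A'_sub] by (simp add: m_assoc)
 thus "x:co (g**a**inv g)" using A'_conj[OF g h(1)] by (auto simp: r_coset_def)
 next
 fix x assume "x:co (g**a**inv g)"
 then obtain h where h: "h:A'" "x=h**(g**a**inv g)" by (auto simp: r_coset_def)
 have "inv g**h**g:A'" using A'_conj[of "inv g" h] g h by simp
 moreover have "x=g**((inv g**h**g)**a)**inv g" using g Ac[OF a] h sg_mem[OF A'_sub] by (simp add: m_assoc)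
 ultimately show "x:(%x. g**x**inv g) ` co a" unfolding r_coset_def by blast
 qed
 thus ?thesis using a by (simp add: cj_def Q_def)
qed

lemma cj_Q: "g:carrier G==>cj g ` Q<=Q" using cj_co A_conj by (auto simp: Q_def)

lemma cj_mult: "g:carrier G==>h:carrier G==>cj (g**h)=cj g \<circ> cj h"
proof
 fix c assume gh: "g:carrier G" "h:carrier G"
 show "cj (g**h) c=(cj g \<circ> cj h) c"
 proof (cases "c:Q")
 case True
 then obtain a where a: "a:A" "c=co a" by (auto simp: Q_def)
 have "g**h**a**inv (g**h)=g**(h**a**inv h)**inv g" using gh Ac[OF a(1)] by (simp add: m_assoc inv_mult_group)
 thus ?thesis using gh a A_conj by (simp add: cj_co)
 qed (simp add: cj_def)
qed

lemma cj_A: "a:A==>cj a=id"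
proof
 fix c assume a: "a:A"
 show "cj a c=id c"
 proof (cases "c:Q")
 case True
 then obtain b where b: "b:A" "c=co b" by (auto simp: Q_def)
 have "a**b**inv a**inv b:A'" using A'_comm[OF a b(1)] by (simp add: comm_def)
 thus ?thesis using a b A_conj Ac by (simp add: cj_co co_eq)
 qed (simp add: cj_def)
qed

definition "E g=basis_map (cj g)"

definition "M={v. Poly_Mapping.keys v<=Q}"

definition "ka a=frag_of (co a)"

lemma kappa_M: "a:A==>ka a:M" by (auto simp: ka_def M_def Q_def)

lemma E_kappa: "g:carrier G==>a:A==>E g$ka a=ka (g**a**inv g)" by (simp add: E_def ka_def cj_co)

lemma M_subgp: "subgp M" unfolding subgp_def M_def using keys_diff by fastforce

sublocale group_action G E
proof
 show "E (x**y)=E x * E y" if "x:carrier G" "y:carrier G" for x y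
 unfolding E_def cj_mult[OF that] by (rule basis_map_comp)
 show "E \<one>=1" unfolding E_def cj_A[OF A_closed(1)] by (rule basis_map_id)
qed

lemma E_A: "a:A==>E a=1" unfolding E_def by (simp add: cj_A basis_map_id)

lemma M_sm: "sm (carrier G) M"
 unfolding sm_def using M_subgp keys_basis_map[OF _ cj_Q] by (auto simp: M_def E_def)

lemma evaluation_exists:
 "EX h. (ALL a:A. h (ka a)=co a)&(ALL v:M. h v:Q)
&(ALL u v a b. u:M-->v:M-->a:A-->b:A-->h u=co a-->h v=co b-->h (u + v)=co (a**b))"
proof -
 let ?GA = "G\<lparr>carrier := A\<rparr>"
 interpret GA: group ?GA by (rule subgroup_imp_group[OF A_sub])
 have d: "derived ?GA (carrier ?GA)=A'" using derived_consistent[OF subset_refl A_sub] by simp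
 interpret C: comm_group "?GA Mod A'" using GA.derived_quot_is_comm_group unfolding d .
 interpret N: normal A' ?GA using GA.derived_self_is_normal unfolding d .
 have co: "A' #>\<^bsub>?GA\<^esub> a=co a" for a by (simp add: r_coset_def)
 have cQ: "carrier (?GA Mod A')=Q" by (auto simp: FactGroup_def RCOSETS_def Q_def r_coset_def)
 have "(%c. c) ` Q<=carrier (?GA Mod A')" by (simp add: cQ)
 then obtain h where h: "h:hom (free_Abelian_group Q) (?GA Mod A')" "!!c. c:Q==>h (frag_of c)=c"
 by (rule C.free_Abelian_group_universal) blast
 have cM: "carrier (free_Abelian_group Q)=M" by (auto simp: M_def free_Abelian_group_def)
 have 1: "h v:Q" if "v:M" for v using hom_in_carrier[OF h(1), of v] that by (simp add: cM cQ)
 have 2: "h (u + v)=co (a**b)" if "u:M" "v:M" "a:A" "b:A" "h u=co a" "h v=co b" for u v a b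
 proof -
 have "h (u + v)=h u **\<^bsub>?GA Mod A'\<^esub> h v" using hom_mult[OF h(1), of u v] that by (simp add: cM)
 also have "\<dots>=co (a**b)" using N.rcos_sum[of a b] that by (simp add: co FactGroup_def set_mult_def)
 finally show ?thesis .
 qed
 have 3: "h (ka a)=co a" if "a:A" for a using h(2)[of "co a"] that by (auto simp: ka_def Q_def)
 show ?thesis by (intro exI[of _ h] conjI ballI allI impI 1 2 3)
qed

definition "evl=(SOME h. (ALL a:A. h (ka a)=co a)&(ALL v:M. h v:Q)
&(ALL u v a b. u:M-->v:M-->a:A-->b:A-->h u=co a-->h v=co b-->h (u + v)=co (a**b)))"

lemma evl_kappa: "a:A==>evl (ka a)=co a"
 and evl_Q: "v:M==>EX a:A. evl v=co a"
 and evl_add: "u:M==>v:M==>a:A==>b:A==>evl u=co a==>evl v=co b==>evl (u + v)=co (a**b)"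
proof -
 note evl = someI_ex[OF evaluation_exists, folded evl_def]
 show "a:A==>evl (ka a)=co a" using evl by (elim conjE bspec)
 show "v:M==>EX a:A. evl v=co a" using conjunct1[OF conjunct2[OF evl]] unfolding Q_def by fastforce
 show "u:M==>v:M==>a:A==>b:A==>evl u=co a==>evl v=co b==>evl (u + v)=co (a**b)"
 using conjunct2[OF conjunct2[OF evl]] by metis
qed

lemma evl_diff: assumes "u:M" "v:M" "a:A" "b:A" "evl u=co a" "evl v=co b" shows "evl (u - v)=co (a**inv b)"
proof -
 have uv: "u - v:M" using subgpD(4)[OF M_subgp] assms by blast
 obtain c where c: "c:A" "evl (u - v)=co c" using evl_Q[OF uv] by blast
 have "co (c**b)=co a" using evl_add[OF uv assms(2) c(1) assms(4) c(2) assms(6)] assms by simp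
 hence "c**b**inv a:A'" using c assms A_closed Ac by (simp add: co_eq)
 moreover have "c**inv (a**inv b)=c**b**inv a" using c assms Ac by (simp add: inv_mult_group m_assoc)
 ultimately show ?thesis using c assms A_closed Ac by (simp add: co_eq)
qed

definition "R={v:M. evl v=co \<one>}"

lemma R_iff: "v:M==>a:A==>evl v=co a==>v:R \<longleftrightarrow> a:A'"
 using Ac by (auto simp: R_def co_eq)

lemma evl_eqD: "u:M==>v:M==>evl u=evl v==>u - v:R"
proof -
 assume uv: "u:M" "v:M" "evl u=evl v"
 obtain a where a: "a:A" "evl u=co a" using evl_Q[OF uv(1)] by blast
 have "evl (u - v)=co (a**inv a)" using evl_diff[OF uv(1,2) a(1,1)] a uv by simp
 thus ?thesis using subgpD(4)[OF M_subgp] uv Ac[OF a(1)] by (simp add: R_def)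
qed

lemma kappa_R: "a:A==>ka a:R \<longleftrightarrow> a:A'" using R_iff[OF kappa_M _ evl_kappa] .

lemma kappa_mult: "a:A==>b:A==>ka (a**b) - (ka a + ka b):R"
proof -
 assume a: "a:A" and b: "b:A"
 have "evl (ka a + ka b)=co (a**b)" by (intro evl_add kappa_M a b evl_kappa)
 thus ?thesis using evl_kappa[OF A_closed(2)[OF a b]]
 by (intro evl_eqD kappa_M A_closed(2) a b subgpD(3)[OF M_subgp]) simp
qed

lemma kappa_inv: "a:A==>ka (inv a) + ka a:R"
proof -
 assume a: "a:A"
 have "evl (ka (inv a) + ka a)=co (inv a**a)" by (intro evl_add kappa_M a A_closed(3) evl_kappa)
 moreover have "ka (inv a) + ka a:M" by (intro subgpD(3)[OF M_subgp] kappa_M a A_closed(3))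
 ultimately show ?thesis using Ac[OF a] by (simp add: R_def)
qed

lemma M_kappa: "v:M==>EX a:A. v - ka a:R"
 using evl_Q[of v] evl_kappa kappa_M evl_eqD by metis

lemma R_sm: "sm (carrier G) R" "R<=M"
proof -
 show RM: "R<=M" by (auto simp: R_def)
 have z: "0:R" using kappa_R[OF A_closed(1)] evl_eqD[OF kappa_M kappa_M, of \<one> \<one>] A_closed(1) by simp
 show "sm (carrier G) R" unfolding sm_def subgp_def
 proof (intro conjI ballI z)
 fix u v assume uv: "u:R" "v:R"
 hence "u - v:M" using RM by (intro subgpD(4)[OF M_subgp]) auto
 thus "u - v:R" using uv evl_diff[of u v \<one> \<one>] A_closed(1) by (simp add: R_def)
 next
 fix g v assume g: "g:carrier G" and v: "v:R"
 have "v:M" using v RM by blast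
 hence "v:M&(ALL a:A. evl v=co a-->evl (E g$v)=co (g**a**inv g))"
 unfolding M_def mem_Collect_eq
 proof (induction v rule: frag_induction)
 case zero
 have "evl 0=co \<one>" using z by (simp add: R_def)
 moreover have "co (g**a**inv g)=co \<one>" if "a:A" "co \<one>=co a" for a
 using cj_co[OF g that(1)] cj_co[OF g A_closed(1)] that(2) g by simp
 ultimately show ?case by auto
 next
 case (one c)
 then obtain b where b: "b:A" "c=co b" by (auto simp: Q_def)
 have "evl (E g$frag_of c)=co (g**b**inv g)" "evl (frag_of c)=co b"
 using E_kappa[OF g b(1)] evl_kappa[OF A_conj[OF g b(1)]] evl_kappa[OF b(1)] b(2) by (simp_all add: ka_def)
 moreover have "co (g**b**inv g)=co (g**a**inv g)" if "a:A" "co b=co a" for a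
 using cj_co[OF g b(1)] cj_co[OF g that(1)] that(2) by simp
 ultimately show ?case using one by auto
 next
 case (diff x y)
 hence xy: "x:M" "y:M" by (auto simp: M_def)
 obtain a b where ab: "a:A" "evl x=co a" "b:A" "evl y=co b" using evl_Q xy by metis
 have gx: "E g$x:M" "E g$y:M" using smD(2)[OF M_sm g] xy by auto
 have "evl (E g$(x - y))=co ((g**a**inv g)**inv (g**b**inv g))"
 unfolding app_diff using diff ab g A_conj by (intro evl_diff gx) auto
 also have "(g**a**inv g)**inv (g**b**inv g)=g**(a**inv b)**inv g"
 using g ab Ac by (simp add: inv_mult_group m_assoc)
 finally have 1: "evl (E g$(x - y))=cj g (co (a**inv b))" using cj_co[OF g] ab A_closed by simp
 have 2: "evl (x - y)=co (a**inv b)" by (rule evl_diff[OF xy ab(1,3,2,4)])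
 have "x - y:M" using subgpD(4)[OF M_subgp] xy by blast
 thus ?case using 1 2 cj_co[OF g] by (auto simp: M_def)
 qed
 moreover have "evl v=co \<one>" using v by (simp add: R_def)
 ultimately have "evl (E g$v)=co (g**\<one>**inv g)" using A_closed(1) by blast
 thus "E g$v:R" using g smD(2)[OF M_sm g] v RM by (auto simp: R_def)
 qed
qed

text \<open>The elements \<open>a\<close> with \<open>ka a\<close> in a submodule over
  \<open>R\<close> form a subgroup invariant under \<open>H\<close>; so finitely many generators of
  \<open>A\<close> under conjugation generate \<open>M\<close> modulo \<open>R\<close>.\<close>

sublocale module_action G E A M R
proof (intro module_action.intro group_action_axioms module_action_axioms.intro A_sub M_sm R_sm E_A)
 fix H n assume H: "fg H" "A<=H" "lcs G H n<=A"
 have sH: "subgroup H G" by (rule fg_subgroup[OF H(1)])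
 obtain Xs where Xs: "finite Xs" "Xs<=A"
 "!!B. subgroup B G==>B<=A==>Xs<=B==>(!!h b. h:H==>b:B==>h**b**inv h:B)==>B=A"
 using polyc_normal_generators[OF H(1) polyc_nilpotent[OF H(1) A_sub H(2,3)] A_sub] by metis
 let ?W = "ssum (span H (ka ` Xs)) R"
 have Rs: "sm H R" by (rule sm_mono[OF R_sm(1)]) (use subgroup.subset[OF sH] in auto)
 have W: "sm H ?W" by (rule sm_ssum[OF sm_span Rs])
 have RW: "R<=?W" "span H (ka ` Xs)<=?W" using ssum_ub[OF smD(1)[OF sm_span] smD(1)[OF Rs]] by blast+
 note w = subgpD[OF smD(1)[OF W]]
 have "{a:A. ka a:?W}=A"
 proof (rule Xs(3))
 show "subgroup {a:A. ka a:?W} G"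
 proof (rule subgroupI)
 show "{a:A. ka a:?W}<=carrier G" using Ac by auto
 show "{a:A. ka a:?W} ~= {}" using kappa_R[OF A_closed(1)] A'_closed(1) A_closed(1) RW(1) by blast
 fix a assume a: "a:{a:A. ka a:?W}"
 have "(ka (inv a) + ka a) - ka a:?W" using a kappa_inv RW(1) by (intro w(4)) auto
 thus "inv a:{a:A. ka a:?W}" using a A_closed(3) by simp
 fix b assume b: "b:{a:A. ka a:?W}"
 have "(ka (a**b) - (ka a + ka b)) + (ka a + ka b):?W" using a b kappa_mult RW(1) by (intro w(3)) auto
 thus "a**b:{a:A. ka a:?W}" using a b A_closed(2) by simp
 qed
 show "Xs<={a:A. ka a:?W}" using Xs(2) RW(2) span_ub[of "ka ` Xs"] by blast
 show "h**b**inv h:{a:A. ka a:?W}" if "h:H" "b:{a:A. ka a:?W}" for h b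
 proof -
 have hb: "h:carrier G" "b:A" "ka b:?W" using that sg_mem[OF sH] by auto
 have "E h$ka b:?W" by (rule smD(2)[OF W that(1) hb(3)])
 thus ?thesis unfolding E_kappa[OF hb(1,2)] using A_conj[OF hb(1,2)] by blast
 qed
 qed auto
 hence "v:?W" if v: "v:M" for v
 proof -
 obtain a where "a:A" "v - ka a:R" using M_kappa[OF v] by blast
 hence "(v - ka a) + ka a:?W" using RW(1) `{a:A. ka a:?W} = A` by (intro w(3)) auto
 thus ?thesis by simp
 qed
 thus "EX Xs. finite Xs&Xs<=M&M<=ssum (span H Xs) R"
 using Xs(1,2) kappa_M by (intro exI[of _ "ka ` Xs"]) auto
qed

text \<open>Modulo \<open>R\<close>, taking the commutator of \<open>a\<close> with \<open>y\<close>
  is the operator \<open>1 - E y\<close>. Nilpotent action therefore continues the descent of the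
  lower central series from \<open>A\<close> to \<open>A'\<close>.\<close>

lemma nilact_lcs:
 assumes Y: "subgroup Y G" "A<=Y" and n: "lcs G Y n<=A" and k: "nilact Y R"
 shows "EX m. lcs G Y m<=A'"
proof -
 obtain k where k: "M<=ser Y R k" using k by (auto simp: nilact_def)
 have Yc: "y:carrier G" if "y:Y" for y using sg_mem[OF Y(1) that] .
 have bR: "bm Y R" using R_sm sm_mono[OF R_sm(1)] Yc by (auto simp: bm_def)
 note bs = bm_ser[OF Y(1) bR]
 have "lcs G Y (n + j)<={a:A. ka a:ser Y R (k - j)}" if "j<=k" for j
 using that
 proof (induction j)
 case 0
 show ?case using n k kappa_M by auto
 next
 case (Suc j)
 define i where "i=k - Suc j"
 have kj: "k - j=Suc i" using Suc.prems by (simp add: i_def)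
 have s: "subgp (ser Y R i)" and Rs: "R<=ser Y R i" using bs[of i] smD(1) by (auto simp: bm_def)
 note sd = subgpD[OF s]
 let ?S = "{a:A. ka a:ser Y R i}"
 have S: "subgroup ?S G"
 proof (rule subgroupI)
 show "?S<=carrier G" using Ac by auto
 show "?S ~= {}" using kappa_R[OF A_closed(1)] A'_closed(1) A_closed(1) Rs by blast
 fix a assume a: "a:?S"
 have "(ka (inv a) + ka a) - ka a:ser Y R i" using a kappa_inv Rs by (intro sd(4)) auto
 thus "inv a:?S" using a A_closed(3) by simp
 fix b assume b: "b:?S"
 have "(ka (a**b) - (ka a + ka b)) + (ka a + ka b):ser Y R i" using a b kappa_mult Rs by (intro sd(3)) auto
 thus "a**b:?S" using a b A_closed(2) by simp
 qed
 have "comm G a y:?S" if a: "a:lcs G Y (n + j)" and y: "y:Y" for a y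
 proof -
 have aA: "a:A" "ka a:ser Y R (Suc i)" using Suc a kj by auto
 have ya: "y**inv a**inv y:A" using A_conj Yc[OF y] A_closed(3) aA by blast
 have eq: "comm G a y=a**(y**inv a**inv y)" using Yc[OF y] Ac[OF aA(1)] by (simp add: comm_def m_assoc)
 have 1: "E y$ka a - ka a:ser Y R i" using aA(2) y by simp
 have "E y$(ka (inv a) + ka a):R" by (rule smD(2)[OF R_sm(1) Yc[OF y] kappa_inv[OF aA(1)]])
 hence "ka (y**inv a**inv y) + E y$ka a:R" using E_kappa[OF Yc[OF y] A_closed(3)[OF aA(1)]] by (simp add: app_add)
 hence 2: "ka (y**inv a**inv y) + E y$ka a:ser Y R i" using Rs by blast
 have 3: "ka (a**(y**inv a**inv y)) - (ka a + ka (y**inv a**inv y)):ser Y R i"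
 using kappa_mult[OF aA(1) ya] Rs by blast
 have "(ka (a**(y**inv a**inv y)) - (ka a + ka (y**inv a**inv y)))
 + ((ka (y**inv a**inv y) + E y$ka a) - (E y$ka a - ka a)):ser Y R i"
 by (rule sd(3)[OF 3 sd(4)[OF 2 1]])
 hence "ka (comm G a y):ser Y R i" unfolding eq by (simp add: algebra_simps)
 moreover have "comm G a y:A" unfolding eq by (rule A_closed(2)[OF aA(1) ya])
 ultimately show ?thesis by blast
 qed
 hence "(UN x:lcs G Y (n + j). UN y:Y. {comm G x y})<=?S" by blast
 from generate_subgroup_incl[OF this S] show ?case by (simp add: i_def)
 qed
 from this[of k] have "lcs G Y (n + k)<={a:A. ka a:R}" by simp
 hence "lcs G Y (n + k)<=A'" using kappa_R by blast
 thus ?thesis by blast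
qed
end

section \<open>Divisible hull and unitriangular families\<close>

locale torsion_free_units = field_set K e for K :: "'k::comm_ring_1 set" and e +
 fixes X0 :: "'k set"
 assumes X0: "X0<=K - {0}" "e:X0" "x:X0==>y:X0==>x * y:X0" "x:X0==>EX y:X0. x * y=e"
 and tf: "x:X0==>(0::nat) < n==>x ^ n=e==>x=e"
begin

lemma X_K: "x:X0==>x:K" "x:X0==>x ~= 0" using X0 by auto

lemma e_mult: "x:K==>e * x=x" "x:K==>x * e=x" using e(3)[of x] by (auto simp: mult.commute[of x])

lemma e_pow: "0 < n==>e ^ n=e" by (induction n) (metis e(1) e_mult(1) neq0_conv power_0 power_Suc mult.right_neutral)+

lemma X_pow: "x:X0==>0 < n==>x ^ n:X0"
proof (induction n)
 case (Suc n) thus ?case using X0(3) by (cases n) auto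
qed simp

lemma pow_inj: assumes "x:X0" "y:X0" "0 < n" "x ^ n=y ^ n" shows "x=y"
proof -
 obtain z where z: "z:X0" "y * z=e" using X0(4) assms by blast
 have "(x * z) ^ n=(y * z) ^ n" using assms(4) by (simp add: power_mult_distrib)
 hence "x * z=e" using tf[OF X0(3)[OF assms(1) z(1)] assms(3)] z e_pow[OF assms(3)] by simp
 hence "e * y=x * (y * z)" by (metis mult.assoc mult.commute)
 thus ?thesis using z(2) e_mult X_K assms by simp
qed

text \<open>The class of the pair \<open>(x, n)\<close> stands for the \<open>n\<close>-th root of
  \<open>x\<close>; torsion-freeness of \<open>X0\<close> makes this relation transitive.\<close>

definition hc :: "'k => nat => ('k \<times> nat) set" where "hc x n={(y, m). y:X0&0 < m&x ^ m=y ^ n}"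

definition hrep :: "('k \<times> nat) set => 'k \<times> nat" where "hrep u=(SOME p. p:u)"

lemma hc_eq:
 assumes "x:X0" "0 < n" "y:X0" "0 < m" shows "hc x n=hc y m \<longleftrightarrow> x ^ m=y ^ n"
proof
 have "(y, m):hc y m" using assms by (simp add: hc_def)
 thus "hc x n=hc y m==>x ^ m=y ^ n" by (auto simp: hc_def)
next
 assume eq: "x ^ m=y ^ n"
 have "x ^ k=z ^ n \<longleftrightarrow> y ^ k=z ^ m" if z: "z:X0" "0 < k" for z k
 proof
 assume "x ^ k=z ^ n"
 hence "(y ^ k) ^ n=(z ^ m) ^ n" using eq by (metis mult.commute power_mult)
 thus "y ^ k=z ^ m" using pow_inj[of "y ^ k" "z ^ m" n] X_pow assms z by simp
 next
 assume "y ^ k=z ^ m"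
 hence "(x ^ k) ^ m=(z ^ n) ^ m" using eq by (metis mult.commute power_mult)
 thus "x ^ k=z ^ n" using pow_inj[of "x ^ k" "z ^ n" m] X_pow assms z by simp
 qed
 thus "hc x n=hc y m" unfolding hc_def by blast
qed

definition dhull :: "('k \<times> nat) set monoid" where
 "dhull=\<lparr>carrier={hc x n | x n. x:X0&0 < n},
 monoid.mult=(%u v. hc (fst (hrep u) ^ snd (hrep v) * fst (hrep v) ^ snd (hrep u)) (snd (hrep u) * snd (hrep v))),
 one=hc e 1\<rparr>"
abbreviation "U \<equiv> carrier dhull"

lemma hcU: "x:X0==>0 < n==>hc x n:U" by (auto simp: dhull_def)

lemma UE: "u:U==>(!!x n. u=hc x n==>x:X0==>0 < n==>thesis)==>thesis" by (auto simp: dhull_def)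

lemma hrep: assumes "x:X0" "0 < n" obtains a b where "hrep (hc x n)=(a, b)" "a:X0" "0 < b" "x ^ b=a ^ n"
proof -
 have "(x, n):hc x n" using assms by (simp add: hc_def)
 hence "hrep (hc x n):hc x n" unfolding hrep_def by (rule someI)
 thus ?thesis using that by (cases "hrep (hc x n)") (auto simp: hc_def)
qed

lemma hull_mult:
 assumes "x:X0" "0 < n" "y:X0" "0 < m" shows "hc x n **\<^bsub>dhull\<^esub> hc y m=hc (x ^ m * y ^ n) (n * m)"
proof -
 obtain a b where ab: "hrep (hc x n)=(a, b)" "a:X0" "0 < b" "x ^ b=a ^ n" using hrep assms by metis
 obtain c d where cd: "hrep (hc y m)=(c, d)" "c:X0" "0 < d" "y ^ d=c ^ m" using hrep assms by metis
 have "(a ^ d * c ^ b) ^ (n * m)=(a ^ n) ^ (d * m) * (c ^ m) ^ (b * n)" by (simp add: power_mult_distrib mult_ac flip: power_mult)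
 also have "\<dots>=(x ^ m * y ^ n) ^ (b * d)" unfolding ab(4)[symmetric] cd(4)[symmetric]
 by (simp add: power_mult_distrib mult_ac flip: power_mult)
 finally show ?thesis using ab cd assms hc_eq[of "a ^ d * c ^ b" "b * d" "x ^ m * y ^ n" "n * m"] X_pow X0(3) by (simp add: dhull_def)
qed

lemma hull_comm_group: "comm_group dhull"
proof (rule comm_groupI)
 have o: "\<one>\<^bsub>dhull\<^esub>=hc e 1" by (simp add: dhull_def)
 show "\<one>\<^bsub>dhull\<^esub>:U" unfolding o using hcU X0(2) by simp
 fix u v assume "u:U" "v:U"
 then obtain x n y m where u: "u=hc x n" "x:X0" "0 < n" and v: "v=hc y m" "y:X0" "0 < m" by (metis UE)
 show "u **\<^bsub>dhull\<^esub> v:U" unfolding u(1) v(1) hull_mult[OF u(2,3) v(2,3)] using u v X_pow X0(3) by (intro hcU) auto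
 show "u **\<^bsub>dhull\<^esub> v=v **\<^bsub>dhull\<^esub> u" unfolding u(1) v(1) hull_mult[OF u(2,3) v(2,3)] hull_mult[OF v(2,3) u(2,3)]
 by (simp add: mult.commute)
 show "\<one>\<^bsub>dhull\<^esub> **\<^bsub>dhull\<^esub> u=u" unfolding o u(1) using u hull_mult[of e 1 x n] X0(2) e_pow e_mult X_K by simp
 obtain z where z: "z:X0" "x * z=e" using X0(4) u by blast
 have "hc z n **\<^bsub>dhull\<^esub> hc x n=hc (z ^ n * x ^ n) (n * n)" by (rule hull_mult[OF z(1) u(3) u(2,3)])
 also have "z ^ n * x ^ n=e" using z(2) e_pow[OF u(3)] by (simp add: mult.commute flip: power_mult_distrib)
 also have "hc e (n * n)=hc e 1" using hc_eq[of e "n * n" e 1] X0(2) e_pow u by simp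
 finally show "EX w:U. w **\<^bsub>dhull\<^esub> u=\<one>\<^bsub>dhull\<^esub>" unfolding o u(1) using hcU[OF z(1) u(3)] by blast
 fix w assume "w:U"
 then obtain z k where w: "w=hc z k" "z:X0" "0 < k" by (metis UE)
 show "u **\<^bsub>dhull\<^esub> v **\<^bsub>dhull\<^esub> w=u **\<^bsub>dhull\<^esub> (v **\<^bsub>dhull\<^esub> w)"
 unfolding u(1) v(1) w(1) using u v w X_pow X0(3) by (simp add: hull_mult power_mult_distrib mult_ac flip: power_mult)
qed

sublocale dhull: comm_group dhull by (rule hull_comm_group)

lemma hc_pow: "x:X0==>0 < n==>0 < k==>hc x n [^]\<^bsub>dhull\<^esub> k=hc (x ^ k) n"
proof (induction k)
 case (Suc k)
 show ?case
 proof (cases k)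
 case 0 thus ?thesis using Suc hcU by simp
 next
 case (Suc k')
 hence "hc x n [^]\<^bsub>dhull\<^esub> Suc k=hc (x ^ k) n **\<^bsub>dhull\<^esub> hc x n" using Suc.IH Suc.prems by simp
 also have "\<dots>=hc ((x ^ k) ^ n * x ^ n) (n * n)"
 by (rule hull_mult[OF X_pow]) (use Suc Suc.prems in auto)
 also have "\<dots>=hc (x ^ Suc k) n"
 proof (rule iffD2[OF hc_eq])
 show "((x ^ k) ^ n * x ^ n) ^ n=(x ^ Suc k) ^ (n * n)"
 by (simp add: power_mult_distrib algebra_simps flip: power_mult power_add)
 qed (use Suc Suc.prems in "auto intro!: X0(3) X_pow simp del: power_Suc")
 finally show ?thesis .
 qed
qed simp

lemma hull_root: assumes "0 < (r::nat)" shows "bij_betw (%u. u [^]\<^bsub>dhull\<^esub> r) U U"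
 unfolding bij_betw_def
proof (intro conjI inj_onI)
 fix u v assume "u:U" "v:U" and eq: "u [^]\<^bsub>dhull\<^esub> r=v [^]\<^bsub>dhull\<^esub> r"
 then obtain x n y m where u: "u=hc x n" "x:X0" "0 < n" and v: "v=hc y m" "y:X0" "0 < m" by (metis UE)
 have "(x ^ r) ^ m=(y ^ r) ^ n" using eq u v assms hc_eq[of "x ^ r" n "y ^ r" m] X_pow by (simp add: hc_pow)
 hence "(x ^ m) ^ r=(y ^ n) ^ r" by (metis mult.commute power_mult)
 hence "x ^ m=y ^ n" using pow_inj[of "x ^ m" "y ^ n" r] X_pow u v assms by simp
 thus "u=v" using hc_eq u v by simp
next
 have "u:(%u. u [^]\<^bsub>dhull\<^esub> r) ` U" if "u:U" for u
 proof -
 from that   obtain x n where u: "u=hc x n" "x:X0" "0 < n" by (metis UE)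
 have "hc x (n * r) [^]\<^bsub>dhull\<^esub> r=hc (x ^ r) (n * r)" using u assms by (intro hc_pow) auto
 also have "\<dots>=u" using hc_eq[of "x ^ r" "n * r" x n] u assms X_pow by (simp add: mult.commute flip: power_mult)
 finally show ?thesis using hcU[of x "n * r"] u assms by (metis imageI mult_pos_pos)
 qed
 thus "(%u. u [^]\<^bsub>dhull\<^esub> r) ` U=U" by auto
qed

definition emb :: "'k => ('k \<times> nat) set" where "emb x=hc x 1"

lemma emb_U [simp]: "x:X0==>emb x:U" by (simp add: emb_def hcU)

lemma emb_mult: "x:X0==>y:X0==>emb (x * y)=emb x **\<^bsub>dhull\<^esub> emb y" by (simp add: emb_def hull_mult)

lemma emb_e: "emb e=\<one>\<^bsub>dhull\<^esub>" by (simp add: emb_def dhull_def)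

lemma emb_inj: "x:X0==>y:X0==>emb x=emb y \<longleftrightarrow> x=y" unfolding emb_def using hc_eq[of x 1 y 1] by simp

lemma emb_pow: "x:X0==>0 < k==>emb x [^]\<^bsub>dhull\<^esub> k=emb (x ^ k)" by (simp add: emb_def hc_pow)

lemma pow_emb: assumes "u:U" obtains x n where "x:X0" "(0::nat) < n" "u [^]\<^bsub>dhull\<^esub> n=emb x"
proof -
 obtain x n where u: "u=hc x n" "x:X0" "0 < n" using assms by (metis UE)
 have "u [^]\<^bsub>dhull\<^esub> n=hc (x ^ n) n" using u hc_pow by simp
 also have "\<dots>=emb x" unfolding emb_def using hc_eq[of "x ^ n" n x 1] u X_pow by simp
 finally show ?thesis using that u by blast
qed

text \<open>Families of strictly upper triangular matrices \<open>N u\<close>, thought of as the unitriangular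
 matrices \<open>1 + N u\<close>, on which \<open>X0\<close> acts by conjugation with diagonal matrices.\<close>

definition Ed :: "nat => (('k \<times> nat) set => 'k) set" where
 "Ed d={m. (ALL u. m u:K)&(ALL u. u ~: U-->m u=0)&(ALL x:X0. ALL u:U. m (emb x **\<^bsub>dhull\<^esub> u)=x ^ d * m u)}"

definition fam :: "(('k \<times> nat) set => nat => nat => 'k) set" where
 "fam={N. ALL i j. if i < j then (%u. N u i j):Ed (j - i) else (ALL u. N u i j=0)}"

lemma famI: "(!!i j. i < j==>(%u. N u i j):Ed (j - i))==>(!!u i j. j<=i==>N u i j=0)==>N:fam"
 by (simp add: fam_def)

lemma famD:
 assumes "N:fam" shows "i < j==>(%u. N u i j):Ed (j - i)" "j<=i==>N u i j=0" "N u i j:K" "u ~: U==>N u i j=0"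
proof -
 show 1: "i < j==>(%u. N u i j):Ed (j - i)" and 2: "j<=i==>N u i j=0" for i j u
 using assms by (auto simp: fam_def split: if_splits dest: spec[of _ i])
 show "N u i j:K" "u ~: U==>N u i j=0"
 using 1[of i j] 2[of j i u] subgpD(1)[OF D(1)] by (cases "i < j"; force simp: Ed_def)+
qed

lemma Ed_diff: "m:Ed d==>m':Ed d==>(%u. m u - m' u):Ed d"
 using subgpD(4)[OF D(1)] by (simp add: Ed_def right_diff_distrib)

lemma Ed_add: "m:Ed d==>m':Ed d==>(%u. m u + m' u):Ed d"
 using subgpD(3)[OF D(1)] by (simp add: Ed_def distrib_left)

lemma Ed_0: "(%u. 0):Ed d" using subgpD(1)[OF D(1)] by (simp add: Ed_def)

lemma Ed_sum: "(!!s. s:I==>f s:Ed d)==>(%u. SUM s:I. f s u):Ed d"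
 by (induction I rule: infinite_finite_induct) (auto intro: Ed_0 Ed_add)

lemma Ed_shift: "m:Ed d==>v:U==>(%u. if u:U then m (u **\<^bsub>dhull\<^esub> v) else 0):Ed d"
 using subgpD(1)[OF D(1)] by (auto simp: Ed_def dhull.m_assoc)

lemma Ed_scale: "m:Ed d==>y:K==>(%u. y * m u):Ed d"
 using D(2) by (auto simp: Ed_def mult.left_commute)

lemma Ed_mult: "m:Ed d==>m':Ed d'==>(%u. m u * m' u):Ed (d + d')"
 using D(2) by (auto simp: Ed_def power_add mult_ac)

text \<open>The product of \<open>1 + N\<close> and \<open>1 + N'\<close>, minus 1. Only
  \<open>k < j\<close> contribute because \<open>N'\<close> is strictly upper triangular, so the
  infinite matrix product is a finite sum.\<close>

definition circ :: "(('k \<times> nat) set => nat => nat => 'k) => (('k \<times> nat) set => nat => nat => 'k) => ('k \<times> nat) set => nat => nat => 'k" where "circ N N'=(%u i j. N u i j + N' u i j + (SUM k<j. N u i k * N' u k j))"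

text \<open>Translation by \<open>v\<close>. For \<open>v = emb x\<close> the equation in
  \<open>Ed\<close> makes it multiply the entry \<open>(i, j)\<close> by \<open>x^(j - i)\<close>,
  the effect of conjugation by a diagonal matrix; translations extend this action from
  \<open>X0\<close> to the divisible hull.\<close>

definition shift where "shift v N=(%u i j. if u:U then N (u **\<^bsub>dhull\<^esub> v) i j else (0 :: 'k))"

lemma fam_0: "(%u i j. 0):fam" by (rule famI) (simp_all add: Ed_0)

lemma fam_shift: "N:fam==>v:U==>shift v N:fam"
proof (rule famI)
 assume N: "N:fam" and v: "v:U"
 show "(%u. shift v N u i j):Ed (j - i)" if "i < j" for i j
 using Ed_shift[OF famD(1)[OF N that] v] by (simp add: shift_def)
 show "shift v N u i j=0" if "j<=i" for u i j using famD(2)[OF N that] by (simp add: shift_def)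
qed

lemma fam_circ: assumes N: "N:fam" "N':fam" shows "circ N N':fam"
proof (rule famI)
 fix i j :: nat assume ij: "i < j"
 have "(%u. N u i k * N' u k j):Ed (j - i)" if "k < j" for k
 proof (cases "i < k")
 case True
 thus ?thesis using Ed_mult[OF famD(1)[OF N(1) True] famD(1)[OF N(2) that]] that by simp
 qed (use famD(2)[OF N(1)] Ed_0 in simp)
 thus "(%u. circ N N' u i j):Ed (j - i)"
 unfolding circ_def using famD(1)[OF N(1) ij] famD(1)[OF N(2) ij] by (intro Ed_add Ed_sum) auto
next
 fix u and i j :: nat assume "j<=i"
 thus "circ N N' u i j=0" using famD(2)[OF N(1)] famD(2)[OF N(2)] by (simp add: circ_def)
qed

lemma circ_assoc: assumes "N1:fam" "N2:fam" "N3:fam" shows "circ (circ N1 N2) N3=circ N1 (circ N2 N3)"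
proof (intro ext)
 fix u and i j :: nat
 have 1: "(SUM k<j. (SUM l<k. N1 u i l * N2 u l k) * N3 u k j)=(SUM k<j. SUM l<j. N1 u i l * N2 u l k * N3 u k j)"
 proof (rule sum.cong[OF HOL.refl])
 fix k assume "k:{..<j}"
 hence "(SUM l<k. N1 u i l * N2 u l k * N3 u k j)=(SUM l<j. N1 u i l * N2 u l k * N3 u k j)"
 using famD(2)[OF assms(2)] by (intro sum.mono_neutral_left) auto
 thus "(SUM l<k. N1 u i l * N2 u l k) * N3 u k j=(SUM l<j. N1 u i l * N2 u l k * N3 u k j)" by (simp add: sum_distrib_right)
 qed
 have 2: "(SUM k<j. SUM l<j. N1 u i l * N2 u l k * N3 u k j)=(SUM l<j. N1 u i l * (SUM k<j. N2 u l k * N3 u k j))"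
 by (subst sum.swap) (simp add: sum_distrib_left mult.assoc)
 show "circ (circ N1 N2) N3 u i j=circ N1 (circ N2 N3) u i j"
 using 1 2 by (simp add: circ_def distrib_left distrib_right sum.distrib add_ac)
qed

lemma circ_0: "circ (%u i j. 0) N=N" "circ N (%u i j. 0)=N" by (auto simp: circ_def)

lemma shift_circ: "shift v (circ N N')=circ (shift v N) (shift v N')" by (auto simp: shift_def circ_def fun_eq_iff)

lemma shift_shift: "v:U==>w:U==>shift v (shift w N)=shift (v **\<^bsub>dhull\<^esub> w) N"
 by (auto simp: shift_def fun_eq_iff dhull.m_assoc)

lemma shift_one: "N:fam==>shift \<one>\<^bsub>dhull\<^esub> N=N" using famD(4) by (auto simp: shift_def fun_eq_iff)

text \<open>Equations that are triangular with respect to the superdiagonals are uniquely solvable.\<close>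

lemma triangular:
 assumes F: "!!N. N:fam==>F N:fam"
 and lin: "!!N N' d i u. N:fam==>N':fam==>0 < d==>(!!u i j. j < i + d==>N u i j=N' u i j) ==>
 F N u i (i + d) - F N' u i (i + d)=L (%u. N u i (i + d) - N' u i (i + d)) u"
 and surj: "!!d m. 0 < d==>m:Ed d==>EX m':Ed d. L m'=m"
 and inj: "!!d m. 0 < d==>m:Ed d==>L m=(%u. 0)==>m=(%u. 0)"
 shows "bij_betw F fam fam"
 unfolding bij_betw_def
proof (intro conjI inj_onI equalityI subsetI)
 fix N N' assume N: "N:fam" "N':fam" and eq: "F N=F N'"
 have "ALL u i j. j < i + d-->N u i j=N' u i j" for d
 proof (induction d)
 case 0 thus ?case using famD(2)[OF N(1)] famD(2)[OF N(2)] by (simp add: less_imp_le)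
 next
 case (Suc d)
 show ?case
 proof (intro allI impI)
 fix u i j assume "j < i + Suc d"
 then consider "j < i + d" | "j=i + d" "d=0" | "j=i + d" "0 < d" by linarith
 thus "N u i j=N' u i j"
 proof cases
 case 3
 let ?m = "%u. N u i (i + d) - N' u i (i + d)"
 have "?m:Ed d" using Ed_diff[OF famD(1)[OF N(1), of i "i + d"] famD(1)[OF N(2), of i "i + d"]] 3 by simp
 moreover have "F N u i (i + d) - F N' u i (i + d)=L ?m u" for u by (rule lin[OF N 3(2)]) (use Suc in auto)
 hence "L ?m=(%u. 0)" using eq by (simp add: fun_eq_iff)
 ultimately have "?m=(%u. 0)" using inj 3(2) by blast
 thus ?thesis using 3(1) by (auto dest: fun_cong[of _ _ u])
 qed (use Suc famD(2)[OF N(1)] famD(2)[OF N(2)] in auto)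
 qed
 qed
 thus "N=N'" proof (intro ext)
 fix u i j show "N u i j=N' u i j" using `!!d. ALL u i j. j < i + d --> N u i j = N' u i j`[of "Suc j"] by simp
 qed
next
 fix T assume T: "T:fam"
 have L0: "L (%u. 0)=(%u. 0)" using lin[OF fam_0 fam_0, of 1] by (auto simp: fun_eq_iff)
 have "EX N':fam. (ALL u i j. j < i + d-->N' u i j=N u i j)&(ALL u i j. j < i + Suc d-->F N' u i j=T u i j)"
 if N: "N:fam" "ALL u i j. j < i + d-->F N u i j=T u i j" for N d
 proof (cases "d=0")
 case True
 thus ?thesis using N(1) famD(2)[OF F[OF N(1)]] famD(2)[OF T] by (intro bexI[of _ N]) auto
 next
 case False
 have "EX m':Ed d. L m'=(%u. T u i (i + d) - F N u i (i + d))" for i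
 using surj[of d] False Ed_diff[OF famD(1)[OF T, of i "i + d"] famD(1)[OF F[OF N(1)], of i "i + d"]] by simp
 then obtain c where c: "!!i. c i:Ed d" "!!i. L (c i)=(%u. T u i (i + d) - F N u i (i + d))" by metis
 define N' where "N' u i j=(if j=i + d then N u i j + c i u else N u i j)" for u i j
 have N': "N':fam"
 proof (rule famI)
 fix i j :: nat assume "i < j"
 thus "(%u. N' u i j):Ed (j - i)"
 unfolding N'_def using famD(1)[OF N(1), of i j] Ed_add[OF famD(1)[OF N(1), of i j], of "c i"] c(1)[of i] by (cases "j=i + d") auto
 qed (use False famD(2)[OF N(1)] in "auto simp: N'_def")
 have "F N' u i j=T u i j" if j: "j < i + Suc d" for u i j
 proof -
 have below: "F N' u i j=F N u i j" if "j < i + d" for u i j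
 proof (cases "j<=i")
 case True thus ?thesis using famD(2)[OF F[OF N']] famD(2)[OF F[OF N(1)]] by simp
 next
 case nle: False
 define d' where "d'=j - i"
 have d': "0 < d'" "d' < d" "j=i + d'" using nle that by (auto simp: d'_def)
 have "F N' u i (i + d') - F N u i (i + d')=L (%u. N' u i (i + d') - N u i (i + d')) u"
 by (rule lin[OF N' N(1) d'(1)]) (use d'(2) in "auto simp: N'_def")
 also have "\<dots>=0" using d'(2) L0 by (simp add: N'_def)
 finally show ?thesis using d'(3) by simp
 qed
 have "F N' u i (i + d) - F N u i (i + d)=L (%u. N' u i (i + d) - N u i (i + d)) u"
 by (rule lin[OF N' N(1)]) (use False in "auto simp: N'_def")
 also have "\<dots>=T u i (i + d) - F N u i (i + d)" using c(2)[of i] by (simp add: N'_def)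
 finally have "F N' u i (i + d)=T u i (i + d)" by simp
 moreover consider "j < i + d" | "j=i + d" using j by linarith
 ultimately show ?thesis using below N(2) by cases auto
 qed
 thus ?thesis using N' by (intro bexI[of _ N']) (auto simp: N'_def)
 qed
 note ex = this
 define f where "f d N=(SOME N'. N':fam&(ALL u i j. j < i + d-->N' u i j=N u i j)
&(ALL u i j. j < i + Suc d-->F N' u i j=T u i j))" for d N
 have f: "f d N:fam&(ALL u i j. j < i + d-->f d N u i j=N u i j)
&(ALL u i j. j < i + Suc d-->F (f d N) u i j=T u i j)"
 if "N:fam" "ALL u i j. j < i + d-->F N u i j=T u i j" for N d
 by (rule someI_ex[OF ex[OF that, unfolded Bex_def], folded f_def])
 \<comment> \<open>Stage \<open>d\<close> solves the equation on the superdiagonals below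
   \<open>d\<close>; later stages leave these entries unchanged.\<close>
 define S where "S=rec_nat (%u i j. 0) f"
 have S: "S d:fam&(ALL u i j. j < i + d-->F (S d) u i j=T u i j)" for d
 proof (induction d)
 case 0 thus ?case using fam_0 famD(2)[OF F[OF fam_0]] famD(2)[OF T] by (simp add: S_def less_imp_le)
 next
 case (Suc d) thus ?case using f[of "S d" d] by (simp add: S_def)
 qed
 have step: "S (d + k) u i j=S d u i j" if "j < i + d" for d k u i j
 by (induction k) (use f[of "S (d + _)" "d + _"] S that in "auto simp: S_def")
 \<comment> \<open>The entry \<open>(i, j)\<close> is final from stage \<open>j - i + 1\<close> on;
   \<open>Suc j\<close> is late enough for every row \<open>i\<close>.\<close>
 define N where "N u i j=S (Suc j) u i j" for u i j
 have NS: "N u i j=S d u i j" if "j < i + d" for u i j d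
 proof (cases "Suc j<=d")
 case True thus ?thesis using step[of j i "Suc j" "d - Suc j" u] by (simp add: N_def)
 next
 case False thus ?thesis using step[of j i d "Suc j - d" u] that by (simp add: N_def)
 qed
 have N: "N:fam"
 proof (rule famI)
 fix i j :: nat assume "i < j"
 thus "(%u. N u i j):Ed (j - i)" using famD(1)[of "S (Suc j)" i j] S by (simp add: N_def)
 qed (use famD(2)[of "S (Suc _)"] S in "simp add: N_def")
 have "F N u i j=T u i j" for u i j
 proof (cases "j<=i")
 case True thus ?thesis using famD(2)[OF F[OF N]] famD(2)[OF T] by simp
 next
 case False
 define d where "d=j - i"
 have d: "0 < d" "j=i + d" using False by (auto simp: d_def)
 let ?S = "S (Suc d)"
 have sF: "?S:fam" using S by blast
 have "F N u i (i + d) - F ?S u i (i + d)=L (%u. N u i (i + d) - ?S u i (i + d)) u"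
 by (rule lin[OF N sF d(1)]) (rule NS, simp)
 also have "\<dots>=0" using NS[of "i + d" i "Suc d"] L0 by simp
 finally show ?thesis using S[of "Suc d"] d(2) by simp
 qed
 hence "F N=T" by (intro ext)
 thus "T:F ` fam" using N by blast
qed (use F in auto)

text \<open>The semidirect product of the unitriangular families with the divisible hull, which acts
  by translation.\<close>

definition tg :: "((('k \<times> nat) set => nat => nat => 'k) \<times> ('k \<times> nat) set) monoid" where
 "tg=\<lparr>carrier=fam \<times> U, monoid.mult=(%p p'. (circ (fst p) (shift (snd p) (fst p')), snd p **\<^bsub>dhull\<^esub> snd p')),
 one=((%u i j. 0), \<one>\<^bsub>dhull\<^esub>)\<rparr>"

lemma tg_carrier: "carrier tg=fam \<times> U" and tg_one: "\<one>\<^bsub>tg\<^esub>=((%u i j. 0), \<one>\<^bsub>dhull\<^esub>)"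
 and tg_mult: "(N, v) **\<^bsub>tg\<^esub> (N', v')=(circ N (shift v N'), v **\<^bsub>dhull\<^esub> v')"
 by (simp_all add: tg_def)

text \<open>On superdiagonal \<open>d\<close> the quadratic term involves only entries of lower
  superdiagonals, where the arguments agree.\<close>

lemma circ_diff:
 assumes "N1:fam" "N2:fam" "N1':fam" "N2':fam" "!!u i j. j < i + d==>N1 u i j=N1' u i j" "!!u i j. j < i + d==>N2 u i j=N2' u i j"
 shows "circ N1 N2 u i (i + d) - circ N1' N2' u i (i + d)=(N1 u i (i + d) - N1' u i (i + d)) + (N2 u i (i + d) - N2' u i (i + d))"
proof -
 have "(SUM k<i + d. N1 u i k * N2 u k (i + d))=(SUM k<i + d. N1' u i k * N2' u k (i + d))"
 proof (rule sum.cong[OF HOL.refl])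
 fix k assume k: "k:{..<i + d}"
 show "N1 u i k * N2 u k (i + d)=N1' u i k * N2' u k (i + d)"
 proof (cases "i < k")
 case True thus ?thesis using assms(5)[of k i u] assms(6)[of "i + d" k u] k by simp
 next
 case False thus ?thesis using famD(2)[OF assms(1)] famD(2)[OF assms(3)] by simp
 qed
 qed
 thus ?thesis by (simp add: circ_def)
qed

lemma tg_group: "group tg"
proof (rule groupI)
 show "\<one>\<^bsub>tg\<^esub>:carrier tg" using fam_0 by (simp add: tg_carrier tg_one)
 fix p assume "p:carrier tg"
 then obtain N v where p: "p=(N, v)" "N:fam" "v:U" by (auto simp: tg_carrier)
 show "\<one>\<^bsub>tg\<^esub> **\<^bsub>tg\<^esub> p=p" using p shift_one by (simp add: tg_one tg_mult circ_0)
 let ?w = "inv\<^bsub>dhull\<^esub> v"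
 have sw: "shift ?w N:fam" using p by (intro fam_shift) auto
 \<comment> \<open>A left inverse is the solution of a triangular equation with the identity as
   linear part.\<close>
 have "bij_betw (%M. circ M (shift ?w N)) fam fam"
 proof (rule triangular[where L = "%m. m"])
 fix M M' d i u assume "M:fam" "M':fam" "!!u i j. j < i + d==>M u i j=M' u i j"
 thus "circ M (shift ?w N) u i (i + d) - circ M' (shift ?w N) u i (i + d)=M u i (i + d) - M' u i (i + d)"
 using circ_diff[of M "shift ?w N" M' "shift ?w N" d] sw by simp
 qed (use fam_circ sw in auto)
 hence "(%u i j. 0):(%M. circ M (shift ?w N)) ` fam" using fam_0 by (simp add: bij_betw_def)
 then obtain M where "M:fam" "circ M (shift ?w N)=(%u i j. 0)" by auto
 thus "EX q:carrier tg. q **\<^bsub>tg\<^esub> p=\<one>\<^bsub>tg\<^esub>" using p by (intro bexI[of _ "(M, ?w)"]) (simp_all add: tg_carrier tg_mult tg_one)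
 fix q r assume "q:carrier tg" "r:carrier tg"
 then obtain N' v' N'' v'' where q: "q=(N', v')" "N':fam" "v':U" and r: "r=(N'', v'')" "N'':fam" "v'':U"
 by (auto simp: tg_carrier)
 show "p **\<^bsub>tg\<^esub> q:carrier tg" using p q fam_circ fam_shift by (simp add: tg_carrier tg_mult)
 show "p **\<^bsub>tg\<^esub> q **\<^bsub>tg\<^esub> r=p **\<^bsub>tg\<^esub> (q **\<^bsub>tg\<^esub> r)"
 using p q r by (simp add: tg_mult shift_circ shift_shift circ_assoc fam_shift dhull.m_assoc)
qed

sublocale tg: group tg by (rule tg_group)

primrec pw_fam where
 "pw_fam v N 0=(%u i j. 0)"
| "pw_fam v N (Suc n)=circ (pw_fam v N n) (shift (v [^]\<^bsub>dhull\<^esub> n) N)"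

lemma pw_fam: "N:fam==>v:U==>pw_fam v N n:fam"
 by (induction n) (auto intro: fam_0 fam_circ fam_shift)

lemma tg_pow: "N:fam==>v:U==>(N, v) [^]\<^bsub>tg\<^esub> (n::nat)=(pw_fam v N n, v [^]\<^bsub>dhull\<^esub> n)"
 by (induction n) (simp_all add: tg_one tg_mult)

text \<open>On the first superdiagonal where two families may differ, the power map is linear: it is
  \<open>1 + v + ... + v^(n-1)\<close>, formed with the translation by \<open>v\<close>.\<close>

lemma pw_fam_diff:
 assumes N: "N:fam" "N':fam" "v:U" and agree: "!!u i j. j < i + d==>N u i j=N' u i j"
 shows "(ALL u i j. j < i + d-->pw_fam v N n u i j=pw_fam v N' n u i j) &
 (ALL u i. pw_fam v N n u i (i + d) - pw_fam v N' n u i (i + d) =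
 (SUM s<n. if u:U then N (u **\<^bsub>dhull\<^esub> v [^]\<^bsub>dhull\<^esub> s) i (i + d) - N' (u **\<^bsub>dhull\<^esub> v [^]\<^bsub>dhull\<^esub> s) i (i + d) else 0))"
proof (induction n)
 case (Suc n)
 let ?P = "pw_fam v N n" and ?P' = "pw_fam v N' n" and ?S = "shift (v [^]\<^bsub>dhull\<^esub> n) N" and ?S' = "shift (v [^]\<^bsub>dhull\<^esub> n) N'"
 have f: "?P:fam" "?P':fam" "?S:fam" "?S':fam" using N pw_fam fam_shift by auto
 have S: "?S u i j=?S' u i j" if "j < i + d" for u i j using agree[OF that] by (simp add: shift_def)
 have "circ ?P ?S u i j=circ ?P' ?S' u i j" if j: "j < i + d" for u i j
 proof (cases "j<=i")
 case True thus ?thesis using famD(2)[OF fam_circ[OF f(1,3)]] famD(2)[OF fam_circ[OF f(2,4)]] by simp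
 next
 case False
 have "circ ?P ?S u i (i + (j - i)) - circ ?P' ?S' u i (i + (j - i))=0"
 using circ_diff[OF f(1,3,2,4), of "j - i" u i] Suc S j False by simp
 thus ?thesis using False by simp
 qed
 moreover have "circ ?P ?S u i (i + d) - circ ?P' ?S' u i (i + d)=(?P u i (i + d) - ?P' u i (i + d)) + (?S u i (i + d) - ?S' u i (i + d))" for u i
 by (rule circ_diff[OF f(1,3,2,4)]) (use Suc S in auto)
 ultimately show ?case using Suc by (simp add: shift_def)
qed simp

text \<open>\<open>L\<close> is \<open>1 + v + ... + v^(r-1)\<close> on \<open>Ed d\<close>. Some
  \<open>v^n\<close> is \<open>emb x\<close>, so \<open>v^(r n)\<close> acts as the scalar
  \<open>x^(d r)\<close>, which differs from \<open>e\<close> for nontrivial \<open>v\<close>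
  because \<open>X0\<close> is torsion-free; and \<open>L\<close> divides
  \<open>1 - v^(r n)\<close>. For trivial \<open>v\<close>, \<open>L\<close> is multiplication by
  \<open>r\<close>, and there the characteristic matters.\<close>

lemma pow_sum_bij:
 assumes v: "v:U" and r: "0 < (r::nat)" "of_nat r * e ~= 0" and d: "0 < (d::nat)"
 defines "L \<equiv> %m u. SUM s<r. if u:U then m (u **\<^bsub>dhull\<^esub> v [^]\<^bsub>dhull\<^esub> s) else (0::'k)"
 shows "m:Ed d==>EX m':Ed d. L m'=m" "m:Ed d==>L m=(%u. 0)==>m=(%u. 0)"
proof -
 have Lu: "L m u=(SUM s<r. m (u **\<^bsub>dhull\<^esub> v [^]\<^bsub>dhull\<^esub> s))" if "u:U" for m u using that by (simp add: L_def)
 have L0: "L m u=0" if "u ~: U" for m u using that by (simp add: L_def)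
 have m0: "m u=0" if "m:Ed d" "u ~: U" for m u using that by (simp add: Ed_def)
 have mK: "m u:K" if "m:Ed d" for m u using that by (simp add: Ed_def)
 have rK: "of_nat k * e:K" for k
 by (induction k) (use subgpD(1,3)[OF D(1)] e(1) in "auto simp: distrib_right")
 obtain x n where x: "x:X0" "(0::nat) < n" "v [^]\<^bsub>dhull\<^esub> n=emb x" using pow_emb[OF v] .
 show "EX m':Ed d. L m'=m" if m: "m:Ed d" for m
 proof (cases "v=\<one>\<^bsub>dhull\<^esub>")
 case True
 obtain y where y: "y:K" "of_nat r * e * y=e" using inverse[OF rK r(2)] by blast
 have "L (%u. y * m u) u=m u" for u
 proof (cases "u:U")
 case True
 have "L (%u. y * m u) u = of_nat r * (y * m u)" using True `v = _` by (simp add: Lu)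
 also have "\<dots> = of_nat r * ((e * y) * m u)" using e_mult(1)[OF y(1)] by simp
 also have "\<dots>=(of_nat r * e * y) * m u" by (simp only: mult.assoc)
 finally show ?thesis using y(2) e_mult mK[OF m] by simp
 qed (use L0 m0[OF m] in simp)
 thus ?thesis using Ed_scale[OF m y(1)] by blast
 next
 case False
 have xe: "x ~= e"
 proof
 assume "x=e"
 hence "v [^]\<^bsub>dhull\<^esub> n=\<one>\<^bsub>dhull\<^esub> [^]\<^bsub>dhull\<^esub> n" using x emb_e by simp
 thus False using hull_root[OF x(2)] v False by (auto simp: bij_betw_def inj_on_def)
 qed
 define mm where "mm=x ^ (d * r)"
 have mu: "mm:X0" "mm ~= e"
 unfolding mm_def by (use X_pow[OF x(1), of "d * r"] tf[OF x(1), of "d * r"] d r(1) xe in auto)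
 have "e - mm:K" "e - mm ~= 0" using subgpD(4)[OF D(1) e(1) X_K(1)[OF mu(1)]] mu by auto
 then obtain y where y: "y:K" "(e - mm) * y=e" using inverse by blast
 define t where "t u k=m (u **\<^bsub>dhull\<^esub> v [^]\<^bsub>dhull\<^esub> k)" for u and k :: nat
 \<comment> \<open>The preimage is obtained by applying \<open>1 - v\<close> times the sum of the
   \<open>v^(r s)\<close> for \<open>s < n\<close>, divided by the scalar \<open>e - mm\<close> of
   \<open>1 - v^(r n)\<close>. Applying \<open>L\<close> telescopes twice.\<close>
 define m' where "m' u=y * (SUM s<n. (if u:U then t u (r * s) else 0) - (if u:U then t u (r * s + 1) else 0))" for u
 have m': "m':Ed d" unfolding m'_def t_def using m v by (intro Ed_scale y Ed_sum Ed_diff Ed_shift) auto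
 have "L m' u=m u" for u
 proof (cases "u:U")
 case True
 have ut: "t (u **\<^bsub>dhull\<^esub> v [^]\<^bsub>dhull\<^esub> a) k=t u (a + k)" for a k
 using True v by (simp add: t_def dhull.m_assoc dhull.nat_pow_mult)
 have "L m' u=(SUM a<r. y * (SUM s<n. t u (a + r * s) - t u (a + (r * s + 1))))"
 using True v by (simp add: Lu m'_def ut)
 also have "\<dots>=y * (SUM s<n. SUM a<r. t u (Suc a + r * s - 1) - t u (Suc a + r * s))"
 unfolding sum_distrib_left[symmetric] by (subst sum.swap) (simp add: add_ac)
 also have "(SUM s<n. SUM a<r. t u (Suc a + r * s - 1) - t u (Suc a + r * s))=(SUM s<n. t u (r * s) - t u (r * Suc s))"
 proof (rule sum.cong[OF HOL.refl])
 fix s show "(SUM a<r. t u (Suc a + r * s - 1) - t u (Suc a + r * s))=t u (r * s) - t u (r * Suc s)"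
 using sum_lessThan_telescope'[of "%a. t u (a + r * s)" r] by simp
 qed
 also have "\<dots>=t u 0 - t u (r * n)" using sum_lessThan_telescope'[of "%s. t u (r * s)" n] by simp
 also have "t u 0=m u" using True by (simp add: t_def)
 also have "t u (r * n)=mm * m u"
 proof -
 have "v [^]\<^bsub>dhull\<^esub> (r * n)=emb (x ^ r)" using x emb_pow[OF x(1) r(1)] v by (metis dhull.nat_pow_pow mult.commute)
 hence "t u (r * n)=m (emb (x ^ r) **\<^bsub>dhull\<^esub> u)" using True X_pow[OF x(1) r(1)] by (simp add: t_def dhull.m_comm)
 also have "\<dots>=(x ^ r) ^ d * m u" using m True X_pow[OF x(1) r(1)] by (simp add: Ed_def)
 finally show ?thesis by (simp add: mm_def mult.commute flip: power_mult)
 qed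
 also have "y * (m u - mm * m u)=((e - mm) * y) * m u"
 using e_mult(1)[OF mK[OF m]] by (simp add: algebra_simps) (metis mult.left_commute)
 finally show ?thesis using y(2) e_mult mK[OF m] by simp
 qed (use L0 m0[OF m] in simp)
 thus ?thesis using m' by blast
 qed
 show "m=(%u. 0)" if m: "m:Ed d" and z: "L m=(%u. 0)" for m
 proof (rule ext)
 fix u
 show "m u=0"
 proof (cases "u:U")
 case u: True
 show ?thesis
 proof (cases "v=\<one>\<^bsub>dhull\<^esub>")
 case True
 have "of_nat r * m u=0" using fun_cong[OF z, of u] u True by (simp add: Lu)
 hence "of_nat r * e * m u=0" using e_mult(1)[OF mK[OF m]] by (simp add: mult.assoc)
 thus ?thesis using no_zero_div[OF rK mK[OF m]] r(2) by blast
 next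
 case False
 have xe: "x ~= e"
 proof
 assume "x=e"
 hence "v [^]\<^bsub>dhull\<^esub> n=\<one>\<^bsub>dhull\<^esub> [^]\<^bsub>dhull\<^esub> n" using x emb_e by simp
 thus False using hull_root[OF x(2)] v False by (auto simp: bij_betw_def inj_on_def)
 qed
 define mm where "mm=x ^ (d * r)"
 have mu: "mm:X0" "mm ~= e"
 unfolding mm_def by (use X_pow[OF x(1), of "d * r"] tf[OF x(1), of "d * r"] d r(1) xe in auto)
 define t where "t k=m (u **\<^bsub>dhull\<^esub> v [^]\<^bsub>dhull\<^esub> k)" for k :: nat
 have Lt: "(SUM s<r. t (k + s))=0" for k
 proof -
 have "L m (u **\<^bsub>dhull\<^esub> v [^]\<^bsub>dhull\<^esub> k)=(SUM s<r. t (k + s))"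
 using u v by (simp add: Lu t_def dhull.m_assoc dhull.nat_pow_mult)
 thus ?thesis using z by simp
 qed
 have tr: "t (k + r)=t k" for k
 proof -
 have "(SUM s<r. t (k + s)) - (SUM s<r. t (k + Suc s))=t k - t (k + r)"
 using sum_lessThan_telescope'[of "%s. t (k + s)" r] by (simp add: sum_subtractf)
 moreover have "(SUM s<r. t (k + Suc s))=0" using Lt[of "Suc k"] by simp
 ultimately show ?thesis using Lt[of k] by simp
 qed
 have "t (r * k)=t 0" for k by (induction k) (simp_all add: tr add.commute[of r])
 hence "t (r * n)=m u" using u by (simp add: t_def)
 moreover have "t (r * n)=mm * m u"
 proof -
 have "v [^]\<^bsub>dhull\<^esub> (r * n)=emb (x ^ r)" using x emb_pow[OF x(1) r(1)] v by (metis dhull.nat_pow_pow mult.commute)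
 hence "t (r * n)=m (emb (x ^ r) **\<^bsub>dhull\<^esub> u)" using u X_pow[OF x(1) r(1)] by (simp add: t_def dhull.m_comm)
 also have "\<dots>=(x ^ r) ^ d * m u" using m u X_pow[OF x(1) r(1)] by (simp add: Ed_def)
 finally show ?thesis by (simp add: mm_def mult.commute flip: power_mult)
 qed
 ultimately have "(e - mm) * m u=0" using e_mult(1)[OF mK[OF m]] by (simp add: left_diff_distrib)
 thus ?thesis using no_zero_div[OF subgpD(4)[OF D(1) e(1) X_K(1)[OF mu(1)]] mK[OF m]] mu by auto
 qed
 qed (use m0[OF m] in simp)
 qed
qed

text \<open>A root is taken first in the divisible hull; for the resulting \<open>v\<close> the
  family part is a triangular equation.\<close>

theorem tg_root:
 assumes r: "0 < (r::nat)" "of_nat r * e ~= 0" shows "bij_betw (%p. p [^]\<^bsub>tg\<^esub> r) (carrier tg) (carrier tg)"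
proof -
 have 1: "bij_betw (%N. pw_fam v N r) fam fam" if v: "v:U" for v
 proof (rule triangular[where L = "%m u. SUM s<r. if u:U then m (u **\<^bsub>dhull\<^esub> v [^]\<^bsub>dhull\<^esub> s) else 0"])
 fix N N' d i u assume "N:fam" "N':fam" "!!u i j. j < i + d==>N u i j=N' u i j"
 thus "pw_fam v N r u i (i + d) - pw_fam v N' r u i (i + d) =
 (SUM s<r. if u:U then N (u **\<^bsub>dhull\<^esub> v [^]\<^bsub>dhull\<^esub> s) i (i + d) - N' (u **\<^bsub>dhull\<^esub> v [^]\<^bsub>dhull\<^esub> s) i (i + d) else 0)"
 using pw_fam_diff[OF _ _ v, of N N' d r] by blast
 qed (use pw_fam v pow_sum_bij[OF v r] in blast)+
 show ?thesis unfolding bij_betw_def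
 proof (intro conjI inj_onI equalityI subsetI)
 fix p q assume "p:carrier tg" "q:carrier tg" and eq: "p [^]\<^bsub>tg\<^esub> r=q [^]\<^bsub>tg\<^esub> r"
 then obtain N v N' v' where p: "p=(N, v)" "N:fam" "v:U" and q: "q=(N', v')" "N':fam" "v':U" by (auto simp: tg_carrier)
 have e2: "pw_fam v N r=pw_fam v' N' r" "v [^]\<^bsub>dhull\<^esub> r=v' [^]\<^bsub>dhull\<^esub> r" using eq p q by (simp_all add: tg_pow)
 have "v=v'" using hull_root[OF r(1)] e2(2) p q by (auto simp: bij_betw_def inj_on_def)
 moreover have "N=N'" using 1[OF p(3)] e2(1) p q `v = v'` by (auto simp: bij_betw_def inj_on_def)
 ultimately show "p=q" using p q by simp
 next
 fix q assume "q:carrier tg"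
 then obtain T w where q: "q=(T, w)" "T:fam" "w:U" by (auto simp: tg_carrier)
 have "w:(%u. u [^]\<^bsub>dhull\<^esub> r) ` U" using hull_root[OF r(1)] q(3) by (simp add: bij_betw_def)
 then obtain v where v: "v:U" "v [^]\<^bsub>dhull\<^esub> r=w" by blast
 have "T:(%N. pw_fam v N r) ` fam" using 1[OF v(1)] q(2) by (simp add: bij_betw_def)
 then obtain N where "N:fam" "pw_fam v N r=T" by blast
 hence "(N, v) [^]\<^bsub>tg\<^esub> r=q" "(N, v):carrier tg" using v q by (simp_all add: tg_pow tg_carrier)
 thus "q:(%p. p [^]\<^bsub>tg\<^esub> r) ` carrier tg" by blast
 qed auto
qed
end

section \<open>Solubility is lost by adjoining roots\<close>

lemma comm_in_derived: "x:H==>y:H==>comm G x y:derived G H"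
 unfolding derived_def comm_def by (rule generate.incl) blast

locale root_target = character G K e Z kh for G (structure) and K :: "'k::comm_ring_1 set" and e Z kh +
 fixes dl and q :: nat and g0
 assumes crossed: "crossed dl" and torsion_free: "g:Z==>(0::nat) < n==>kh (g [^] n)=e==>kh g=e"
 and q: "1 < q" "of_nat q * e ~= 0" and g0: "g0:Z" "g:Z==>kh (g [^] q) ~= kh g0"
begin

lemma chi_pow': "g:Z==>(0::nat) < n==>kh (g [^] n)=kh g ^ n"
 using chi_pow[of g n] e_mult(1)[OF chi_K(1), of g] by (cases n) (auto simp: mult.assoc[symmetric])

sublocale torsion_free_units K e "kh ` Z"
proof unfold_locales
 show "kh ` Z<=K - {0}" using chi by auto
 show "e:kh ` Z" using chi_one Y_closed(1) by (metis imageI)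
 show "x * y:kh ` Z" if "x:kh ` Z" "y:kh ` Z" for x y using that chi_mult Y_closed(2) by (auto simp flip: chi_mult)
 show "EX y:kh ` Z. x * y=e" if "x:kh ` Z" for x using that chi_inv Y_closed(3) by blast
 show "x=e" if x: "x:kh ` Z" and n: "0 < n" "x ^ n=e" for x n
 proof -
 obtain g where "x=kh g" "g:Z" using x by blast
 thus ?thesis using torsion_free[of g n] chi_pow'[of g n] n by simp
 qed
qed

definition c :: "nat => ('k \<times> nat) set" where "c i=(SOME u. u:U&u [^]\<^bsub>dhull\<^esub> (q ^ i)=emb (kh g0))"

lemma c: "c i:U" "c i [^]\<^bsub>dhull\<^esub> (q ^ i)=emb (kh g0)"
proof -
 have "emb (kh g0):(%u. u [^]\<^bsub>dhull\<^esub> (q ^ i)) ` U"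
 using hull_root[of "q ^ i"] q(1) g0(1) emb_U by (simp add: bij_betw_def)
 hence "EX u. u:U&u [^]\<^bsub>dhull\<^esub> (q ^ i)=emb (kh g0)" by auto
 from someI_ex[OF this] show "c i:U" "c i [^]\<^bsub>dhull\<^esub> (q ^ i)=emb (kh g0)" by (simp_all add: c_def)
qed

text \<open>With \<open>k = j - i\<close>, the \<open>q^k\<close>-th power of \<open>c j\<close> is
  \<open>c i\<close>. If both lay in one coset of the value group, raising to \<open>q^k\<close>
  would fix that coset. After \<open>j\<close> rounds the exponent is a multiple of
  \<open>q^j\<close>, so \<open>c j\<close> would itself be a value and \<open>kh g0\<close> a
  \<open>q\<close>-th power.\<close>

lemma c_less: assumes ij: "i < j" and x: "x:kh ` Z" shows "c i ~= c j **\<^bsub>dhull\<^esub> emb x"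
proof
 assume eq: "c i=c j **\<^bsub>dhull\<^esub> emb x"
 define k where "k=j - i"
 have q0: "0 < q" using q by simp
 have k: "c j [^]\<^bsub>dhull\<^esub> (q ^ k)=c i"
 proof -
 have "(c j [^]\<^bsub>dhull\<^esub> (q ^ k)) [^]\<^bsub>dhull\<^esub> (q ^ i)=c i [^]\<^bsub>dhull\<^esub> (q ^ i)"
 using c[of j] c[of i] ij by (simp add: k_def dhull.nat_pow_pow flip: power_add)
 thus ?thesis using hull_root[of "q ^ i"] c(1) q0 by (auto simp: bij_betw_def inj_on_def)
 qed
 have "EX y:kh ` Z. c j [^]\<^bsub>dhull\<^esub> (q ^ (k * n))=c j **\<^bsub>dhull\<^esub> emb y" for n
 proof (induction n)
 case 0 show ?case using X0(2) c(1) by (intro bexI[of _ e]) (simp_all add: emb_e)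
 next
 case (Suc n)
 then obtain y where y: "y:kh ` Z" "c j [^]\<^bsub>dhull\<^esub> (q ^ (k * n))=c j **\<^bsub>dhull\<^esub> emb y" by blast
 have yq: "y ^ (q ^ k):kh ` Z" using X_pow[OF y(1)] q0 by simp
 have "c j [^]\<^bsub>dhull\<^esub> (q ^ (k * Suc n))=(c j [^]\<^bsub>dhull\<^esub> (q ^ (k * n))) [^]\<^bsub>dhull\<^esub> (q ^ k)"
 using c(1) by (simp add: dhull.nat_pow_pow power_add mult.commute)
 also have "\<dots>=c i **\<^bsub>dhull\<^esub> emb (y ^ (q ^ k))" unfolding y(2)
 using c(1) y(1) q0 k emb_pow[OF y(1)] by (simp add: dhull.nat_pow_distrib emb_U)
 also have "\<dots>=c j **\<^bsub>dhull\<^esub> emb (x * y ^ (q ^ k))" unfolding eq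
 using c(1) x yq by (simp add: emb_mult dhull.m_assoc emb_U)
 finally show ?case using X0(3)[OF x yq] by blast
 qed
 then obtain y where y: "y:kh ` Z" "c j [^]\<^bsub>dhull\<^esub> (q ^ (k * j))=c j **\<^bsub>dhull\<^esub> emb y" by blast
 obtain z where z: "z:kh ` Z" "y * z=e" using X0(4) y(1) by blast
 define w where "w=kh g0 ^ (q ^ (k * j - j))"
 have w: "w:kh ` Z" unfolding w_def using X_pow[of "kh g0"] g0(1) q0 by simp
 have kj: "k * j=j + (k * j - j)" using ij by (cases k) (auto simp: k_def)
 have "c j [^]\<^bsub>dhull\<^esub> (q ^ (k * j))=(c j [^]\<^bsub>dhull\<^esub> (q ^ j)) [^]\<^bsub>dhull\<^esub> (q ^ (k * j - j))"
 using c(1) by (subst kj) (simp only: dhull.nat_pow_pow power_add)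
 also have "\<dots>=emb w" unfolding w_def c(2) using g0(1) q0 by (intro emb_pow) auto
 finally have "emb w=c j **\<^bsub>dhull\<^esub> emb y" using y(2) by simp
 hence "emb (w * z)=c j **\<^bsub>dhull\<^esub> (emb y **\<^bsub>dhull\<^esub> emb z)" using emb_mult[OF w z(1)] dhull.m_assoc[OF c(1) emb_U[OF y(1)] emb_U[OF z(1)]] by simp
 also have "emb y **\<^bsub>dhull\<^esub> emb z=\<one>\<^bsub>dhull\<^esub>" using y(1) z emb_mult emb_e by metis
 finally have cj: "c j=emb (w * z)" using c(1) by simp
 obtain g where g: "g:Z" "w * z=kh g" using X0(3)[OF w z(1)] by blast
 obtain j' where j': "j=Suc j'" using ij by (cases j) auto
 have "emb (kh g ^ (q ^ j))=emb (kh g0)" using c(2)[of j] emb_pow[of "kh g" "q ^ j"] g q0 cj by simp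
 hence "kh g ^ (q ^ j)=kh g0" using emb_inj X_pow[of "kh g" "q ^ j"] g(1) g0(1) q0 by simp
 moreover have "kh ((g [^] (q ^ j')) [^] q)=kh g ^ (q ^ j)"
 using chi_pow'[OF g(1), of "q ^ j"] g(1) Yc q0 by (simp add: nat_pow_pow j' mult.commute)
 moreover have "g [^] (q ^ j'):Z" using subgroup_closed(6)[OF Y g(1)] .
 ultimately show False using g0(2) by metis
qed

lemma c_ne: assumes "i ~= j" "x:kh ` Z" shows "c i ~= c j **\<^bsub>dhull\<^esub> emb x"
proof (cases "i < j")
 case False
 hence ji: "j < i" using assms by simp
 obtain z where z: "z:kh ` Z" "x * z=e" using X0(4) assms by blast
 have "emb x **\<^bsub>dhull\<^esub> emb z=\<one>\<^bsub>dhull\<^esub>" using assms z emb_mult emb_e by metis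
 hence "c j **\<^bsub>dhull\<^esub> emb x **\<^bsub>dhull\<^esub> emb z=c j"
 using dhull.m_assoc[OF c(1) emb_U[OF assms(2)] emb_U[OF z(1)]] c(1) by simp
 thus ?thesis using c_less[OF ji z(1)] by metis
qed (use c_less assms in blast)

text \<open>One entry per row, just above the diagonal, supported on the coset of \<open>c i\<close>
  by the value group; there it is determined by its value \<open>dl g\<close> at
  \<open>c i\<close>.\<close>

definition De :: "'a => ('k \<times> nat) set => nat => nat => 'k" where
 "De g u i j=(if j=Suc i&(EX x:kh ` Z. u=c i **\<^bsub>dhull\<^esub> emb x)
 then (THE x. x:kh ` Z&u=c i **\<^bsub>dhull\<^esub> emb x) * dl g else 0)"

lemma Delta_c: assumes x: "x:kh ` Z" shows "De g (c i **\<^bsub>dhull\<^esub> emb x) i (Suc i)=x * dl g"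
proof -
 have "(THE y. y:kh ` Z&c i **\<^bsub>dhull\<^esub> emb x=c i **\<^bsub>dhull\<^esub> emb y)=x"
 proof (rule the_equality)
 fix y assume y: "y:kh ` Z&c i **\<^bsub>dhull\<^esub> emb x=c i **\<^bsub>dhull\<^esub> emb y"
 hence "emb x=emb y" using dhull.l_cancel[OF _ emb_U[OF x] emb_U c(1)] by blast
 thus "y=x" using emb_inj x y by blast
 qed (use x in simp)
 thus ?thesis using x by (auto simp: De_def)
qed

lemma Delta_0: "j ~= Suc i==>De g u i j=0" "(!!x. x:kh ` Z==>u ~= c i **\<^bsub>dhull\<^esub> emb x)==>De g u i j=0"
 unfolding De_def by auto

lemma coset_emb:
 assumes "u:U" "y:kh ` Z" "u **\<^bsub>dhull\<^esub> emb y=c i **\<^bsub>dhull\<^esub> emb x" "x:kh ` Z"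
 obtains z where "z:kh ` Z" "u=c i **\<^bsub>dhull\<^esub> emb z"
proof -
 obtain w where w: "w:kh ` Z" "y * w=e" using X0(4) assms by blast
 have "emb y **\<^bsub>dhull\<^esub> emb w=\<one>\<^bsub>dhull\<^esub>" using assms w emb_mult emb_e by metis
 hence "u=u **\<^bsub>dhull\<^esub> emb y **\<^bsub>dhull\<^esub> emb w" using assms(1,2) w(1) by (simp add: dhull.m_assoc emb_U)
 also have "\<dots>=c i **\<^bsub>dhull\<^esub> emb (x * w)" unfolding assms(3) using assms(4) w(1) c(1) by (simp add: emb_mult dhull.m_assoc emb_U)
 finally show ?thesis by (rule that[OF X0(3)[OF assms(4) w(1)]])
qed

lemma Delta_shift:
 assumes u: "u:U" and y: "y:kh ` Z" shows "De g (u **\<^bsub>dhull\<^esub> emb y) i j=y * De g u i j"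
proof (cases "j=Suc i&(EX x:kh ` Z. u=c i **\<^bsub>dhull\<^esub> emb x)")
 case True
 then obtain x where x: "j=Suc i" "x:kh ` Z" "u=c i **\<^bsub>dhull\<^esub> emb x" by blast
 have "u **\<^bsub>dhull\<^esub> emb y=c i **\<^bsub>dhull\<^esub> emb (x * y)" using x y c(1) by (simp add: emb_mult dhull.m_assoc emb_U)
 thus ?thesis using Delta_c X0(3) x y by (simp add: mult_ac)
next
 case False
 hence "De g u i j=0" by (auto simp: De_def)
 moreover have "De g (u **\<^bsub>dhull\<^esub> emb y) i j=0" using False coset_emb[OF u y] by (metis Delta_0)
 ultimately show ?thesis by simp
qed

lemma Delta_fam: assumes g: "g:Z" shows "De g:fam"
proof (rule famI)
 have dK: "dl g:K" using crossed g by (simp add: crossed_def)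
 fix i j :: nat assume "i < j"
 have "De g u i j:K" for u
 proof (cases "j=Suc i&(EX x:kh ` Z. u=c i **\<^bsub>dhull\<^esub> emb x)")
 case True thus ?thesis using Delta_c D(2) X_K dK by auto
 next
 case False thus ?thesis using subgpD(1)[OF D(1)] by (auto simp: De_def)
 qed
 moreover have "De g u i j=0" if "u ~: U" for u
 proof (rule Delta_0(2))
 fix x assume "x:kh ` Z" thus "u ~= c i **\<^bsub>dhull\<^esub> emb x" using that c(1)[of i] emb_U[of x] dhull.m_closed by blast
 qed
 moreover have "De g (emb x **\<^bsub>dhull\<^esub> u) i j=x ^ (j - i) * De g u i j" if "x:kh ` Z" "u:U" for x u
 using Delta_shift[OF that(2,1)] dhull.m_comm[OF emb_U[OF that(1)] that(2)] Delta_0(1)[of j i g u] by (cases "j=Suc i") auto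
 ultimately show "(%u. De g u i j):Ed (j - i)" by (simp add: Ed_def)
qed (use Delta_0 in auto)

definition th :: "'a => _" where "th g=(De g, emb (kh g))"

lemma th_carrier: "g:Z==>th g:carrier tg" using Delta_fam by (simp add: th_def tg_carrier)

text \<open>Consecutive rows have disjoint supports because the cosets differ. So the quadratic term
  of \<open>circ\<close> vanishes, and what remains is the law of a crossed homomorphism.\<close>

lemma th_mult: assumes "g:Z" "h:Z" shows "th (g**h)=th g **\<^bsub>tg\<^esub> th h"
proof -
 have X: "kh g:kh ` Z" using assms by blast
 have "De (g**h) u i j=circ (De g) (shift (emb (kh g)) (De h)) u i j" for u i j
 proof (cases "u:U")
 case u: True
 have "De g u i k * De h (u **\<^bsub>dhull\<^esub> emb (kh g)) k j=0" for k
 proof (rule ccontr)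
 assume "~ ?thesis"
 hence nz: "De g u i k ~= 0" "De h u k j ~= 0" unfolding Delta_shift[OF u X] by auto
 have k: "k=Suc i" "j=Suc k" using nz Delta_0(1) by blast+
 obtain x y where xy: "x:kh ` Z" "u=c i **\<^bsub>dhull\<^esub> emb x" "y:kh ` Z" "u=c k **\<^bsub>dhull\<^esub> emb y" using nz Delta_0(2) by metis
 then obtain z where "z:kh ` Z" "c i=c k **\<^bsub>dhull\<^esub> emb z" using coset_emb[OF c(1) xy(1), of i k y] by metis
 thus False using c_ne[of i k z] k by simp
 qed
 hence "circ (De g) (shift (emb (kh g)) (De h)) u i j=De g u i j + kh g * De h u i j"
 using u Delta_shift[OF u X] by (simp add: circ_def shift_def)
 also have "\<dots>=De (g**h) u i j"
 using crossed assms unfolding De_def crossed_def by (auto simp: algebra_simps)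
 finally show ?thesis ..
 next
 case False
 thus ?thesis using famD(4)[OF fam_circ[OF Delta_fam fam_shift[OF Delta_fam]]] famD(4)[OF Delta_fam] assms emb_U Y_closed by simp
 qed
 thus ?thesis using assms by (simp add: th_def tg_mult chi_mult emb_mult fun_eq_iff)
qed

text \<open>At the point 1 of the hull, \<open>p\<close> begins like an elementary matrix with entry
  \<open>al\<close> at position \<open>(i, i + d)\<close>; higher superdiagonals are left
  free.\<close>

definition tp :: "nat => nat => 'k => _ => bool" where
 "tp d i al p \<longleftrightarrow> p:carrier tg&snd p=\<one>\<^bsub>dhull\<^esub>&(ALL i' j. j < i' + d-->fst p \<one>\<^bsub>dhull\<^esub> i' j=0)
&(ALL i'. fst p \<one>\<^bsub>dhull\<^esub> i' (i' + d)=(if i'=i then al else 0))"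

text \<open>Conjugation by an element over \<open>c i\<close> moves the value of row
  \<open>i\<close> at \<open>c i\<close> to the point 1, while the other rows vanish at
  \<open>c i\<close>. The unitriangular part of \<open>p\<close> does not affect the first
  superdiagonal.\<close>

lemma tp_conj:
 assumes a: "a:Z" "kh a=e" and p: "p:carrier tg" "snd p=c i"
 shows "tp 1 i (dl a) (p **\<^bsub>tg\<^esub> th a **\<^bsub>tg\<^esub> inv\<^bsub>tg\<^esub> p)"
proof -
 let ?x = "p **\<^bsub>tg\<^esub> th a **\<^bsub>tg\<^esub> inv\<^bsub>tg\<^esub> p" and ?o = "\<one>\<^bsub>dhull\<^esub>"
 have x: "?x:carrier tg" using p th_carrier[OF a(1)] by simp
 obtain C v where C: "?x=(C, v)" "C:fam" "v:U" using x by (cases ?x) (auto simp: tg_carrier)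
 obtain M where M: "p=(M, c i)" "M:fam" using p by (cases p) (auto simp: tg_carrier)
 have tha: "th a=(De a, ?o)" using a by (simp add: th_def emb_e)
 have "?x **\<^bsub>tg\<^esub> p=p **\<^bsub>tg\<^esub> th a" using p th_carrier[OF a(1)] by (simp add: tg.m_assoc)
 hence "(C, v) **\<^bsub>tg\<^esub> (M, c i)=(M, c i) **\<^bsub>tg\<^esub> (De a, ?o)" unfolding C(1) unfolding tha by (simp only: M(1))
 hence eq: "circ C (shift v M)=circ M (shift (c i) (De a))" "v **\<^bsub>dhull\<^esub> c i=c i"
 using c(1) by (simp_all add: tg_mult)
 have v: "v=?o" using eq(2) c(1) C(3) by simp
 have "C ?o i' (Suc i')=(if i'=i then dl a else 0)" for i'
 proof -
 have s: "(SUM k<Suc i'. N ?o i' k * N' k)=0" if "N:fam" for N and N' :: "nat => 'k"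
 using famD(2)[OF that] by (intro sum.neutral) auto
 have "C ?o i' (Suc i') + M ?o i' (Suc i')=M ?o i' (Suc i') + De a (c i) i' (Suc i')"
 using fun_cong[OF fun_cong[OF fun_cong[OF eq(1), of ?o], of i'], of "Suc i'"] c(1) v C(2) M(2)
 by (simp add: circ_def s[OF C(2)] s[OF M(2)] shift_def del: sum.lessThan_Suc)
 moreover have "De a (c i) i' (Suc i')=(if i'=i then dl a else 0)"
 proof (cases "i'=i")
 case True
 have "De a (c i **\<^bsub>dhull\<^esub> emb e) i (Suc i)=e * dl a" by (rule Delta_c[OF X0(2)])
 thus ?thesis using True c(1) crossed a(1) e_mult by (simp add: emb_e crossed_def)
 next
 case False thus ?thesis using c_ne[of i i'] Delta_0(2)[of "c i" i' a "Suc i'"] by auto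
 qed
 ultimately show ?thesis by simp
 qed
 thus ?thesis unfolding tp_def using x C v famD(2)[OF C(2)] by (simp add: C(1) less_Suc_eq_le)
qed

text \<open>On leading superdiagonals this is the commutator relation of elementary matrices:
  positions \<open>(i, i + d)\<close> and \<open>(i + d, i + 2 d)\<close> give
  \<open>(i, i + 2 d)\<close>.\<close>

lemma tp_comm:
 assumes d: "0 < d" and p: "tp d i al p" and p': "tp d (i + d) bt p'"
 shows "tp (2 * d) i (al * bt) (comm tg p p')"
proof -
 let ?o = "\<one>\<^bsub>dhull\<^esub>"
 have pc: "p:carrier tg" "p':carrier tg" using p p' by (auto simp: tp_def)
 obtain N N' where N: "p=(N, ?o)" "N:fam" "p'=(N', ?o)" "N':fam"
 using p p' by (cases p; cases p') (auto simp: tp_def tg_carrier)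
 have x: "comm tg p p':carrier tg" using pc by (rule tg.comm_closed)
 obtain C v where C: "comm tg p p'=(C, v)" "C:fam" "v:U" using x by (cases "comm tg p p'") (auto simp: tg_carrier)
 have "comm tg p p' **\<^bsub>tg\<^esub> (p' **\<^bsub>tg\<^esub> p)=p **\<^bsub>tg\<^esub> p'" using pc by (simp add: comm_def tg.m_assoc)
 hence eq: "circ C (shift v (circ N' N))=circ N N'" "v=?o"
 unfolding C(1) unfolding N(1,3) using C(3) N by (auto simp add: tg_mult shift_one)
 have eq': "circ C (circ N' N)=circ N N'" using eq(1) unfolding eq(2) shift_one[OF fam_circ[OF N(4,2)]] .
 have z: "j < i' + d==>N ?o i' j=0" "j < i' + d==>N' ?o i' j=0" for i' j
 using p p' N by (auto simp: tp_def)
 have dg: "N ?o i' (i' + d)=(if i'=i then al else 0)" "N' ?o i' (i' + d)=(if i'=i + d then bt else 0)" for i'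
 using p p' N by (auto simp: tp_def)
 have prod0: "M ?o i' k * M' ?o k j=0" if "j < i' + 2 * d | k ~= i' + d" "j<=i' + 2 * d" "!!i' j. j < i' + d==>M ?o i' j=0" "!!i' j. j < i' + d==>M' ?o i' j=0" for M M' :: "_ => nat => nat => 'k" and i' k j
 proof (cases "k < i' + d")
 case False
 hence "j < k + d" using that(1,2) by linarith
 thus ?thesis using that(4) by simp
 qed (simp add: that(3))
 have rel: "C ?o i' j=(SUM k<j. N ?o i' k * N' ?o k j) - (SUM k<j. N' ?o i' k * N ?o k j) - (SUM k<j. C ?o i' k * circ N' N ?o k j)" for i' j
 using fun_cong[OF fun_cong[OF fun_cong[OF eq', of ?o], of i'], of j] unfolding circ_def by (simp add: algebra_simps)
 have C0: "C ?o i' j=0" if "j < i' + 2 * d" for i' j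
 using that
 proof (induction j rule: less_induct)
 case (less j)
 have "(SUM k<j. N ?o i' k * N' ?o k j)=0" "(SUM k<j. N' ?o i' k * N ?o k j)=0"
 using less.prems by (auto intro!: sum.neutral prod0 z)
 moreover have "(SUM k<j. C ?o i' k * circ N' N ?o k j)=0" using less by (intro sum.neutral) auto
 ultimately show ?case using rel[of i' j] by simp
 qed
 have "C ?o i' (i' + 2 * d)=(if i'=i then al * bt else 0)" for i'
 proof -
 have s: "(SUM k<i' + 2 * d. M ?o i' k * M' ?o k (i' + 2 * d))=M ?o i' (i' + d) * M' ?o (i' + d) ((i' + d) + d)"
 if "!!i' j. j < i' + d==>M ?o i' j=0" "!!i' j. j < i' + d==>M' ?o i' j=0" for M M' :: "_ => nat => nat => 'k"
 proof -
 have "(SUM k<i' + 2 * d. M ?o i' k * M' ?o k (i' + 2 * d))=(SUM k:{i' + d}. M ?o i' k * M' ?o k (i' + 2 * d))"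
 by (rule sum.mono_neutral_right) (use d that in "auto intro!: prod0")
 thus ?thesis by (simp add: mult_2 add.assoc)
 qed
 have "(SUM k<i' + 2 * d. C ?o i' k * circ N' N ?o k (i' + 2 * d))=0" using C0 by (intro sum.neutral) auto
 thus ?thesis using rel[of i' "i' + 2 * d"] s[of N N', OF z(1) z(2)] s[of N' N, OF z(2) z(1)] d unfolding dg by auto
 qed
 thus ?thesis unfolding tp_def using x C0 eq(2) by (simp add: C(1))
qed

text \<open>\<open>P\<close> contains a \<open>q^i\<close>-th root of \<open>th g0\<close> for each
  \<open>i\<close>; it lies over \<open>c i\<close> and conjugates \<open>th a\<close> to an element
  that is elementary in row \<open>i\<close>. Each derived step doubles the superdiagonal, and the
  infinitely many rows never run out.\<close>

theorem roots_not_soluble: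
 assumes a: "a:Z" "kh a=e" "dl a ~= 0" and P: "tg.isol {q} P" "th ` Z<=P"
 shows "(derived tg ^^ k) P ~= {\<one>\<^bsub>tg\<^esub>}"
proof -
 have sP: "subgroup P tg" and rt: "!!x. x:carrier tg==>x [^]\<^bsub>tg\<^esub> q:P==>x:P"
 using P(1) by (auto simp: tg.isol_def)
 have ex: "EX p:P. p [^]\<^bsub>tg\<^esub> (q ^ i)=th g0" for i
 proof (induction i)
 case 0 show ?case using P(2) g0(1) th_carrier by (intro bexI[of _ "th g0"]) auto
 next
 case (Suc i)
 then obtain p where p: "p:P" "p [^]\<^bsub>tg\<^esub> (q ^ i)=th g0" by blast
 have "p:(%p. p [^]\<^bsub>tg\<^esub> q) ` carrier tg"
 using tg_root[OF _ q(2)] q(1) sg_mem[OF sP p(1)] by (simp add: bij_betw_def)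
 then obtain r where r: "r:carrier tg" "r [^]\<^bsub>tg\<^esub> q=p" by blast
 hence "r [^]\<^bsub>tg\<^esub> (q ^ Suc i)=th g0" using p(2) by (auto simp: tg.nat_pow_pow)
 moreover have "r:P" using rt[OF r(1)] r(2) p(1) by simp
 ultimately show ?case by blast
 qed
 have base: "EX p:P. tp 1 i (dl a) p" for i
 proof -
 obtain p where p: "p:P" "p [^]\<^bsub>tg\<^esub> (q ^ i)=th g0" using ex by blast
 have pc: "p:carrier tg" using sg_mem[OF sP p(1)] .
 obtain M v where M: "p=(M, v)" "M:fam" "v:U" using pc by (cases p) (auto simp: tg_carrier)
 have "v [^]\<^bsub>dhull\<^esub> (q ^ i)=c i [^]\<^bsub>dhull\<^esub> (q ^ i)" using p(2) M tg_pow[OF M(2,3)] c(2) by (simp add: th_def)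
 hence "v=c i" using hull_root[of "q ^ i"] q(1) M(3) c(1)[of i] by (auto simp: bij_betw_def inj_on_def)
 hence "tp 1 i (dl a) (p **\<^bsub>tg\<^esub> th a **\<^bsub>tg\<^esub> inv\<^bsub>tg\<^esub> p)" using tp_conj[OF a(1,2) pc] M(1) by simp
 moreover have "p **\<^bsub>tg\<^esub> th a **\<^bsub>tg\<^esub> inv\<^bsub>tg\<^esub> p:P"
 using p(1) P(2) a(1) by (intro sg_mult[OF sP] sg_inv[OF sP]) auto
 ultimately show ?thesis by blast
 qed
 have "EX p:(derived tg ^^ k) P. EX al:K - {0}. tp (2 ^ k) i al p" for i
 proof (induction k arbitrary: i)
 case 0
 have "dl a:K - {0}" using a crossed by (simp add: crossed_def)
 thus ?case using base[of i] by auto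
 next
 case (Suc k)
 obtain p al where p: "p:(derived tg ^^ k) P" "al:K - {0}" "tp (2 ^ k) i al p" using Suc by blast
 obtain p' bt where p': "p':(derived tg ^^ k) P" "bt:K - {0}" "tp (2 ^ k) (i + 2 ^ k) bt p'" using Suc by blast
 have "comm tg p p':derived tg ((derived tg ^^ k) P)"
 using p(1) p'(1) by (rule comm_in_derived)
 moreover have "tp (2 ^ Suc k) i (al * bt) (comm tg p p')" using tp_comm[OF _ p(3) p'(3)] by simp
 moreover have "al * bt:K - {0}" using p(2) p'(2) D(2) no_zero_div by blast
 ultimately show ?case by (intro bexI) simp_all
 qed
 then obtain p al where p: "p:(derived tg ^^ k) P" "al ~= 0" "tp (2 ^ k) 0 al p" by blast
 have "p ~= \<one>\<^bsub>tg\<^esub>" using p(2,3) by (auto simp: tp_def tg_one split: if_splits)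
 thus ?thesis using p(1) by blast
qed
end

section \<open>The character attached to a soluble group\<close>

lemma (in character) restrict_character: "subgroup Z G==>Z<=Y==>character G K e Z kh"
 using chi chi_mult by (intro character.intro character_axioms.intro is_group field_set_axioms) blast+

lemma (in group) fidx_enlarge:
 assumes Y0: "fidx G Y0 H" and Y: "subgroup Y G" "Y0<=Y" "Y<=H" shows "fidx G Y H"
proof -
 obtain T where T: "finite T" "T<=carrier G" "ALL h:H. EX t:T. h**inv t:Y0" using Y0 by (auto simp: fidx_def)
 have "ALL h:H. EX t:T. h**inv t:Y" using T(3) Y(2) by (meson subsetD)
 thus ?thesis using T(1,2) Y fidxD(2)[OF Y0] unfolding fidx_def by metis
qed

text \<open>If all values of the character were torsion, its kernel would have finite index and act
  trivially on \<open>M / B\<close>, against \<open>nva\<close>. The map \<open>l\<close> is the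
  coordinate \<open>rh\<close> restricted to \<open>A\<close>; it is nonzero because the elements
  \<open>ka a\<close> cover \<open>M\<close> modulo \<open>R\<close>.\<close>

lemma (in derived_section) section_character:
 assumes Y: "adm Y" and nva: "nva Y R"
 obtains Y1 and K :: "(('a set endo cprod \<times> 'a set endo cprod) cprod) set" and e kh l
 where "fidx G Y1 Y" "A<=Y1" "character G K e Y1 kh" "character.equivariant G K e Y1 kh A l"
 "EX a:A. l a ~= 0" "EX g:Y1. ALL n>0. kh (g [^] (n::nat)) ~= e"
proof -
 obtain n where n: "lcs G Y n<=A" using Y by (auto simp: adm_def)
 have R: "bm Y R" unfolding bm_def using R_sm sm_mono[OF R_sm(1) subgroup.subset[OF admD(1)[OF Y]]] by blast
 have R0: "0:R" using subgpD(1)[OF smD(1)[OF R_sm(1)]] .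
 have "E g$v - v:R" if "g:lcs G Y n" "v:M" for g v using that n E_A R0 by (auto simp: subset_iff)
 from abelian_reduction[OF Y R nva this]
 obtain Y1 B where YB: "fidx G Y1 Y" "A<=Y1" "R<=B" "maxm Y1 B"
 "!!g v. g:lcs G Y1 1==>v:M==>E g$v - v:B" by metis
 interpret maximal_module G E A M R Y1 B
 by (intro maximal_module.intro maximal_module_axioms.intro module_action_axioms adm_fidx[OF Y YB(1,2)] YB(4))
 interpret abelian_module G E A M R Y1 B
 proof (intro abelian_module.intro abelian_module_axioms.intro maximal_module_axioms)
 fix g h assume gh: "g:Y1" "h:Y1"
 have "comm G g h:lcs G Y1 1" using comm_in_lcs[of g Y1 0 h] gh by simp
 hence "eqm (E (comm G g h)) 1" using YB(5) by (simp add: eqm_def)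
 thus "eqm (E g * E h) (E h * E g)" by (rule comm_ker[OF gh])
 qed
 obtain K :: "(('a set endo cprod \<times> 'a set endo cprod) cprod) set" and e kh rh
 where ch: "field_set K e" "ALL g:Y1. kh g:K - {0}" "ALL g:Y1. ALL h:Y1. kh (g**h)=kh g * kh h"
 "ALL g:Y1. kh g=e \<longleftrightarrow> eqm (E g) 1" "ALL v:M. rh v:K&(rh v=0 \<longleftrightarrow> v:B)"
 "ALL u:M. ALL v:M. rh (u + v)=rh u + rh v" "ALL g:Y1. ALL v:M. rh (E g$v)=kh g * rh v"
 by (rule exE[OF character_exists], elim exE conjE) (rule that, assumption+)
 interpret ch: character G K e Y1 kh
 by (intro character.intro character_axioms.intro is_group ch(1) sH) (use ch(2,3) in auto)
 have nvaB: "nva Y1 B" using max by (simp add: maxm_def)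
 have notin: "EX a:A. ka a ~: B"
 proof (rule ccontr)
 assume no: "~ ?thesis"
 have "v:B" if v: "v:M" for v
 proof -
 obtain a where a: "a:A" "v - ka a:R" using M_kappa[OF v] by blast
 hence "(v - ka a) + ka a:B" using no YB(3) by (intro b(3)) auto
 thus ?thesis by simp
 qed
 hence "M<=ser Y1 B 0" by auto
 thus False using nvaB fidx_refl[OF sH] YB(2) unfolding nva_def nilact_def by blast
 qed
 have A1: "eqm (E a) 1" if "a:A" for a using E_A[OF that] by simp
 have "~ (ALL g:Y1. EX n>0. kh (g [^] (n::nat))=e)"
 proof
 assume "ALL g:Y1. EX n>0. kh (g [^] (n::nat))=e"
 hence f: "fidx G {g:Y1. kh g=e} Y1" using ch.ker_fidx[OF admD(3)[OF H]] by blast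
 have "M<=ser {g:Y1. kh g=e} B (Suc 0)" using ch(4) by (auto simp: eqm_def)
 thus False using nvaB f YB(2) A1 ch(4) unfolding nva_def nilact_def by blast
 qed
 moreover have "ch.equivariant A (%a. rh (ka a))" unfolding ch.equivariant_def
 proof (intro conjI ballI A_sub YB(2))
 fix a assume a: "a:A"
 show "kh a=e" using A1[OF a] ch(4) YB(2) a by blast
 show "rh (ka a):K" using ch(5) kappa_M[OF a] by blast
 fix b assume b: "b:A"
 have m: "ka a:M" "ka b:M" "ka (a**b):M" using kappa_M a b A_closed(2) by auto
 have ab: "ka a + ka b:M" using subgpD(3)[OF M_subgp] m by blast
 have d: "ka (a**b) - (ka a + ka b):M" using subgpD(4)[OF M_subgp m(3) ab] .
 have "rh (ka (a**b))=rh ((ka (a**b) - (ka a + ka b)) + (ka a + ka b))" by simp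
 also have "\<dots>=rh (ka (a**b) - (ka a + ka b)) + (rh (ka a) + rh (ka b))"
 unfolding ch(6)[rule_format, OF d ab] ch(6)[rule_format, OF m(1,2)] ..
 also have "rh (ka (a**b) - (ka a + ka b))=0" using ch(5) d kappa_mult[OF a b] YB(3) by blast
 finally show "rh (ka (a**b))=rh (ka a) + rh (ka b)" by simp
 next
 fix g a assume g: "g:Y1" and a: "a:A"
 have gc: "g:carrier G" using Hc[OF g] .
 show "g**a**inv g:A" using A_conj[OF gc a] .
 show "rh (ka (g**a**inv g))=kh g * rh (ka a)" using ch(7) g kappa_M[OF a] by (simp flip: E_kappa[OF gc a])
 qed
 moreover have "EX a:A. rh (ka a) ~= 0" using notin ch(5) kappa_M by blast
 ultimately show ?thesis using that[OF YB(1,2) ch.character_axioms] by blast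
qed

context group
begin

text \<open>For normal \<open>D\<close> this is virtual nilpotency of \<open>G / D\<close>, phrased
  without the quotient group.\<close>

definition vn_mod :: "'a set => bool" where "vn_mod D \<longleftrightarrow> (EX Y n. fidx G Y (carrier G)&lcs G Y n<=D)"

lemma set_mult_ub:
 assumes A: "subgroup A G" and Y: "subgroup Y G" shows "Y<=A <#>\<^bsub>G\<^esub> Y" "A<=A <#>\<^bsub>G\<^esub> Y"
proof -
 have m: "a:A==>y:Y==>a**y:A <#>\<^bsub>G\<^esub> Y" for a y unfolding set_mult_def by blast
 show "Y<=A <#>\<^bsub>G\<^esub> Y"
 proof
 fix y assume y: "y:Y"
 show "y:A <#>\<^bsub>G\<^esub> Y" using m[OF sg_one[OF A] y] sg_mem[OF Y y] by simp
 qed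
 show "A<=A <#>\<^bsub>G\<^esub> Y"
 proof
 fix a assume a: "a:A"
 show "a:A <#>\<^bsub>G\<^esub> Y" using m[OF a sg_one[OF Y]] sg_mem[OF A a] by simp
 qed
qed

text \<open>\<open>Y\<close> and its product with \<open>A\<close> have the same image in
  \<open>G Mod A\<close>, so their lower central series agree there.\<close>

lemma lcs_normal_mult:
 assumes A: "A \<lhd> G" and Y: "subgroup Y G" "lcs G Y n<=A"
 shows "lcs G (A <#>\<^bsub>G\<^esub> Y) n<=A"
proof -
 interpret A: normal A G by fact
 let ?fi = "%x. A #> x" and ?Y = "A <#>\<^bsub>G\<^esub> Y"
 have sY: "subgroup ?Y G" by (rule mult_norm_subgroup[OF A Y(1)])
 have YY: "Y<=?Y" by (rule set_mult_ub(1)[OF A.subgroup_axioms Y(1)])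
 have gM: "group (G Mod A)" by (rule A.factorgroup_is_group)
 have "?fi ` ?Y=?fi ` Y"
 proof
 show "?fi ` Y<=?fi ` ?Y" using YY by blast
 show "?fi ` ?Y<=?fi ` Y"
 proof (rule image_subsetI)
 fix x assume "x:?Y"
 then obtain a y where ay: "a:A" "y:Y" "x=a**y" by (auto simp: set_mult_def)
 have yc: "y:carrier G" using sg_mem[OF Y(1) ay(2)] .
 have "A #> x=A #> y"
 using coset_mult_assoc[OF A.subset A.mem_carrier[OF ay(1)] yc] coset_join2[OF A.mem_carrier[OF ay(1)] A.subgroup_axioms ay(1)] ay(3) by simp
 thus "A #> x:?fi ` Y" using ay(2) by blast
 qed
 qed
 hence im: "?fi ` lcs G ?Y n=?fi ` lcs G Y n"
 using hom_lcs[OF is_group gM A.r_coset_hom_Mod sY, of n] hom_lcs[OF is_group gM A.r_coset_hom_Mod Y(1), of n] by simp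
 have zA: "?fi z=A" if "z:A" for z using coset_join2[OF A.mem_carrier[OF that] A.subgroup_axioms that] .
 have 1: "A #> x=A" if x: "x:lcs G ?Y n" for x
 proof -
 have "?fi x:?fi ` lcs G Y n" unfolding im[symmetric] by (rule imageI[OF x])
 then obtain z where "z:lcs G Y n" "A #> x=A #> z" by (rule imageE)
 thus ?thesis using zA[of z] subsetD[OF Y(2)] by simp
 qed
 show ?thesis
 proof
 fix x assume x: "x:lcs G ?Y n"
 hence "x:carrier G" using sg_mem[OF lcs_subgroup[OF sY]] by blast
 thus "x:A" using 1[OF x] rcos_self[OF _ A.subgroup_axioms, of x] by simp
 qed
qed

text \<open>\<open>G\<close> is virtually nilpotent modulo \<open>D 0\<close> but not modulo the
  trivial \<open>D m\<close>, so the property is lost between some \<open>D i\<close> and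
  \<open>D (Suc i)\<close>. By \<open>nilact_lcs\<close> this factor carries no virtually nilpotent
  action and yields a character. Subgroups of finite index then make its values torsion-free, and a
  core that keeps \<open>A\<close> makes the domain normal in \<open>G\<close>.\<close>

theorem soluble_character:
 assumes fgG: "finitely_generated G" and sol: "solvable G" and nvn: "~ virtually_nilpotent G"
 obtains K :: "(('a set endo cprod \<times> 'a set endo cprod) cprod) set" and e Z kh dl a
 where "Z \<lhd> G" "fidx G Z (carrier G)" "character G K e Z kh" "character.crossed G K Z kh dl"
 "a:Z" "kh a=e" "dl a ~= 0" "!!g n. g:Z==>(0::nat) < n==>kh (g [^] n)=e==>kh g=e"
 "!!q::nat. 1 < q==>EX g0:Z. ALL g:Z. kh (g [^] q) ~= kh g0"
proof -
 define D where "D i=(derived G ^^ i) (carrier G)" for i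
 have D_normal: "D i \<lhd> G" for i unfolding D_def by (induction i) (simp_all add: normal_self derived_is_normal)
 have v0: "vn_mod (D 0)" unfolding vn_mod_def D_def using fidx_refl[OF subgroup_self] by (intro exI[of _ "carrier G"] exI[of _ 0]) simp
 obtain m where m: "D m={\<one>}" using sol solvable_iff_trivial_derived_seq by (auto simp: D_def)
 have vm: "~ vn_mod (D m)"
 proof
 assume "vn_mod (D m)"
 then obtain Y n where Y: "fidx G Y (carrier G)" "lcs G Y n<={\<one>}" using m by (auto simp: vn_mod_def)
 have "lcs G Y n={\<one>}" using Y(2) sg_one[OF lcs_subgroup[OF fidxD(1)[OF Y(1)]]] by blast
 hence "virtually_nilpotent G" unfolding virtually_nilpotent_def
 using Y(1) fidx_finite_rcosets nilpotent_subgroup_iff by blast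
 thus False using nvn by contradiction
 qed
 have "EX i. vn_mod (D i)&~ vn_mod (D (Suc i))"
 proof (rule ccontr)
 assume "~ ?thesis"
 hence "vn_mod (D i)" for i by (induction i) (use v0 in auto)
 thus False using vm by blast
 qed
 then obtain i where i: "vn_mod (D i)" "~ vn_mod (D (Suc i))" by blast
 define A where "A=D i"
 have nA: "A \<lhd> G" and dA: "derived G A=D (Suc i)" unfolding A_def using D_normal by (auto simp: D_def)
 interpret derived_section G A by (intro derived_section.intro derived_section_axioms.intro is_group nA)
 obtain Y0 n where Y0: "fidx G Y0 (carrier G)" "lcs G Y0 n<=A" using i(1) by (auto simp: vn_mod_def A_def)
 define Y where "Y=A <#>\<^bsub>G\<^esub> Y0"
 have sY: "subgroup Y G" unfolding Y_def by (rule mult_norm_subgroup[OF nA fidxD(1)[OF Y0(1)]])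
 have "Y0<=Y" unfolding Y_def by (rule set_mult_ub(1)[OF A_sub fidxD(1)[OF Y0(1)]])
 hence fY: "fidx G Y (carrier G)" using fidx_enlarge[OF Y0(1) sY] subgroup.subset[OF sY] by blast
 have AY: "A<=Y" unfolding Y_def by (rule set_mult_ub(2)[OF A_sub fidxD(1)[OF Y0(1)]])
 have lY: "lcs G Y n<=A" unfolding Y_def by (rule lcs_normal_mult[OF nA fidxD(1)[OF Y0(1)] Y0(2)])
 have "fg (carrier G)" using fgG by (simp add: finitely_generated_def fg_def)
 hence Y: "adm Y" using fg_fidx[OF fY] AY lY by (auto simp: adm_def)
 have "nva Y R" unfolding nva_def
 proof (intro allI impI notI)
 fix Y' assume Y': "fidx G Y' Y" "A<=Y'" "nilact Y' R"
 have "lcs G Y' n<=A" using lcs_mono[OF sY fidxD(1)[OF Y'(1)] fidxD(3)[OF Y'(1)], of n] lY by blast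
 then obtain m where "lcs G Y' m<=D (Suc i)" using nilact_lcs[OF fidxD(1)[OF Y'(1)] Y'(2) _ Y'(3)] dA by metis
 thus False using i(2) fidx_trans[OF Y'(1) fY] unfolding vn_mod_def by blast
 qed
 then obtain Y1 and K :: "(('a set endo cprod \<times> 'a set endo cprod) cprod) set" and e kh l
 where Y1: "fidx G Y1 Y" "A<=Y1" "character G K e Y1 kh" "character.equivariant G K e Y1 kh A l"
 "EX a:A. l a ~= 0" "EX g:Y1. ALL n>0. kh (g [^] (n::nat)) ~= e"
 using section_character[OF Y] by metis
 interpret c1: character G K e Y1 kh by (rule Y1(3))
 have eA: "kh a=e" if "a:A" for a using Y1(4) that by (simp add: c1.equivariant_def)
 have aY1: "adm Y1" by (rule adm_fidx[OF Y Y1(1,2)])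
 obtain Y2 where Y2: "fidx G Y2 Y1" "A<=Y2" "!!g n. g:Y2==>(0::nat) < n==>kh (g [^] n)=e==>kh g=e"
 using c1.torsion_free_subgroup[OF admD(3)[OF aY1] A_sub eA adm_polyc[OF aY1 admD(1)[OF aY1] Y1(2) subset_refl]] by metis
 note s2 = fidxD(1)[OF Y2(1)]
 interpret c2: character G K e Y2 kh by (rule c1.restrict_character[OF s2 fidxD(3)[OF Y2(1)]])
 obtain g where g: "g:Y1" "!!n. 0 < n==>kh (g [^] (n::nat)) ~= e" using Y1(6) by blast
 have fY2: "fidx G Y2 (carrier G)" by (rule fidx_trans[OF fidx_trans[OF Y2(1) Y1(1)] fY])
 obtain Z where Z: "Z \<lhd> G" "Z<=Y2" "fidx G Z (carrier G)" "ALL A. A \<lhd> G-->A<=Y2-->A<=Z"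
 using fidx_core[OF fY2] by blast
 \<comment> \<open>A power of \<open>g\<close> lies in \<open>Z\<close>, and its value is still
   different from \<open>e\<close>. It serves as \<open>t\<close> both for the extension of
   \<open>l\<close> and for \<open>not_all_powers\<close>.\<close>
 obtain k where k: "0 < k" "g [^] (k::nat):Z" using fidx_pow[OF Z(3) c1.Yc[OF g(1)]] by blast
 have AZ: "A<=Z" using Z(4) nA Y2(2) by blast
 have "c2.equivariant A l" using Y1(4) Y2(2) fidxD(3)[OF Y2(1)] unfolding c1.equivariant_def c2.equivariant_def by blast
 moreover have "lcs G Y2 n<=A" using lcs_mono[OF sY s2] fidxD(3)[OF Y2(1)] fidxD(3)[OF Y1(1)] lY by blast
 ultimately obtain dl where dl: "c2.crossed dl" "ALL a:A. dl a=l a"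
 using c2.split_extension[OF _ g(2)[OF k(1)], of A l n] k(2) Z(2) by blast
 note sZ = normal_imp_subgroup[OF Z(1)]
 interpret z: character G K e Z kh by (rule c2.restrict_character[OF sZ Z(2)])
 have ZY: "Z<=Y" using Z(2) fidxD(3)[OF Y2(1)] fidxD(3)[OF Y1(1)] by blast
 have pol: "polyc A Z" by (rule adm_polyc[OF Y sZ AZ ZY])
 have tfZ: "kh g=e" if "g:Z" "(0::nat) < n" "kh (g [^] n)=e" for g n using Y2(3)[of g n] that Z(2) by blast
 have np: "EX g0:Z. ALL g:Z. kh (g [^] q) ~= kh g0" if q: "1 < (q::nat)" for q
 proof (rule z.not_all_powers[where q = q and A = A and t = "g [^] k"])
 fix g0 assume "g0:Z" "!!g. g:Z==>kh (g [^] q) ~= kh g0"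
 thus ?thesis by (intro bexI[of _ g0]) simp_all
 qed (use A_sub eA pol tfZ k(2) g(2)[OF k(1)] q in simp_all)
 obtain a where a: "a:A" "l a ~= 0" using Y1(5) by blast
 have cr: "z.crossed dl" using dl(1) Z(2) unfolding c2.crossed_def z.crossed_def by (meson subsetD)
 have aZ: "a:Z" "dl a ~= 0" using a AZ dl(2) by auto
 show ?thesis
 by (rule that[OF Z(1,3) z.character_axioms cr aZ(1) eA[OF a(1)] aZ(2)]) (rule tfZ, assumption+, rule np, assumption)
qed
end

section \<open>Passage to a subgroup of finite index\<close>

text \<open>A homomorphism on \<open>Z\<close> induces one from \<open>G\<close> to the wreath product with \<open>G / Z\<close> (Kaloujnine
 and Krasner). Functions are total; the translations act as the identity off \<open>G / Z\<close>.\<close>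

locale induced_wreath = group G for G :: "('a, 'm) monoid_scheme" (structure) +
 fixes T :: "('t, 'n) monoid_scheme" and Z and tt :: "'a => 't"
 assumes T: "group T" and Z: "Z \<lhd> G"
 and th: "g:Z==>tt g:carrier T" "g:Z==>h:Z==>tt (g**h)=tt g **\<^bsub>T\<^esub> tt h"
begin

sublocale T: group T by (rule T)

sublocale Z: normal Z G by (rule Z)

sublocale Q: group "G Mod Z" by (rule Z.factorgroup_is_group)
abbreviation "Q \<equiv> G Mod Z"

definition sh :: "'a set => ('a set => 't) => 'a set => 't" where
 "sh c f=(%x. if x:carrier Q then f (x **\<^bsub>Q\<^esub> c) else f x)"

definition wr :: "(('a set => 't) \<times> 'a set) monoid" where
 "wr=\<lparr>carrier={f. ALL x. f x:carrier T} \<times> carrier Q,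
 monoid.mult=(%p p'. (%x. fst p x **\<^bsub>T\<^esub> sh (snd p) (fst p') x, snd p **\<^bsub>Q\<^esub> snd p')), one=(%x. \<one>\<^bsub>T\<^esub>, \<one>\<^bsub>Q\<^esub>)\<rparr>"

lemma wr_carrier: "(f, c):carrier wr \<longleftrightarrow> (ALL x. f x:carrier T)&c:carrier Q"
 and wr_one: "\<one>\<^bsub>wr\<^esub>=(%x. \<one>\<^bsub>T\<^esub>, \<one>\<^bsub>Q\<^esub>)"
 and wr_mult: "(f, c) **\<^bsub>wr\<^esub> (f', c')=(%x. f x **\<^bsub>T\<^esub> sh c f' x, c **\<^bsub>Q\<^esub> c')"
 by (simp_all add: wr_def)

lemma sh_closed: "ALL x. f x:carrier T==>sh c f x:carrier T" by (simp add: sh_def)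

lemma sh_sh: "c:carrier Q==>d:carrier Q==>sh c (sh d f)=sh (c **\<^bsub>Q\<^esub> d) f"
 unfolding sh_def by (rule ext) (simp add: Q.m_assoc Q.m_closed del: mult_FactGroup)

lemma sh_one: "sh \<one>\<^bsub>Q\<^esub> f=f" unfolding sh_def by (rule ext) (simp del: mult_FactGroup one_FactGroup)

lemma sh_mult: "sh c (%x. f x **\<^bsub>T\<^esub> g x)=(%x. sh c f x **\<^bsub>T\<^esub> sh c g x)" by (rule ext) (simp add: sh_def)

lemma wr_group: "group wr"
proof (rule groupI)
 show "\<one>\<^bsub>wr\<^esub>:carrier wr" unfolding wr_one wr_carrier using Q.one_closed by blast
 fix p assume "p:carrier wr"
 then obtain f c where p: "p=(f, c)" "ALL x. f x:carrier T" "c:carrier Q" by (cases p) (simp only: wr_carrier, blast)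
 show "\<one>\<^bsub>wr\<^esub> **\<^bsub>wr\<^esub> p=p" unfolding p(1) wr_one wr_mult sh_one Q.l_one[OF p(3)] using p(2) by simp
 have "(%x. inv\<^bsub>T\<^esub> sh (inv\<^bsub>Q\<^esub> c) f x, inv\<^bsub>Q\<^esub> c):carrier wr" unfolding wr_carrier using p Q.inv_closed sh_closed by blast
 moreover have "(%x. inv\<^bsub>T\<^esub> sh (inv\<^bsub>Q\<^esub> c) f x, inv\<^bsub>Q\<^esub> c) **\<^bsub>wr\<^esub> p=\<one>\<^bsub>wr\<^esub>"
 unfolding p(1) wr_mult wr_one Q.l_inv[OF p(3)] using sh_closed[OF p(2)] by simp
 ultimately show "EX p':carrier wr. p' **\<^bsub>wr\<^esub> p=\<one>\<^bsub>wr\<^esub>" by (rule bexI[rotated])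
 fix p' p'' assume "p':carrier wr" "p'':carrier wr"
 then obtain f' c' f'' c'' where p': "p'=(f', c')" "ALL x. f' x:carrier T" "c':carrier Q"
 and p'': "p''=(f'', c'')" "ALL x. f'' x:carrier T" "c'':carrier Q" by (cases p'; cases p'') (simp only: wr_carrier, blast)
 show "p **\<^bsub>wr\<^esub> p':carrier wr" unfolding p(1) p'(1) wr_mult wr_carrier using p p' Q.m_closed sh_closed T.m_closed by blast
 show "p **\<^bsub>wr\<^esub> p' **\<^bsub>wr\<^esub> p''=p **\<^bsub>wr\<^esub> (p' **\<^bsub>wr\<^esub> p'')"
 unfolding p(1) p'(1) p''(1) wr_mult sh_mult sh_sh[OF p(3) p'(3)] Q.m_assoc[OF p(3) p'(3) p''(3)]
 using p(2) sh_closed[OF p'(2)] sh_closed[OF p''(2)] by (simp add: T.m_assoc)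
qed

sublocale wr: group wr by (rule wr_group)

definition base where "base={p:carrier wr. snd p=\<one>\<^bsub>Q\<^esub>}"

lemma base_iff: "(f, c):base \<longleftrightarrow> (ALL x. f x:carrier T)&c=\<one>\<^bsub>Q\<^esub>"
 unfolding base_def using wr_carrier Q.one_closed by (metis (mono_tags) mem_Collect_eq snd_conv)

lemma snd_hom: "group_hom wr Q snd"
 by (intro group_hom.intro group_hom_axioms.intro wr_group Q.is_group homI) (auto simp: wr_def simp del: mult_FactGroup)

lemma base_normal: "base \<lhd> wr"
proof -
 interpret h: group_hom wr Q snd by (rule snd_hom)
 show ?thesis using h.normal_kernel unfolding kernel_def base_def .
qed

lemma base_pow: "(f, \<one>\<^bsub>Q\<^esub>) [^]\<^bsub>wr\<^esub> (r::nat)=(%x. f x [^]\<^bsub>T\<^esub> r, \<one>\<^bsub>Q\<^esub>)"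
proof (induction r)
 case 0 show ?case by (simp add: wr_one)
next
 case (Suc r) show ?case unfolding wr.nat_pow_Suc Suc wr_mult sh_one Q.l_one[OF Q.one_closed] by simp
qed

lemma base_root: assumes r: "pbij T r (carrier T)" shows "pbij wr r base"
 unfolding bij_betw_def
proof (intro conjI inj_onI)
 fix p p' assume pp: "p:base" "p':base" and eq: "p [^]\<^bsub>wr\<^esub> r=p' [^]\<^bsub>wr\<^esub> r"
 then obtain f f' where p: "p=(f, \<one>\<^bsub>Q\<^esub>)" "ALL x. f x:carrier T" "p'=(f', \<one>\<^bsub>Q\<^esub>)" "ALL x. f' x:carrier T"
 by (cases p; cases p') (simp only: base_iff, blast)
 have "f x [^]\<^bsub>T\<^esub> r=f' x [^]\<^bsub>T\<^esub> r" for x using eq unfolding p(1,3) base_pow by (auto dest: fun_cong[of _ _ x])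
 hence "f=f'" using r p(2,4) by (auto simp: bij_betw_def inj_on_def)
 thus "p=p'" using p by simp
next
 show "(%p. p [^]\<^bsub>wr\<^esub> r) ` base=base"
 proof
 have "p [^]\<^bsub>wr\<^esub> r:base" if "p:base" for p
 using that by (cases p) (auto simp only: base_iff base_pow T.nat_pow_closed)
 thus "(%p. p [^]\<^bsub>wr\<^esub> r) ` base<=base" by blast
 show "base<=(%p. p [^]\<^bsub>wr\<^esub> r) ` base"
 proof
 fix p assume "p:base"
 then obtain f where p: "p=(f, \<one>\<^bsub>Q\<^esub>)" "ALL x. f x:carrier T" by (cases p) (simp only: base_iff, blast)
 have "EX y:carrier T. y [^]\<^bsub>T\<^esub> r=f x" for x
 proof -
 have "f x:(%y. y [^]\<^bsub>T\<^esub> r) ` carrier T" using r p(2) by (simp add: bij_betw_def)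
 thus ?thesis by auto
 qed
 then obtain g where g: "!!x. g x:carrier T" "!!x. g x [^]\<^bsub>T\<^esub> r=f x" by metis
 show "p:(%p. p [^]\<^bsub>wr\<^esub> r) ` base"
 by (rule image_eqI[of _ _ "(g, \<one>\<^bsub>Q\<^esub>)"]) (simp_all add: p(1) base_pow base_iff g del: one_FactGroup)
 qed
 qed
qed

text \<open>Roots in the base group are taken pointwise, and the order of the finite top group is an
  exponent prime to \<open>r\<close> that sends every element into the base.\<close>

lemma wr_root:
 assumes r: "pbij T r (carrier T)" and fin: "finite (carrier Q)" and co: "coprime (Coset.order Q) r"
 shows "pbij wr r (carrier wr)"
proof (rule wr.pow_bij_extension[OF base_normal base_root[OF r]])
 interpret h: group_hom wr Q snd by (rule snd_hom)
 fix p assume p: "p:carrier wr"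
 have "snd (p [^]\<^bsub>wr\<^esub> Coset.order Q)=\<one>\<^bsub>Q\<^esub>" using h.hom_nat_pow[OF p] Q.pow_order_eq_1[OF h.hom_closed[OF p]] by metis
 hence "p [^]\<^bsub>wr\<^esub> Coset.order Q:base" using p by (simp add: base_def del: one_FactGroup)
 thus "EX m>0. coprime m r&p [^]\<^bsub>wr\<^esub> m:base" using co Q.order_gt_0_iff_finite fin by blast
qed

text \<open>The representative of \<open>Z\<close> itself is normalized to 1, so that
  \<open>Te z\<close> has the value \<open>tt z\<close> at the trivial coset
  (\<open>Theta_Z\<close>).\<close>

definition transv :: "'a set => 'a" where "transv x=(if x=Z then \<one> else SOME g. g:carrier G&x=Z #> g)"

lemma transv: "x:carrier Q==>transv x:carrier G&x=Z #> transv x"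
proof -
 assume "x:carrier Q"
 hence ex: "EX g. g:carrier G&x=Z #> g" by (auto simp: FactGroup_def RCOSETS_def)
 show "transv x:carrier G&x=Z #> transv x"
 proof (cases "x=Z")
 case True thus ?thesis using coset_mult_one[OF Z.subset] by (simp add: transv_def)
 next
 case False thus ?thesis unfolding transv_def using someI_ex[OF ex] by simp
 qed
qed

lemma coset_Q: "g:carrier G==>Z #> g:carrier Q" by (auto simp: FactGroup_def RCOSETS_def)

lemma coset_mult: "g:carrier G==>h:carrier G==>(Z #> g) **\<^bsub>Q\<^esub> (Z #> h)=Z #> (g**h)"
 by (simp add: FactGroup_def Z.rcos_sum)

definition cy :: "'a set => 'a => 'a" where "cy x g=transv x**g**inv (transv (x **\<^bsub>Q\<^esub> (Z #> g)))"

lemma cy: assumes x: "x:carrier Q" and g: "g:carrier G" shows "cy x g:Z"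
proof -
 let ?y = "x **\<^bsub>Q\<^esub> (Z #> g)"
 have y: "?y:carrier Q" by (rule Q.m_closed[OF x coset_Q[OF g]])
 have "Z #> transv ?y=Z #> (transv x**g)"
 using coset_mult[of "transv x" g] transv[OF x] transv[OF y] g by metis
 moreover have "transv x**g:Z #> (transv x**g)" using transv[OF x] g by (intro rcos_self Z.subgroup_axioms) simp
 ultimately have "transv x**g:Z #> transv ?y" by simp
 thus ?thesis unfolding cy_def using subgroup.rcos_module_imp[OF Z.subgroup_axioms is_group] transv[OF y] by blast
qed

lemma cy_mult:
 assumes x: "x:carrier Q" and g: "g:carrier G" "h:carrier G"
 shows "cy x (g**h)=cy x g**cy (x **\<^bsub>Q\<^esub> (Z #> g)) h"
proof -
 have y: "x **\<^bsub>Q\<^esub> (Z #> g):carrier Q" by (rule Q.m_closed[OF x coset_Q[OF g(1)]])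
 have z: "x **\<^bsub>Q\<^esub> (Z #> g) **\<^bsub>Q\<^esub> (Z #> h)=x **\<^bsub>Q\<^esub> (Z #> (g**h))"
 unfolding Q.m_assoc[OF x coset_Q[OF g(1)] coset_Q[OF g(2)]] coset_mult[OF g] ..
 have w: "x **\<^bsub>Q\<^esub> (Z #> (g**h)):carrier Q" using g by (intro Q.m_closed x coset_Q) simp
 show ?thesis unfolding cy_def z using transv[OF x] transv[OF y] transv[OF w] g by (simp add: m_assoc del: mult_FactGroup)
qed

definition Te where "Te g=(%x. if x:carrier Q then tt (cy x g) else \<one>\<^bsub>T\<^esub>, Z #> g)"

lemma Theta_hom: "Te:hom G wr"
proof (rule homI)
 fix g assume g: "g:carrier G"
 show "Te g:carrier wr" unfolding Te_def wr_carrier using cy[OF _ g] th(1) coset_Q[OF g] by simp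
 fix h assume h: "h:carrier G"
 have "tt (cy x (g**h))=tt (cy x g) **\<^bsub>T\<^esub> tt (cy (x **\<^bsub>Q\<^esub> (Z #> g)) h)" if x: "x:carrier Q" for x
 unfolding cy_mult[OF x g h] by (rule th(2)[OF cy[OF x g] cy[OF Q.m_closed[OF x coset_Q[OF g]] h]])
 moreover have "x **\<^bsub>Q\<^esub> (Z #> g):carrier Q" if "x:carrier Q" for x by (rule Q.m_closed[OF that coset_Q[OF g]])
 ultimately show "Te (g**h)=Te g **\<^bsub>wr\<^esub> Te h"
 unfolding Te_def wr_mult coset_mult[OF g h] sh_def by (auto simp: fun_eq_iff simp del: mult_FactGroup)
qed

lemma Theta_Z: assumes "z:Z" shows "Te z:base" "fst (Te z) \<one>\<^bsub>Q\<^esub>=tt z"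
proof -
 have zc: "z:carrier G" using Z.mem_carrier[OF assms] .
 have Zz: "Z #> z=\<one>\<^bsub>Q\<^esub>" using coset_join2[OF zc Z.subgroup_axioms assms] by simp
 show "Te z:base" using funcset_mem[OF _ zc, of Te "carrier wr"] Theta_hom Zz unfolding base_def hom_def by (simp add: Te_def del: one_FactGroup)
 have "cy \<one>\<^bsub>Q\<^esub> z=z" unfolding cy_def Zz Q.l_one[OF Q.one_closed] using zc by (simp add: transv_def)
 thus "fst (Te z) \<one>\<^bsub>Q\<^esub>=tt z" unfolding Te_def using Q.one_closed by (simp del: one_FactGroup)
qed

text \<open>Evaluation at the trivial coset is a homomorphism on the base group. It preserves
  isolation for \<open>q\<close>, because roots in the base are pointwise and unique, and it
  preserves triviality of a derived term.\<close>

theorem restrict_to_base: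
 assumes P: "wr.isol {q} P" "Te ` carrier G<=P" and q: "pbij T q (carrier T)" and sol: "(derived wr ^^ k) P={\<one>\<^bsub>wr\<^esub>}"
 obtains P0 where "T.isol {q} P0" "tt ` Z<=P0" "(derived T ^^ k) P0={\<one>\<^bsub>T\<^esub>}"
proof -
 let ?h = "%p. fst p \<one>\<^bsub>Q\<^esub>" and ?W = "wr\<lparr>carrier := base\<rparr>"
 have sB: "subgroup base wr" using base_normal by (rule normal_imp_subgroup)
 have sP: "subgroup P wr" and rt: "!!x. x:carrier wr==>x [^]\<^bsub>wr\<^esub> q:P==>x:P" using P(1) by (auto simp: wr.isol_def)
 have sPB: "subgroup (P Int base) wr" using sP sB by (rule wr.subgroups_Inter_pair)
 interpret h: group_hom ?W T ?h
 proof (intro group_hom.intro group_hom_axioms.intro subgroup.subgroup_is_group[OF sB wr_group] T homI)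
 fix p assume "p:carrier ?W"
 then obtain f where p: "p=(f, \<one>\<^bsub>Q\<^esub>)" "ALL x. f x:carrier T" by (cases p) (simp only: base_iff partial_object.simps, auto simp add: base_iff simp del: one_FactGroup)
 show "?h p:carrier T" using p by simp
 fix p' assume "p':carrier ?W"
 then obtain f' where p': "p'=(f', \<one>\<^bsub>Q\<^esub>)" by (cases p') (auto simp add: base_iff simp del: one_FactGroup)
 show "?h (p **\<^bsub>?W\<^esub> p')=?h p **\<^bsub>T\<^esub> ?h p'" unfolding p(1) p'(1) by (simp add: wr_mult sh_one del: one_FactGroup)
 qed
 have PW: "P Int base<=carrier ?W" by simp
 have d: "(derived ?W ^^ n) (P Int base)=(derived wr ^^ n) (P Int base)&(derived wr ^^ n) (P Int base)<=base" for n
 proof (induction n)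
 case (Suc n)
 have "derived wr ((derived wr ^^ n) (P Int base))<=base" by (rule wr.derived_incl[OF _ sB]) (use Suc in blast)
 thus ?case using Suc wr.derived_consistent[OF _ sB] by simp
 qed simp
 have "(derived wr ^^ k) (P Int base)<={\<one>\<^bsub>wr\<^esub>}"
 using wr.mono_exp_of_derived[OF Int_lower1[of P base], of k] sol by simp
 hence "(derived wr ^^ k) (P Int base)={\<one>\<^bsub>wr\<^esub>}"
 using sg_one[OF wr.exp_of_derived_is_subgroup[OF sPB]] by blast
 hence "(derived T ^^ k) (?h ` (P Int base))={\<one>\<^bsub>T\<^esub>}"
 unfolding h.exp_of_derived_img[OF PW] using d[of k] by (simp add: wr_one)
 moreover have "tt ` Z<=?h ` (P Int base)"
 proof (rule image_subsetI)
 fix z assume z: "z:Z"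
 have "Te z:P" using P(2) Z.mem_carrier[OF z] by blast
 thus "tt z:?h ` (P Int base)" using Theta_Z[OF z] by (intro image_eqI[of _ _ "Te z"]) simp_all
 qed
 moreover have "T.isol {q} (?h ` (P Int base))" unfolding T.isol_def
 proof (intro conjI ballI impI)
 have "subgroup (P Int base) ?W" using wr.subgroup_incl[OF sPB sB] by blast
 thus "subgroup (?h ` (P Int base)) T" by (rule h.subgroup_img_is_subgroup)
 fix r x assume r: "r:{q}" and x: "x:carrier T" "x [^]\<^bsub>T\<^esub> r:?h ` (P Int base)"
 then obtain p where p: "p:P" "p:base" "x [^]\<^bsub>T\<^esub> q=?h p" by auto
 have "p:(%p. p [^]\<^bsub>wr\<^esub> q) ` base" using base_root[OF q] p(2) by (simp add: bij_betw_def)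
 then obtain p' where p': "p':base" "p=p' [^]\<^bsub>wr\<^esub> q" by blast
 obtain f where f: "p'=(f, \<one>\<^bsub>Q\<^esub>)" "ALL x. f x:carrier T" using p'(1) by (cases p') (simp only: base_iff, blast)
 have "p':P" using rt[of p'] p' p(1) by (auto simp: base_def)
 moreover have "x [^]\<^bsub>T\<^esub> q=f \<one>\<^bsub>Q\<^esub> [^]\<^bsub>T\<^esub> q" using p(3) unfolding p'(2) f(1) base_pow by simp
 hence "x=f \<one>\<^bsub>Q\<^esub>" using q x(1) f(2) unfolding bij_betw_def inj_on_def by blast
 ultimately show "x:?h ` (P Int base)" using p'(1) f(1) by (intro image_eqI[of _ _ p']) simp_all
 qed
 ultimately show ?thesis using that by blast
qed
end

text \<open>Two such primes would be coprime, and Bezout would give \<open>e = 0\<close>.\<close>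

lemma (in field_set) finite_characteristics: "finite {r. prime r&of_nat r * e=0}"
proof -
 have "r=s" if "prime r" "of_nat r * e=0" "prime s" "of_nat s * e=0" for r s :: nat
 proof (rule ccontr)
 assume "r ~= s"
 hence "coprime (int r) (int s)" using that(1,3) primes_coprime by simp
 then obtain x y where xy: "x * int r + y * int s=1" using bezout_int[of "int r" "int s"] by (auto simp: coprime_iff_gcd_eq_1)
 have "e = of_int (x * int r + y * int s) * e" using xy by simp
 also have "\<dots> = of_int x * (of_nat r * e) + of_int y * (of_nat s * e)" by (simp add: distrib_right mult.assoc)
 finally show False using that(2,4) e(2) by simp
 qed
 hence "{r. prime r&of_nat r * e=0}<={r0}" if "r0:{r. prime r&of_nat r * e=0}" for r0 using that by auto
 thus ?thesis by (metis (no_types, lifting) all_not_in_conv finite.emptyI finite.insertI finite_subset)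
qed

theorem theorem3p4:
 fixes G :: "('a, 'm) monoid_scheme"
 assumes "group G" and "finitely_generated G" and "solvable G"
 shows "(\<forall>pj (L :: ('b::infinite) monoid) fi.
 pj \<subseteq> {p. prime p} \<and> pj \<noteq> {p. prime p} \<and> pi_localization pj G L fi
 \<longrightarrow> virtually_nilpotent L)
 \<or> (\<exists>tau. finite tau \<and> tau \<subseteq> {p. prime p} \<and>
 (\<forall>pj (L :: 'b monoid) fi.
 pj \<subseteq> {p. prime p} \<and> pj \<noteq> {p. prime p} \<and> tau \<subseteq> pj \<and> pi_localization pj G L fi
 \<longrightarrow> \<not> solvable L))"
proof (cases "virtually_nilpotent G")
 case True
 thus ?thesis using virtually_nilpotent_localization[OF assms(1) True] by blast
next
 case False
 interpret group G by (rule assms(1))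
 obtain Z and K :: "(('a set endo cprod \<times> 'a set endo cprod) cprod) set" and e kh dl a
 where Z: "Z \<lhd> G" "fidx G Z (carrier G)" and ch: "character G K e Z kh" "character.crossed G K Z kh dl"
 and a: "a:Z" "kh a=e" "dl a ~= 0"
 and tf: "!!g n. g:Z==>(0::nat) < n==>kh (g [^]\<^bsub>G\<^esub> n)=e==>kh g=e"
 and np: "!!q::nat. 1 < q==>EX g0:Z. ALL g:Z. kh (g [^]\<^bsub>G\<^esub> q) ~= kh g0"
 by (rule soluble_character[OF assms(2,3) False]) (rule that)
 interpret character G K e Z kh by (rule ch(1))
 have finQ: "finite (carrier (G Mod Z))" using Z(2) fidx_finite_rcosets by (simp add: FactGroup_def)
 interpret Q: group "G Mod Z" using Z(1) by (rule normal.factorgroup_is_group)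
 have oQ: "0 < Coset.order (G Mod Z)" using finQ Q.order_gt_0_iff_finite by blast
 \<comment> \<open>The first set protects roots in the wreath product, the second is the
   characteristic of \<open>K\<close>. Neither depends on \<open>pj\<close>.\<close>
 define tau where "tau={r. prime r&r dvd Coset.order (G Mod Z)} Un {r. prime r&of_nat r * e=0}"
 have "finite {r. r dvd Coset.order (G Mod Z)}" using oQ by simp
 hence fin: "finite tau" unfolding tau_def using finite_characteristics by (auto intro: finite_subset)
 have sub: "tau<={p. prime p}" by (auto simp: tau_def)
 have ns: "~ solvable L"
 if L: "pj<={p. prime p}" "pj ~= {p. prime p}" "tau<=pj" "pi_localization pj G L fi" for pj and L :: "'b monoid" and fi
 proof
 assume sol: "solvable L"
 \<comment> \<open>A prime outside \<open>pj\<close> exists because \<open>pj\<close> is not the set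
   of all primes; \<open>q\<close>-th roots are available in \<open>L\<close>.\<close>
 obtain q where pq: "prime q" "q ~: pj" using L(1,2) by blast
 have q1: "1 < q" using prime_gt_1_nat[OF pq(1)] .
 have out: "0 < r" "of_nat r * e ~= 0" "coprime (Coset.order (G Mod Z)) r" if "prime r" "r ~: pj" for r
 proof -
 have "~ r dvd Coset.order (G Mod Z)" "of_nat r * e ~= 0" using that L(3) by (auto simp: tau_def)
 thus "0 < r" "of_nat r * e ~= 0" "coprime (Coset.order (G Mod Z)) r"
 using prime_gt_0_nat[OF that(1)] coprime_commute[THEN iffD1, OF prime_imp_coprime[OF that(1)]] by simp_all
 qed
 \<comment> \<open>\<open>tau\<close> was fixed before \<open>q\<close>; only \<open>g0\<close>, and
   with it the map \<open>th\<close>, depend on \<open>q\<close>.\<close>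
 obtain g0 where g0: "g0:Z" "!!g. g:Z==>kh (g [^]\<^bsub>G\<^esub> q) ~= kh g0" using np[OF q1] by blast
 interpret root_target G K e Z kh dl q g0
 by (rule root_target.intro[OF ch(1) root_target_axioms.intro], rule ch(2), rule tf, assumption+,
 rule q1, rule out(2)[OF pq], rule g0(1), rule g0(2), assumption)
 interpret induced_wreath G tg Z th
 by (intro induced_wreath.intro induced_wreath_axioms.intro is_group tg_group Z(1) th_carrier th_mult)
 have loc: "pi_local pj wr" unfolding pi_local_iff
 using wr_group wr_root[OF tg_root finQ] out by blast
 have Ll: "pi_local pj L" using L(4) by (simp add: pi_localization_def)
 interpret L: group L using Ll by (simp add: pi_local_def)
 \<comment> \<open>The wreath product lives on another type than \<open>L\<close>, so the universal
   property is used across types; it applies because a finitely generated group is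
   countable.\<close>
 obtain ps where ps: "ps:hom L wr" "!!x. x:carrier G==>ps (fi x)=Te x"
 using pi_localization_universal[OF assms(1) finitely_generated_countable[OF assms(1,2)] L(4) loc Theta_hom] by blast
 interpret ps: group_hom L wr ps using ps(1) by unfold_locales
 obtain k where k: "(derived L ^^ k) (carrier L)={\<one>\<^bsub>L\<^esub>}" using sol L.solvable_iff_trivial_derived_seq by blast
 have "(derived wr ^^ k) (ps ` carrier L)={\<one>\<^bsub>wr\<^esub>}" using ps.exp_of_derived_img[OF subset_refl, of k] k by simp
 moreover have "Te ` carrier G<=ps ` carrier L"
 proof (rule image_subsetI)
 fix x assume x: "x:carrier G"
 hence "fi x:carrier L" using L(4) by (auto simp: pi_localization_def hom_def)
 thus "Te x:ps ` carrier L" unfolding ps(2)[OF x, symmetric] by (rule imageI)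
 qed
 \<comment> \<open>A \<open>q\<close>-th root of an image element exists in the image because
   \<open>L\<close> is local, and it is the only root in \<open>wr\<close>.\<close>
 moreover have "wr.isol {q} (ps ` carrier L)" unfolding wr.isol_def
 proof (intro conjI ballI impI ps.subgroup_img_is_subgroup L.subgroup_self)
 fix r x assume r: "r:{q}" and x: "x:carrier wr" "x [^]\<^bsub>wr\<^esub> r:ps ` carrier L"
 then obtain y where y: "y:carrier L" "x [^]\<^bsub>wr\<^esub> q=ps y" by auto
 have "y:(%z. z [^]\<^bsub>L\<^esub> q) ` carrier L" using Ll pq y(1) by (simp add: pi_local_def bij_betw_def)
 then obtain z where z: "z:carrier L" "y=z [^]\<^bsub>L\<^esub> q" by blast
 have "x [^]\<^bsub>wr\<^esub> q=ps z [^]\<^bsub>wr\<^esub> q" unfolding y(2) z(2) by (rule ps.hom_nat_pow[OF z(1)])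
 moreover have "inj_on (%x. x [^]\<^bsub>wr\<^esub> q) (carrier wr)" using loc pq by (simp add: pi_local_def bij_betw_def)
 ultimately have "x=ps z" using x(1) ps.hom_closed[OF z(1)] by (auto simp: inj_on_def)
 thus "x:ps ` carrier L" using z(1) by blast
 qed
 ultimately obtain P0 where "tg.isol {q} P0" "th ` Z<=P0" "(derived tg ^^ k) P0={\<one>\<^bsub>tg\<^esub>}"
 using restrict_to_base[OF _ _ tg_root[OF out(1,2)[OF pq]]] by metis
 thus False using roots_not_soluble[OF a] by blast
 qed
 show ?thesis
 proof (rule disjI2, rule exI[of _ tau], intro conjI allI impI)
 show "finite tau" "tau<={p. prime p}" by (rule fin, rule sub)
 fix pj fi and L :: "'b monoid"
 assume "pj<={p. prime p}&pj ~= {p. prime p}&tau<=pj&pi_localization pj G L fi"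
 thus "~ solvable L" by (elim conjE) (rule ns)
 qed
qed

end
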